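(* Let $0<m<1$, $\nu>0$, and let $h:\mathbb{R}\to[0,\infty)$ be a probability density with $h(x)=0$ for $x<0$ which has a nonincreasing representative on $(0,\infty)$. Write $\check h(x):=h(-x)$ and define, for a.e. $x\in\mathbb{R}$, $$\rho_h(x):=\frac{h(|x|)-m(h*\check h)(x)}{2-m}.$$ Then $\rho_h$ admits an even probability-density representative on $\mathbb{R}$; in particular $\widehat{\rho_h}$ is real-valued. Let $$p_n:=\frac{(2n-2)!}{2^{2n-1}n!(n-1)!}\,\frac{[m(2-m)]^n}{m},\qquad n\ge1.$$ Then $\sum_{n\ge1}p_n=1$. If $K$ has law $\mathbb{P}(K=n)=p_n$, if $Y_1,Y_2,\dots$ are i.i.d. with any even density representative of $\rho_h$, if $K$ is independent of $Y_1,Y_2,\dots$, and if $Y=\sum_{k=1}^KY_k$, then $Y$ has an even density $\varphi_h$ and $$\widehat{\varphi_h}(\omega)=\frac{1-\sqrt{1-m(2-m)\widehat{\rho_h}(\omega)}}{m},$$ where the square root is the positive real square root; indeed $$1-m(2-m)\widehat{\rho_h}(\omega)=|1-m\widehat h(\omega)|^2\ge(1-m)^2>0 .$$ Moreover, $$|1-m\widehat{\varphi_h}(\omega)|^2=|1-m\widehat h(\omega)|^2 .$$ Consequently, the stationary Poisson branching-cluster process with immigrant rate $\nu$ and offspring density $m\varphi_h$ is reversible, and it has the same total intensity $\lambda=\nu/(1-m)$ and the same full Bartlett spectrum as the one-sided stationary Poisson branching-cluster process with immigrant rate $\nu$ and offspring density $mh$. The complete reduced covariance measures of these two processes are finite and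 also agree. In addition, the reversible process (with offspring density $m\varphi_h$) has real complete and factorial third-order Fourier--Stieltjes transforms $\widehat{\gamma_3^{\mathrm{red}}}$ and $\widehat{\kappa_3^{\mathrm{red}}}$. If its reduced third factorial cumulant $\kappa_3^{\mathrm{red}}$ has an $L^1(\mathbb{R}^2)$ density, then its factorial bispectrum (the Fourier transform of that density) is real, and the complete third-order transform differs from it only by real diagonal Fourier--Stieltjes terms.
   Context: Fourier convention: $\widehat f(\omega)=\int e^{-\mathrm{i}\omega\cdot t}f(t)\,dt$, and likewise for finite signed measures (Fourier--Stieltjes transform). $*$ is convolution on $\mathbb{R}$. Poisson branching-cluster process with immigrant rate $\nu$ and offspring density $mg$ ($g$ a probability density on $\mathbb{R}$): the rooted cluster $C$ is the counting measure of all individuals of a branching process started from one individual at $0$, in which each individual at $x$ independently produces offspring at the points of a Poisson process on $\mathbb{R}$ with intensity $m g(y-x)\,dy$; the stationary process is $N=\sum_j\vartheta_{U_j}C_j$ with $\{U_j\}$ a homogeneous Poisson process of rate $\nu$, independent of the i.i.d. copies $C_j$ of $C$, and $(\vartheta_u\mu)(A)=\mu(A-u)$. With $(RN)(A)=N(-A)$, $N$ is reversible if $N\stackrel{d}{=}RN$. Cumulant measures: $K_{\mathrm{fac}}(q)=\log\mathbb{E}\prod_{x\in N}(1+q(x))$ and $K_{\mathrm{comp}}(f)=\log\mathbb{E}e^{\int f\,dN}$. The factorial cumulant measure $\kappa_n$ and complete (ordinary) cumulant measure $\gamma_n$ are characterized by $\int\prod_jf_j(t_j)\,M_n(dt)=\partial_{s_0}\cdots\partial_{s_{n-1}}K(\sum_js_jf_j)|_{s=0}$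 for bounded compactly supported $f_0,\dots,f_{n-1}$, with $(M_n,K)=(\kappa_n,K_{\mathrm{fac}})$ or $(\gamma_n,K_{\mathrm{comp}})$, interpreted as finite-order variational derivatives at the origin (the standard factorial and ordinary cumulant measures). The reduced versions are defined by $\int F\,dM_n=\int_{\mathbb{R}}\int_{\mathbb{R}^{n-1}}F(t_0,t_0+\tau_1,\dots,t_0+\tau_{n-1})\,M_n^{\mathrm{red}}(d\tau)\,dt_0$. The complete reduced covariance measure is $\gamma_2^{\mathrm{red}}=\lambda\delta_0+\kappa_2^{\mathrm{red}}$, where $\lambda$ is the intensity, and the full Bartlett spectrum is $\Gamma=\widehat{\gamma_2^{\mathrm{red}}}$. Diagonal terms: the complete and factorial third-order transforms are related through $\widehat{\gamma_3^{\mathrm{red}}}(\omega_1,\omega_2)=\widehat{\kappa_3^{\mathrm{red}}}(\omega_1,\omega_2)+\Gamma(\omega_1)+\Gamma(\omega_2)+\Gamma(\omega_1+\omega_2)-2\lambda$; the terms other than $\widehat{\kappa_3^{\mathrm{red}}}$ are the diagonal Fourier--Stieltjes terms. *)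

theory Defs
  imports "HOL-Probability.Probability"
begin

section \<open>Densities, convolution, Fourier transform\<close>

definition prob_density :: "(real \<Rightarrow> real) \<Rightarrow> bool" where
  "prob_density f \<longleftrightarrow> f \<in> borel_measurable borel \<and> (\<forall>x. 0 \<le> f x) \<and> has_bochner_integral lborel f 1"

definition even_fun :: "(real \<Rightarrow> real) \<Rightarrow> bool" where
  "even_fun f \<longleftrightarrow> (\<forall>x. f (- x) = f x)"

definition fun_conv :: "(real \<Rightarrow> real) \<Rightarrow> (real \<Rightarrow> real) \<Rightarrow> real \<Rightarrow> real" where
  "fun_conv f g x = (LINT y|lborel. f (x - y) * g y)"

definition fourier :: "(real \<Rightarrow> real) \<Rightarrow> real \<Rightarrow> complex" where
  "fourier f w = (CLINT t|lborel. iexp (- (w * t)) * complex_of_real (f t))"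

definition rho :: "real \<Rightarrow> (real \<Rightarrow> real) \<Rightarrow> real \<Rightarrow> real" where
  "rho m h x = (h \<bar>x\<bar> - m * fun_conv h (\<lambda>y. h (- y)) x) / (2 - m)"

text \<open>Only meant for \<open>n \<ge> 1\<close>.\<close>

definition p_weight :: "real \<Rightarrow> nat \<Rightarrow> real" where
  "p_weight m n =
     fact (2 * n - 2) / (2 ^ (2 * n - 1) * fact n * fact (n - 1)) * ((m * (2 - m)) ^ n / m)"


section \<open>Point processes on the line\<close>

text \<open>
  Point processes are random elements of the space of Borel measures on the line. Its
  \<open>\<sigma>\<close>-algebra is generated by the evaluations \<open>\<mu> \<mapsto> \<mu> A\<close>,
  exactly as for the library's \<open>subprob_algebra\<close>, but without the bound on the total mass.
\<close>

definition measure_space_real :: "real measure measure" where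
  "measure_space_real =
     (SUP A \<in> sets (borel :: real measure).
        vimage_algebra {\<mu>. sets \<mu> = sets (borel :: real measure)} (\<lambda>\<mu>. emeasure \<mu> A) borel)"

text \<open>The library's \<open>indep_var\<close> needs both variables to have the same type.\<close>

definition indep_rvs ::
  "'w measure \<Rightarrow> 'x measure \<Rightarrow> ('w \<Rightarrow> 'x) \<Rightarrow> 'y measure \<Rightarrow> ('w \<Rightarrow> 'y) \<Rightarrow> bool" where
  "indep_rvs M S X T Y \<longleftrightarrow>
     X \<in> measurable M S \<and> Y \<in> measurable M T \<and>
     prob_space.indep_set M {X -` A \<inter> space M | A. A \<in> sets S} {Y -` B \<inter> space M | B. B \<in> sets T}"

text \<open>The counting measure \<open>\<Sum>i\<in>I. \<delta>(x i)\<close>; multiplicities are kept.\<close>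

definition points_measure :: "'i set \<Rightarrow> ('i \<Rightarrow> real) \<Rightarrow> real measure" where
  "points_measure I x = distr (count_space I) borel x"

definition translate :: "real \<Rightarrow> real measure \<Rightarrow> real measure" where
  "translate u \<mu> = distr \<mu> borel (\<lambda>x. x + u)"

definition reflect :: "real measure \<Rightarrow> real measure" where
  "reflect \<mu> = distr \<mu> borel uminus"

definition reversible :: "'w measure \<Rightarrow> ('w \<Rightarrow> real measure) \<Rightarrow> bool" where
  "reversible M N \<longleftrightarrow>
     distr M measure_space_real N = distr M measure_space_real (\<lambda>\<omega>. reflect (N \<omega>))"

definition has_intensity :: "'w measure \<Rightarrow> ('w \<Rightarrow> real measure) \<Rightarrow> real \<Rightarrow> bool" where
  "has_intensity M N l \<longleftrightarrow>
     (\<forall>A\<in>sets borel. (\<integral>\<^sup>+\<omega>. emeasure (N \<omega>) A \<partial>M) = ennreal l * emeasure lborel A)"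

text \<open>
  The Poisson probabilities are written out because the library's \<open>poisson_pmf\<close> is
  unspecified for rate \<open>0\<close>, which occurs for null sets.
\<close>

definition poisson_process :: "'w measure \<Rightarrow> real measure \<Rightarrow> ('w \<Rightarrow> real measure) \<Rightarrow> bool" where
  "poisson_process M \<Lambda> N \<longleftrightarrow>
     N \<in> measurable M measure_space_real \<and>
     (\<forall>A\<in>sets borel. emeasure \<Lambda> A < \<infinity> \<longrightarrow>
        (\<forall>k. measure M {\<omega>\<in>space M. emeasure (N \<omega>) A = of_nat k} =
           measure \<Lambda> A ^ k / fact k * exp (- measure \<Lambda> A))) \<and>
     (\<forall>A :: nat \<Rightarrow> real set. range A \<subseteq> sets borel \<and> disjoint_family A \<longrightarrow>
        prob_space.indep_vars M (\<lambda>_. borel) (\<lambda>i \<omega>. emeasure (N \<omega>) (A i)) UNIV)"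


section \<open>Poisson branching-cluster processes\<close>

text \<open>
  Individuals are labelled by their ancestral line, most recent generation first: the root is
  \<open>[]\<close> and \<open>i # u\<close> is the \<open>i\<close>-th child of \<open>u\<close>. The
  number of children of \<open>u\<close> is \<open>K u\<close>, and \<open>X u i\<close> is the
  displacement of the child \<open>i # u\<close> from its parent. The numbers \<open>K u\<close>,
  \<open>X u i\<close> are given for every label \<open>u\<close>; only those of labels that occur
  in the tree matter.
\<close>

primrec in_tree :: "(nat list \<Rightarrow> nat) \<Rightarrow> nat list \<Rightarrow> bool" where
  "in_tree K [] \<longleftrightarrow> True"
| "in_tree K (i # u) \<longleftrightarrow> in_tree K u \<and> i < K u"

primrec position :: "(nat list \<Rightarrow> nat \<Rightarrow> real) \<Rightarrow> nat list \<Rightarrow> real" where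
  "position X [] = 0"
| "position X (i # u) = position X u + X u i"

text \<open>
  The offspring of an individual at \<open>x\<close> form a Poisson process with intensity
  \<open>m g(y - x) dy\<close>, that is, their displacements from \<open>x\<close> form one with
  intensity \<open>m g(y) dy\<close>. How the points of this process are enumerated is
  immaterial, since different individuals reproduce independently.
\<close>

definition rooted_cluster ::
  "'w measure \<Rightarrow> real \<Rightarrow> (real \<Rightarrow> real) \<Rightarrow> ('w \<Rightarrow> real measure) \<Rightarrow> bool" where
  "rooted_cluster M m g C \<longleftrightarrow>
     (\<exists>(K :: nat list \<Rightarrow> 'w \<Rightarrow> nat) (X :: nat list \<Rightarrow> nat \<Rightarrow> 'w \<Rightarrow> real).
        prob_space.indep_vars M (\<lambda>_. count_space UNIV \<Otimes>\<^sub>M (\<Pi>\<^sub>M i\<in>UNIV. borel))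
          (\<lambda>u \<omega>. (K u \<omega>, \<lambda>i. X u i \<omega>)) UNIV \<and>
        (\<forall>u. poisson_process M (density lborel (\<lambda>y. ennreal (m * g y)))
               (\<lambda>\<omega>. points_measure {..<K u \<omega>} (\<lambda>i. X u i \<omega>))) \<and>
        (\<forall>\<omega>\<in>space M. C \<omega> =
           points_measure {u. in_tree (\<lambda>v. K v \<omega>) u} (position (\<lambda>v i. X v i \<omega>))))"

definition poisson_branching_cluster_process ::
  "'w measure \<Rightarrow> real \<Rightarrow> real \<Rightarrow> (real \<Rightarrow> real) \<Rightarrow> ('w \<Rightarrow> real measure) \<Rightarrow> bool" where
  "poisson_branching_cluster_process M \<nu> m g N \<longleftrightarrow>
     prob_space M \<and>
     (\<exists>(U :: nat \<Rightarrow> 'w \<Rightarrow> real) (C :: nat \<Rightarrow> 'w \<Rightarrow> real measure).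
        (\<forall>j. U j \<in> borel_measurable M) \<and>
        poisson_process M (density lborel (\<lambda>_. ennreal \<nu>)) (\<lambda>\<omega>. points_measure UNIV (\<lambda>j. U j \<omega>)) \<and>
        (\<forall>j. rooted_cluster M m g (C j)) \<and>
        prob_space.indep_vars M (\<lambda>_. measure_space_real) C UNIV \<and>
        indep_rvs M (\<Pi>\<^sub>M j\<in>UNIV. borel) (\<lambda>\<omega> j. U j \<omega>)
          (\<Pi>\<^sub>M j\<in>UNIV. measure_space_real) (\<lambda>\<omega> j. C j \<omega>) \<and>
        (\<forall>\<omega>\<in>space M. sets (N \<omega>) = sets borel \<and>
           (\<forall>A\<in>sets borel. emeasure (N \<omega>) A = (\<Sum>j. emeasure (translate (U j \<omega>) (C j \<omega>)) A))))"


section \<open>Cumulant measures\<close>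

text \<open>
  The product of \<open>1 + q x\<close> over the points of \<open>\<mu>\<close>, with multiplicity.
  If infinitely many points lie where \<open>q\<close> does not vanish (a null event below),
  the value is \<open>0\<close> by convention.
\<close>

definition point_prod :: "(real \<Rightarrow> real) \<Rightarrow> real measure \<Rightarrow> real" where
  "point_prod q \<mu> =
     (if emeasure \<mu> {x. q x \<noteq> 0} < \<infinity>
      then \<Prod>x | q x \<noteq> 0 \<and> emeasure \<mu> {x} \<noteq> 0. (1 + q x) ^ nat \<lfloor>measure \<mu> {x}\<rfloor>
      else 0)"

definition K_fac :: "'w measure \<Rightarrow> ('w \<Rightarrow> real measure) \<Rightarrow> (real \<Rightarrow> real) \<Rightarrow> real" where
  "K_fac M N q = ln (LINT \<omega>|M. point_prod q (N \<omega>))"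

definition K_comp :: "'w measure \<Rightarrow> ('w \<Rightarrow> real measure) \<Rightarrow> (real \<Rightarrow> real) \<Rightarrow> real" where
  "K_comp M N f = ln (LINT \<omega>|M. exp (LINT x|N \<omega>. f x))"

text \<open>
  \<open>has_mixed_partial n F D\<close>: the iterated derivative
  \<open>\<partial>\<^sub>0 \<dots> \<partial>\<^sub>n\<^sub>-\<^sub>1 F\<close> exists at the origin
  (innermost derivative with respect to the last variable) and equals \<open>D\<close>.
\<close>

primrec has_mixed_partial :: "nat \<Rightarrow> ((nat \<Rightarrow> real) \<Rightarrow> real) \<Rightarrow> real \<Rightarrow> bool" where
  "has_mixed_partial 0 F D \<longleftrightarrow> F (\<lambda>_. 0) = D"
| "has_mixed_partial (Suc n) F D \<longleftrightarrow>
     (\<exists>G. (\<exists>e>0. \<forall>s. (\<forall>j<n. \<bar>s j\<bar> < e) \<and> (\<forall>j\<ge>n. s j = 0) \<longrightarrow>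
              ((\<lambda>t. F (s(n := t))) has_real_derivative G s) (at 0)) \<and>
          has_mixed_partial n G D)"

text \<open>
  Signed measures are given by a pair \<open>(P, Q)\<close> of positive measures standing for
  \<open>P - Q\<close>; the pair is not unique, but every notion below depends on the difference
  only. Vectors indexed by a finite set \<open>J\<close> of numbers live in the product space
  over \<open>J\<close>: cumulant measures of order \<open>n\<close> have coordinates
  \<open>0, \<dots>, n - 1\<close> and reduced ones \<open>1, \<dots>, n - 1\<close>.
\<close>

type_synonym signed_pair = "(nat \<Rightarrow> real) measure \<times> (nat \<Rightarrow> real) measure"

definition signed_integral :: "signed_pair \<Rightarrow> ((nat \<Rightarrow> real) \<Rightarrow> real) \<Rightarrow> real" where
  "signed_integral \<sigma> F = (LINT t|fst \<sigma>. F t) - (LINT t|snd \<sigma>. F t)"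

definition locally_finite_on :: "nat set \<Rightarrow> (nat \<Rightarrow> real) measure \<Rightarrow> bool" where
  "locally_finite_on J P \<longleftrightarrow>
     sets P = sets (\<Pi>\<^sub>M j\<in>J. (borel :: real measure)) \<and>
     (\<forall>r. emeasure P (\<Pi>\<^sub>E j\<in>J. {-r..r}) < \<infinity>)"

definition signed_measure_on :: "nat set \<Rightarrow> signed_pair \<Rightarrow> bool" where
  "signed_measure_on J \<sigma> \<longleftrightarrow> locally_finite_on J (fst \<sigma>) \<and> locally_finite_on J (snd \<sigma>)"

definition finite_signed :: "signed_pair \<Rightarrow> bool" where
  "finite_signed \<sigma> \<longleftrightarrow> finite_measure (fst \<sigma>) \<and> finite_measure (snd \<sigma>)"

definition bounded_compact_support :: "(real \<Rightarrow> real) \<Rightarrow> bool" where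
  "bounded_compact_support f \<longleftrightarrow>
     f \<in> borel_measurable borel \<and> (\<exists>B. \<forall>x. \<bar>f x\<bar> \<le> B) \<and> (\<exists>r. \<forall>x. f x \<noteq> 0 \<longrightarrow> \<bar>x\<bar> \<le> r)"

definition bounded_compact_support_on :: "nat set \<Rightarrow> ((nat \<Rightarrow> real) \<Rightarrow> real) \<Rightarrow> bool" where
  "bounded_compact_support_on J F \<longleftrightarrow>
     F \<in> borel_measurable (\<Pi>\<^sub>M j\<in>J. borel) \<and> (\<exists>B. \<forall>t. \<bar>F t\<bar> \<le> B) \<and>
     (\<exists>r. \<forall>t. F t \<noteq> 0 \<longrightarrow> (\<forall>j\<in>J. \<bar>t j\<bar> \<le> r))"

definition is_cumulant_measure :: "((real \<Rightarrow> real) \<Rightarrow> real) \<Rightarrow> nat \<Rightarrow> signed_pair \<Rightarrow> bool" where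
  "is_cumulant_measure K n \<sigma> \<longleftrightarrow>
     signed_measure_on {..<n} \<sigma> \<and>
     (\<forall>f :: nat \<Rightarrow> real \<Rightarrow> real. (\<forall>j<n. bounded_compact_support (f j)) \<longrightarrow>
        has_mixed_partial n (\<lambda>s. K (\<lambda>x. \<Sum>j<n. s j * f j x))
          (signed_integral \<sigma> (\<lambda>t. \<Prod>j<n. f j (t j))))"

definition is_reduction :: "nat \<Rightarrow> signed_pair \<Rightarrow> signed_pair \<Rightarrow> bool" where
  "is_reduction n \<sigma> \<tau> \<longleftrightarrow>
     signed_measure_on {1..<n} \<tau> \<and>
     (\<forall>F. bounded_compact_support_on {..<n} F \<longrightarrow>
        signed_integral \<sigma> F =
          (LINT t0|lborel. signed_integral \<tau> (\<lambda>v. F (\<lambda>j\<in>{..<n}. if j = 0 then t0 else t0 + v j))))"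

definition is_reduced_cumulant_measure ::
  "((real \<Rightarrow> real) \<Rightarrow> real) \<Rightarrow> nat \<Rightarrow> signed_pair \<Rightarrow> bool" where
  "is_reduced_cumulant_measure K n \<tau> \<longleftrightarrow> (\<exists>\<sigma>. is_cumulant_measure K n \<sigma> \<and> is_reduction n \<sigma> \<tau>)"

text \<open>The frequencies \<open>\<omega>\<^sub>1, \<dots>, \<omega>\<^sub>n\<^sub>-\<^sub>1\<close> are \<open>w 1, \<dots>, w (n - 1)\<close>.\<close>

definition fourier_stieltjes :: "nat \<Rightarrow> signed_pair \<Rightarrow> (nat \<Rightarrow> real) \<Rightarrow> complex" where
  "fourier_stieltjes n \<tau> w =
     (CLINT v|fst \<tau>. iexp (- (\<Sum>j\<in>{1..<n}. w j * v j))) -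
     (CLINT v|snd \<tau>. iexp (- (\<Sum>j\<in>{1..<n}. w j * v j)))"

definition lborel_on :: "nat set \<Rightarrow> (nat \<Rightarrow> real) measure" where
  "lborel_on J = (\<Pi>\<^sub>M j\<in>J. lborel)"

definition signed_density :: "nat set \<Rightarrow> ((nat \<Rightarrow> real) \<Rightarrow> real) \<Rightarrow> signed_pair" where
  "signed_density J k =
     (density (lborel_on J) (\<lambda>v. ennreal (k v)), density (lborel_on J) (\<lambda>v. ennreal (- k v)))"

definition fourier_on :: "nat set \<Rightarrow> ((nat \<Rightarrow> real) \<Rightarrow> real) \<Rightarrow> (nat \<Rightarrow> real) \<Rightarrow> complex" where
  "fourier_on J k w =
     (CLINT v|lborel_on J. iexp (- (\<Sum>j\<in>J. w j * v j)) * complex_of_real (k v))"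

definition full_bartlett_spectrum ::
  "'w measure \<Rightarrow> ('w \<Rightarrow> real measure) \<Rightarrow> (real \<Rightarrow> complex) \<Rightarrow> bool" where
  "full_bartlett_spectrum M N \<Gamma> \<longleftrightarrow>
     (\<exists>\<gamma>. is_reduced_cumulant_measure (K_comp M N) 2 \<gamma> \<and> finite_signed \<gamma> \<and>
          (\<forall>w. \<Gamma> w = fourier_stieltjes 2 \<gamma> (\<lambda>_. w)))"

end

theory Submission
  imports Defs
begin

text \<open>
  On the Fourier side \<open>\<phi>\<close> is determined by \<open>1 - m \<phi>^ = |1 - m h^|\<close>, since
  \<open>1 - m (2 - m) \<rho>^ = |1 - m h^|\<^sup>2\<close> and the weights \<open>p\<^sub>n\<close> are the coefficients of
  \<open>(1 - sqrt (1 - m (2 - m) z)) / m\<close>.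
  The log-Laplace functional of the process is \<open>\<nu> \<integral> (G a x - 1) dx\<close>, where \<open>G a x\<close> is the expected
  product of \<open>a\<close> over a cluster rooted at \<open>x\<close>. For even \<open>\<phi>\<close> the functional \<open>G\<close> is invariant under
  reflection, which gives reversibility and symmetric, hence real, transforms.
  Differentiating under the integral expresses the cumulants by sums over tuples of individuals of one
  cluster; the second-order sum is the squared modulus of \<open>\<Sum>\<^sub>u exp (- i w X\<^sub>u)\<close>, whose mean is
  \<open>1 / ((1 - m) |1 - m \<phi>^|\<^sup>2)\<close> because the tree decomposes this sum into orthogonal increments, and
  the third-order relation splits triples by their coincidences.
\<close>

text \<open>All facts about the law of a cluster come from one recursion: integrating out the
  offspring of generation \<open>n\<close> turns a weight \<open>g\<close> on generation
  \<open>n + 1\<close> into the weight \<open>a * mult g\<close> on generation \<open>n\<close>, and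
  \<open>mult\<close> involves only \<open>m\<close> and \<phi>. Hence the functionals depend on
  \<open>(m, \<phi>)\<close> alone, and reflection passes through every step. The obstacle is
  integrability: derivatives in all directions require products of weights above 1 over a random
  tree. Since \<open>m < 1\<close> there are constants above 1 with
  \<open>alpha * exp (m * (beta - 1)) = beta\<close>, so the recursion preserves the bound
  \<open>beta\<close>, and \<open>alpha ^ |C|\<close> has finite mean for the cluster size |C|.
  Weights are then kept between some \<delta> > 0 and \<open>theta = sqrt alpha\<close>: logarithms
  stay bounded, and the slack between \<open>theta\<close> and \<open>alpha\<close> absorbs every
  power of |C| that differentiation produces. A second obstacle is that the theorem speaks of
  arbitrary reduced cumulant measures, given as non-unique pairs. So transforms are compared through
  product test functions, and one explicit positive representative \<open>red_pair\<close> serves as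
  the reference.\<close>

abbreviation (input) "BM M \<equiv> borel_measurable M"

abbreviation (input) LIMSEQ_ascii ("((_)/ ----> (_))" [60, 60] 60) where
  "X ----> L \<equiv> X \<longlonglongrightarrow> L"

lemmas bintegrable_add = Bochner_Integration.integrable_add
 and bintegrable_bound = Bochner_Integration.integrable_bound
 and bintegrable_diff = Bochner_Integration.integrable_diff
 and bintegral_add = Bochner_Integration.integral_add
 and bintegral_cong = Bochner_Integration.integral_cong
 and bintegral_diff = Bochner_Integration.integral_diff
 and bintegral_nonneg = Bochner_Integration.integral_nonneg
 and bintegral_sum = Bochner_Integration.integral_sum

section \<open>The summand density and the law of the number of summands\<close>

text \<open>Consecutive binomial coefficients of 1/2 have the same ratio, by
  \<open>gbinomial_mult_1\<close>, as consecutive factorial quotients. The sign pattern makes every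
  coefficient after the constant one negative, so that they can be read as minus
  probabilities.\<close>

lemma gbinomial_half_Suc:
 "(1 / 2 gchoose Suc n) * (- 1) ^ Suc n =
  - (fact (2 * n) / (2 ^ (2 * n + 1) * fact (Suc n) * fact n) :: real)"
proof (induction n)
 case 0
 then show ?case by simp
next
 case (Suc n)
 have r: "(1 / 2 gchoose Suc (Suc n)) * real (n + 2) = (1 / 2 - real (n + 1)) * (1 / 2 gchoose Suc n)"
  using gbinomial_mult_1[of "1 / 2 :: real" "Suc n"] by (simp add: algebra_simps)
 have "(1 / 2 gchoose Suc (Suc n)) * (- 1) ^ Suc (Suc n) * real (n + 2)
   = ((1 / 2 gchoose Suc (Suc n)) * real (n + 2)) * (- 1) ^ Suc (Suc n)"
  by (simp only: mult_ac)
 also have "... = - (1 / 2 - real (n + 1)) * ((1 / 2 gchoose Suc n) * (- 1) ^ Suc n)"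
  unfolding r by (simp add: algebra_simps)
 also have "... = (1 / 2 - real (n + 1)) * (fact (2 * n) / (2 ^ (2 * n + 1) * fact (Suc n) * fact n))"
  unfolding Suc.IH by (simp only: mult_minus_left mult_minus_right minus_minus)
 also have "... = - (fact (2 * Suc n) / (2 ^ (2 * Suc n + 1) * fact (Suc (Suc n)) * fact (Suc n))) * real (n + 2)"
 proof -
  \<comment> \<open>With factorials and powers frozen as atoms the claim is an identity of rational
    functions in \<open>x\<close>.\<close>
  define F where "F = (fact (2 * n) :: real)"
  define a where "a = (fact n :: real)"
  define p where "p = (2 ^ (2 * n) :: real)"
  define x where "x = real n"
  have nz: "a ~= 0" "p ~= 0" "1 + x ~= 0" "2 + x ~= 0"
   unfolding a_def p_def x_def by auto
  have e: "fact (2 * Suc n) = (2 * x + 2) * (2 * x + 1) * F" "fact (Suc n) = (1 + x) * a"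
   "fact (Suc (Suc n)) = (2 + x) * ((1 + x) * a)"
   "(2::real) ^ (2 * n + 1) = 2 * p" "(2::real) ^ (2 * Suc n + 1) = 8 * p" "real (n + 2) = 2 + x" "real (n + 1) = 1 + x"
   unfolding F_def a_def p_def x_def by (simp_all add: algebra_simps)
  show ?thesis
   unfolding e F_def[symmetric] a_def[symmetric] using nz by (simp add: divide_simps) (simp add: algebra_simps)
 qed
 finally show ?case by (simp only: mult_cancel_right) simp
qed

lemma sums_one_minus_sqrt:
 fixes z :: real
 assumes "\<bar>z\<bar> < 1"
 shows "(%n. fact (2 * n) / (2 ^ (2 * n + 1) * fact (Suc n) * fact n) * z ^ Suc n) sums (1 - sqrt (1 - z))"
proof -
 have "(%n. (1 / 2 gchoose n) * (- z) ^ n) sums sqrt (1 + - z)"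
  using assms by (intro sqrt_series) simp
 then have "(%n. (1 / 2 gchoose Suc n) * (- z) ^ Suc n) sums (sqrt (1 - z) - 1)"
  by (subst sums_Suc_iff) simp
 then have "(%n. - ((1 / 2 gchoose Suc n) * (- z) ^ Suc n)) sums - (sqrt (1 - z) - 1)"
  by (rule sums_minus)
 moreover have "- ((1 / 2 gchoose Suc n) * (- z) ^ Suc n) =
   fact (2 * n) / (2 ^ (2 * n + 1) * fact (Suc n) * fact n) * z ^ Suc n" for n
 proof -
  have "(- z) ^ Suc n = (- 1) ^ Suc n * z ^ Suc n"
   by (rule power_minus)
  then show ?thesis
   using gbinomial_half_Suc[of n] by (metis minus_mult_left mult.assoc minus_minus)
 qed
 ultimately show ?thesis by simp
qed

lemma p_weight_Suc:
 "p_weight m (Suc n) =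
  fact (2 * n) / (2 ^ (2 * n + 1) * fact (Suc n) * fact n) * (m * (2 - m)) ^ Suc n / m"
 by (simp add: p_weight_def)

text \<open>The probability generating function of the law of \<open>K\<close>. Evaluated at a real
  value \<open>r\<close> of the transform of one summand it becomes the transform of the random
  sum.\<close>

lemma p_weight_power_sums:
 assumes "\<bar>m * (2 - m) * r\<bar> < 1"
 shows "(%n. p_weight m (Suc n) * r ^ Suc n) sums ((1 - sqrt (1 - m * (2 - m) * r)) / m)"
proof -
 have "p_weight m (Suc n) * r ^ Suc n =
   fact (2 * n) / (2 ^ (2 * n + 1) * fact (Suc n) * fact n) * (m * (2 - m) * r) ^ Suc n / m" for n
  unfolding p_weight_Suc power_mult_distrib[of "m * (2 - m)"] by simp
 then show ?thesis
  using sums_divide[OF sums_one_minus_sqrt[OF assms], of m] by simp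
qed

lemma mult_two_minus_bounds:
 fixes m :: real
 assumes "0 < m" "m < 1"
 shows "0 < m * (2 - m)" "m * (2 - m) < 1"
proof -
 show "0 < m * (2 - m)" using assms by simp
 have "0 < (1 - m)\<^sup>2" using assms by simp
 then show "m * (2 - m) < 1" by (simp add: power2_eq_square algebra_simps)
qed

text \<open>At \<open>r = 1\<close> the square root is exactly \<open>1 - m\<close>, because
  \<open>1 - m * (2 - m)\<close> is the square of this positive number.\<close>

lemma p_weight_sums:
 assumes "0 < m" "m < 1"
 shows "(%n. p_weight m (Suc n)) sums 1"
proof -
 have "1 - m * (2 - m) = (1 - m)\<^sup>2" by (simp add: power2_eq_square algebra_simps)
 then have "sqrt (1 - m * (2 - m)) = 1 - m" using assms by simp
 then show ?thesis
  using p_weight_power_sums[of m 1] mult_two_minus_bounds[OF assms] assms by simp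
qed

section \<open>Fourier transforms and convolutions of integrable functions\<close>

lemma prob_densityD:
 assumes "prob_density f"
 shows "f \<in> BM borel" "0 <= f x" "integrable lborel f" "integral\<^sup>L lborel f = 1"
 using assms by (auto simp: prob_density_def has_bochner_integral_iff)

lemma integrable_fourier [intro]:
 assumes "integrable lborel f"
 shows "integrable lborel (%t. iexp (- (w * t)) * complex_of_real (f t))"
 by (rule bintegrable_bound[OF integrable_norm[OF assms]])
  (use assms in "auto simp: norm_mult")

lemma integrable_lborel_diff:
 fixes f :: "real => real"
 assumes "integrable lborel f"
 shows "integrable lborel (%x. f (x - y))"
 using lborel_integrable_real_affine[OF assms, of 1 "- y"] by simp

lemma integral_lborel_diff:
 fixes f :: "real => 'a :: {banach, second_countable_topology}"
 shows "(LINT x|lborel. f (x - y)) = integral\<^sup>L lborel f"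
 using lborel_integral_real_affine[of 1 f "- y"] by simp

text \<open>Tonelli is run with \<open>y\<close> outside: for fixed \<open>y\<close> the inner
  integral over \<open>x\<close> is translation invariant, so the double integral factors. The
  coordinates are swapped back at the end.\<close>

lemma integrable_conv_pair:
 fixes f g :: "real => real"
 assumes f: "integrable lborel f" and g: "integrable lborel g"
 shows "integrable (lborel \<Otimes>\<^sub>M lborel) (%(x, y). f (x - y) * g y :: real)"
proof -
 have [measurable]: "f \<in> BM borel" "g \<in> BM borel"
  using f g by auto
 have "integrable (lborel \<Otimes>\<^sub>M lborel) (%(y, x). f (x - y) * g y)"
 proof (rule lborel_pair.Fubini_integrable)
  show "(%(y, x). f (x - y) * g y) \<in> BM (lborel \<Otimes>\<^sub>M lborel)"
   by measurable
  have *: "(LINT x|lborel. norm (f (x - y) * g y)) = (LINT x|lborel. \<bar>f x\<bar>) * \<bar>g y\<bar>" for y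
   using integral_lborel_diff[of "%x. \<bar>f x\<bar>" y] by (simp add: abs_mult)
  show "integrable lborel (%y. LINT x|lborel. norm (case (y, x) of (y, x) => f (x - y) * g y))"
   by (simp only: prod.case *) (use g in auto)
  show "AE y in lborel. integrable lborel (%x. case (y, x) of (y, x) => f (x - y) * g y)"
   using integrable_lborel_diff[OF f] by auto
 qed
 from lborel_pair.integrable_product_swap[OF this] show ?thesis
  by (simp add: case_prod_unfold)
qed

lemma integrable_fun_conv:
 assumes "integrable lborel f" "integrable lborel g"
 shows "integrable lborel (fun_conv f g)"
proof -
 show ?thesis
  using lborel_pair.integrable_fst'[OF integrable_conv_pair[OF assms]] by (simp add: fun_conv_def[abs_def])
qed

lemma fourier_fun_conv:
 assumes f: "integrable lborel f" and g: "integrable lborel g"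
 shows "fourier (fun_conv f g) w = fourier f w * fourier g w"
proof -
 have [measurable]: "f \<in> BM borel" "g \<in> BM borel"
  using f g by auto
 define F where "F = (%x y. iexp (- (w * x)) * complex_of_real (f (x - y) * g y))"
 have int: "integrable (lborel \<Otimes>\<^sub>M lborel) (%(x, y). F x y)"
  by (rule bintegrable_bound[OF integrable_norm[OF integrable_conv_pair[OF f g]]])
   (auto simp: F_def norm_mult)
 have "fourier (fun_conv f g) w = (LINT x|lborel. LINT y|lborel. F x y)"
  unfolding fourier_def fun_conv_def F_def by (simp flip: integral_complex_of_real)
 also have "... = (LINT y|lborel. LINT x|lborel. F x y)"
  using lborel_pair.Fubini_integral[of "%x y. F x y"] int by simp
 also have "... = (LINT y|lborel. fourier f w * (iexp (- (w * y)) * complex_of_real (g y)))"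
 proof (rule bintegral_cong[OF refl])
  fix y :: real
  have "(LINT x|lborel. F x y) =
    (LINT x|lborel. (iexp (- (w * (x - y))) * complex_of_real (f (x - y))) * (iexp (- (w * y)) * complex_of_real (g y)))"
   by (intro bintegral_cong)
    (auto simp: F_def algebra_simps simp flip: exp_add)
  also have "... = (LINT x|lborel. iexp (- (w * (x - y))) * complex_of_real (f (x - y))) * (iexp (- (w * y)) * complex_of_real (g y))"
   by (rule integral_mult_left_zero)
  also have "(LINT x|lborel. iexp (- (w * (x - y))) * complex_of_real (f (x - y))) = fourier f w"
   unfolding fourier_def using integral_lborel_diff[of "%x. iexp (- (w * x)) * complex_of_real (f x)" y] by simp
  finally show "(LINT x|lborel. F x y) = fourier f w * (iexp (- (w * y)) * complex_of_real (g y))" .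
 qed
 also have "... = fourier f w * fourier g w"
  by (simp add: fourier_def)
 finally show ?thesis .
qed

lemma integrable_uminus:
 fixes f :: "real => real"
 shows "integrable lborel f ==> integrable lborel (%x. f (- x))"
 using lborel_integrable_real_affine[of f "-1" 0] by simp

lemma integral_lborel_uminus:
 fixes f :: "real => 'a :: {banach, second_countable_topology}"
 shows "(LINT x|lborel. f (- x)) = integral\<^sup>L lborel f"
 using lborel_integral_real_affine[of "-1" f 0] by simp

lemma fourier_uminus: "fourier (%x. f (- x)) w = cnj (fourier f w)"
proof -
 have "cnj (fourier f w) = (LINT t|lborel. cnj (iexp (- (w * t)) * complex_of_real (f t)))"
  unfolding fourier_def by (rule Bochner_Integration.integral_cnj[symmetric])
 also have "... = (LINT t|lborel. iexp (w * t) * complex_of_real (f t))"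
  by (simp add: exp_cnj)
 also have "... = (LINT t|lborel. iexp (w * - t) * complex_of_real (f (- t)))"
  by (rule integral_lborel_uminus[symmetric])
 finally show ?thesis by (simp add: fourier_def)
qed

lemma fourier_norm_le:
 assumes "prob_density f"
 shows "cmod (fourier f w) <= 1"
proof -
 have "cmod (fourier f w) <= (LINT t|lborel. cmod (iexp (- (w * t)) * complex_of_real (f t)))"
  unfolding fourier_def by (rule integral_norm_bound)
 also have "... = 1" using prob_densityD[OF assms] by (simp add: norm_mult)
 finally show ?thesis .
qed

section \<open>The summand density \<open>rho m h\<close>\<close>

context
 fixes m :: real and h :: "real => real"
 assumes m: "0 < m" "m < 1" and h: "prob_density h" and h0: "\<forall>x<0. h x = 0"
begin

private lemma h_meas [measurable]: "h \<in> BM borel"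
 and h_int: "integrable lborel h" and h_int': "integrable lborel (%x. h (- x))"
 using prob_densityD[OF h] integrable_uminus[of h] by auto

text \<open>Off the origin one of \<open>h x\<close> and \<open>h (- x)\<close> vanishes and the
  other is \<open>h \<bar>x\<bar>\<close>; at 0 the sum would count \<open>h 0\<close> twice. This
  makes \<open>rho\<close> accessible to linearity of the transform.\<close>

private lemma rho_AE:
 "AE x in lborel. rho m h x = (h x + h (- x) - m * fun_conv h (%y. h (- y)) x) / (2 - m)"
proof -
 have "AE x in lborel. x ~= (0::real)" by (rule AE_lborel_singleton)
 then show ?thesis
  by eventually_elim (use h0 in "auto simp: rho_def abs_if")
qed

private lemma int_conv: "integrable lborel (fun_conv h (%y. h (- y)))"
 by (rule integrable_fun_conv[OF h_int h_int'])

lemma rho_measurable: "rho m h \<in> BM borel"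
 unfolding rho_def fun_conv_def by measurable

lemma integrable_rho: "integrable lborel (rho m h)"
proof (subst integrable_cong_AE[OF _ _ rho_AE])
 show "rho m h \<in> BM lborel" using rho_measurable by simp
 have [measurable]: "fun_conv h (%y. h (- y)) \<in> BM borel" using int_conv by auto
 show "(%x. (h x + h (- x) - m * fun_conv h (%y. h (- y)) x) / (2 - m)) \<in> BM lborel"
  by measurable
 show "integrable lborel (%x. (h x + h (- x) - m * fun_conv h (%y. h (- y)) x) / (2 - m))"
  using h_int h_int' int_conv by (intro integrable_divide bintegrable_diff bintegrable_add integrable_mult_right) auto
qed

lemma fourier_rho:
 "(2 - m) * fourier (rho m h) w = fourier h w + cnj (fourier h w) - m * (fourier h w * cnj (fourier h w))"
proof -
 have [measurable]: "fun_conv h (%y. h (- y)) \<in> BM borel" using int_conv by auto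
 have [measurable]: "rho m h \<in> BM borel" using rho_measurable by simp
 let ?e = "%t. iexp (- (w * t))"
 have "(2 - m) * fourier (rho m h) w = (LINT t|lborel. (2 - m) * (?e t * complex_of_real (rho m h t)))"
  unfolding fourier_def by simp
 also have "... = (LINT t|lborel. ?e t * complex_of_real (h t) + ?e t * complex_of_real (h (- t))
   - m * (?e t * complex_of_real (fun_conv h (%y. h (- y)) t)))"
 proof (rule integral_cong_AE)
  show "AE x in lborel. complex_of_real (2 - m) * (?e x * complex_of_real (rho m h x)) =
    ?e x * complex_of_real (h x) + ?e x * complex_of_real (h (- x)) -
    complex_of_real m * (?e x * complex_of_real (fun_conv h (%y. h (- y)) x))"
   using rho_AE
  proof eventually_elim
   case (elim x)
   then have "(2 - m) * rho m h x = h x + h (- x) - m * fun_conv h (%y. h (- y)) x"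
    using m by simp
   then have "?e x * complex_of_real ((2 - m) * rho m h x) =
    ?e x * complex_of_real (h x + h (- x) - m * fun_conv h (%y. h (- y)) x)"
    by (simp only:)
   then show ?case
    by (simp add: algebra_simps)
  qed
 qed measurable
 also have "... = fourier h w + fourier (%x. h (- x)) w - m * fourier (fun_conv h (%y. h (- y))) w"
  unfolding fourier_def
  using integrable_fourier[OF h_int, of w] integrable_fourier[OF h_int', of w] integrable_fourier[OF int_conv, of w]
  by simp
 finally show ?thesis
  by (simp add: fourier_uminus fourier_fun_conv[OF h_int h_int'])
qed

text \<open>By \<open>fourier_rho\<close> the left-hand side multiplies out from
  \<open>1 - m h^\<close> times its conjugate. The divisor \<open>2 - m\<close> in
  \<open>rho\<close>, which normalises its mass to 1, cancels here against the factor
  \<open>2 - m\<close>.\<close>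

lemma one_minus_fourier_rho:
 "1 - m * (2 - m) * fourier (rho m h) w = complex_of_real ((cmod (1 - m * fourier h w))\<^sup>2)"
proof -
 have "complex_of_real ((cmod (1 - m * fourier h w))\<^sup>2) = (1 - m * fourier h w) * cnj (1 - m * fourier h w)"
  by (rule complex_norm_square)
 also have "... = 1 - m * (fourier h w + cnj (fourier h w) - m * (fourier h w * cnj (fourier h w)))"
  by (simp add: algebra_simps)
 also have "... = 1 - m * ((2 - m) * fourier (rho m h) w)"
  unfolding fourier_rho ..
 finally show ?thesis by (simp add: mult.assoc)
qed

lemma fourier_rho_real: "fourier (rho m h) w \<in> \<real>"
proof -
 have "m * (2 - m) * fourier (rho m h) w = complex_of_real (1 - (cmod (1 - m * fourier h w))\<^sup>2)"
  using one_minus_fourier_rho[of w] by (simp add: algebra_simps)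
 then have "complex_of_real (m * (2 - m)) * fourier (rho m h) w \<in> \<real>"
  by (simp only: Reals_of_real)
 moreover have "complex_of_real (m * (2 - m)) ~= 0"
  unfolding of_real_eq_0_iff using m by simp
 ultimately show ?thesis
  by (metis Reals_divide Reals_of_real nonzero_mult_div_cancel_left)
qed

lemma cmod_one_minus_fourier_ge: "(1 - m)\<^sup>2 <= (cmod (1 - m * fourier h w))\<^sup>2"
proof -
 have "cmod (m * fourier h w) <= m"
  using fourier_norm_le[OF h, of w] m by (simp add: norm_mult mult_left_le)
 then have "1 - m <= cmod (1 - m * fourier h w)"
  using norm_triangle_ineq2[of 1 "m * fourier h w"] by simp
 then show ?thesis using m by (intro power_mono) auto
qed

lemma rho_even: "rho m h (- x) = rho m h x"
proof -
 have "fun_conv h (%y. h (- y)) (- x) = (LINT y|lborel. h (- x - (y - x)) * h (- (y - x)))"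
  unfolding fun_conv_def using integral_lborel_diff[of "%y. h (- x - y) * h (- y)" x] by simp
 also have "... = fun_conv h (%y. h (- y)) x"
  unfolding fun_conv_def by (intro bintegral_cong) (auto simp: mult.commute)
 finally show ?thesis by (simp add: rho_def)
qed

text \<open>For \<open>x > 0\<close> the correlation is the integral of
  \<open>h (x + z) * h z\<close>. Only \<open>z > 0\<close> matters, where monotonicity bounds the
  first factor by \<open>h x\<close>; as \<open>h\<close> has mass 1 the correlation is at most
  \<open>h x\<close>, and \<open>m < 1\<close> finishes. Negative \<open>x\<close> follow by
  evenness.\<close>

lemma rho_nonneg_AE:
 assumes "antimono_on {0<..} h'" and "AE x in lborel. 0 < x --> h' x = h x"
 shows "AE x in lborel. 0 <= rho m h x"
proof -
 have pos: "0 <= rho m h x" if "0 < x" "h' x = h x" for x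
 proof -
  \<comment> \<open>The set where the monotone version \<open>h'\<close> differs from
    \<open>h\<close> is null, and so is its translate by \<open>x\<close>; the comparison of
    \<open>h (x + z)\<close> with \<open>h x\<close> is thus available for almost every
    \<open>z\<close>.\<close>
  have "AE z in distr lborel borel ((+) x). 0 < z --> h' z = h z"
   unfolding lborel_distr_plus by (rule assms(2))
  then have "AE z in lborel. 0 < x + z --> h' (x + z) = h (x + z)"
   by (rule AE_distrD[rotated]) simp
  then have AE: "AE z in lborel. h (x + z) * h z <= h x * h z"
   using AE_lborel_singleton[of 0]
  proof eventually_elim
   case (elim z)
   show ?case
   proof (cases "0 < z")
    case True
    then have "h (x + z) = h' (x + z)" using elim that by simp
    also have "... <= h' x"
    using monotone_onD[OF assms(1), of x "x + z"] True that by simp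
    finally show ?thesis
    using that prob_densityD(2)[OF h, of z] by (simp add: mult_right_mono)
   next
    case False
    then show ?thesis using h0 elim by simp
   qed
  qed
  have "fun_conv h (%y. h (- y)) x = (LINT z|lborel. h (x + z) * h z)"
   unfolding fun_conv_def using integral_lborel_uminus[of "%y. h (x - y) * h (- y)"] by simp
  also have "... <= (LINT z|lborel. h x * h z)"
   using h_int AE prob_densityD(2)[OF h] by (intro integral_mono_AE') auto
  also have "... = h x" using prob_densityD(4)[OF h] by simp
  finally have "m * fun_conv h (%y. h (- y)) x <= m * h x"
   using m by (intro mult_left_mono) auto
  also have "... <= 1 * h x"
   using m prob_densityD(2)[OF h, of x] by (intro mult_right_mono) auto
  finally have "m * fun_conv h (%y. h (- y)) x <= h x" by simp
  then show ?thesis using that m by (simp add: rho_def)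
 qed
 have "AE z in distr lborel borel uminus. 0 < z --> h' z = h z"
  unfolding lborel_distr_uminus by (rule assms(2))
 then have "AE z in lborel. 0 < - z --> h' (- z) = h (- z)"
  by (rule AE_distrD[rotated]) simp
 then show ?thesis
  using assms(2) AE_lborel_singleton[of 0]
 proof eventually_elim
  case (elim x)
  consider "0 < x" | "0 < - x" using elim by linarith
  then show ?case
   using pos[of x] pos[of "- x"] elim rho_even[of x] by cases auto
 qed
qed

lemma ex_rho_density:
 assumes "\<exists>h'. antimono_on {0<..} h' \<and> (AE x in lborel. 0 < x --> h' x = h x)"
 shows "\<exists>\<rho>. prob_density \<rho> \<and> even_fun \<rho> \<and> (AE x in lborel. \<rho> x = rho m h x)"
proof -
 have nn: "AE x in lborel. 0 <= rho m h x" using assms rho_nonneg_AE by blast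
 have [measurable]: "rho m h \<in> BM borel" by (rule rho_measurable)
 \<comment> \<open>\<open>rho m h\<close> is nonnegative only almost everywhere, while
   \<open>prob_density\<close> asks for every point; hence the truncation at 0.\<close>
 have eq: "AE x in lborel. max 0 (rho m h x) = rho m h x"
  using nn by eventually_elim simp
 \<comment> \<open>The mass is read off the transform at frequency 0, where the right-hand side of
   \<open>fourier_rho\<close> is \<open>1 + 1 - m\<close>.\<close>
 have "fourier h 0 = 1" using prob_densityD(4)[OF h] by (simp add: fourier_def)
 then have "complex_of_real (2 - m) * fourier (rho m h) 0 = complex_of_real (2 - m) * 1"
  using fourier_rho[of 0] by simp
 moreover have "complex_of_real (2 - m) ~= 0"
  unfolding of_real_eq_0_iff using m by simp
 ultimately have "fourier (rho m h) 0 = 1"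
  by (simp only: mult_cancel_left) simp
 then have "integral\<^sup>L lborel (rho m h) = 1" by (simp add: fourier_def)
 then have "has_bochner_integral lborel (%x. max 0 (rho m h x)) 1"
  using integrable_rho eq
  by (subst has_bochner_integral_cong_AE[OF _ _ eq]) (auto simp: has_bochner_integral_iff)
 then show ?thesis
  using eq rho_even
  by (intro exI[of _ "%x. max 0 (rho m h x)"]) (auto simp: prob_density_def even_fun_def)
qed

declare h_meas [measurable del]

end

section \<open>The random sum\<close>

lemma (in prob_space) indep_rvsD:
 assumes "indep_rvs M S X T Y" "A \<in> sets S" "B \<in> sets T"
 shows "prob {om \<in> space M. X om \<in> A \<and> Y om \<in> B} =
  prob {om \<in> space M. X om \<in> A} * prob {om \<in> space M. Y om \<in> B}"
proof -
 have "indep_set {X -` A \<inter> space M | A. A \<in> sets S} {Y -` B \<inter> space M | B. B \<in> sets T}"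
  using assms by (simp add: indep_rvs_def)
 from indep_setD[OF this, of "X -` A \<inter> space M" "Y -` B \<inter> space M"] assms(2,3)
 have "prob ((X -` A \<inter> space M) \<inter> (Y -` B \<inter> space M)) = prob (X -` A \<inter> space M) * prob (Y -` B \<inter> space M)"
  by blast
 then show ?thesis
  by (simp add: vimage_def Int_def conj_ac)
qed

lemma (in prob_space) distr_pair_eqI:
 assumes [measurable]: "X \<in> measurable M S" "Y \<in> measurable M T"
  and prod: "!!A B. A \<in> sets S ==> B \<in> sets T ==>
   prob {om \<in> space M. X om \<in> A \<and> Y om \<in> B} =
   prob {om \<in> space M. X om \<in> A} * prob {om \<in> space M. Y om \<in> B}"
 shows "distr M S X \<Otimes>\<^sub>M distr M T Y = distr M (S \<Otimes>\<^sub>M T) (%om. (X om, Y om))"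
proof (rule pair_measure_eqI)
 interpret X: prob_space "distr M S X" by (rule prob_space_distr) fact
 interpret Y: prob_space "distr M T Y" by (rule prob_space_distr) fact
 show "sigma_finite_measure (distr M S X)" "sigma_finite_measure (distr M T Y)" by unfold_locales
 show "sets (distr M S X \<Otimes>\<^sub>M distr M T Y) = sets (distr M (S \<Otimes>\<^sub>M T) (%om. (X om, Y om)))"
  by (simp cong: sets_pair_measure_cong)
 fix A B assume A: "A \<in> sets (distr M S X)" and B: "B \<in> sets (distr M T Y)"
 then have [measurable]: "A \<in> sets S" "B \<in> sets T" by auto
 have "emeasure (distr M (S \<Otimes>\<^sub>M T) (%om. (X om, Y om))) (A \<times> B) =
   emeasure M ((%om. (X om, Y om)) -` (A \<times> B) \<inter> space M)"
  by (rule emeasure_distr) measurable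
 also have "(%om. (X om, Y om)) -` (A \<times> B) \<inter> space M = {om \<in> space M. X om \<in> A \<and> Y om \<in> B}"
  by auto
 also have "emeasure M ... = emeasure M {om \<in> space M. X om \<in> A} * emeasure M {om \<in> space M. Y om \<in> B}"
  using prod[of A B] by (simp add: emeasure_eq_measure ennreal_mult)
 also have "... = emeasure (distr M S X) A * emeasure (distr M T Y) B"
  by (simp add: emeasure_distr vimage_def Int_def conj_commute)
 finally show "emeasure (distr M S X) A * emeasure (distr M T Y) B =
   emeasure (distr M (S \<Otimes>\<^sub>M T) (%om. (X om, Y om))) (A \<times> B)" ..
qed

lemma (in prob_space) indep_rvs_distr:
 assumes "indep_rvs M S X T Y"
 shows "distr M S X \<Otimes>\<^sub>M distr M T Y = distr M (S \<Otimes>\<^sub>M T) (%om. (X om, Y om))"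
 using assms indep_rvsD[OF assms] by (intro distr_pair_eqI) (auto simp: indep_rvs_def)

text \<open>Functions into a common type turn \<open>indep_rvs\<close> into
  \<open>indep_var\<close>, whose product rules for integrals then apply.\<close>

lemma (in prob_space) indep_rvs_compose:
 assumes XY: "indep_rvs M S X T Y" and f: "f \<in> measurable S N" and g: "g \<in> measurable T N'"
 shows "indep_var N (%om. f (X om)) N' (%om. g (Y om))"
proof -
 have X: "X \<in> measurable M S" and Y: "Y \<in> measurable M T"
  using XY by (auto simp: indep_rvs_def)
 note [measurable] = X Y f g
 have "prob {om \<in> space M. f (X om) \<in> A \<and> g (Y om) \<in> B} =
   prob {om \<in> space M. f (X om) \<in> A} * prob {om \<in> space M. g (Y om) \<in> B}"
  if "A \<in> sets N" "B \<in> sets N'" for A B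
 proof -
  have "f -` A \<inter> space S \<in> sets S" "g -` B \<inter> space T \<in> sets T"
   using that f g by (auto intro: measurable_sets)
  from indep_rvsD[OF XY this] show ?thesis
   using measurable_space[OF X] measurable_space[OF Y] by (simp cong: conj_cong)
 qed
 then show ?thesis
  unfolding indep_var_distribution_eq by (auto intro!: distr_pair_eqI measurable_compose[OF X f] measurable_compose[OF Y g])
qed

lemma integral_iexp_distributed:
 assumes d: "distributed M lborel X (%x. ennreal (f x))" and f: "prob_density f"
 shows "(LINT om|M. iexp (- (w * X om))) = fourier f w"
proof -
 have X: "X \<in> measurable M borel" using distributed_measurable[OF d] by simp
 have "(LINT om|M. iexp (- (w * X om))) = (LINT x|distr M lborel X. iexp (- (w * x)))"
  using X by (subst integral_distr) auto
 also have "... = (LINT x|density lborel (%x. ennreal (f x)). iexp (- (w * x)))"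
  using distributed_distr_eq_density[OF d] by simp
 also have "... = (LINT x|lborel. f x *\<^sub>R iexp (- (w * x)))"
  using prob_densityD[OF f] by (subst integral_density) auto
 also have "... = fourier f w"
  unfolding fourier_def by (simp add: scaleR_conv_of_real mult.commute)
 finally show ?thesis .
qed

section \<open>The random sum of even summands\<close>

context
 fixes m :: real and \<rho> :: "real => real" and \<Omega> :: "'k measure" and K :: "'k => nat" and Y :: "nat => 'k => real"
 assumes m: "0 < m" "m < 1"
  and rho: "prob_density \<rho>" "even_fun \<rho>"
  and prob: "prob_space \<Omega>"
  and K [measurable]: "K \<in> measurable \<Omega> (count_space UNIV)"
  and K_law: "\<forall>n\<ge>1. measure \<Omega> {om\<in>space \<Omega>. K om = n} = p_weight m n"
  and Y_indep: "prob_space.indep_vars \<Omega> (%_. borel) Y {1..}"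
  and Y_law: "\<forall>k\<ge>1. distributed \<Omega> lborel (Y k) (%x. ennreal (\<rho> x))"
  and KY: "indep_rvs \<Omega> (count_space UNIV) K (\<Pi>\<^sub>M k\<in>{1..}. borel) (%om. \<lambda>k\<in>{1..}. Y k om)"
 fixes S :: "'k => real"
 assumes S_eq: "S = (%om. \<Sum>k=1..K om. Y k om)"
begin

interpretation prob_space \<Omega> by (rule prob)

private lemma Y_meas: "1 <= k ==> Y k \<in> BM \<Omega>"
 using Y_law distributed_measurable[of \<Omega> lborel "Y k"] by auto

private lemma S_meas [measurable]: "S \<in> BM \<Omega>"
 unfolding S_eq by (rule measurable_compose_countable'[where I=UNIV, OF _ K]) (auto intro!: borel_measurable_sum Y_meas)

text \<open>On \<open>K = n\<close> the sum has the fixed length \<open>n\<close>, so the indicator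
  splits off by independence from the sequence \<open>Y\<close>, and the \<open>n\<close> summands
  contribute a power of one transform.\<close>

private lemma partial_char:
 "(LINT om|\<Omega>. indicator {n} (K om) * iexp (- (w * S om))) =
  measure \<Omega> {om\<in>space \<Omega>. K om = n} * fourier \<rho> w ^ n"
proof -
 let ?f = "%k. indicator {n} k :: complex"
 let ?g = "%y. \<Prod>k\<in>{1..n}. iexp (- (w * y k))"
 have g: "?g \<in> BM (\<Pi>\<^sub>M k\<in>{1..}. borel)" by measurable
 have gY: "?g (\<lambda>k\<in>{1..}. Y k om) = (\<Prod>k\<in>{1..n}. iexp (- (w * Y k om)))" for om
  by (intro prod.cong) auto
 have meas: "(%om. \<Prod>k\<in>{1..n}. iexp (- (w * Y k om))) \<in> BM \<Omega>"
  using Y_meas by (intro borel_measurable_prod) (auto intro!: measurable_compose[OF Y_meas])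
 have ind: "indep_var borel (%om. ?f (K om)) borel (%om. \<Prod>k\<in>{1..n}. iexp (- (w * Y k om)))"
  using indep_rvs_compose[OF KY _ g, of ?f borel] unfolding gY by simp
 have "(LINT om|\<Omega>. indicator {n} (K om) * iexp (- (w * S om))) =
   (LINT om|\<Omega>. ?f (K om) * (\<Prod>k\<in>{1..n}. iexp (- (w * Y k om))))"
  by (intro bintegral_cong)
   (auto simp: S_eq indicator_def sum_distrib_left sum_negf exp_sum[symmetric])
 also have "... = (LINT om|\<Omega>. ?f (K om)) * (LINT om|\<Omega>. (\<Prod>k\<in>{1..n}. iexp (- (w * Y k om))))"
 proof (rule indep_var_lebesgue_integral[OF ind])
  show "integrable \<Omega> (%om. ?f (K om))"
   by (rule integrable_const_bound[of _ 1]) (auto simp: indicator_def)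
  show "integrable \<Omega> (%om. \<Prod>k\<in>{1..n}. iexp (- (w * Y k om)))"
   using meas by (intro integrable_const_bound[of _ 1]) (auto simp flip: prod_norm)
 qed
 also have "(LINT om|\<Omega>. ?f (K om)) = measure \<Omega> {om\<in>space \<Omega>. K om = n}"
 proof -
  have "(LINT om|\<Omega>. ?f (K om)) = (LINT om|\<Omega>. complex_of_real (indicator {om\<in>space \<Omega>. K om = n} om))"
   by (intro bintegral_cong) (auto simp: indicator_def)
  also have "... = measure \<Omega> {om\<in>space \<Omega>. K om = n}"
   unfolding integral_complex_of_real by simp
  finally show ?thesis .
 qed
 also have "(LINT om|\<Omega>. (\<Prod>k\<in>{1..n}. iexp (- (w * Y k om)))) = (\<Prod>k\<in>{1..n}. LINT om|\<Omega>. iexp (- (w * Y k om)))"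
 proof (rule indep_vars_lebesgue_integral)
  show "indep_vars (%_. borel) (%k om. iexp (- (w * Y k om))) {1..n}"
   by (rule indep_vars_compose2[OF indep_vars_subset[OF Y_indep]]) auto
  show "integrable \<Omega> (%om. iexp (- (w * Y k om)))" if "k \<in> {1..n}" for k
   using that Y_meas[of k] by (intro integrable_const_bound[of _ 1]) auto
 qed simp
 also have "... = (\<Prod>k\<in>{1..n}. fourier \<rho> w)"
  using Y_law rho by (intro prod.cong refl integral_iexp_distributed) auto
 finally show ?thesis by simp
qed

private lemma char_sums:
 "(%n. measure \<Omega> {om\<in>space \<Omega>. K om = n} * fourier \<rho> w ^ n) sums (LINT om|\<Omega>. iexp (- (w * S om)))"
proof -
 have "(%N. LINT om|\<Omega>. (\<Sum>n<N. indicator {n} (K om) * iexp (- (w * S om))))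
   ----> (LINT om|\<Omega>. iexp (- (w * S om)))"
 proof (rule integral_dominated_convergence[where w="%_. 1"])
  have eq: "(\<Sum>n<N. indicator {n} (K om) * c) = (if K om < N then c else 0)" for N om and c :: complex
   by (auto simp: indicator_def if_distrib[of "%x. x * c"] cong: if_cong)
  show "AE om in \<Omega>. (%N. \<Sum>n<N. indicator {n} (K om) * iexp (- (w * S om))) ----> iexp (- (w * S om))"
   unfolding eq
   by (intro AE_I2 tendsto_eventually) (auto intro!: eventually_mono[OF eventually_gt_at_top])
  show "AE om in \<Omega>. norm (\<Sum>n<N. indicator {n} (K om) * iexp (- (w * S om))) <= 1" for N
   unfolding eq by auto
 qed auto
 also have "(%N. LINT om|\<Omega>. (\<Sum>n<N. indicator {n} (K om) * iexp (- (w * S om)))) =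
  (%N. \<Sum>n<N. measure \<Omega> {om\<in>space \<Omega>. K om = n} * fourier \<rho> w ^ n)"
 proof
  fix N
  have int: "integrable \<Omega> (%om. indicator {n} (K om) * iexp (- (w * S om)))" for n
   by (intro integrable_const_bound[of _ 1]) (auto simp: indicator_def)
  show "(LINT om|\<Omega>. (\<Sum>n<N. indicator {n} (K om) * iexp (- (w * S om)))) =
   (\<Sum>n<N. measure \<Omega> {om\<in>space \<Omega>. K om = n} * fourier \<rho> w ^ n)"
   by (subst bintegral_sum[OF int]) (simp only: partial_char)
 qed
 finally show ?thesis by (simp add: sums_def)
qed

private lemma fourier_rho_0: "fourier \<rho> 0 = 1"
 using prob_densityD(4)[OF rho(1)] by (simp add: fourier_def)

text \<open>The hypothesis fixes the law of \<open>K\<close> only for \<open>n \<ge> 1\<close>.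
  Those weights already sum to 1, as does the whole law by \<open>char_sums\<close> at frequency 0,
  so nothing is left for \<open>K = 0\<close>.\<close>

private lemma K_0: "measure \<Omega> {om\<in>space \<Omega>. K om = 0} = 0"
proof -
 have "(%n. complex_of_real (measure \<Omega> {om\<in>space \<Omega>. K om = n})) sums complex_of_real 1"
  using char_sums[of 0] by (simp add: fourier_rho_0 prob_space)
 then have "(%n. measure \<Omega> {om\<in>space \<Omega>. K om = n}) sums 1"
  unfolding sums_of_real_iff .
 then have "(%n. measure \<Omega> {om\<in>space \<Omega>. K om = Suc n}) sums (1 - measure \<Omega> {om\<in>space \<Omega>. K om = 0})"
  by (subst sums_Suc_iff) simp
 moreover have "(%n. measure \<Omega> {om\<in>space \<Omega>. K om = Suc n}) sums 1"
  using p_weight_sums[OF m] K_law by simp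
 ultimately show ?thesis by (auto dest: sums_unique2)
qed

private lemma fourier_real: "fourier \<rho> w = complex_of_real (Re (fourier \<rho> w))"
proof -
 have "(%x. \<rho> (- x)) = \<rho>" using rho(2) by (auto simp: even_fun_def)
 then have "cnj (fourier \<rho> w) = fourier \<rho> w" using fourier_uminus[of \<rho> w] by simp
 then show ?thesis by (metis Reals_cnj_iff of_real_Re)
qed

text \<open>The series over the values of \<open>K\<close> is the power series of
  \<open>p_weight_power_sums\<close> at the real point \<open>r\<close>. Since
  \<open>m * (2 - m) < 1\<close> the argument stays strictly inside the disc of convergence even if
  \<open>r\<close> has modulus 1.\<close>

lemma char_random_sum:
 "(LINT om|\<Omega>. iexp (- (w * S om))) =
  complex_of_real ((1 - sqrt (1 - m * (2 - m) * Re (fourier \<rho> w))) / m)"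
proof -
 define r where "r = Re (fourier \<rho> w)"
 have "\<bar>r\<bar> <= 1"
  using fourier_norm_le[OF rho(1), of w] abs_Re_le_cmod[of "fourier \<rho> w"] by (simp add: r_def)
 then have "\<bar>m * (2 - m) * r\<bar> <= m * (2 - m) * 1"
  using mult_two_minus_bounds[OF m] unfolding abs_mult[of "m * (2 - m)"] by (intro mult_mono) auto
 then have "\<bar>m * (2 - m) * r\<bar> < 1" using mult_two_minus_bounds[OF m] by simp
 from p_weight_power_sums[OF this]
 have "(%n. complex_of_real (p_weight m (Suc n) * r ^ Suc n)) sums complex_of_real ((1 - sqrt (1 - m * (2 - m) * r)) / m)"
  by (rule sums_of_real)
 moreover have "(%n. measure \<Omega> {om\<in>space \<Omega>. K om = Suc n} * fourier \<rho> w ^ Suc n) sums (LINT om|\<Omega>. iexp (- (w * S om)))"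
 proof -
  define F where "F n = measure \<Omega> {om\<in>space \<Omega>. K om = n} * fourier \<rho> w ^ n" for n
  have "F sums (LINT om|\<Omega>. iexp (- (w * S om)))"
   using char_sums[of w] unfolding F_def .
  moreover have "F 0 = 0" using K_0 by (simp add: F_def)
  ultimately have "(%n. F (Suc n)) sums (LINT om|\<Omega>. iexp (- (w * S om)))"
   by (simp add: sums_Suc_iff)
  then show ?thesis unfolding F_def .
 qed
 moreover have "measure \<Omega> {om\<in>space \<Omega>. K om = Suc n} * fourier \<rho> w ^ Suc n = complex_of_real (p_weight m (Suc n) * r ^ Suc n)" for n
  using K_law fourier_real[of w, folded r_def] by simp
 ultimately show ?thesis
  unfolding r_def by (simp only:) (rule sums_unique2)
qed

text \<open>At least one summand is present, so repeated convolution gives the partial sum a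
  density, and null sets are not charged.\<close>

private lemma partial_sum_null:
 assumes "A \<in> null_sets lborel"
 shows "{om \<in> space \<Omega>. (\<Sum>k=1..Suc n. Y k om) \<in> A} \<in> null_sets \<Omega>"
proof -
 have ex: "\<exists>f. distributed \<Omega> lborel (%om. \<Sum>k=1..Suc n. Y k om) f"
 proof (induction n)
  case 0
  have "distributed \<Omega> lborel (Y 1) (%x. ennreal (\<rho> x))" using Y_law by auto
  then show ?case by auto
 next
  case (Suc n)
  then obtain f where f: "distributed \<Omega> lborel (%om. \<Sum>k=1..Suc n. Y k om) f" by blast
  have "indep_vars (%_. borel) Y (insert (Suc (Suc n)) {1..Suc n})"
   by (rule indep_vars_subset[OF Y_indep]) auto
  then have "indep_var borel (Y (Suc (Suc n))) borel (%om. \<Sum>k=1..Suc n. Y k om)"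
   by (rule indep_vars_sum[rotated -1]) auto
  have Y': "distributed \<Omega> lborel (Y (Suc (Suc n))) (%x. ennreal (\<rho> x))" using Y_law by auto
  from distributed_convolution[OF \<open>indep_var borel (Y (Suc (Suc n))) borel _\<close> Y' f]
  have "\<exists>f. distributed \<Omega> lborel (%om. Y (Suc (Suc n)) om + (\<Sum>k=1..Suc n. Y k om)) f"
   by blast
  then show ?case by (simp add: add.commute)
 qed
 then obtain f where f: "distributed \<Omega> lborel (%om. \<Sum>k=1..Suc n. Y k om) f" by blast
 have meas: "(%om. \<Sum>k=1..Suc n. Y k om) \<in> BM \<Omega>"
  using distributed_measurable[OF f] by simp
 have "A \<in> null_sets (density lborel f)"
  using assms distributed_borel_measurable[OF f] AE_not_in[OF assms]
  by (subst null_sets_density_iff) auto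
 then have "A \<in> null_sets (distr \<Omega> lborel (%om. \<Sum>k=1..Suc n. Y k om))"
  using distributed_distr_eq_density[OF f] by simp
 then show ?thesis
  using meas by (subst (asm) null_sets_distr_iff) (auto simp: vimage_def Int_def conj_commute)
qed

text \<open>Absolute continuity survives the mixture over \<open>K\<close>: apart from the null
  event \<open>K = 0\<close>, the event splits into countably many with a fixed number of
  terms.\<close>

private lemma random_sum_null:
 assumes A: "A \<in> null_sets lborel"
 shows "A \<in> null_sets (distr \<Omega> lborel S)"
proof -
 have "{om\<in>space \<Omega>. K om = 0} \<in> null_sets \<Omega>"
  using K_0 by (intro null_setsI) (auto simp: emeasure_eq_measure)
 then have "{om\<in>space \<Omega>. K om = 0} \<union> (\<Union>n. {om \<in> space \<Omega>. (\<Sum>k=1..Suc n. Y k om) \<in> A}) \<in> null_sets \<Omega>"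
  using partial_sum_null[OF A] by auto
 then have "{om \<in> space \<Omega>. S om \<in> A} \<in> null_sets \<Omega>"
 proof (rule null_sets_subset)
  have [measurable]: "A \<in> sets borel" using A by auto
  show "{om \<in> space \<Omega>. S om \<in> A} \<in> sets \<Omega>" by measurable
  show "{om \<in> space \<Omega>. S om \<in> A} \<subseteq> {om\<in>space \<Omega>. K om = 0} \<union> (\<Union>n. {om \<in> space \<Omega>. (\<Sum>k=1..Suc n. Y k om) \<in> A})"
  proof
   fix om assume "om \<in> {om \<in> space \<Omega>. S om \<in> A}"
   then show "om \<in> {om\<in>space \<Omega>. K om = 0} \<union> (\<Union>n. {om \<in> space \<Omega>. (\<Sum>k=1..Suc n. Y k om) \<in> A})"
    unfolding S_eq by (cases "K om") auto
  qed
 qed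
 then show ?thesis
  using A by (subst null_sets_distr_iff) (auto simp: vimage_def Int_def conj_commute)
qed

text \<open>Radon-Nikodym gives a density \<open>f\<close>. It is even almost everywhere because
  \<open>S\<close> and \<open>- S\<close> have the same characteristic function; averaging
  \<open>f x\<close> and \<open>f (- x)\<close> makes it even at every point without changing the
  law.\<close>

lemma ex_even_density_random_sum:
 "\<exists>\<phi>. prob_density \<phi> \<and> even_fun \<phi> \<and> distributed \<Omega> lborel S (%x. ennreal (\<phi> x))"
proof -
 let ?D = "distr \<Omega> lborel S"
 have S': "S \<in> measurable \<Omega> lborel" by simp
 have PD: "prob_space ?D" by (rule prob_space_distr[OF S'])
 then have fin: "finite_measure ?D" by (simp add: prob_space_def)
 have "absolutely_continuous lborel ?D"
  using random_sum_null by (auto simp: absolutely_continuous_def)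
 then obtain f where f: "f \<in> BM lborel" "AE x in lborel. RN_deriv lborel ?D x = ennreal (f x)"
   "!!x. 0 <= f x"
  using sigma_finite_measure.real_RN_deriv[OF lborel.sigma_finite_measure_axioms fin] by auto
 note [measurable] = f(1)
 have "density lborel (RN_deriv lborel ?D) = ?D"
  using \<open>absolutely_continuous lborel ?D\<close> by (intro sigma_finite_measure.density_RN_deriv[OF lborel.sigma_finite_measure_axioms]) auto
 also have "density lborel (RN_deriv lborel ?D) = density lborel (%x. ennreal (f x))"
  using f(2) by (intro density_cong) auto
 finally have Df: "?D = density lborel (%x. ennreal (f x))" ..
 have sym: "distr \<Omega> borel (%om. - S om) = distr \<Omega> borel S"
 proof (rule Levy_uniqueness)
  show "real_distribution (distr \<Omega> borel (%om. - S om))" "real_distribution (distr \<Omega> borel S)"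
   by (auto intro!: real_distribution_distr)
  show "char (distr \<Omega> borel (%om. - S om)) = char (distr \<Omega> borel S)"
  proof
   fix t
   have e: "fourier \<rho> (- t) = fourier \<rho> t"
   proof -
    have "fourier \<rho> (- t) = fourier (%x. \<rho> (- x)) t"
    unfolding fourier_def using integral_lborel_uminus[of "%x. iexp (t * x) * complex_of_real (\<rho> x)"] by simp
    then show ?thesis using rho(2) by (simp add: even_fun_def)
   qed
   have "char (distr \<Omega> borel (%om. - S om)) t = (LINT om|\<Omega>. iexp (- (t * S om)))"
    unfolding char_def by (subst integral_distr) auto
   also have "... = (LINT om|\<Omega>. iexp (- (- t * S om)))"
    unfolding char_random_sum e ..
   also have "... = char (distr \<Omega> borel S) t"
    unfolding char_def by (subst integral_distr) auto
   finally show "char (distr \<Omega> borel (%om. - S om)) t = char (distr \<Omega> borel S) t" .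
  qed
 qed
 have "density lborel (%x. ennreal (f (- x))) = density lborel (%x. ennreal (f x))"
 proof (rule measure_eqI)
  fix A assume "A \<in> sets (density lborel (%x. ennreal (f (- x))))"
  then have [measurable]: "A \<in> sets borel" by simp
  have "emeasure (density lborel (%x. ennreal (f (- x)))) A = (\<integral>\<^sup>+x. ennreal (f (- x)) * indicator A x \<partial>lborel)"
   by (subst emeasure_density) auto
  also have "... = (\<integral>\<^sup>+x. ennreal (f x) * indicator A (- x) \<partial>lborel)"
   by (subst lborel_distr_uminus[symmetric], subst nn_integral_distr) (auto simp: lborel_distr_uminus)
  also have "... = (\<integral>\<^sup>+x. indicator A (- x) \<partial>?D)"
   unfolding Df by (subst nn_integral_density) auto
  also have "... = (\<integral>\<^sup>+om. indicator A (- S om) \<partial>\<Omega>)"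
   by (subst nn_integral_distr) auto
  also have "... = (\<integral>\<^sup>+x. indicator A x \<partial>distr \<Omega> borel (%om. - S om))"
   by (subst nn_integral_distr) auto
  also have "... = (\<integral>\<^sup>+x. indicator A x \<partial>?D)"
   unfolding sym by (subst (1 2) nn_integral_distr) auto
  also have "... = emeasure (density lborel (%x. ennreal (f x))) A"
   unfolding Df by simp
  finally show "emeasure (density lborel (%x. ennreal (f (- x)))) A = emeasure (density lborel (%x. ennreal (f x))) A" .
 qed simp
 then have "AE x in lborel. ennreal (f (- x)) = ennreal (f x)"
  by (intro sigma_finite_measure.density_unique[OF lborel.sigma_finite_measure_axioms]) auto
 then have ae: "AE x in lborel. (f x + f (- x)) / 2 = f x"
  by eventually_elim (use f(3) in auto)
 define \<phi> where "\<phi> x = (f x + f (- x)) / 2" for x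
 have [measurable]: "\<phi> \<in> BM borel" unfolding \<phi>_def by measurable
 have D\<phi>: "?D = density lborel (%x. ennreal (\<phi> x))"
  unfolding Df using ae by (intro density_cong) (auto simp: \<phi>_def)
 have "emeasure ?D UNIV = 1" using prob_space.emeasure_space_1[OF PD] by simp
 then have "(\<integral>\<^sup>+x. ennreal (\<phi> x) \<partial>lborel) = 1"
  unfolding D\<phi> by (subst (asm) emeasure_density) auto
 then have "has_bochner_integral lborel \<phi> 1"
  using f(3) by (intro has_bochner_integral_nn_integral) (auto simp: \<phi>_def)
 then have "prob_density \<phi>" using f(3) by (auto simp: prob_density_def \<phi>_def)
 moreover have "even_fun \<phi>" by (auto simp: even_fun_def \<phi>_def)
 moreover have "distributed \<Omega> lborel S (%x. ennreal (\<phi> x))"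
  using D\<phi> by (auto simp: distributed_def)
 ultimately show ?thesis by blast
qed

declare S_meas [measurable del]

end

section \<open>Poisson processes\<close>

text \<open>The mean value theorem bounds the difference quotients by \<open>w\<close>, so that
  dominated convergence applies along every sequence tending to 0.\<close>

lemma has_real_derivative_integral:
 fixes f f' :: "real => 'a => real"
 assumes e: "0 < e"
  and int: "!!t. \<bar>t\<bar> < e ==> integrable M (f t)"
  and f'_meas: "f' 0 \<in> BM M"
  and deriv: "!!t x. \<bar>t\<bar> < e ==> x \<in> space M ==> ((%t. f t x) has_real_derivative f' t x) (at t)"
  and bound: "!!t x. \<bar>t\<bar> < e ==> x \<in> space M ==> \<bar>f' t x\<bar> <= w x"
  and w: "integrable M w"
 shows "((%t. LINT x|M. f t x) has_real_derivative (LINT x|M. f' 0 x)) (at 0)"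
proof -
 have quot: "\<bar>(f h x - f 0 x) / h\<bar> <= w x" if h: "\<bar>h\<bar> < e" "h ~= 0" and x: "x \<in> space M" for h x
 proof -
  have "\<exists>z. \<bar>z\<bar> < e \<and> f h x - f 0 x = h * f' z x"
  proof (cases "0 < h")
   case True
   have "\<exists>z>0. z < h \<and> f h x - f 0 x = (h - 0) * f' z x"
    by (rule MVT2[OF True]) (use h x in "auto intro!: deriv")
   then obtain z where "0 < z" "z < h" "f h x - f 0 x = (h - 0) * f' z x" by blast
   then show ?thesis using h by (intro exI[of _ z]) auto
  next
   case False
   then have "h < 0" using h by simp
   have "\<exists>z>h. z < 0 \<and> f 0 x - f h x = (0 - h) * f' z x"
    by (rule MVT2[OF \<open>h < 0\<close>]) (use h x in "auto intro!: deriv")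
   then obtain z where "h < z" "z < 0" "f 0 x - f h x = (0 - h) * f' z x" by blast
   then show ?thesis using h by (intro exI[of _ z]) (auto simp: algebra_simps)
  qed
  then show ?thesis using h x bound by (auto simp: abs_mult)
 qed
 have "((%h. ((LINT x|M. f (0 + h) x) - (LINT x|M. f 0 x)) / h) \<longlongrightarrow> (LINT x|M. f' 0 x)) (at 0)"
  unfolding tendsto_at_iff_sequentially comp_def
 proof (intro allI impI)
  fix X :: "nat => real"
  assume X: "\<forall>i. X i \<in> UNIV - {0}" and lim: "X ----> 0"
  \<comment> \<open>Quotients whose step is too large are replaced by the limit, so that the bound
    \<open>w\<close> holds for every \<open>i\<close> and not only eventually.\<close>
  define g where "g i x = (if \<bar>X i\<bar> < e then (f (X i) x - f 0 x) / X i else f' 0 x)" for i x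
  have ev: "eventually (%i. \<bar>X i\<bar> < e) sequentially"
   using tendstoD[OF lim e] by (simp add: dist_real_def)
  have "(%i. LINT x|M. g i x) ----> (LINT x|M. f' 0 x)"
  proof (rule integral_dominated_convergence[where w=w])
   show "g i \<in> BM M" for i
    using int[of "X i"] int[of 0] f'_meas e unfolding g_def by (cases "\<bar>X i\<bar> < e") auto
   show "AE x in M. (%i. g i x) ----> f' 0 x"
   proof (intro AE_I2)
    fix x assume x: "x \<in> space M"
    have "(%h. (f (0 + h) x - f 0 x) / h) \<midarrow>0\<rightarrow> f' 0 x"
    using deriv[of 0 x] x e by (simp add: DERIV_def)
    then have "(%i. (f (X i) x - f 0 x) / X i) ----> f' 0 x"
    using X lim by (auto simp: tendsto_at_iff_sequentially comp_def)
    then show "(%i. g i x) ----> f' 0 x"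
    by (rule Lim_transform_eventually) (use ev in "eventually_elim, auto simp: g_def")
   qed
   show "AE x in M. norm (g i x) <= w x" for i
    using quot[of "X i"] bound[of 0] X e by (auto simp: g_def)
  qed (use f'_meas w in auto)
  then show "(%i. ((LINT x|M. f (0 + X i) x) - (LINT x|M. f 0 x)) / X i) ----> (LINT x|M. f' 0 x)"
  proof (rule Lim_transform_eventually)
   show "\<forall>\<^sub>F i in sequentially. (LINT x|M. g i x) = ((LINT x|M. f (0 + X i) x) - (LINT x|M. f 0 x)) / X i"
    using ev
   proof eventually_elim
    case (elim i)
    then show ?case
    using int[of "X i"] int[of 0] e by (simp add: g_def)
   qed
  qed
 qed
 then show ?thesis by (simp add: DERIV_def)
qed

section \<open>Measurability of integrals as functions of the measure\<close>

lemma space_measure_space_real: "space measure_space_real = {\<mu>. sets \<mu> = sets borel}"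
 by (auto simp: measure_space_real_def space_Sup_eq_UN)

lemma measurable_emeasure_measure_space_real [measurable]:
 "A \<in> sets borel ==> (%\<mu>. emeasure \<mu> A) \<in> BM measure_space_real"
 by (auto intro!: measurable_Sup1 measurable_vimage_algebra1 simp: measure_space_real_def)

lemma measurable_measure_space_realI:
 assumes "!!a. a \<in> space M ==> sets (K a) = sets borel"
  and "!!A. A \<in> sets borel ==> (%a. emeasure (K a) A) \<in> BM M"
 shows "K \<in> measurable M measure_space_real"
 using assms by (auto intro!: measurable_Sup2 measurable_vimage_algebra2 simp: measure_space_real_def)

lemma measurable_nn_integral_measure_space_real:
 fixes f :: "real => ennreal"
 assumes "f \<in> BM borel"
 shows "(%\<mu>. integral\<^sup>N \<mu> f) \<in> BM measure_space_real"
 using assms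
proof induct
 case (cong f g)
 then have "f = g" by auto
 with cong show ?case by simp
next
 case (set B)
 have "(%\<mu>. integral\<^sup>N \<mu> (indicator B)) \<in> BM measure_space_real \<longleftrightarrow> (%\<mu>. emeasure \<mu> B) \<in> BM measure_space_real"
  using set by (intro measurable_cong) (auto simp: space_measure_space_real)
 then show ?case using set by simp
next
 case (mult f c)
 have "(%\<mu>. integral\<^sup>N \<mu> (%x. c * f x)) \<in> BM measure_space_real \<longleftrightarrow> (%\<mu>. c * integral\<^sup>N \<mu> f) \<in> BM measure_space_real"
  using mult by (intro measurable_cong nn_integral_cmult) (auto simp: space_measure_space_real cong: measurable_cong_sets)
 then show ?case using mult by simp
next
 case (add f g)
 have "(%\<mu>. integral\<^sup>N \<mu> (%x. g x + f x)) \<in> BM measure_space_real \<longleftrightarrow> (%\<mu>. integral\<^sup>N \<mu> g + integral\<^sup>N \<mu> f) \<in> BM measure_space_real"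
  using add by (intro measurable_cong nn_integral_add) (auto simp: space_measure_space_real cong: measurable_cong_sets)
 then show ?case using add by simp
next
 case (seq F)
 have eq: "integral\<^sup>N \<mu> (\<Squnion> (range F)) = (SUP i. integral\<^sup>N \<mu> (F i))" if "\<mu> \<in> space measure_space_real" for \<mu>
 proof -
  have "integral\<^sup>N \<mu> (%x. SUP i. F i x) = (SUP i. integral\<^sup>N \<mu> (F i))"
   using seq that by (intro nn_integral_monotone_convergence_SUP) (auto simp: space_measure_space_real cong: measurable_cong_sets)
  then show ?thesis by (simp add: SUP_apply[abs_def] image_image)
 qed
 have "(%\<mu>. SUP i. integral\<^sup>N \<mu> (F i)) \<in> BM measure_space_real"
  using seq by (intro borel_measurable_SUP) auto
 then show ?case by (subst measurable_cong[OF eq])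
qed

text \<open>The Bochner integral is 0 by default for non-integrable functions. Making this case
  explicit reduces measurability in \<mu> to that of nonnegative integrals.\<close>

lemma real_integral_nn:
 fixes f :: "real => real"
 assumes "f \<in> BM borel" "sets \<mu> = sets borel"
 shows "(LINT x|\<mu>. f x) = (if (\<integral>\<^sup>+x. ennreal \<bar>f x\<bar> \<partial>\<mu>) < \<infinity>
  then enn2real (\<integral>\<^sup>+x. ennreal (f x) \<partial>\<mu>) - enn2real (\<integral>\<^sup>+x. ennreal (- f x) \<partial>\<mu>) else 0)"
proof -
 have f: "f \<in> BM \<mu>" using assms by (simp cong: measurable_cong_sets)
 then have "integrable \<mu> f \<longleftrightarrow> (\<integral>\<^sup>+x. ennreal \<bar>f x\<bar> \<partial>\<mu>) < \<infinity>"
  by (simp add: integrable_iff_bounded)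
 then show ?thesis using real_lebesgue_integral_def[of \<mu> f] not_integrable_integral_eq[of \<mu> f] by auto
qed

lemma measurable_integral_measure_space_real:
 fixes f :: "real => real"
 assumes [measurable]: "f \<in> BM borel"
 shows "(%\<mu>. LINT x|\<mu>. f x) \<in> BM measure_space_real"
proof -
 have [measurable]: "(%\<mu>. \<integral>\<^sup>+x. ennreal \<bar>f x\<bar> \<partial>\<mu>) \<in> BM measure_space_real"
  "(%\<mu>. \<integral>\<^sup>+x. ennreal (f x) \<partial>\<mu>) \<in> BM measure_space_real"
  "(%\<mu>. \<integral>\<^sup>+x. ennreal (- f x) \<partial>\<mu>) \<in> BM measure_space_real"
  by (auto intro!: measurable_nn_integral_measure_space_real)
 have "(%\<mu>. LINT x|\<mu>. f x) \<in> BM measure_space_real \<longleftrightarrow>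
  (%\<mu>. if (\<integral>\<^sup>+x. ennreal \<bar>f x\<bar> \<partial>\<mu>) < \<infinity>
   then enn2real (\<integral>\<^sup>+x. ennreal (f x) \<partial>\<mu>) - enn2real (\<integral>\<^sup>+x. ennreal (- f x) \<partial>\<mu>) else 0) \<in> BM measure_space_real"
  by (intro measurable_cong real_integral_nn) (auto simp: space_measure_space_real)
 then show ?thesis by simp
qed

lemma abs_exp_minus_one_le: "\<bar>exp x - 1\<bar> <= \<bar>x\<bar> * exp (max 0 x)" for x :: real
proof (cases "0 <= x")
 case True
 have "1 + - x <= exp (- x)" by (rule exp_ge_add_one_self)
 then have "(1 - x) * exp x <= exp (- x) * exp x" by (intro mult_right_mono) auto
 then show ?thesis using True by (simp add: algebra_simps flip: exp_add)
next
 case False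
 have "1 + x <= exp x" "exp x <= 1" "max 0 x = 0"
  using False exp_ge_add_one_self[of x] by auto
 then show ?thesis using False by (simp only: exp_zero mult_1_right)
qed

section \<open>Counts, mean and exponential functional of a Poisson process\<close>

locale poisson_loc = prob_space M + sigma_finite_measure \<Lambda>
 for M :: "'w measure" and \<Lambda> :: "real measure" +
 fixes N :: "'w => real measure"
 assumes PP: "poisson_process M \<Lambda> N" and sets_Lambda [measurable_cong]: "sets \<Lambda> = sets borel"
begin

lemma N_measurable [measurable]: "N \<in> measurable M measure_space_real"
 using PP by (simp add: poisson_process_def)

lemma sets_N: "om \<in> space M ==> sets (N om) = sets borel"
 using measurable_space[OF N_measurable] by (simp add: space_measure_space_real)

lemma emeasure_N_measurable [measurable]: "A \<in> sets borel ==> (%om. emeasure (N om) A) \<in> BM M"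
 by (rule measurable_compose[OF N_measurable measurable_emeasure_measure_space_real])

lemma measure_N_measurable [measurable]:
 assumes [measurable]: "A \<in> sets borel"
 shows "(%om. measure (N om) A) \<in> BM M"
 unfolding measure_def by measurable

lemma integral_N_measurable: "f \<in> BM borel ==> (%om. LINT x|N om. f x :: real) \<in> BM M"
 by (rule measurable_compose[OF N_measurable]) (rule measurable_integral_measure_space_real)

lemma nn_integral_N_measurable: "f \<in> BM borel ==> (%om. \<integral>\<^sup>+x. f x \<partial>N om) \<in> BM M"
 by (rule measurable_compose[OF N_measurable]) (rule measurable_nn_integral_measure_space_real)

lemma count_law:
 assumes "A \<in> sets borel" "emeasure \<Lambda> A < \<infinity>"
 shows "prob {om\<in>space M. emeasure (N om) A = of_nat k} = measure \<Lambda> A ^ k / fact k * exp (- measure \<Lambda> A)"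
 using PP assms by (simp add: poisson_process_def)

lemma poisson_sums: "(%k. l ^ k / fact k * exp (- l)) sums (1::real)"
proof -
 have "(%k. l ^ k / fact k * exp (- l)) sums (exp l * exp (- l))"
  using exp_converges[of l] by (intro sums_mult2) (simp add: divide_inverse mult.commute)
 then show ?thesis by (simp flip: exp_add)
qed

text \<open>The prescribed probabilities of the natural values sum to 1, so all other values of the
  count form a null event. In this way integrality follows from the one-dimensional laws.\<close>

lemma count_AE:
 assumes A [measurable]: "A \<in> sets borel" and fin: "emeasure \<Lambda> A < \<infinity>"
 shows "AE om in M. \<exists>k. emeasure (N om) A = of_nat k"
proof -
 let ?E = "%k. {om\<in>space M. emeasure (N om) A = of_nat k}"
 have "(%k. prob (?E k)) sums prob (\<Union>k. ?E k)"
  by (rule finite_measure_UNION) (auto simp: disjoint_family_on_def)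
 then have "prob (\<Union>k. ?E k) = 1"
  using poisson_sums[of "measure \<Lambda> A"] unfolding count_law[OF assms] by (rule sums_unique2)
 then have "AE om in M. om \<in> (\<Union>k. ?E k)" by (rule AE_prob_1)
 then show ?thesis by eventually_elim auto
qed

lemma count_finite_AE:
 assumes "A \<in> sets borel" "emeasure \<Lambda> A < \<infinity>"
 shows "AE om in M. emeasure (N om) A < \<infinity>"
 using count_AE[OF assms] by eventually_elim (auto simp: of_nat_less_top)

lemma nn_integral_count:
 assumes A [measurable]: "A \<in> sets borel" and fin: "emeasure \<Lambda> A < \<infinity>"
  and [measurable]: "h \<in> BM borel"
 shows "(\<integral>\<^sup>+om. h (measure (N om) A) \<partial>M) =
  (\<Sum>k. h (real k) * ennreal (measure \<Lambda> A ^ k / fact k * exp (- measure \<Lambda> A)))"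
proof -
 let ?E = "%k. {om\<in>space M. emeasure (N om) A = of_nat k}"
 have "(\<integral>\<^sup>+om. h (measure (N om) A) \<partial>M) = (\<integral>\<^sup>+om. (\<Sum>k. h (real k) * indicator (?E k) om) \<partial>M)"
 proof (rule nn_integral_cong_AE)
  show "AE om in M. h (measure (N om) A) = (\<Sum>k. h (real k) * indicator (?E k) om)"
   using count_AE[OF A fin] AE_space
  proof eventually_elim
   case (elim om)
   then obtain k where k: "emeasure (N om) A = of_nat k" by blast
   then have "measure (N om) A = real k"
    by (simp add: measure_def)
   moreover have "(\<Sum>j. h (real j) * indicator (?E j) om) = (\<Sum>j\<in>{k}. h (real j) * indicator (?E j) om)"
    using k by (intro suminf_finite) (auto simp: indicator_def)
   ultimately show ?case using k elim by (simp add: indicator_def)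
  qed
 qed
 also have "... = (\<Sum>k. \<integral>\<^sup>+om. h (real k) * indicator (?E k) om \<partial>M)"
  by (rule nn_integral_suminf) measurable
 also have "... = (\<Sum>k. h (real k) * ennreal (measure \<Lambda> A ^ k / fact k * exp (- measure \<Lambda> A)))"
  by (subst nn_integral_cmult_indicator) (auto simp: emeasure_eq_measure count_law[OF A fin])
 finally show ?thesis .
qed

lemma count_exp:
 assumes A: "A \<in> sets borel" "emeasure \<Lambda> A < \<infinity>"
 shows "(\<integral>\<^sup>+om. ennreal (exp (s * measure (N om) A)) \<partial>M) = ennreal (exp (measure \<Lambda> A * (exp s - 1)))"
proof -
 let ?l = "measure \<Lambda> A"
 have *: "(%k. ((exp s * ?l) ^ k / fact k) * exp (- ?l)) sums (exp (exp s * ?l) * exp (- ?l))"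
  using exp_converges[of "exp s * ?l"] by (intro sums_mult2) (simp add: divide_inverse mult.commute)
 have "(%k. exp (s * real k) * (?l ^ k / fact k * exp (- ?l))) sums exp (?l * (exp s - 1))"
 proof -
  have "((exp s * ?l) ^ k / fact k) * exp (- ?l) = exp (s * real k) * (?l ^ k / fact k * exp (- ?l))" for k
   by (simp add: power_mult_distrib exp_of_nat2_mult)
  moreover have "exp (exp s * ?l) * exp (- ?l) = exp (?l * (exp s - 1))"
   unfolding exp_add[symmetric] by (simp add: algebra_simps)
  ultimately show ?thesis using * by (simp only:)
 qed
 then have "(\<Sum>k. ennreal (exp (s * real k) * (?l ^ k / fact k * exp (- ?l)))) = ennreal (exp (?l * (exp s - 1)))"
  by (intro suminf_ennreal_eq) auto
 moreover have "(\<integral>\<^sup>+om. ennreal (exp (s * measure (N om) A)) \<partial>M) =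
  (\<Sum>k. ennreal (exp (s * real k)) * ennreal (?l ^ k / fact k * exp (- ?l)))"
  by (rule nn_integral_count[OF A, where h="%x. ennreal (exp (s * x))"]) measurable
 moreover have "ennreal (exp (s * real k)) * ennreal (?l ^ k / fact k * exp (- ?l)) =
   ennreal (exp (s * real k) * (?l ^ k / fact k * exp (- ?l)))" for k
  by (rule ennreal_mult[symmetric]) auto
 ultimately show ?thesis by (simp only:)
qed

lemma count_mean:
 assumes A: "A \<in> sets borel" "emeasure \<Lambda> A < \<infinity>"
 shows "(\<integral>\<^sup>+om. emeasure (N om) A \<partial>M) = emeasure \<Lambda> A"
proof -
 let ?l = "measure \<Lambda> A"
 have "(%k. ?l * (?l ^ k / fact k * exp (- ?l))) sums (?l * 1)"
  by (intro sums_mult poisson_sums)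
 moreover have "real (Suc k) * (?l ^ Suc k / fact (Suc k) * exp (- ?l)) = ?l * (?l ^ k / fact k * exp (- ?l))" for k
  by (simp add: field_simps del: of_nat_Suc)
 ultimately have "(%k. real (Suc k) * (?l ^ Suc k / fact (Suc k) * exp (- ?l))) sums ?l"
  by (simp only: mult_1_right)
 then have "(%k. real k * (?l ^ k / fact k * exp (- ?l))) sums ?l"
  by (subst (asm) sums_Suc_iff) simp
 then have s: "(\<Sum>k. ennreal (real k * (?l ^ k / fact k * exp (- ?l)))) = ennreal ?l"
  by (intro suminf_ennreal_eq) auto
 have "(\<integral>\<^sup>+om. emeasure (N om) A \<partial>M) = (\<integral>\<^sup>+om. ennreal (measure (N om) A) \<partial>M)"
  using count_finite_AE[OF A] by (intro nn_integral_cong_AE) (auto elim!: eventually_mono simp: emeasure_eq_ennreal_measure)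
 also have "... = (\<Sum>k. ennreal (real k) * ennreal (?l ^ k / fact k * exp (- ?l)))"
  by (rule nn_integral_count[OF A, where h="%x. ennreal x"]) measurable
 also have "... = (\<Sum>k. ennreal (real k * (?l ^ k / fact k * exp (- ?l))))"
  by (intro suminf_cong ennreal_mult[symmetric]) auto
 also have "... = ennreal ?l" by (rule s)
 also have "... = emeasure \<Lambda> A" using A by (simp add: emeasure_eq_ennreal_measure)
 finally show ?thesis .
qed

text \<open>A countable partition into sets of finite intensity removes the finiteness assumption of
  \<open>count_mean\<close>.\<close>

lemma count_mean':
 assumes A [measurable]: "A \<in> sets borel"
 shows "(\<integral>\<^sup>+om. emeasure (N om) A \<partial>M) = emeasure \<Lambda> A"
proof -
 obtain F :: "nat => real set" where F: "range F \<subseteq> sets \<Lambda>" "(\<Union>i. F i) = space \<Lambda>"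
   "!!i. emeasure \<Lambda> (F i) ~= \<infinity>" "disjoint_family F"
  using sigma_finite_disjoint by metis
 have sp: "space \<Lambda> = UNIV" using sets_eq_imp_space_eq[OF sets_Lambda] by simp
 have [measurable]: "A \<inter> F i \<in> sets borel" for i using F(1) sets_Lambda A by blast
 have AF: "(\<Union>i. A \<inter> F i) = A" using F(2) sp by blast
 have disj: "disjoint_family (%i. A \<inter> F i)" using F(4) by (auto simp: disjoint_family_on_def)
 have fin: "emeasure \<Lambda> (A \<inter> F i) < \<infinity>" for i
  using emeasure_mono[of "A \<inter> F i" "F i" \<Lambda>] F(1) F(3)[of i] by (auto simp: less_top[symmetric] top_unique)
 have "(\<integral>\<^sup>+om. emeasure (N om) A \<partial>M) = (\<integral>\<^sup>+om. (\<Sum>i. emeasure (N om) (A \<inter> F i)) \<partial>M)"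
  using disj AF by (intro nn_integral_cong) (subst suminf_emeasure, auto simp: sets_N)
 also have "... = (\<Sum>i. \<integral>\<^sup>+om. emeasure (N om) (A \<inter> F i) \<partial>M)"
  by (rule nn_integral_suminf) measurable
 also have "... = (\<Sum>i. emeasure \<Lambda> (A \<inter> F i))" by (subst count_mean[OF _ fin]) auto
 also have "... = emeasure \<Lambda> A" using disj AF by (subst suminf_emeasure) (auto simp: sets_Lambda)
 finally show ?thesis .
qed

lemma campbell:
 fixes f :: "real => ennreal"
 assumes "f \<in> BM borel"
 shows "(\<integral>\<^sup>+om. (\<integral>\<^sup>+x. f x \<partial>N om) \<partial>M) = (\<integral>\<^sup>+x. f x \<partial>\<Lambda>)"
 using assms
proof induct
 case (cong f g)
 then have "f = g" by auto
 with cong show ?case by simp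
next
 case (set A)
 have "(\<integral>\<^sup>+om. (\<integral>\<^sup>+x. indicator A x \<partial>N om) \<partial>M) = (\<integral>\<^sup>+om. emeasure (N om) A \<partial>M)"
  using set by (intro nn_integral_cong) (auto simp: sets_N)
 then show ?case using set count_mean'[of A] by (simp add: sets_Lambda)
next
 case (mult f c)
 have "(\<integral>\<^sup>+om. (\<integral>\<^sup>+x. c * f x \<partial>N om) \<partial>M) = (\<integral>\<^sup>+om. c * (\<integral>\<^sup>+x. f x \<partial>N om) \<partial>M)"
  using mult by (intro nn_integral_cong nn_integral_cmult) (auto simp: sets_N cong: measurable_cong_sets)
 then show ?case
  using mult nn_integral_N_measurable[of f] by (simp add: nn_integral_cmult measurable_cong_sets[OF sets_Lambda refl])
next
 case (add f g)
 have "(\<integral>\<^sup>+om. (\<integral>\<^sup>+x. g x + f x \<partial>N om) \<partial>M) = (\<integral>\<^sup>+om. (\<integral>\<^sup>+x. g x \<partial>N om) + (\<integral>\<^sup>+x. f x \<partial>N om) \<partial>M)"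
  using add by (intro nn_integral_cong nn_integral_add) (auto simp: sets_N cong: measurable_cong_sets)
 then show ?case
  using add nn_integral_N_measurable[of f] nn_integral_N_measurable[of g] by (simp add: nn_integral_add measurable_cong_sets[OF sets_Lambda refl])
next
 case (seq F)
 have [measurable]: "F i \<in> BM borel" for i using seq by simp
 have "(\<integral>\<^sup>+om. (\<integral>\<^sup>+x. (SUP i. F i) x \<partial>N om) \<partial>M) = (\<integral>\<^sup>+om. (SUP i. \<integral>\<^sup>+x. F i x \<partial>N om) \<partial>M)"
  unfolding SUP_apply
  using seq by (intro nn_integral_cong nn_integral_monotone_convergence_SUP) (auto simp: sets_N cong: measurable_cong_sets)
 also have "... = (SUP i. \<integral>\<^sup>+om. (\<integral>\<^sup>+x. F i x \<partial>N om) \<partial>M)"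
  using seq by (intro nn_integral_monotone_convergence_SUP nn_integral_N_measurable)
   (auto simp: incseq_def le_fun_def intro!: nn_integral_mono)
 also have "... = (SUP i. \<integral>\<^sup>+x. F i x \<partial>\<Lambda>)" using seq by simp
 also have "... = (\<integral>\<^sup>+x. (SUP i. F i) x \<partial>\<Lambda>)"
  unfolding SUP_apply using seq by (intro nn_integral_monotone_convergence_SUP[symmetric]) (auto simp: measurable_cong_sets[OF sets_Lambda refl])
 finally show ?case .
qed

lemma AE_integrable_N:
 fixes f :: "real => real"
 assumes f: "integrable \<Lambda> f"
 shows "AE om in M. integrable (N om) f"
proof -
 have [measurable]: "f \<in> BM borel"
  using borel_measurable_integrable[OF f] by (simp add: measurable_cong_sets[OF sets_Lambda refl])
 have "(\<integral>\<^sup>+om. (\<integral>\<^sup>+x. ennreal (norm (f x)) \<partial>N om) \<partial>M) = (\<integral>\<^sup>+x. ennreal (norm (f x)) \<partial>\<Lambda>)"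
  by (rule campbell) measurable
 also have "... < \<infinity>" using f by (simp add: integrable_iff_bounded)
 finally have "AE om in M. (\<integral>\<^sup>+x. ennreal (norm (f x)) \<partial>N om) ~= \<infinity>"
  by (intro nn_integral_PInf_AE nn_integral_N_measurable) auto
 then show ?thesis using AE_space
  by eventually_elim (auto simp: integrable_iff_bounded less_top sets_N cong: measurable_cong_sets)
qed

lemma exp_disjoint_sum:
 assumes A: "!!i. A i \<in> sets borel" "!!i. emeasure \<Lambda> (A i) < \<infinity>" "disjoint_family (A :: nat => real set)"
 shows "(\<integral>\<^sup>+om. ennreal (exp (\<Sum>i<n. y i * measure (N om) (A i))) \<partial>M) =
  ennreal (exp (\<Sum>i<n. measure \<Lambda> (A i) * (exp (y i) - 1)))"
proof -
 have "indep_vars (%_. borel) (%i om. emeasure (N om) (A i)) UNIV"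
 proof -
  have "range A \<subseteq> sets borel \<and> disjoint_family A" using A by auto
  then show ?thesis using PP unfolding poisson_process_def by blast
 qed
 then have ind: "indep_vars (%_. borel) (%i om. emeasure (N om) (A i)) {..<n}"
  by (rule indep_vars_subset) simp
 have ind': "indep_vars (%_. borel) (%i om. ennreal (exp (y i * enn2real (emeasure (N om) (A i))))) {..<n}"
  by (rule indep_vars_compose2[OF ind]) measurable
 have "(\<integral>\<^sup>+om. ennreal (exp (\<Sum>i<n. y i * measure (N om) (A i))) \<partial>M) =
  (\<integral>\<^sup>+om. (\<Prod>i<n. ennreal (exp (y i * enn2real (emeasure (N om) (A i))))) \<partial>M)"
  by (intro nn_integral_cong) (simp add: exp_sum prod_ennreal measure_def)
 also have "... = (\<Prod>i<n. \<integral>\<^sup>+om. ennreal (exp (y i * enn2real (emeasure (N om) (A i)))) \<partial>M)"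
  by (rule indep_vars_nn_integral[OF _ ind']) auto
 also have "... = (\<Prod>i<n. ennreal (exp (measure \<Lambda> (A i) * (exp (y i) - 1))))"
  using count_exp[OF A(1,2)] by (simp add: measure_def)
 also have "... = ennreal (exp (\<Sum>i<n. measure \<Lambda> (A i) * (exp (y i) - 1)))"
  by (simp add: exp_sum prod_ennreal)
 finally show ?thesis .
qed

text \<open>A simple function takes its finitely many nonzero values on disjoint sets, and the
  counts of these are independent.\<close>

lemma exp_simple:
 fixes g :: "real => real"
 assumes g: "simple_function borel g" and fin: "emeasure \<Lambda> {x. g x ~= 0} < \<infinity>"
 shows "(\<integral>\<^sup>+om. ennreal (exp (LINT x|N om. g x)) \<partial>M) = ennreal (exp (LINT x|\<Lambda>. exp (g x) - 1))"
proof -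
 have [measurable]: "g \<in> BM borel" by (rule borel_measurable_simple_function[OF g])
 define R where "R = g ` UNIV - {0}"
 have "finite R" using simple_functionD(1)[OF g] by (simp add: R_def)
 then obtain ys where ys: "set ys = R" "distinct ys" using finite_distinct_list by blast
 define n where "n = length ys"
 \<comment> \<open>Independence is stated for sequences of disjoint sets, so the finite list of
   level sets is continued by empty sets.\<close>
 define A where "A i = (if i < n then g -` {ys ! i} else {})" for i
 have A_meas: "A i \<in> sets borel" for i
  unfolding A_def using measurable_sets[of g borel borel "{ys ! i}"] by simp
 have ysR: "ys ! i \<in> R" if "i < n" for i using that ys by (auto simp: n_def)
 have A_sub: "A i \<subseteq> {x. g x ~= 0}" for i
  using ysR[of i] by (auto simp: A_def R_def)
 have nz_meas: "{x. g x ~= 0} \<in> sets borel" by measurable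
 have A_fin: "emeasure \<Lambda> (A i) < \<infinity>" for i
  using emeasure_mono[OF A_sub[of i], of \<Lambda>] fin nz_meas sets_Lambda by (simp add: le_less_trans)
 have disj: "disjoint_family A"
  using ys by (auto simp: disjoint_family_on_def A_def n_def nth_eq_iff_index_eq)
 \<comment> \<open>Used for the identity and for \<open>exp y - 1\<close>. Both vanish at 0, so the
   level set of 0, which may have infinite intensity, drops out.\<close>
 have rep: "h (g x) = (\<Sum>i<n. h (ys ! i) * indicator (A i) x)" if "h 0 = 0" for h :: "real => real" and x
 proof (cases "g x = 0")
  case True
  then have "indicator (A i) x = (0::real)" for i using A_sub[of i] by (auto simp: indicator_def)
  then show ?thesis using True that by simp
 next
  case False
  then have "g x \<in> set ys" using ys by (auto simp: R_def)
  then obtain i where i: "i < n" "ys ! i = g x" by (auto simp: in_set_conv_nth n_def)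
  have "(\<Sum>j<n. h (ys ! j) * indicator (A j) x) = (\<Sum>j\<in>{i}. h (ys ! j) * indicator (A j) x)"
  proof (rule sum.mono_neutral_right)
   show "\<forall>j\<in>{..<n} - {i}. h (ys ! j) * indicator (A j) x = 0"
    using i ys by (auto simp: A_def indicator_def n_def nth_eq_iff_index_eq)
  qed (use i in auto)
  then show ?thesis using i by (simp add: A_def)
 qed
 have int: "(LINT x|\<mu>. h (g x)) = (\<Sum>i<n. h (ys ! i) * measure \<mu> (A i))"
  if "h 0 = 0" "sets \<mu> = sets borel" "!!i. emeasure \<mu> (A i) < \<infinity>" for h :: "real => real" and \<mu>
 proof -
  have "(LINT x|\<mu>. h (g x)) = (\<Sum>i<n. LINT x|\<mu>. h (ys ! i) * indicator (A i) x)"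
   unfolding rep[of h, OF that(1)] using that A_meas by (intro bintegral_sum) auto
  then show ?thesis using that A_meas by (simp add: sets_eq_imp_space_eq[OF that(2)])
 qed
 have "(\<integral>\<^sup>+om. ennreal (exp (LINT x|N om. g x)) \<partial>M) = (\<integral>\<^sup>+om. ennreal (exp (\<Sum>i<n. ys ! i * measure (N om) (A i))) \<partial>M)"
 proof (rule nn_integral_cong_AE)
  have "AE om in M. \<forall>i. emeasure (N om) (A i) < \<infinity>"
   unfolding AE_all_countable using count_finite_AE[OF A_meas A_fin] by blast
  then show "AE om in M. ennreal (exp (LINT x|N om. g x)) = ennreal (exp (\<Sum>i<n. ys ! i * measure (N om) (A i)))"
   using AE_space by eventually_elim (use int[of "%x. x"] sets_N in auto)
 qed
 also have "... = ennreal (exp (\<Sum>i<n. measure \<Lambda> (A i) * (exp (ys ! i) - 1)))"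
  by (rule exp_disjoint_sum[OF A_meas A_fin disj])
 also have "(\<Sum>i<n. measure \<Lambda> (A i) * (exp (ys ! i) - 1)) = (LINT x|\<Lambda>. exp (g x) - 1)"
  using int[of "%x. exp x - 1" \<Lambda>] A_fin by (simp add: sets_Lambda mult.commute)
 finally show ?thesis .
qed

lemma integrable_exp_minus_one:
 assumes f: "integrable \<Lambda> f" and B: "!!x. \<bar>f x\<bar> <= (B::real)"
 shows "integrable \<Lambda> (%x. exp (f x) - 1)"
proof (rule bintegrable_bound)
 show "integrable \<Lambda> (%x. f x * exp B)" using f by simp
 show "AE x in \<Lambda>. norm (exp (f x) - 1) <= norm (f x * exp B)" (is "AE x in _. ?AE x")
 proof (rule AE_I2)
  fix x
  have "\<bar>exp (f x) - 1\<bar> <= \<bar>f x\<bar> * exp (max 0 (f x))" by (rule abs_exp_minus_one_le)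
  also have "... <= \<bar>f x\<bar> * exp B" using B[of x] by (intro mult_left_mono) auto
  finally show "?AE x" by (simp add: abs_mult)
 qed
qed (use f in auto)

lemma tendsto_integral_exp_minus_one:
 assumes f: "integrable \<Lambda> f" and B: "!!x. \<bar>f x\<bar> <= (B::real)"
  and s: "!!k. s k \<in> BM \<Lambda>" "!!k x. \<bar>s k x\<bar> <= 2 * \<bar>f x\<bar>" "!!x. (%k. s k x) ----> f x"
 shows "(%k. LINT x|\<Lambda>. exp (s k x) - 1) ----> (LINT x|\<Lambda>. exp (f x) - 1)"
proof (rule integral_dominated_convergence[where w="%x. 2 * \<bar>f x\<bar> * exp (2 * B)"])
 show "integrable \<Lambda> (%x. 2 * \<bar>f x\<bar> * exp (2 * B))" using f by simp
 show "AE x in \<Lambda>. (%k. exp (s k x) - 1) ----> exp (f x) - 1"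
  using s(3) by (intro AE_I2 tendsto_intros)
 show "AE x in \<Lambda>. norm (exp (s k x) - 1) <= 2 * \<bar>f x\<bar> * exp (2 * B)" (is "AE x in _. ?AE x") for k
 proof (rule AE_I2)
  fix x
  have "\<bar>exp (s k x) - 1\<bar> <= \<bar>s k x\<bar> * exp (max 0 (s k x))" by (rule abs_exp_minus_one_le)
  also have "... <= (2 * \<bar>f x\<bar>) * exp (2 * B)"
  proof (intro mult_mono)
   have "0 <= B" using B[of x] by linarith
   then show "exp (max 0 (s k x)) <= exp (2 * B)" using s(2)[of k x] B[of x] by simp
  qed (use s(2)[of k x] in auto)
  finally show "?AE x" by simp
 qed
qed (use f s in auto)

text \<open>The nonnegative case is settled by monotone convergence alone. It provides the finite
  exponential moment that dominates the signed case in \<open>exp_formula\<close>.\<close>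

lemma exp_nonneg:
 assumes f: "integrable \<Lambda> f" and B: "!!x. \<bar>f x\<bar> <= (B::real)" and nn: "!!x. 0 <= f x"
 shows "(\<integral>\<^sup>+om. ennreal (exp (LINT x|N om. f x)) \<partial>M) = ennreal (exp (LINT x|\<Lambda>. exp (f x) - 1))"
proof -
 have fm [measurable]: "f \<in> BM borel"
  using borel_measurable_integrable[OF f] by (simp add: measurable_cong_sets[OF sets_Lambda refl])
 obtain s where s: "incseq s" "!!i. simple_function borel (s i)" "!!x. bdd_above (range (%i. s i x))"
   "!!i x. (0::real) <= s i x" "f = (SUP i. s i)"
  using borel_measurable_implies_simple_function_sequence_real[OF fm nn] by auto
 have sm [measurable]: "s i \<in> BM borel" for i by (rule borel_measurable_simple_function[OF s(2)])
 have f_eq: "f x = (SUP i. s i x)" for x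
  using s(5) by (metis (no_types, lifting) SUP_apply image_cong)
 have s_le: "s i x <= f x" for i x unfolding f_eq by (rule cSUP_upper[OF _ s(3)]) simp
 have s_mono: "incseq (%i. s i x)" for x using s(1) by (auto simp: incseq_def le_fun_def)
 have lim: "(%i. s i x) ----> f x" for x
  unfolding f_eq by (rule LIMSEQ_incseq_SUP[OF s(3) s_mono])
 have s_int: "integrable \<mu> (s i)" if "integrable \<mu> f" "sets \<mu> = sets borel" for \<mu> i
  using that s(4)[of i] nn s_le[of i] sm[of i]
  by (intro bintegrable_bound[OF that(1)]) (auto simp: measurable_cong_sets[OF that(2) refl])
 have s_fin: "emeasure \<Lambda> {x. s i x ~= 0} < \<infinity>" for i
 proof -
  have "finite (s i ` UNIV - {0})" using simple_functionD(1)[OF s(2)] by simp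
  have "emeasure \<Lambda> {x. s i x ~= 0} = emeasure \<Lambda> (\<Union>y\<in>s i ` UNIV - {0}. {x. s i x = y})"
   by (rule arg_cong[where f="emeasure \<Lambda>"]) auto
  also have "... <= (\<Sum>y\<in>s i ` UNIV - {0}. emeasure \<Lambda> {x. s i x = y})"
   using \<open>finite (s i ` UNIV - {0})\<close> by (intro emeasure_subadditive_finite) (auto simp: sets_Lambda)
  also have "... < \<infinity>"
  proof -
   \<comment> \<open>Markov's inequality: a positive level of a function below an integrable one is
     attained on a set of finite mass.\<close>
   have "emeasure \<Lambda> {x. s i x = y} < \<infinity>" if "y \<in> s i ` UNIV - {0}" for y
   proof -
    have "0 < y" using that s(4)[of i] by (metis Diff_iff image_iff insertI1 less_eq_real_def)
    have "ennreal y * emeasure \<Lambda> {x. s i x = y} = (\<integral>\<^sup>+x. ennreal y * indicator {x. s i x = y} x \<partial>\<Lambda>)"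
    by (subst nn_integral_cmult_indicator) (auto simp: sets_Lambda)
    also have "... <= (\<integral>\<^sup>+x. ennreal (f x) \<partial>\<Lambda>)"
    using s_le[of i] nn by (intro nn_integral_mono) (auto simp: indicator_def)
    also have "... < \<infinity>"
    proof -
    have "(\<integral>\<^sup>+x. ennreal (f x) \<partial>\<Lambda>) = (\<integral>\<^sup>+x. ennreal (norm (f x)) \<partial>\<Lambda>)" using nn by simp
    then show ?thesis using f by (simp add: integrable_iff_bounded)
    qed
    finally show ?thesis using \<open>0 < y\<close> by (auto simp: ennreal_mult_less_top)
   qed
   then show ?thesis using \<open>finite (s i ` UNIV - {0})\<close> by (simp add: less_top)
  qed
  finally show ?thesis .
 qed
 have AEf: "AE om in M. integrable (N om) f" by (rule AE_integrable_N[OF f])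
 have conv: "AE om in M. (%i. LINT x|N om. s i x) ----> (LINT x|N om. f x)"
  using AEf AE_space
 proof eventually_elim
  case (elim om)
  then show ?case
   using lim s(4) s_le nn sm
   by (intro integral_dominated_convergence[where w=f]) (auto simp: measurable_cong_sets[OF sets_N refl])
 qed
 have mono: "AE om in M. \<forall>i. ennreal (exp (LINT x|N om. s i x)) <= ennreal (exp (LINT x|N om. s (Suc i) x))"
  using AEf AE_space
 proof eventually_elim
  case (elim om)
  then show ?case
   using incseq_SucD[OF s_mono] by (auto intro!: integral_mono s_int sets_N)
 qed
 have mm: "(%om. ennreal (exp (LINT x|N om. g x))) \<in> BM M" if "g \<in> BM borel" for g
  using integral_N_measurable[OF that] by measurable
 have "(\<integral>\<^sup>+om. (SUP i. ennreal (exp (LINT x|N om. s i x))) \<partial>M) = (SUP i. \<integral>\<^sup>+om. ennreal (exp (LINT x|N om. s i x)) \<partial>M)"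
  by (rule nn_integral_monotone_convergence_SUP_AE) (use mono mm sm in auto)
 also have "(\<integral>\<^sup>+om. (SUP i. ennreal (exp (LINT x|N om. s i x))) \<partial>M) = (\<integral>\<^sup>+om. ennreal (exp (LINT x|N om. f x)) \<partial>M)"
 proof (rule nn_integral_cong_AE)
  show "AE om in M. (SUP i. ennreal (exp (LINT x|N om. s i x))) = ennreal (exp (LINT x|N om. f x))"
   using conv mono
  proof eventually_elim
   case (elim om)
   have "(%i. ennreal (exp (LINT x|N om. s i x))) ----> ennreal (exp (LINT x|N om. f x))"
    using elim by (intro tendsto_ennrealI tendsto_exp) auto
   moreover have "(%i. ennreal (exp (LINT x|N om. s i x))) ----> (SUP i. ennreal (exp (LINT x|N om. s i x)))"
    using elim by (intro LIMSEQ_SUP incseq_SucI) auto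
   ultimately show ?case by (rule LIMSEQ_unique[rotated])
  qed
 qed
 also have "(SUP i. \<integral>\<^sup>+om. ennreal (exp (LINT x|N om. s i x)) \<partial>M) = (SUP i. ennreal (exp (LINT x|\<Lambda>. exp (s i x) - 1)))"
  using exp_simple[OF s(2) s_fin] by simp
 also have "... = ennreal (exp (LINT x|\<Lambda>. exp (f x) - 1))"
 proof (rule LIMSEQ_unique)
  have B0: "\<bar>s i x\<bar> <= B" for i x using s(4)[of i x] s_le[of i x] B[of x] by linarith
  have "(LINT x|\<Lambda>. exp (s i x) - 1) <= (LINT x|\<Lambda>. exp (s (Suc i) x) - 1)" for i
   using incseq_SucD[OF s_mono] B0 by (intro integral_mono integrable_exp_minus_one[where B=B] s_int f sets_Lambda) auto
  then show "(%i. ennreal (exp (LINT x|\<Lambda>. exp (s i x) - 1))) ----> (SUP i. ennreal (exp (LINT x|\<Lambda>. exp (s i x) - 1)))"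
   by (intro LIMSEQ_SUP incseq_SucI) (auto intro!: ennreal_leI)
  have "(%i. LINT x|\<Lambda>. exp (s i x) - 1) ----> (LINT x|\<Lambda>. exp (f x) - 1)"
  proof (rule tendsto_integral_exp_minus_one[OF f B])
   show "\<bar>s k x\<bar> <= 2 * \<bar>f x\<bar>" for k x using s(4)[of k x] s_le[of k x] nn[of x] by linarith
  qed (use lim in "auto simp: measurable_cong_sets[OF sets_Lambda refl]")
  then show "(%i. ennreal (exp (LINT x|\<Lambda>. exp (s i x) - 1))) ----> ennreal (exp (LINT x|\<Lambda>. exp (f x) - 1))"
   by (intro tendsto_ennrealI tendsto_exp)
 qed
 finally show ?thesis .
qed

lemma integrable_exp_abs:
 assumes f: "integrable \<Lambda> f" and B: "!!x. \<bar>f x\<bar> <= (B::real)"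
 shows "integrable M (%om. exp (LINT x|N om. \<bar>f x\<bar>))"
proof -
 have fm [measurable]: "f \<in> BM borel"
  using borel_measurable_integrable[OF f] by (simp add: measurable_cong_sets[OF sets_Lambda refl])
 have [measurable]: "(%om. LINT x|N om. \<bar>f x\<bar>) \<in> BM M"
  by (rule integral_N_measurable) measurable
 show ?thesis
  using exp_nonneg[of "%x. \<bar>f x\<bar>" B] f B by (intro integrableI_bounded) auto
qed

text \<open>Simple functions bounded by \<open>2 * \<bar>f x\<bar>\<close> approximate
  \<open>f\<close>. On the random side the exponential of the integral of
  \<open>\<bar>2 * f x\<bar>\<close> dominates, and it is integrable by the nonnegative
  case.\<close>

theorem exp_formula:
 assumes f: "integrable \<Lambda> f" and B: "!!x. \<bar>f x\<bar> <= (B::real)"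
 shows "integrable M (%om. exp (LINT x|N om. f x))"
  and "(LINT om|M. exp (LINT x|N om. f x)) = exp (LINT x|\<Lambda>. exp (f x) - 1)"
proof -
 have fm [measurable]: "f \<in> BM borel"
  using borel_measurable_integrable[OF f] by (simp add: measurable_cong_sets[OF sets_Lambda refl])
 have mm: "(%om. exp (LINT x|N om. g x)) \<in> BM M" if "g \<in> BM borel" for g :: "real => real"
  using integral_N_measurable[OF that] by measurable
 have sp: "space \<Lambda> = UNIV" using sets_eq_imp_space_eq[OF sets_Lambda] by simp
 obtain s where s: "!!i. simple_function \<Lambda> (s i)" "!!i. emeasure \<Lambda> {y \<in> space \<Lambda>. s i y ~= 0} ~= \<infinity>"
   "!!x. x \<in> space \<Lambda> ==> (%i. s i x) ----> f x" "!!x i. x \<in> space \<Lambda> ==> norm (s i x) <= 2 * norm (f x)"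
 proof (rule integrable_implies_simple_function_sequence[OF f])
  fix s
  assume "!!i. simple_function \<Lambda> (s i)" "!!i. emeasure \<Lambda> {y \<in> space \<Lambda>. s i y ~= 0} ~= \<infinity>"
   "!!x. x \<in> space \<Lambda> ==> (%i. s i x) ----> f x" "!!x i. x \<in> space \<Lambda> ==> norm (s i x) <= 2 * norm (f x)"
  then show thesis by (rule that)
 qed
 have ss: "simple_function borel (s i)" for i
  using s(1)[of i] sp by (simp add: simple_function_def sets_Lambda)
 have sm [measurable]: "s i \<in> BM borel" for i by (rule borel_measurable_simple_function[OF ss])
 have le: "\<bar>s i x\<bar> <= \<bar>2 * f x\<bar>" for i x using s(4)[of x i] sp by (simp add: abs_mult)
 have eq: "(\<integral>\<^sup>+om. ennreal (exp (LINT x|N om. s i x)) \<partial>M) = ennreal (exp (LINT x|\<Lambda>. exp (s i x) - 1))" for i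
  using s(2)[of i] sp by (intro exp_simple[OF ss]) (auto simp: less_top)
 have eq': "(LINT om|M. exp (LINT x|N om. s i x)) = exp (LINT x|\<Lambda>. exp (s i x) - 1)" for i
  using eq[of i] by (subst integral_eq_nn_integral) (auto intro!: mm)
 have B2: "\<bar>2 * f x\<bar> <= 2 * B" for x using B[of x] by (simp add: abs_mult)
 have dom: "integrable M (%om. exp (LINT x|N om. \<bar>2 * f x\<bar>))"
  by (rule integrable_exp_abs[OF _ B2]) (use f in simp)
 have AEf: "AE om in M. integrable (N om) f" by (rule AE_integrable_N[OF f])
 have conv: "AE om in M. (%i. exp (LINT x|N om. s i x)) ----> exp (LINT x|N om. f x)"
  using AEf AE_space
 proof eventually_elim
  case (elim om)
  then show ?case
   using s(3) le sp
   by (intro tendsto_exp integral_dominated_convergence[where w="%x. \<bar>2 * f x\<bar>"]) (auto simp: measurable_cong_sets[OF sets_N refl])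
 qed
 have bd: "AE om in M. norm (exp (LINT x|N om. s i x)) <= exp (LINT x|N om. \<bar>2 * f x\<bar>)" for i
  using AEf AE_space
 proof eventually_elim
  case (elim om)
  have "s i x <= \<bar>2 * f x\<bar>" for x using le[of i x] by linarith
  then have "(LINT x|N om. s i x) <= (LINT x|N om. \<bar>2 * f x\<bar>)"
   using elim by (intro integral_mono_AE') auto
  then show ?case by simp
 qed
 show "integrable M (%om. exp (LINT x|N om. f x))"
  by (rule integrable_dominated_convergence[OF _ _ dom conv bd]) (auto intro!: mm)
 have "(%i. LINT om|M. exp (LINT x|N om. s i x)) ----> (LINT om|M. exp (LINT x|N om. f x))"
  by (rule integral_dominated_convergence[OF _ _ dom conv bd]) (auto intro!: mm)
 moreover have "(%i. LINT x|\<Lambda>. exp (s i x) - 1) ----> (LINT x|\<Lambda>. exp (f x) - 1)"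
  using s(3) sp le
  by (intro tendsto_integral_exp_minus_one[OF f B]) (auto simp: measurable_cong_sets[OF sets_Lambda refl] abs_mult)
 then have "(%i. exp (LINT x|\<Lambda>. exp (s i x) - 1)) ----> exp (LINT x|\<Lambda>. exp (f x) - 1)"
  by (rule tendsto_exp)
 ultimately show "(LINT om|M. exp (LINT x|N om. f x)) = exp (LINT x|\<Lambda>. exp (f x) - 1)"
  unfolding eq' by (rule LIMSEQ_unique)
qed

end

text \<open>Exponential moments of all orders allow differentiating the moment generating function
  under the integral, at every \<open>t\<close> and repeatedly: a power
  \<open>\<bar>y\<bar> ^ k\<close> costs no more than a factor
  \<open>exp (k * \<bar>y\<bar>)\<close>.\<close>

lemma (in finite_measure) exp_moment_deriv:
 fixes Y :: "'a => real"
 assumes Y [measurable]: "Y \<in> BM M"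
  and int: "!!c. integrable M (%x. exp (c * \<bar>Y x\<bar>))"
 shows "integrable M (%x. Y x ^ k * exp (t * Y x))"
  and "((%t. LINT x|M. Y x ^ k * exp (t * Y x)) has_real_derivative (LINT x|M. Y x ^ Suc k * exp (t * Y x))) (at t)"
proof -
 have pow: "\<bar>y\<bar> ^ k <= exp (real k * \<bar>y\<bar>)" for y :: real and k
 proof -
  have "\<bar>y\<bar> <= exp \<bar>y\<bar>" using exp_ge_add_one_self[of "\<bar>y\<bar>"] by linarith
  then have "\<bar>y\<bar> ^ k <= exp \<bar>y\<bar> ^ k" by (intro power_mono) auto
  then show ?thesis by (simp add: exp_of_nat_mult)
 qed
 have bd: "\<bar>y ^ k * exp (s * y)\<bar> <= exp ((real k + \<bar>t\<bar> + 1) * \<bar>y\<bar>)" if "\<bar>s\<bar> <= \<bar>t\<bar> + 1" for y s t :: real and k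
 proof -
  have "s * y <= \<bar>s\<bar> * \<bar>y\<bar>" by (metis abs_ge_self abs_mult)
  also have "... <= (\<bar>t\<bar> + 1) * \<bar>y\<bar>" using that by (intro mult_right_mono) auto
  finally have "exp (s * y) <= exp ((\<bar>t\<bar> + 1) * \<bar>y\<bar>)" by simp
  then have "\<bar>y\<bar> ^ k * exp (s * y) <= exp (real k * \<bar>y\<bar>) * exp ((\<bar>t\<bar> + 1) * \<bar>y\<bar>)"
   using pow[of y k] by (intro mult_mono) auto
  also have "... = exp ((real k + \<bar>t\<bar> + 1) * \<bar>y\<bar>)"
   unfolding exp_add[symmetric] by (simp add: algebra_simps)
  finally show ?thesis by (simp add: abs_mult power_abs)
 qed
 have I: "integrable M (%x. Y x ^ k * exp (t * Y x))" for k t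
  by (rule bintegrable_bound[OF int[of "real k + \<bar>t\<bar> + 1"]])
   (use bd[of t t _ k] in auto)
 show "integrable M (%x. Y x ^ k * exp (t * Y x))" by (rule I)
 have "((%s. LINT x|M. Y x ^ k * exp ((s + t) * Y x)) has_real_derivative (LINT x|M. Y x ^ Suc k * exp ((0 + t) * Y x))) (at 0)"
 proof (rule has_real_derivative_integral[where e=1 and w="%x. exp ((real (Suc k) + \<bar>t\<bar> + 1) * \<bar>Y x\<bar>)"])
  fix s :: real and x assume "\<bar>s\<bar> < 1"
  then show "\<bar>Y x ^ Suc k * exp ((s + t) * Y x)\<bar> <= exp ((real (Suc k) + \<bar>t\<bar> + 1) * \<bar>Y x\<bar>)"
   by (intro bd) auto
  show "((%s. Y x ^ k * exp ((s + t) * Y x)) has_real_derivative Y x ^ Suc k * exp ((s + t) * Y x)) (at s)"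
   by (auto intro!: derivative_eq_intros)
 qed (use I int in auto)
 then show "((%t. LINT x|M. Y x ^ k * exp (t * Y x)) has_real_derivative (LINT x|M. Y x ^ Suc k * exp (t * Y x))) (at t)"
  using DERIV_shift[of "%t. LINT x|M. Y x ^ k * exp (t * Y x)" "LINT x|M. Y x ^ Suc k * exp (t * Y x)" 0 t]
  by simp
qed

context poisson_loc
begin

text \<open>Mean and second moment of a Poisson integral, from two derivatives of the exponential
  formula at 0. \<open>G k\<close> and \<open>P k\<close> are the k-th derivatives of the generating
  functions of the random integral and of \<open>f\<close> under \<Lambda>; the formula says
  \<open>G 0 = exp (P 0 - P 0 0)\<close>.\<close>

lemma bounded_moments:
 fixes f :: "real => real"
 assumes fin: "emeasure \<Lambda> UNIV < \<infinity>" and f [measurable]: "f \<in> BM borel" and B: "!!x. \<bar>f x\<bar> <= B"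
 shows "integrable M (%om. exp (c * \<bar>LINT x|N om. f x\<bar>))"
  and "integrable M (%om. LINT x|N om. f x)" and "(LINT om|M. LINT x|N om. f x) = (LINT x|\<Lambda>. f x)"
  and "integrable M (%om. (LINT x|N om. f x)\<^sup>2)"
  and "(LINT om|M. (LINT x|N om. f x)\<^sup>2) = (LINT x|\<Lambda>. (f x)\<^sup>2) + (LINT x|\<Lambda>. f x)\<^sup>2"
proof -
 define Y where "Y om = (LINT x|N om. f x)" for om
 have sp: "space \<Lambda> = UNIV" using sets_eq_imp_space_eq[OF sets_Lambda] by simp
 interpret L: finite_measure \<Lambda>
  by (rule finite_measureI) (use fin sp in auto)
 have f_Lm [measurable]: "f \<in> BM \<Lambda>" by (simp add: measurable_cong_sets[OF sets_Lambda refl])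
 have Y_meas [measurable]: "Y \<in> BM M" unfolding Y_def by (rule integral_N_measurable) fact
 have L_int: "integrable \<Lambda> h" if "h \<in> BM \<Lambda>" "!!x. \<bar>h x\<bar> <= C" for h :: "real => real" and C
  using that by (intro L.integrable_const_bound[of _ C]) auto
 have int: "integrable M (%om. exp (c * \<bar>Y om\<bar>))" for c
 proof (rule bintegrable_bound)
  have B': "\<bar>c * f x\<bar> <= \<bar>c\<bar> * B" for x using B[of x] by (simp add: abs_mult mult_left_mono)
  show "integrable M (%om. exp (LINT x|N om. \<bar>c * f x\<bar>))"
   by (rule integrable_exp_abs[OF L_int[OF _ B'] B']) auto
  show "AE om in M. norm (exp (c * \<bar>Y om\<bar>)) <= norm (exp (LINT x|N om. \<bar>c * f x\<bar>))" (is "AE om in _. ?AE om")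
  proof (rule AE_I2)
   fix om
   have "c * \<bar>Y om\<bar> <= \<bar>c * Y om\<bar>" by (simp add: abs_mult mult_right_mono)
   also have "\<bar>c * Y om\<bar> = \<bar>LINT x|N om. c * f x\<bar>" by (simp add: Y_def)
   also have "... <= (LINT x|N om. \<bar>c * f x\<bar>)" by (rule integral_abs_bound)
   finally show "?AE om" by simp
  qed
 qed measurable
 then show "integrable M (%om. exp (c * \<bar>LINT x|N om. f x\<bar>))" by (simp add: Y_def)
 have intL: "integrable \<Lambda> (%x. exp (c * \<bar>f x\<bar>))" for c
 proof (rule L_int)
  fix x
  have "c * \<bar>f x\<bar> <= \<bar>c\<bar> * B" using B[of x] by (meson abs_ge_self abs_ge_zero mult_mono)
  then show "\<bar>exp (c * \<bar>f x\<bar>)\<bar> <= exp (\<bar>c\<bar> * B)" by simp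
 qed measurable
 note DY = exp_moment_deriv[OF Y_meas int] and DL = L.exp_moment_deriv[OF f_Lm intL]
 define G where "G k t = (LINT om|M. Y om ^ k * exp (t * Y om))" for k t
 define P where "P k t = (LINT x|\<Lambda>. f x ^ k * exp (t * f x))" for k t
 have dG: "(G k has_real_derivative G (Suc k) t) (at t)" for k t
  using DY(2)[of k t] unfolding G_def[abs_def] .
 have dP: "(P k has_real_derivative P (Suc k) t) (at t)" for k t
  using DL(2)[of k t] unfolding P_def[abs_def] .
 have G0: "G 0 t = exp (P 0 t - measure \<Lambda> UNIV)" for t
 proof -
  have "\<bar>t * f x\<bar> <= \<bar>t\<bar> * B" for x using B[of x] by (simp add: abs_mult mult_left_mono)
  from exp_formula(2)[OF L_int[OF _ this] this]
  have "(LINT om|M. exp (LINT x|N om. t * f x)) = exp (LINT x|\<Lambda>. exp (t * f x) - 1)" by simp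
  moreover have "(LINT x|\<Lambda>. exp (t * f x) - 1) = P 0 t - measure \<Lambda> UNIV"
   using DL(1)[of 0 t] by (simp add: P_def sp)
  ultimately show ?thesis by (simp add: G_def Y_def)
 qed
 have G1: "G 1 t = P 1 t * exp (P 0 t - measure \<Lambda> UNIV)" for t
 proof (rule DERIV_unique)
  show "(G 0 has_real_derivative G 1 t) (at t)" using dG[of 0 t] by simp
  show "(G 0 has_real_derivative P 1 t * exp (P 0 t - measure \<Lambda> UNIV)) (at t)"
   unfolding G0[abs_def] using dP[of 0 t] by (auto intro!: derivative_eq_intros)
 qed
 have G2: "G 2 t = P 2 t * exp (P 0 t - measure \<Lambda> UNIV) + P 1 t * (P 1 t * exp (P 0 t - measure \<Lambda> UNIV))" for t
 proof (rule DERIV_unique)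
  show "(G 1 has_real_derivative G 2 t) (at t)" using dG[of 1 t] by (simp add: numeral_2_eq_2)
  show "(G 1 has_real_derivative P 2 t * exp (P 0 t - measure \<Lambda> UNIV) + P 1 t * (P 1 t * exp (P 0 t - measure \<Lambda> UNIV))) (at t)"
   unfolding G1[abs_def] using dP[of 0 t] dP[of 1 t]
   by (auto intro!: derivative_eq_intros simp: numeral_2_eq_2)
 qed
 have P0: "P 0 0 = measure \<Lambda> UNIV" by (simp add: P_def sp)
 show "integrable M (%om. LINT x|N om. f x)" "integrable M (%om. (LINT x|N om. f x)\<^sup>2)"
  using DY(1)[of 1 0] DY(1)[of 2 0] by (simp_all add: Y_def)
 show "(LINT om|M. LINT x|N om. f x) = (LINT x|\<Lambda>. f x)"
  using G1[of 0] by (simp add: P0) (simp add: G_def P_def Y_def)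
 show "(LINT om|M. (LINT x|N om. f x)\<^sup>2) = (LINT x|\<Lambda>. (f x)\<^sup>2) + (LINT x|\<Lambda>. f x)\<^sup>2"
  using G2[of 0] by (simp add: P0) (simp add: G_def P_def Y_def power2_eq_square)
qed

end

section \<open>Clusters\<close>

abbreviation "offspring_space \<equiv> (count_space UNIV \<Otimes>\<^sub>M (\<Pi>\<^sub>M i\<in>UNIV. borel)) :: (nat \<times> (nat => real)) measure"

abbreviation "family_space \<equiv> (\<Pi>\<^sub>M u\<in>UNIV. offspring_space) :: (nat list => nat \<times> (nat => real)) measure"

text \<open>Existence and position are read off one realised family \<open>ze\<close>, so that
  independence of the individuals becomes independence of the coordinates of
  \<open>ze\<close>.\<close>

definition alive :: "(nat list => nat \<times> (nat => real)) => nat list => bool" where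
 "alive ze u \<longleftrightarrow> in_tree (%v. fst (ze v)) u"

definition place :: "(nat list => nat \<times> (nat => real)) => nat list => real" where
 "place ze u = position (%v. snd (ze v)) u"

lemma alive_simps [simp]:
 "alive ze []" "alive ze (i # u) \<longleftrightarrow> alive ze u \<and> i < fst (ze u)"
 by (auto simp: alive_def)

lemma place_simps [simp]:
 "place ze [] = 0" "place ze (i # u) = place ze u + snd (ze u) i"
 by (auto simp: place_def)

text \<open>Whether \<open>u\<close> exists is decided by its proper ancestors, whose labels are
  shorter; the data of any label at least as long, that of \<open>u\<close> included, do not matter.
  This is what allows a generation to be integrated out given the earlier ones.\<close>

lemma alive_upd: "length u <= length v ==> alive (ze(v := c)) u = alive ze u"
 by (induction u) auto

lemma place_upd: "length u <= length v ==> place (ze(v := c)) u = place ze u"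
 by (induction u) auto

lemma measurable_family_component: "(%ze. ze u) \<in> measurable family_space offspring_space"
 by (rule measurable_component_singleton) simp

lemma measurable_fst_component [measurable]: "(%ze. fst (ze u)) \<in> measurable family_space (count_space UNIV)"
 by (rule measurable_compose[OF measurable_family_component measurable_fst])

lemma measurable_snd_component [measurable]: "(%ze. snd (ze u) i) \<in> BM family_space"
proof -
 have "(%z. snd z i) \<in> BM offspring_space" by measurable
 from measurable_compose[OF measurable_family_component this] show ?thesis .
qed

lemma pred_alive [measurable]: "Measurable.pred family_space (%ze. alive ze u)"
proof (induction u)
 case (Cons i u)
 note [measurable] = Cons.IH
 show ?case unfolding alive_simps by measurable
qed simp

lemma measurable_place [measurable]: "(%ze. place ze u) \<in> BM family_space"
 by (induction u) auto

text \<open>Infinite trees will form a null event. Sending them to the empty set makes the tree a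
  random variable with countably many values, so that sums and products over it are measurable
  without exceptional sets.\<close>

definition finite_part :: "'a set => 'a set" where
 "finite_part A = (if finite A then A else {})"

lemma finite_finite_part [simp]: "finite (finite_part A)"
 by (simp add: finite_part_def)

lemma finite_part_eq [simp]: "finite A ==> finite_part A = A"
 by (simp add: finite_part_def)

lemma measurable_finite_part:
 fixes T :: "'a => 'b :: countable set"
 assumes [measurable]: "!!u. Measurable.pred M (%om. u \<in> T om)"
 shows "(%om. finite_part (T om)) \<in> measurable M (count_space {A. finite A})"
proof -
 have c: "countable {A :: 'b set. finite A}" by (rule countable_Collect_finite)
 have eq [measurable]: "Measurable.pred M (%om. T om = A)" for A
 proof -
  have "Measurable.pred M (%om. \<forall>u. u \<in> T om \<longleftrightarrow> u \<in> A)" by measurable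
  then show ?thesis by (simp add: set_eq_iff)
 qed
 have fin: "Measurable.pred M (%om. finite (T om))"
 proof -
  have "(\<Union>A\<in>{A. finite A}. {om \<in> space M. T om = A}) \<in> sets M"
   using eq by (intro sets.countable_UN'[OF c]) (auto simp: pred_def)
  also have "(\<Union>A\<in>{A. finite A}. {om \<in> space M. T om = A}) = {om \<in> space M. finite (T om)}" by auto
  finally show ?thesis by (simp add: pred_def)
 qed
 have "Measurable.pred M (%om. finite_part (T om) = A)" for A
 proof -
  note [measurable] = fin
  have "Measurable.pred M (%om. if finite (T om) then T om = A else {} = A)" by measurable
  then show ?thesis by (simp add: finite_part_def if_distrib[of "%x. x = A"] cong: if_cong)
 qed
 then have "{om \<in> space M. finite_part (T om) = A} \<in> sets M" for A by (simp add: pred_def)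
 then show ?thesis
  unfolding measurable_count_space_eq_countable[OF c]
  by (auto simp: vimage_def Int_def conj_commute)
qed

lemma measurable_finite_part_compose:
 fixes T :: "'a => 'b :: countable set"
 assumes "!!u. Measurable.pred M (%om. u \<in> T om)"
  and "!!A. finite A ==> (%om. F A om) \<in> measurable M N"
 shows "(%om. F (finite_part (T om)) om) \<in> measurable M N"
 by (rule measurable_compose_countable'[OF _ measurable_finite_part[OF assms(1)] countable_Collect_finite])
  (use assms(2) in auto)

text \<open>A generation is a random set of labels, but independence is applied to fixed finite sets
  of them. Labels with code below \<open>k\<close> are the deterministic exhaustion that links the
  two.\<close>

lemma finite_to_nat_less: "finite {u \<in> A. to_nat (u :: 'a :: countable) < k}"
proof (rule finite_subset)
 show "{u \<in> A. to_nat u < k} \<subseteq> to_nat -` {..<k}" by auto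
 show "finite (to_nat -` {..<k} :: 'a set)" by (rule finite_vimageI) auto
qed

lemma eventually_subset_to_nat_less:
 assumes "finite U" "U \<subseteq> A"
 shows "eventually (%k. U \<subseteq> {u \<in> A. to_nat (u :: 'a :: countable) < k}) sequentially"
proof -
 have "eventually (%k. \<forall>u\<in>U. to_nat u < k) sequentially"
  using assms(1) by (intro eventually_ball_finite) (auto intro: eventually_gt_at_top)
 then show ?thesis by eventually_elim (use assms(2) in auto)
qed

section \<open>Generations of a tree\<close>

definition gen :: "nat => (nat list => nat \<times> (nat => real)) => nat list set" where
 "gen n ze = {u. alive ze u \<and> length u = n}"

definition gens :: "nat => (nat list => nat \<times> (nat => real)) => nat list set" where
 "gens n ze = {u. alive ze u \<and> length u < n}"

lemma gens_Suc: "gens (Suc n) ze = gens n ze \<union> gen n ze" "gens n ze \<inter> gen n ze = {}"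
 by (auto simp: gens_def gen_def)

lemma gen_Suc: "gen (Suc n) ze = (%(u, i). i # u) ` (SIGMA u:gen n ze. {..<fst (ze u)})"
proof (intro set_eqI iffI)
 fix w assume "w \<in> gen (Suc n) ze"
 then show "w \<in> (%(u, i). i # u) ` (SIGMA u:gen n ze. {..<fst (ze u)})"
  by (cases w) (auto simp: gen_def image_iff)
qed (auto simp: gen_def)

lemma prod_gen_Suc:
 assumes "finite (gen n ze)"
 shows "(\<Prod>w\<in>gen (Suc n) ze. g (x + place ze w)) =
  (\<Prod>u\<in>gen n ze. \<Prod>i<fst (ze u). g (x + place ze u + snd (ze u) i :: real))"
proof -
 have inj: "inj_on (%(u, i). i # u) (SIGMA u:gen n ze. {..<fst (ze u)})" by (auto simp: inj_on_def)
 have "(\<Prod>w\<in>gen (Suc n) ze. g (x + place ze w)) =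
  (\<Prod>(u, i)\<in>(SIGMA u:gen n ze. {..<fst (ze u)}). g (x + place ze u + snd (ze u) i))"
  unfolding gen_Suc prod.reindex[OF inj] by (intro prod.cong) (auto simp: add.assoc)
 also have "... = (\<Prod>u\<in>gen n ze. \<Prod>i<fst (ze u). g (x + place ze u + snd (ze u) i))"
  using assms by (subst prod.Sigma) auto
 finally show ?thesis .
qed

section \<open>One subcritical cluster: offspring of an individual and removal of a
  generation\<close>

locale cluster = prob_space M
 for M :: "'w measure" +
 fixes m :: real and \<phi> :: "real => real" and K :: "nat list => 'w => nat" and X :: "nat list => nat => 'w => real"
 assumes m: "0 < m" "m < 1" and phi: "prob_density \<phi>"
  and indep: "indep_vars (%_. offspring_space) (%u om. (K u om, %i. X u i om)) UNIV"
  and pois: "!!u. poisson_process M (density lborel (%y. ennreal (m * \<phi> y)))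
   (%om. points_measure {..<K u om} (%i. X u i om))"
begin

definition fam :: "'w => nat list => nat \<times> (nat => real)" where
 "fam om = (%u. (K u om, %i. X u i om))"

abbreviation "mu \<equiv> density lborel (%y. ennreal (m * \<phi> y))"

lemma fam_component_measurable [measurable]: "(%om. fam om u) \<in> measurable M offspring_space"
 using indep unfolding indep_vars_def fam_def by auto

lemma fam_measurable [measurable]: "fam \<in> measurable M family_space"
 using measurable_PiM_single'[of UNIV "%u om. fam om u" M "%_. offspring_space"] fam_component_measurable
 by (simp add: space_pair_measure space_PiM PiE_UNIV_domain)

lemma phi_meas [measurable]: "\<phi> \<in> BM borel"
 and phi_nn: "0 <= \<phi> x" and phi_int: "integrable lborel \<phi>"
 using prob_densityD[OF phi] by auto

lemma emeasure_mu: "emeasure mu UNIV = ennreal m"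
proof -
 have "emeasure mu UNIV = (\<integral>\<^sup>+y. ennreal (m * \<phi> y) \<partial>lborel)" by (subst emeasure_density) auto
 also have "... = ennreal (LINT y|lborel. m * \<phi> y)"
  using phi_int phi_nn m by (intro nn_integral_eq_integral) auto
 finally show ?thesis using prob_densityD(4)[OF phi] by simp
qed

sublocale mu: finite_measure mu
 by (rule finite_measureI) (simp add: emeasure_mu)

lemma measure_mu: "measure mu UNIV = m"
 using emeasure_mu m by (simp add: measure_def)

lemma offspring_poisson: "poisson_loc M mu (%om. points_measure {..<K u om} (%i. X u i om))"
 by unfold_locales (use pois in auto)

lemma integral_points: "(LINT x|points_measure {..<k::nat} X'. f x :: real) = (\<Sum>i<k. f (X' i))" if "f \<in> BM borel"
 using that unfolding points_measure_def
 by (subst integral_distr) (simp_all add: lebesgue_integral_count_space_finite[OF finite_lessThan])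

text \<open>Generating functional of the offspring of an individual at \<open>y\<close>: the mean
  product of \<open>g\<close> over its children, written as the Poisson exponential formula for
  \<open>ln g\<close>.\<close>

definition mult :: "(real => real) => real => real" where
 "mult g y = exp (LINT z|mu. g (y + z) - 1)"

lemma mult_measurable [measurable]:
 assumes [measurable]: "g \<in> BM borel"
 shows "mult g \<in> BM borel"
 unfolding mult_def[abs_def] by measurable

lemma integrable_mu_bounded:
 assumes "g \<in> BM borel" "!!x. \<bar>g x\<bar> <= B"
 shows "integrable mu (g :: real => real)"
 using assms by (intro mu.integrable_const_bound[of _ B]) auto

text \<open>The two positive bounds on \<open>g\<close> make \<open>ln g\<close> bounded, hence
  integrable against the finite measure \<open>mu\<close> and admissible in
  \<open>exp_formula\<close>.\<close>

lemma offspring_prod: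
 assumes g [measurable]: "g \<in> BM borel" and lb: "!!x. \<delta> <= g x" "0 < \<delta>" and ub: "!!x. g x <= B"
 shows "(\<integral>\<^sup>+om. ennreal (\<Prod>i<K u om. g (y + X u i om)) \<partial>M) = ennreal (mult g y)"
proof -
 interpret P: poisson_loc M mu "%om. points_measure {..<K u om} (%i. X u i om)" by (rule offspring_poisson)
 have pos: "0 < g x" for x using lb(1)[of x] lb(2) by linarith
 let ?f = "%z. ln (g (y + z))"
 let ?B = "\<bar>ln \<delta>\<bar> + \<bar>ln B\<bar>"
 have bd: "\<bar>?f z\<bar> <= ?B" for z
 proof -
  have "ln \<delta> <= ?f z" using lb(1)[of "y + z"] lb(2) pos by simp
  moreover have "?f z <= ln B" using ub[of "y + z"] pos[of "y + z"] by simp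
  ultimately show ?thesis by linarith
 qed
 have eq: "exp (LINT x|points_measure {..<K u om} (%i. X u i om). ?f x) = (\<Prod>i<K u om. g (y + X u i om))" for om
  by (subst integral_points) (auto simp: exp_sum pos)
 have int: "integrable mu ?f" by (rule integrable_mu_bounded[OF _ bd]) measurable
 note F = P.exp_formula[OF int bd]
 have "(\<integral>\<^sup>+om. ennreal (\<Prod>i<K u om. g (y + X u i om)) \<partial>M) = ennreal (LINT om|M. (\<Prod>i<K u om. g (y + X u i om)))"
  using F(1) pos unfolding eq by (intro nn_integral_eq_integral AE_I2 prod_nonneg) (auto intro: less_imp_le)
 then show ?thesis using F(2) pos unfolding eq by (simp add: mult_def)
qed

lemma offspring_mean: "(\<integral>\<^sup>+om. of_nat (K u om) \<partial>M) = ennreal m"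
proof -
 interpret P: poisson_loc M mu "%om. points_measure {..<K u om} (%i. X u i om)" by (rule offspring_poisson)
 have "emeasure (points_measure {..<K u om} (%i. X u i om)) UNIV = of_nat (K u om)" for om
  unfolding points_measure_def by (subst emeasure_distr) auto
 then show ?thesis using P.count_mean'[of UNIV] emeasure_mu by simp
qed

text \<open>The data of one label against the data of all other labels jointly. Coordinate
  \<open>v\<close> and the remaining ones live in different spaces, hence
  \<open>indep_rvs\<close>.\<close>

lemma indep_rest:
 "indep_rvs M offspring_space (%om. fam om v) (Pi\<^sub>M (- {v}) (%_. offspring_space)) (%om. restrict (fam om) (- {v}))"
proof -
 let ?S = "%_::nat list. offspring_space"
 have "indep_var (Pi\<^sub>M {v} ?S) (%om. restrict (fam om) {v}) (Pi\<^sub>M (- {v}) ?S) (%om. restrict (fam om) (- {v}))"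
  using indep_var_restrict[OF indep, of "{v}" "- {v}"] by (simp add: fam_def)
 note D = indep_varD[OF this]
 have R [measurable]: "(%om. restrict (fam om) (- {v})) \<in> measurable M (Pi\<^sub>M (- {v}) ?S)"
  using fam_component_measurable by (intro measurable_restrict) auto
 show ?thesis
  unfolding indep_rvs_def
 proof (intro conjI indep_setI)
  fix a b
  assume "a \<in> {(%om. fam om v) -` A \<inter> space M | A. A \<in> sets offspring_space}"
   and "b \<in> {(%om. restrict (fam om) (- {v})) -` B \<inter> space M | B. B \<in> sets (Pi\<^sub>M (- {v}) ?S)}"
  then obtain A B where A: "A \<in> sets offspring_space" "a = (%om. fam om v) -` A \<inter> space M"
   and B: "B \<in> sets (Pi\<^sub>M (- {v}) ?S)" "b = (%om. restrict (fam om) (- {v})) -` B \<inter> space M" by blast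
  define A' where "A' = (%f. f v) -` A \<inter> space (Pi\<^sub>M {v} ?S)"
  have A': "A' \<in> sets (Pi\<^sub>M {v} ?S)"
   unfolding A'_def by (rule measurable_sets[OF measurable_component_singleton]) (use A in auto)
  have "a = (%om. restrict (fam om) {v}) -` A' \<inter> space M"
   unfolding A A'_def by (auto simp: space_PiM space_pair_measure)
  then show "prob (a \<inter> b) = prob a * prob b"
   using D[OF A' B(1)] unfolding B by (simp add: vimage_def Int_def conj_ac)
 qed (auto intro: R measurable_sets[OF fam_component_measurable] measurable_sets[OF R])
qed

lemma measurable_insert_component:
 assumes "c \<in> space offspring_space"
 shows "(%r. r(v := c)) \<in> measurable (Pi\<^sub>M (- {v}) (%_. offspring_space)) family_space"
 by (rule measurable_fun_upd[where J="- {v}"]) (use assms in auto)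

lemma restrict_upd: "(restrict (fam om) (- {v}))(v := c) = (fam om)(v := c)"
 by (auto simp: fun_eq_iff)

text \<open>\<open>H\<close> does not look at coordinate \<open>v\<close> of its first argument, and
  that coordinate is independent of all the others; so it may be replaced by an independent
  copy.\<close>

lemma peel_nn:
 assumes H [measurable]: "H \<in> BM (family_space \<Otimes>\<^sub>M offspring_space)"
  and dep: "!!ze z c. H (ze(v := c), z) = H (ze, z)"
 shows "(\<integral>\<^sup>+om. H (fam om, fam om v) \<partial>M) = (\<integral>\<^sup>+om. (\<integral>\<^sup>+om'. H (fam om, fam om' v) \<partial>M) \<partial>M)"
proof -
 let ?R = "Pi\<^sub>M (- {v}) (%_. offspring_space)"
 let ?r = "%om. restrict (fam om) (- {v})"
 \<comment> \<open>Dummy data for label \<open>v\<close>: it completes a restricted family to a full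
   one and is invisible to \<open>H\<close>.\<close>
 define c :: "nat \<times> (nat => real)" where "c = (0, %_. 0)"
 have [measurable]: "(%r. r(v := c)) \<in> measurable ?R family_space"
  by (rule measurable_insert_component) (simp add: space_pair_measure space_PiM)
 note I = indep_rest[of v]
 have [measurable]: "?r \<in> measurable M ?R" using I by (simp add: indep_rvs_def)
 define H' where "H' = (%p. H ((snd p)(v := c), fst p))"
 have [measurable]: "H' \<in> BM (offspring_space \<Otimes>\<^sub>M ?R)"
  unfolding H'_def by measurable
 have HH: "H' (z, ?r om) = H (fam om, z)" for z om
  unfolding H'_def by (simp add: restrict_upd dep)
 interpret D1: prob_space "distr M offspring_space (%om. fam om v)" by (rule prob_space_distr) simp
 interpret D2: prob_space "distr M ?R ?r" by (rule prob_space_distr) simp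
 interpret pair_sigma_finite "distr M offspring_space (%om. fam om v)" "distr M ?R ?r" ..
 have "(\<integral>\<^sup>+om. H (fam om, fam om v) \<partial>M) = (\<integral>\<^sup>+p. H' p \<partial>distr M (offspring_space \<Otimes>\<^sub>M ?R) (%om. (fam om v, ?r om)))"
  by (subst nn_integral_distr) (auto simp: HH)
 also have "... = (\<integral>\<^sup>+p. H' p \<partial>(distr M offspring_space (%om. fam om v) \<Otimes>\<^sub>M distr M ?R ?r))"
  by (simp add: indep_rvs_distr[OF I])
 also have "... = (\<integral>\<^sup>+r. (\<integral>\<^sup>+z. H' (z, r) \<partial>distr M offspring_space (%om. fam om v)) \<partial>distr M ?R ?r)"
  by (rule nn_integral_snd[symmetric]) simp
 also have "... = (\<integral>\<^sup>+om. (\<integral>\<^sup>+z. H' (z, ?r om) \<partial>distr M offspring_space (%om. fam om v)) \<partial>M)"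
  by (subst nn_integral_distr) auto
 also have "... = (\<integral>\<^sup>+om. (\<integral>\<^sup>+om'. H' (fam om' v, ?r om) \<partial>M) \<partial>M)"
  by (intro nn_integral_cong, subst nn_integral_distr) (auto intro!: measurable_compose[OF _ \<open>H' \<in> _\<close>] measurable_Pair2')
 finally show ?thesis unfolding HH .
qed

text \<open>The labels of one generation are integrated out one at a time. The free factor
  \<open>B\<close> is the device of the induction: the mean factor of a finished label depends on
  shorter labels only and is absorbed into \<open>B\<close>.\<close>

lemma peel_step:
 assumes a [measurable]: "a \<in> BM borel" and a0: "!!x. 0 <= a x"
  and g [measurable]: "g \<in> BM borel" and g_lb: "!!x. \<delta> <= g x" "0 < \<delta>" and g_ub: "!!x. g x <= b"
  and J: "finite J" "J \<subseteq> {u. length u = n}"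
 shows "B \<in> BM family_space ==> (!!ze v c. n <= length v ==> B (ze(v := c)) = B ze) ==>
  (\<integral>\<^sup>+om. B (fam om) * (\<Prod>u\<in>J. if alive (fam om) u then ennreal (a (x + place (fam om) u) *
    (\<Prod>i<fst (fam om u). g (x + place (fam om) u + snd (fam om u) i))) else 1) \<partial>M) =
  (\<integral>\<^sup>+om. B (fam om) * (\<Prod>u\<in>J. if alive (fam om) u then ennreal (a (x + place (fam om) u) *
    mult g (x + place (fam om) u)) else 1) \<partial>M)"
 using J
proof (induction J arbitrary: B rule: finite_induct)
 case empty
 then show ?case by simp
next
 case (insert v J)
 have v: "length v = n" and Jn: "!!u. u \<in> J ==> length u = n" using insert.prems by auto
 note B [measurable] = insert.prems(1)
 define P where "P ze = (\<Prod>u\<in>J. if alive ze u then ennreal (a (x + place ze u) *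
    (\<Prod>i<fst (ze u). g (x + place ze u + snd (ze u) i))) else 1)" for ze
 define Q where "Q ze z = (if alive ze v then ennreal (a (x + place ze v) *
    (\<Prod>i<fst z. g (x + place ze v + snd z i))) else 1)" for ze and z :: "nat \<times> (nat => real)"
 define R where "R ze = (if alive ze v then ennreal (a (x + place ze v) * mult g (x + place ze v)) else 1)" for ze
 have [measurable]: "(%ze. \<Prod>i<fst (ze u). g (x + place ze u + snd (ze u) i)) \<in> BM family_space" for u
  by (rule measurable_compose_countable'[where I=UNIV and f="%k ze. \<Prod>i<k. g (x + place ze u + snd (ze u) i)", OF _ measurable_fst_component]) auto
 have P_meas [measurable]: "P \<in> BM family_space" unfolding P_def by measurable
 have [measurable]: "(%p. \<Prod>i<fst (snd p). g (x + place (fst p) v + snd (snd p) i)) \<in> BM (family_space \<Otimes>\<^sub>M offspring_space)"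
  by (rule measurable_compose_countable'[where I=UNIV and f="%k p. \<Prod>i<k. g (x + place (fst p) v + snd (snd p) i)"]) auto
 have [measurable]: "(%p. Q (fst p) (snd p)) \<in> BM (family_space \<Otimes>\<^sub>M offspring_space)"
  unfolding Q_def by measurable
 have P_upd: "P (ze(v := c)) = P ze" for ze c
  unfolding P_def using insert.hyps Jn v by (intro prod.cong refl) (auto simp: alive_upd place_upd)
 have R_upd: "R (ze(w := c)) = R ze" if "n <= length w" for ze c w
  unfolding R_def using that v by (simp add: alive_upd place_upd)
 have [measurable]: "R \<in> BM family_space" unfolding R_def by measurable
 have Q_int: "(\<integral>\<^sup>+om'. Q ze (fam om' v) \<partial>M) = R ze" for ze
 proof -
  have *: "(\<integral>\<^sup>+om. ennreal (\<Prod>i<K v om. g (y + X v i om)) \<partial>M) = ennreal (mult g y)" for y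
   by (rule offspring_prod[OF g g_lb g_ub])
  have [measurable]: "(%om. \<Prod>i<K v om. g (y + X v i om)) \<in> BM M" for y
  proof -
   have "(%om. \<Prod>i<fst (fam om v). g (y + snd (fam om v) i)) \<in> BM M"
    by (rule measurable_compose_countable'[where I=UNIV and f="%k om. \<Prod>i<k. g (y + snd (fam om v) i)"]) auto
   then show ?thesis by (simp add: fam_def)
  qed
  show ?thesis
   using * g_lb a0 unfolding Q_def R_def fam_def
   by (auto simp: ennreal_mult prod_nonneg less_imp_le order_trans[OF less_imp_le[OF g_lb(2)]] nn_integral_cmult emeasure_space_1 mult_def)
 qed
 have "(\<integral>\<^sup>+om. B (fam om) * (P (fam om) * Q (fam om) (fam om v)) \<partial>M) =
  (\<integral>\<^sup>+om. (\<integral>\<^sup>+om'. B (fam om) * (P (fam om) * Q (fam om) (fam om' v)) \<partial>M) \<partial>M)"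
  using peel_nn[of "%p. B (fst p) * (P (fst p) * Q (fst p) (snd p))" v] insert.prems(2)[of v] P_upd v
  by (simp add: Q_def alive_upd place_upd)
 also have "... = (\<integral>\<^sup>+om. B (fam om) * (P (fam om) * R (fam om)) \<partial>M)"
 proof (intro nn_integral_cong)
  fix om assume "om \<in> space M"
  then have "fam om \<in> space family_space" by (rule measurable_space[OF fam_measurable])
  then have [measurable]: "(%om'. Q (fam om) (fam om' v)) \<in> BM M"
   using measurable_compose[OF measurable_Pair[OF measurable_const fam_component_measurable] \<open>(%p. Q (fst p) (snd p)) \<in> _\<close>]
   by simp
  show "(\<integral>\<^sup>+om'. B (fam om) * (P (fam om) * Q (fam om) (fam om' v)) \<partial>M) = B (fam om) * (P (fam om) * R (fam om))"
   by (simp add: nn_integral_cmult Q_int)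
 qed
 also have "... = (\<integral>\<^sup>+om. (B (fam om) * R (fam om)) * P (fam om) \<partial>M)"
  by (simp add: mult_ac)
 also have "... = (\<integral>\<^sup>+om. (B (fam om) * R (fam om)) * (\<Prod>u\<in>J. if alive (fam om) u then ennreal (a (x + place (fam om) u) *
    mult g (x + place (fam om) u)) else 1) \<partial>M)"
  unfolding P_def
 proof (rule insert.IH)
  show "B (ze(w := c)) * R (ze(w := c)) = B ze * R ze" if "n <= length w" for ze w c
   by (simp only: insert.prems(2)[OF that] R_upd[OF that])
  show "J \<subseteq> {u. length u = n}" using insert.prems by auto
 qed measurable
 finally show ?case
  using insert.hyps by (simp add: P_def Q_def R_def mult_ac)
qed

end

lemma finite_part_subset: "finite_part A \<subseteq> A"
 by (simp add: finite_part_def)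

lemma nn_integral_lists_Suc:
 "(\<integral>\<^sup>+w. F w * indicator {w. length w = Suc n} w \<partial>count_space UNIV) =
 (\<integral>\<^sup>+u. (\<integral>\<^sup>+i. F (i # u) \<partial>count_space UNIV) * indicator {u. length u = n} u \<partial>count_space UNIV)"
proof -
 let ?G = "%w. F w * indicator {w. length w = Suc n} w"
 have "bij_betw (%(u, i). i # u) UNIV {w. w ~= []}"
  by (rule bij_betw_byWitness[where f'="%w. (tl w, hd w)"]) auto
 then have "(\<integral>\<^sup>+p. ?G ((%(u, i). i # u) p) \<partial>count_space UNIV) = (\<integral>\<^sup>+w. ?G w \<partial>count_space {w. w ~= []})"
  by (rule nn_integral_bij_count_space)
 also have "... = (\<integral>\<^sup>+w. ?G w \<partial>count_space UNIV)"
  by (rule nn_integral_count_space_eq) auto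
 finally have "(\<integral>\<^sup>+w. ?G w \<partial>count_space UNIV) = (\<integral>\<^sup>+p. ?G ((%(u, i). i # u) p) \<partial>count_space UNIV)" ..
 also have "... = (\<integral>\<^sup>+u. (\<integral>\<^sup>+i. ?G (i # u) \<partial>count_space UNIV) \<partial>count_space UNIV)"
  by (subst nn_integral_fst_count_space[symmetric]) simp
 also have "... = (\<integral>\<^sup>+u. (\<integral>\<^sup>+i. F (i # u) \<partial>count_space UNIV) * indicator {u. length u = n} u \<partial>count_space UNIV)"
  by (intro nn_integral_cong) (auto simp: indicator_def)
 finally show ?thesis .
qed

text \<open>Products over the fixed sets \<open>J k\<close> approximate the product over the finite
  set \<open>U\<close>. The dominating factors are at least 1, so that the full product over
  \<open>U\<close> also bounds every subproduct.\<close>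

lemma trunc_prod:
 fixes U L :: "'b :: countable set" and F G :: "'b => real"
 defines "J \<equiv> %k. {u \<in> L. to_nat u < k}"
 assumes U: "finite U" "U \<subseteq> L" and F: "!!u. u \<in> U ==> 0 <= F u" "!!u. u \<in> U ==> F u <= G u" and G: "!!u. u \<in> U ==> 1 <= G u"
 shows "(%k. \<Prod>u\<in>J k. if u \<in> U then ennreal (F u) else 1) ----> ennreal (\<Prod>u\<in>U. F u)"
  and "(\<Prod>u\<in>J k. if u \<in> U then ennreal (F u) else 1) <= ennreal (\<Prod>u\<in>U. G u)"
proof -
 have fin: "finite (J k)" for k unfolding J_def by (rule finite_to_nat_less)
 have eq: "(\<Prod>u\<in>J k. if u \<in> U then ennreal (F u) else 1) = ennreal (\<Prod>u\<in>{u \<in> J k. u \<in> U}. F u)" for k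
 proof -
  have "(\<Prod>u\<in>J k. if u \<in> U then ennreal (F u) else 1) = (\<Prod>u\<in>{u \<in> J k. u \<in> U}. ennreal (F u))"
   using fin[of k] by (rule prod.inter_filter[symmetric])
  also have "... = ennreal (\<Prod>u\<in>{u \<in> J k. u \<in> U}. F u)" using F by (intro prod_ennreal) auto
  finally show ?thesis .
 qed
 have "eventually (%k. U \<subseteq> J k) sequentially"
  unfolding J_def by (rule eventually_subset_to_nat_less[OF U])
 then have "eventually (%k. ennreal (\<Prod>u\<in>U. F u) = (\<Prod>u\<in>J k. if u \<in> U then ennreal (F u) else 1)) sequentially"
 proof eventually_elim
  case (elim k)
  then have "{u \<in> J k. u \<in> U} = U" by auto
  then show ?case unfolding eq by simp
 qed
 then show "(%k. \<Prod>u\<in>J k. if u \<in> U then ennreal (F u) else 1) ----> ennreal (\<Prod>u\<in>U. F u)"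
  by (rule Lim_transform_eventually[OF tendsto_const])
 have "(\<Prod>u\<in>{u \<in> J k. u \<in> U}. F u) <= (\<Prod>u\<in>{u \<in> J k. u \<in> U}. G u)"
  using F by (intro prod_mono) auto
 also have "... <= (\<Prod>u\<in>U. G u)"
  using G U by (intro prod_mono2) (auto intro: order_trans[OF zero_le_one])
 finally show "(\<Prod>u\<in>J k. if u \<in> U then ennreal (F u) else 1) <= ennreal (\<Prod>u\<in>U. G u)"
  unfolding eq by (rule ennreal_leI)
qed

text \<open>The boundary weight \<open>g\<close> is the variable of the generation recursion, in
  which it accumulates the effect of the later generations. The boundary weight 1 cuts the tree
  below generation \<open>n\<close>.\<close>

definition gen_weight :: "nat => (real => real) => (real => real) => real => (nat list => nat \<times> (nat => real)) => real" where
 "gen_weight n a g x ze =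
  (\<Prod>u\<in>finite_part (gens n ze). a (x + place ze u)) * (\<Prod>u\<in>finite_part (gen n ze). g (x + place ze u))"

lemma measurable_prod_gens:
 assumes [measurable]: "a \<in> BM borel"
 shows "(%ze. \<Prod>u\<in>finite_part (gens n ze). a (x + place ze u) :: real) \<in> BM family_space"
  and "(%ze. \<Prod>u\<in>finite_part (gen n ze). a (x + place ze u) :: real) \<in> BM family_space"
 by (rule measurable_finite_part_compose[where F="%A ze. \<Prod>u\<in>A. a (x + place ze u)"]; simp add: gens_def gen_def; measurable)+

lemma measurable_gen_weight:
 assumes "a \<in> BM borel" "g \<in> BM borel"
 shows "gen_weight n a g x \<in> BM family_space"
 unfolding gen_weight_def[abs_def] using assms by (intro borel_measurable_times measurable_prod_gens)

lemma gen_weight_0: "gen_weight 0 a g x ze = g x"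
proof -
 have "gens 0 ze = {}" "gen 0 ze = {[]}" by (auto simp: gens_def gen_def)
 then show ?thesis by (simp add: gen_weight_def)
qed

text \<open>The last generation is grouped by parents, the form to which \<open>peel_step\<close>
  applies.\<close>

lemma gen_weight_Suc:
 assumes "finite {u. alive ze u}"
 shows "gen_weight (Suc n) a g x ze = (\<Prod>u\<in>gens n ze. a (x + place ze u)) *
  (\<Prod>u\<in>gen n ze. a (x + place ze u) * (\<Prod>i<fst (ze u). g (x + place ze u + snd (ze u) i)))"
proof -
 have fin: "finite (gens n ze)" "finite (gen n ze)" for n
  using assms by (auto simp: gens_def gen_def intro: finite_subset[OF _ assms])
 show ?thesis
  unfolding gen_weight_def finite_part_eq[OF fin(1)] finite_part_eq[OF fin(2)] prod_gen_Suc[OF fin(2)]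
  unfolding gens_Suc(1) prod.distrib
  by (subst prod.union_disjoint) (use fin gens_Suc(2) in "auto simp: mult.assoc")
qed

section \<open>Expected size, recursion over generations, exponential moment of the size\<close>

context cluster
begin

definition tree :: "'w => nat list set" where
 "tree om = {u. alive (fam om) u}"

text \<open>Whether \<open>u\<close> lives is independent of how many children its data provide, so
  the expected number of living children is \<open>m\<close> times the probability that
  \<open>u\<close> lives.\<close>

lemma emeasure_alive_Cons:
 "(\<integral>\<^sup>+i. emeasure M {om \<in> space M. alive (fam om) (i # u)} \<partial>count_space UNIV) =
 ennreal m * emeasure M {om \<in> space M. alive (fam om) u}"
proof -
 let ?A = "%om. indicator {om \<in> space M. alive (fam om) u} om :: ennreal"
 have [measurable]: "Measurable.pred M (%om. alive (fam om) u)" for u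
  by (rule measurable_compose[OF fam_measurable pred_alive])
 have [measurable]: "(%om. fst (fam om u)) \<in> measurable M (count_space UNIV)"
  by (rule measurable_compose[OF fam_component_measurable measurable_fst])
 have "(\<integral>\<^sup>+i. emeasure M {om \<in> space M. alive (fam om) (i # u)} \<partial>count_space UNIV) =
  (\<Sum>i. \<integral>\<^sup>+om. indicator {om \<in> space M. alive (fam om) (i # u)} om \<partial>M)"
  by (subst nn_integral_count_space_nat) (simp del: alive_simps)
 also have "... = (\<integral>\<^sup>+om. (\<Sum>i. indicator {om \<in> space M. alive (fam om) (i # u)} om) \<partial>M)"
  by (rule nn_integral_suminf[symmetric]) measurable
 also have "... = (\<integral>\<^sup>+om. indicator {ze. alive ze u} (fam om) * of_nat (fst (fam om u)) \<partial>M)"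
 proof (intro nn_integral_cong)
  fix om assume "om \<in> space M"
  have "(\<Sum>i. indicator {om \<in> space M. alive (fam om) (i # u)} om :: ennreal) =
    (\<Sum>i<fst (fam om u). indicator {om \<in> space M. alive (fam om) (i # u)} om)"
   by (rule suminf_finite) (auto simp: indicator_def)
  also have "... = (\<Sum>i<fst (fam om u). indicator {ze. alive ze u} (fam om))"
   using \<open>om \<in> space M\<close> by (intro sum.cong) (auto simp: indicator_def)
  finally show "(\<Sum>i. indicator {om \<in> space M. alive (fam om) (i # u)} om) =
    indicator {ze. alive ze u} (fam om) * (of_nat (fst (fam om u)) :: ennreal)"
   by (simp add: mult.commute)
 qed
 also have "... = (\<integral>\<^sup>+om. (\<integral>\<^sup>+om'. indicator {ze. alive ze u} (fam om) * of_nat (fst (fam om' u)) \<partial>M) \<partial>M)"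
 proof -
  have "(%p. indicator {ze. alive ze u} (fst p) * of_nat (fst (snd p)) :: ennreal) \<in> BM (family_space \<Otimes>\<^sub>M offspring_space)"
   by measurable
  from peel_nn[OF this, of u] show ?thesis by (simp add: indicator_def alive_upd)
 qed
 also have "... = (\<integral>\<^sup>+om. ennreal m * ?A om \<partial>M)"
  using offspring_mean[of u]
  by (intro nn_integral_cong) (auto simp: indicator_def fam_def)
 finally show ?thesis by (simp add: nn_integral_cmult)
qed

lemma pred_alive_fam [measurable]: "Measurable.pred M (%om. alive (fam om) u)"
 by (rule measurable_compose[OF fam_measurable pred_alive])

lemma generation_mean:
 "(\<integral>\<^sup>+u. emeasure M {om \<in> space M. alive (fam om) u} * indicator {u. length u = n} u \<partial>count_space UNIV) = ennreal (m ^ n)"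
proof (induction n)
 case 0
 have "(\<integral>\<^sup>+u. emeasure M {om \<in> space M. alive (fam om) u} * indicator {u. length u = 0} u \<partial>count_space UNIV) =
  (\<integral>\<^sup>+u. indicator {[] :: nat list} u \<partial>count_space UNIV)"
  by (intro nn_integral_cong) (auto simp: indicator_def emeasure_space_1)
 then show ?case by simp
next
 case (Suc n)
 show ?case
  unfolding nn_integral_lists_Suc emeasure_alive_Cons mult.assoc
  using Suc m by (subst nn_integral_cmult) (auto simp: ennreal_mult)
qed

lemma sum_alive: "(\<integral>\<^sup>+u. emeasure M {om \<in> space M. alive (fam om) u} \<partial>count_space UNIV) = ennreal (1 / (1 - m))"
proof -
 let ?p = "%u. emeasure M {om \<in> space M. alive (fam om) u}"
 have "(\<integral>\<^sup>+u. ?p u \<partial>count_space UNIV) = (\<integral>\<^sup>+u. (\<Sum>n. ?p u * indicator {u. length u = n} u) \<partial>count_space UNIV)"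
 proof (intro nn_integral_cong)
  fix u :: "nat list"
  have "(\<Sum>n. ?p u * indicator {u. length u = n} u) = (\<Sum>n\<in>{length u}. ?p u * indicator {u. length u = n} u)"
   by (rule suminf_finite) auto
  then show "?p u = (\<Sum>n. ?p u * indicator {u. length u = n} u)" by simp
 qed
 also have "... = (\<Sum>n. ennreal (m ^ n))"
  by (subst nn_integral_suminf) (auto simp: generation_mean)
 also have "... = ennreal (1 / (1 - m))"
  using m geometric_sums[of m] by (intro suminf_ennreal_eq) auto
 finally show ?thesis .
qed

lemma tree_emeasure_mean: "(\<integral>\<^sup>+om. emeasure (count_space UNIV) (tree om) \<partial>M) = ennreal (1 / (1 - m))"
proof -
 interpret CS: sigma_finite_measure "count_space (UNIV :: nat list set)"
  by (rule sigma_finite_measure_count_space)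
 interpret pair_sigma_finite "count_space (UNIV :: nat list set)" M ..
 have meas: "(%(u, om). indicator (tree om) u :: ennreal) \<in> BM (count_space UNIV \<Otimes>\<^sub>M M)"
  by (rule measurable_pair_measure_countable1) (auto simp: tree_def indicator_def)
 have "(\<integral>\<^sup>+om. emeasure (count_space UNIV) (tree om) \<partial>M) = (\<integral>\<^sup>+om. (\<integral>\<^sup>+u. indicator (tree om) u \<partial>count_space UNIV) \<partial>M)"
  by simp
 also have "... = (\<integral>\<^sup>+u. (\<integral>\<^sup>+om. indicator (tree om) u \<partial>M) \<partial>count_space UNIV)"
  by (rule Fubini'[OF meas])
 also have "... = (\<integral>\<^sup>+u. emeasure M {om \<in> space M. alive (fam om) u} \<partial>count_space UNIV)"
 proof (intro nn_integral_cong)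
  fix u
  have "(\<integral>\<^sup>+om. indicator (tree om) u \<partial>M) = (\<integral>\<^sup>+om. indicator {om \<in> space M. alive (fam om) u} om \<partial>M)"
   by (intro nn_integral_cong) (auto simp: tree_def indicator_def)
  then show "(\<integral>\<^sup>+om. indicator (tree om) u \<partial>M) = emeasure M {om \<in> space M. alive (fam om) u}" by simp
 qed
 finally show ?thesis by (simp add: sum_alive)
qed

lemma tree_emeasure_measurable [measurable]: "(%om. emeasure (count_space UNIV) (tree om)) \<in> BM M"
proof -
 interpret CS: sigma_finite_measure "count_space (UNIV :: nat list set)"
  by (rule sigma_finite_measure_count_space)
 have meas: "(%(om, u). indicator (tree om) u :: ennreal) \<in> BM (M \<Otimes>\<^sub>M count_space UNIV)"
  by (rule measurable_pair_swap_iff[THEN iffD2], rule measurable_pair_measure_countable1) (auto simp: tree_def indicator_def)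
 show ?thesis using CS.borel_measurable_nn_integral[OF meas] by simp
qed

lemma finite_tree: "AE om in M. finite (tree om)"
proof -
 have "AE om in M. emeasure (count_space UNIV) (tree om) ~= \<infinity>"
  by (rule nn_integral_PInf_AE) (auto simp: tree_emeasure_mean)
 then show ?thesis by eventually_elim (auto simp: emeasure_count_space split: if_splits)
qed

definition ftree :: "'w => nat list set" where
 "ftree om = finite_part (tree om)"

lemma finite_ftree [simp]: "finite (ftree om)" by (simp add: ftree_def)

lemma measurable_ftree_compose:
 assumes "!!A. finite A ==> (%om. F A om) \<in> measurable M N"
 shows "(%om. F (ftree om) om) \<in> measurable M N"
 unfolding ftree_def by (rule measurable_finite_part_compose) (use assms in "auto simp: tree_def")

lemma ftree_eq: "finite (tree om) ==> ftree om = tree om" by (simp add: ftree_def)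

lemma ftree_card_mean: "(\<integral>\<^sup>+om. of_nat (card (ftree om)) \<partial>M) = ennreal (1 / (1 - m))"
proof -
 have "(\<integral>\<^sup>+om. of_nat (card (ftree om)) \<partial>M) = (\<integral>\<^sup>+om. emeasure (count_space UNIV) (tree om) \<partial>M)"
  using finite_tree by (intro nn_integral_cong_AE) (auto elim!: eventually_mono simp: ftree_eq)
 then show ?thesis by (simp add: tree_emeasure_mean)
qed

text \<open>The mean \<open>b\<close> of \<open>a ^ |C|\<close> solves
  \<open>b = a * exp (m * (b - 1))\<close>. Seen as a function of \<open>b\<close>, the base
  \<open>a = b * exp (- m * (b - 1))\<close> is largest at \<open>b = 1 / m\<close>, with value
  \<open>exp (m - 1) / m\<close>: the largest base with a finite mean.\<close>

definition alpha :: real where "alpha = exp (m - 1) / m"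
definition beta :: real where "beta = 1 / m"

lemma beta_gt_1: "1 < beta" using m by (simp add: beta_def)

lemma alpha_gt_1: "1 < alpha"
proof -
 have "m < exp (m - 1)"
 proof -
  have "ln m <= m - 1" using m by (intro ln_le_minus_one) auto
  moreover have "ln m ~= m - 1" using ln_eq_minus_one[of m] m by auto
  ultimately have "ln m < m - 1" by simp
  then have "exp (ln m) < exp (m - 1)" by simp
  then show ?thesis using m by simp
 qed
 then show ?thesis using m by (simp add: alpha_def)
qed

lemma alpha_beta: "alpha * exp (m * (beta - 1)) = beta"
proof -
 have "m * (beta - 1) = 1 - m" using m by (simp add: beta_def right_diff_distrib)
 then show ?thesis by (simp add: alpha_def beta_def flip: exp_add)
qed

definition EW :: "nat => (real => real) => (real => real) => real => ennreal" where
 "EW n a g x = (\<integral>\<^sup>+om. ennreal (gen_weight n a g x (fam om)) \<partial>M)"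

lemma EW_0: "EW 0 a g x = ennreal (g x)"
 by (simp add: EW_def gen_weight_0 emeasure_space_1)

lemma mult_bounds:
 assumes [measurable]: "g \<in> BM borel" and g: "!!x. \<delta> <= g x" "!!x. g x <= B"
 shows "exp (m * (\<delta> - 1)) <= mult g y" "mult g y <= exp (m * (B - 1))"
proof -
 have int: "integrable mu (%z. g (y + z) - 1)"
 proof (rule integrable_mu_bounded)
  fix z
  show "\<bar>g (y + z) - 1\<bar> <= \<bar>\<delta>\<bar> + \<bar>B\<bar> + 1" using g(1)[of "y + z"] g(2)[of "y + z"] by linarith
 qed measurable
 have c: "(LINT z|mu. c) = m * c" for c :: real using measure_mu by simp
 have "(LINT z|mu. \<delta> - 1) <= (LINT z|mu. g (y + z) - 1)"
  using int g by (intro integral_mono) auto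
 moreover have "(LINT z|mu. g (y + z) - 1) <= (LINT z|mu. B - 1)"
  using int g by (intro integral_mono) auto
 ultimately show "exp (m * (\<delta> - 1)) <= mult g y" "mult g y <= exp (m * (B - 1))"
  unfolding c mult_def by auto
qed

text \<open>With generation \<open>n\<close> cut to the fixed labels \<open>J k\<close>, the two
  means agree exactly by \<open>peel_step\<close>, and both integrands converge. The bounds are
  exported with the limits because the limit is taken in two ways: by Fatou while finiteness is
  still open, by dominated convergence afterwards.\<close>

lemma gen_weight_approx:
 assumes a [measurable]: "a \<in> BM borel" and a_b: "!!x. 0 <= a x" "!!x. a x <= alpha"
  and g [measurable]: "g \<in> BM borel" and g_b: "!!x. \<delta> <= g x" "0 < \<delta>" "!!x. g x <= beta"
 shows "\<exists>P Q. (\<forall>k::nat. P k \<in> BM M \<and> Q k \<in> BM M \<and> integral\<^sup>N M (P k) = integral\<^sup>N M (Q k)) \<and>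
  (AE om in M. (%k. P k om) ----> ennreal (gen_weight (Suc n) a g x (fam om))) \<and>
  (AE om in M. (%k. Q k om) ----> ennreal (gen_weight n a (%y. a y * mult g y) x (fam om))) \<and>
  (\<forall>k. AE om in M. P k om <= ennreal (gen_weight (Suc n) (%_. alpha) (%_. beta) x (fam om))) \<and>
  (\<forall>k. AE om in M. Q k om <= ennreal (gen_weight n (%_. alpha) (%_. beta) x (fam om)))"
proof -
 define J where "J k = {u \<in> {u :: nat list. length u = n}. to_nat u < k}" for k
 have J: "finite (J k)" "J k \<subseteq> {u. length u = n}" for k
  unfolding J_def by (rule finite_to_nat_less) auto
 define B where "B ze = ennreal (\<Prod>u\<in>finite_part (gens n ze). a (x + place ze u))" for ze
 have B_meas: "B \<in> BM family_space"
  unfolding B_def using measurable_prod_gens(1)[OF a, of x n] by measurable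
 have B_upd: "B (ze(v := c)) = B ze" if "n <= length v" for ze v c
 proof -
  have "gens n (ze(v := c)) = gens n ze" using that by (auto simp: gens_def alive_upd)
  then show ?thesis unfolding B_def using that finite_part_subset[of "gens n ze"]
   by (intro arg_cong[where f=ennreal] prod.cong) (auto simp: gens_def place_upd)
 qed
 define F1 where "F1 ze u = a (x + place ze u) * (\<Prod>i<fst (ze u). g (x + place ze u + snd (ze u) i))" for ze u
 define F2 where "F2 ze u = a (x + place ze u) * mult g (x + place ze u)" for ze u
 define P where "P k om = B (fam om) * (\<Prod>u\<in>J k. if alive (fam om) u then ennreal (F1 (fam om) u) else 1)" for k om
 define Q where "Q k om = B (fam om) * (\<Prod>u\<in>J k. if alive (fam om) u then ennreal (F2 (fam om) u) else 1)" for k om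
 have eq: "integral\<^sup>N M (P k) = integral\<^sup>N M (Q k)" for k
  unfolding P_def Q_def F1_def F2_def
  by (rule peel_step[OF a a_b(1) g g_b J B_meas B_upd])
 have [measurable]: "(%ze. \<Prod>i<fst (ze u). g (x + place ze u + snd (ze u) i)) \<in> BM family_space" for u
  by (rule measurable_compose_countable'[where I=UNIV and f="%k ze. \<Prod>i<k. g (x + place ze u + snd (ze u) i)", OF _ measurable_fst_component]) auto
 note [measurable] = B_meas
 have "(%ze. B ze * (\<Prod>u\<in>J k. if alive ze u then ennreal (F1 ze u) else 1)) \<in> BM family_space" for k
  unfolding F1_def by measurable
 then have Pm: "P k \<in> BM M" for k
  unfolding P_def[abs_def] by (rule measurable_compose[OF fam_measurable])
 have "(%ze. B ze * (\<Prod>u\<in>J k. if alive ze u then ennreal (F2 ze u) else 1)) \<in> BM family_space" for k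
  unfolding F2_def by measurable
 then have Qm: "Q k \<in> BM M" for k
  unfolding Q_def[abs_def] by (rule measurable_compose[OF fam_measurable])
 have g0: "0 <= g x" for x using g_b(1)[of x] g_b(2) by linarith
 have mb: "mult g y <= exp (m * (beta - 1))" for y by (rule mult_bounds(2)[OF g g_b(1,3)])
 have m0: "0 <= mult g y" for y by (simp add: mult_def)
 have F1_b: "0 <= F1 ze u" "F1 ze u <= alpha * (\<Prod>i<fst (ze u). beta)" "1 <= alpha * (\<Prod>i<fst (ze u). beta)" for ze u
 proof -
  show "0 <= F1 ze u" using a_b(1) g0 by (auto simp: F1_def intro!: mult_nonneg_nonneg prod_nonneg)
  show "F1 ze u <= alpha * (\<Prod>i<fst (ze u). beta)"
   unfolding F1_def using a_b g0 g_b(3) by (intro mult_mono prod_mono prod_nonneg) (auto intro: order_trans)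
  have "1 * 1 <= alpha * beta ^ fst (ze u)"
   using alpha_gt_1 beta_gt_1 by (intro mult_mono) (auto intro: one_le_power)
  then show "1 <= alpha * (\<Prod>i<fst (ze u). beta)" by simp
 qed
 have F2_b: "0 <= F2 ze u" "F2 ze u <= beta" "1 <= beta" for ze :: "nat list => nat \<times> (nat => real)" and u
 proof -
  show "0 <= F2 ze u" using a_b(1) m0 by (auto simp: F2_def)
  \<comment> \<open>Here the fixed point enters: after the offspring are integrated out, the bound
    on the boundary weight is \<open>beta\<close> again.\<close>
  have "F2 ze u <= alpha * exp (m * (beta - 1))"
   unfolding F2_def using a_b mb m0 alpha_gt_1 by (intro mult_mono) auto
  then show "F2 ze u <= beta" by (simp add: alpha_beta)
  show "1 <= beta" using beta_gt_1 by simp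
 qed
 have main: "(%k. P k om) ----> ennreal (gen_weight (Suc n) a g x (fam om)) \<and>
  (%k. Q k om) ----> ennreal (gen_weight n a (%y. a y * mult g y) x (fam om)) \<and>
  P k om <= ennreal (gen_weight (Suc n) (%_. alpha) (%_. beta) x (fam om)) \<and>
  Q k om <= ennreal (gen_weight n (%_. alpha) (%_. beta) x (fam om))" if fin: "finite (tree om)" for om k
 proof -
  let ?ze = "fam om"
  have fins: "finite (gens n ?ze)" "finite (gen n ?ze)"
   using fin by (auto simp: gens_def gen_def tree_def intro: finite_subset[OF _ fin[unfolded tree_def]])
  have sub: "gen n ?ze \<subseteq> {u. length u = n}" by (auto simp: gen_def)
  have cong: "(\<Prod>u\<in>J k. if alive ?ze u then ennreal (F u) else 1) = (\<Prod>u\<in>J k. if u \<in> gen n ?ze then ennreal (F u) else 1)" for F k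
   using J(2)[of k] by (intro prod.cong) (auto simp: gen_def)
  have B_eq: "B ?ze = ennreal (\<Prod>u\<in>gens n ?ze. a (x + place ?ze u))"
   unfolding B_def finite_part_eq[OF fins(1)] ..
  have pa: "0 <= (\<Prod>u\<in>gens n ?ze. a (x + place ?ze u))" by (intro prod_nonneg) (auto simp: a_b)
  have Ble: "B ?ze <= ennreal (\<Prod>u\<in>gens n ?ze. alpha)"
   unfolding B_eq by (intro ennreal_leI prod_mono) (auto simp: a_b)
  have W1: "gen_weight (Suc n) a g x ?ze = (\<Prod>u\<in>gens n ?ze. a (x + place ?ze u)) * (\<Prod>u\<in>gen n ?ze. F1 ?ze u)"
   using fin unfolding F1_def tree_def by (rule gen_weight_Suc)
  have W1': "gen_weight (Suc n) (%_. alpha) (%_. beta) x ?ze = (\<Prod>u\<in>gens n ?ze. alpha) * (\<Prod>u\<in>gen n ?ze. alpha * (\<Prod>i<fst (?ze u). beta))"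
   using fin unfolding tree_def by (rule gen_weight_Suc)
  have W2: "gen_weight n a (%y. a y * mult g y) x ?ze = (\<Prod>u\<in>gens n ?ze. a (x + place ?ze u)) * (\<Prod>u\<in>gen n ?ze. F2 ?ze u)"
   unfolding gen_weight_def F2_def finite_part_eq[OF fins(1)] finite_part_eq[OF fins(2)] ..
  have W2': "gen_weight n (%_. alpha) (%_. beta) x ?ze = (\<Prod>u\<in>gens n ?ze. alpha) * (\<Prod>u\<in>gen n ?ze. beta)"
   unfolding gen_weight_def finite_part_eq[OF fins(1)] finite_part_eq[OF fins(2)] ..
  note T1 = trunc_prod[OF fins(2) sub, of "F1 ?ze" "%u. alpha * (\<Prod>i<fst (?ze u). beta)", OF F1_b(1)[of ?ze] F1_b(2)[of ?ze] F1_b(3)[of ?ze], folded J_def]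
  note T2 = trunc_prod[OF fins(2) sub, of "F2 ?ze" "%u. beta", OF F2_b(1)[of ?ze] F2_b(2)[of ?ze] F2_b(3), folded J_def]
  have pal: "0 <= (\<Prod>u\<in>gens n ?ze. alpha)" using alpha_gt_1 by (intro prod_nonneg) auto
  have lim: "(%k. ennreal c * X k) ----> ennreal c * l" if "X ----> l" for c X l
   using that by (intro ennreal_tendsto_cmult) auto
  show ?thesis
   unfolding P_def Q_def cong W1 W2 W1' W2'
   unfolding ennreal_mult'[OF pa] ennreal_mult'[OF pal]
   using lim[OF T1(1)] lim[OF T2(1)] mult_mono[OF Ble T1(2)[of k]] mult_mono[OF Ble T2(2)[of k]]
   unfolding B_eq by auto
 qed
 show ?thesis
 proof (rule exI[of _ P], rule exI[of _ Q], intro conjI allI)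
  show "AE om in M. (%k. P k om) ----> ennreal (gen_weight (Suc n) a g x (fam om))"
   "AE om in M. (%k. Q k om) ----> ennreal (gen_weight n a (%y. a y * mult g y) x (fam om))"
   using finite_tree main by (auto elim!: eventually_mono)
  show "AE om in M. P k om <= ennreal (gen_weight (Suc n) (%_. alpha) (%_. beta) x (fam om))"
   "AE om in M. Q k om <= ennreal (gen_weight n (%_. alpha) (%_. beta) x (fam om))" for k
   using finite_tree main by (auto elim!: eventually_mono)
 qed (use Pm Qm eq in auto)
qed

lemma fam_gen_weight_measurable:
 "a \<in> BM borel ==> g \<in> BM borel ==> (%om. ennreal (gen_weight n a g x (fam om))) \<in> BM M"
 using measurable_compose[OF fam_measurable measurable_gen_weight] by measurable

lemma nn_integral_fatou_le:
 assumes "!!k. u k \<in> BM M" "AE om in M. (%k. u k om) ----> (l om :: ennreal)" "!!k. integral\<^sup>N M (u k) <= C"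
 shows "integral\<^sup>N M l <= C"
proof -
 have "integral\<^sup>N M l = (\<integral>\<^sup>+om. liminf (%k. u k om) \<partial>M)"
  using assms(2) by (intro nn_integral_cong_AE) (auto elim!: eventually_mono simp: lim_imp_Liminf)
 also have "... <= liminf (%k. integral\<^sup>N M (u k))" by (rule nn_integral_liminf) (use assms in auto)
 also have "... <= liminf (%k. C)" using assms(3) by (intro Liminf_mono) auto
 finally show ?thesis by (simp add: Liminf_const)
qed

text \<open>The bound for generation \<open>n\<close> controls the means of all \<open>Q k\<close>,
  which are those of \<open>P k\<close>, and Fatou passes it to generation \<open>n + 1\<close>. It
  does not grow because \<open>beta\<close> is the fixed point.\<close>

lemma EW_const_le: "EW n (%_. alpha) (%_. beta) x <= ennreal beta"
proof (induction n)
 case 0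
 then show ?case by (simp add: EW_0)
next
 case (Suc n)
 have "\<exists>P Q. (\<forall>k::nat. P k \<in> BM M \<and> Q k \<in> BM M \<and> integral\<^sup>N M (P k) = integral\<^sup>N M (Q k)) \<and>
  (AE om in M. (%k. P k om) ----> ennreal (gen_weight (Suc n) (%_. alpha) (%_. beta) x (fam om))) \<and>
  (AE om in M. (%k. Q k om) ----> ennreal (gen_weight n (%_. alpha) (%y. alpha * mult (%_. beta) y) x (fam om))) \<and>
  (\<forall>k. AE om in M. P k om <= ennreal (gen_weight (Suc n) (%_. alpha) (%_. beta) x (fam om))) \<and>
  (\<forall>k. AE om in M. Q k om <= ennreal (gen_weight n (%_. alpha) (%_. beta) x (fam om)))"
  by (rule gen_weight_approx[where \<delta>=1]) (use alpha_gt_1 beta_gt_1 in auto)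
 then obtain P Q where PQ: "!!k. P k \<in> BM M" "!!k. integral\<^sup>N M (P k) = integral\<^sup>N M (Q k)"
  "AE om in M. (%k. P k om) ----> ennreal (gen_weight (Suc n) (%_. alpha) (%_. beta) x (fam om))"
  "!!k::nat. AE om in M. Q k om <= ennreal (gen_weight n (%_. alpha) (%_. beta) x (fam om))"
  by blast
 have "integral\<^sup>N M (Q k) <= EW n (%_. alpha) (%_. beta) x" for k
  unfolding EW_def by (rule nn_integral_mono_AE[OF PQ(4)])
 then have "integral\<^sup>N M (P k) <= ennreal beta" for k unfolding PQ(2) using Suc.IH by (rule order_trans)
 from nn_integral_fatou_le[OF PQ(1,3) this] show ?case unfolding EW_def .
qed

text \<open>The recursion that determines the law: iterated, it expresses \<open>EW n a g\<close>
  through \<open>mult\<close> alone, down to \<open>EW_0\<close>. The upper bounds on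
  \<open>a\<close> and \<open>g\<close> reproduce themselves, since \<open>a * mult g\<close> is
  again at most \<open>beta\<close>.\<close>

lemma EW_Suc:
 assumes a: "a \<in> BM borel" and a_b: "!!x. 0 <= a x" "!!x. a x <= alpha"
  and g: "g \<in> BM borel" and g_b: "!!x. \<delta> <= g x" "0 < \<delta>" "!!x. g x <= beta"
 shows "EW (Suc n) a g x = EW n a (%y. a y * mult g y) x"
proof -
 obtain P Q where PQ: "!!k. P k \<in> BM M" "!!k. Q k \<in> BM M" "!!k. integral\<^sup>N M (P k) = integral\<^sup>N M (Q k)"
  "AE om in M. (%k. P k om) ----> ennreal (gen_weight (Suc n) a g x (fam om))"
  "AE om in M. (%k. Q k om) ----> ennreal (gen_weight n a (%y. a y * mult g y) x (fam om))"
  "!!k::nat. AE om in M. P k om <= ennreal (gen_weight (Suc n) (%_. alpha) (%_. beta) x (fam om))"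
  "!!k::nat. AE om in M. Q k om <= ennreal (gen_weight n (%_. alpha) (%_. beta) x (fam om))"
  using gen_weight_approx[OF a a_b g g_b, of n x] by blast
 have fin: "(\<integral>\<^sup>+om. ennreal (gen_weight n (%_. alpha) (%_. beta) x (fam om)) \<partial>M) < \<infinity>" for n
  using EW_const_le[of n x] unfolding EW_def by (rule le_less_trans) simp
 have "(%k. integral\<^sup>N M (P k)) ----> EW (Suc n) a g x"
  unfolding EW_def
  by (rule nn_integral_dominated_convergence[OF PQ(1) _ _ PQ(6) fin PQ(4)]) (use a g in "auto intro!: fam_gen_weight_measurable")
 moreover have "(%k. integral\<^sup>N M (Q k)) ----> EW n a (%y. a y * mult g y) x"
  unfolding EW_def
  by (rule nn_integral_dominated_convergence[OF PQ(2) _ _ PQ(7) fin PQ(5)])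
   (use a g mult_measurable[OF g] in "auto intro!: fam_gen_weight_measurable")
 ultimately show ?thesis unfolding PQ(3) by (rule LIMSEQ_unique)
qed

lemma eventually_gens_eq_tree:
 assumes "finite (tree om)"
 shows "eventually (%n. gens n (fam om) = tree om) sequentially"
proof -
 have "eventually (%n. \<forall>u\<in>tree om. length u < n) sequentially"
  using assms by (intro eventually_ball_finite) (auto intro: eventually_gt_at_top)
 then show ?thesis by eventually_elim (auto simp: gens_def tree_def)
qed

lemma gen_weight_one:
 assumes "finite (tree om)"
 shows "gen_weight n a (%_. 1) x (fam om) = (\<Prod>u\<in>gens n (fam om). a (x + place (fam om) u))"
proof -
 have "finite (gens n (fam om))" by (rule finite_subset[OF _ assms]) (auto simp: gens_def tree_def)
 then show ?thesis by (simp add: gen_weight_def)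
qed

lemma gen_weight_one_tendsto:
 assumes "finite (tree om)"
 shows "(%n. ennreal (gen_weight n a (%_. 1) x (fam om))) ----> ennreal (\<Prod>u\<in>ftree om. a (x + place (fam om) u))"
proof (rule Lim_transform_eventually[OF tendsto_const])
 show "\<forall>\<^sub>F n in sequentially. ennreal (\<Prod>u\<in>ftree om. a (x + place (fam om) u)) = ennreal (gen_weight n a (%_. 1) x (fam om))"
  using eventually_gens_eq_tree[OF assms]
  by eventually_elim (simp add: gen_weight_one[OF assms] ftree_eq[OF assms])
qed

text \<open>Lowering the boundary weight from \<open>beta\<close> to 1 keeps the uniform bound, and
  then the boundary can be sent to infinity.\<close>

lemma exp_moment: "(\<integral>\<^sup>+om. ennreal (alpha ^ card (ftree om)) \<partial>M) <= ennreal beta"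
proof (rule nn_integral_fatou_le)
 show "AE om in M. (%n. ennreal (gen_weight n (%_. alpha) (%_. 1) 0 (fam om))) ----> ennreal (alpha ^ card (ftree om))"
  using finite_tree by eventually_elim (use gen_weight_one_tendsto[of _ "%_. alpha"] in simp)
 show "(\<integral>\<^sup>+om. ennreal (gen_weight n (%_. alpha) (%_. 1) 0 (fam om)) \<partial>M) <= ennreal beta" for n
 proof (rule order_trans[OF nn_integral_mono])
  show "ennreal (gen_weight n (%_. alpha) (%_. 1) 0 (fam om)) <= ennreal (gen_weight n (%_. alpha) (%_. beta) 0 (fam om))" for om
   unfolding gen_weight_def using alpha_gt_1 beta_gt_1
   by (intro ennreal_leI mult_left_mono prod_mono prod_nonneg) auto
  show "(\<integral>\<^sup>+om. ennreal (gen_weight n (%_. alpha) (%_. beta) 0 (fam om)) \<partial>M) <= ennreal beta"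
   using EW_const_le[of n 0] unfolding EW_def .
 qed
qed (auto intro!: fam_gen_weight_measurable)

section \<open>Generating functional of the whole cluster and its reflection\<close>

definition EG :: "(real => real) => real => ennreal" where
 "EG a x = (\<integral>\<^sup>+om. ennreal (\<Prod>u\<in>ftree om. a (x + place (fam om) u)) \<partial>M)"

lemma place_fam_measurable [measurable]: "(%om. place (fam om) u) \<in> BM M"
 by (rule measurable_compose[OF fam_measurable measurable_place])

lemma prod_ftree_measurable:
 assumes [measurable]: "a \<in> BM borel"
 shows "(%om. \<Prod>u\<in>ftree om. a (x + place (fam om) u) :: real) \<in> BM M"
 by (rule measurable_ftree_compose) measurable

lemma card_ftree_measurable [measurable]: "(%om. card (ftree om)) \<in> measurable M (count_space UNIV)"
 by (rule measurable_ftree_compose) simp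

lemma EW_tendsto_EG:
 assumes a: "a \<in> BM borel" and a_b: "!!x. 0 <= a x" "!!x. a x <= alpha"
 shows "(%n. EW n a (%_. 1) x) ----> EG a x"
 unfolding EW_def EG_def
proof (rule nn_integral_dominated_convergence[where w="%om. ennreal (alpha ^ card (ftree om))"])
 show "AE om in M. (%n. ennreal (gen_weight n a (%_. 1) x (fam om))) ----> ennreal (\<Prod>u\<in>ftree om. a (x + place (fam om) u))"
  using finite_tree by eventually_elim (rule gen_weight_one_tendsto)
 show "AE om in M. ennreal (gen_weight n a (%_. 1) x (fam om)) <= ennreal (alpha ^ card (ftree om))" for n
  using finite_tree
 proof eventually_elim
  case (elim om)
  have "(\<Prod>u\<in>gens n (fam om). a (x + place (fam om) u)) <= (\<Prod>u\<in>gens n (fam om). alpha)"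
   using a_b by (intro prod_mono) auto
  also have "... <= (\<Prod>u\<in>tree om. alpha)"
   using elim alpha_gt_1 by (intro prod_mono2) (auto simp: gens_def tree_def)
  finally show ?case using gen_weight_one[OF elim] ftree_eq[OF elim] by (intro ennreal_leI) simp
 qed
 show "(\<integral>\<^sup>+om. ennreal (alpha ^ card (ftree om)) \<partial>M) < \<infinity>"
  using exp_moment by (rule le_less_trans) simp
 show "(%om. ennreal (\<Prod>u\<in>ftree om. a (x + place (fam om) u))) \<in> BM M"
  using prod_ftree_measurable[OF a] by measurable
qed (use a in "auto intro!: fam_gen_weight_measurable")

text \<open>The only point of the recursion where evenness of \<phi> enters: the substitution of
  \<open>- z\<close> for \<open>z\<close> in the integral over the displacement.\<close>

lemma mult_reflect:
 assumes even: "even_fun \<phi>" and [measurable]: "g \<in> BM borel"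
 shows "mult (%z. g (- z)) (- y) = mult g y"
proof -
 have eq: "(LINT z|mu. g' (y' + z) - 1) = (LINT z|lborel. (m * \<phi> z) * (g' (y' + z) - 1))" 
  if [measurable]: "g' \<in> BM borel" for g' :: "real => real" and y'
  using m phi_nn by (subst integral_density) auto
 have "(LINT z|mu. g (- (- y + z)) - 1) = (LINT z|lborel. (m * \<phi> z) * (g (- (- y + z)) - 1))"
  by (rule eq[of "%z. g (- z)" "- y"]) measurable
 also have "... = (LINT z|lborel. (m * \<phi> (- z)) * (g (- (- y + - z)) - 1))"
  by (rule integral_lborel_uminus[symmetric])
 also have "... = (LINT z|lborel. (m * \<phi> z) * (g (y + z) - 1))"
  using even by (simp add: even_fun_def add.commute)
 also have "... = (LINT z|mu. g (y + z) - 1)" by (rule eq[symmetric]) measurable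
 finally show ?thesis by (simp only: mult_def)
qed

text \<open>Reflection commutes with each step of \<open>EW_Suc\<close>. The induction ranges over
  all \<open>g\<close>, since the step changes the boundary weight, and over \<delta>, since its
  lower bound becomes \<open>\<delta>' * exp (m * (\<delta> - 1))\<close>.\<close>

lemma EW_reflect:
 assumes even: "even_fun \<phi>" and a: "a \<in> BM borel" and a_b: "!!x. \<delta>' <= a x" "0 < \<delta>'" "!!x. a x <= alpha"
 shows "g \<in> BM borel ==> (!!x. \<delta> <= g x) ==> 0 < \<delta> ==> (!!x. g x <= beta) ==>
  EW n (%y. a (- y)) (%y. g (- y)) (- x) = EW n a g x"
proof (induction n arbitrary: g \<delta>)
 case 0
 then show ?case by (simp add: EW_0)
next
 case (Suc n)
 have a0: "0 <= a x" for x using a_b(1)[of x] a_b(2) by linarith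
 have "EW (Suc n) (%y. a (- y)) (%y. g (- y)) (- x) = EW n (%y. a (- y)) (%y. a (- y) * mult (%y. g (- y)) y) (- x)"
  by (rule EW_Suc[where \<delta>=\<delta>]) (use Suc.prems a a0 a_b in auto)
 also have "... = EW n (%y. a (- y)) (%y. a (- y) * mult g (- y)) (- x)"
 proof -
  have "mult (%y. g (- y)) y = mult g (- y)" for y
   using mult_reflect[OF even Suc.prems(1), of "- y"] by simp
  then show ?thesis by simp
 qed
 also have "... = EW n a (%y. a y * mult g y) x"
 proof (rule Suc.IH[of "%y. a y * mult g y" "\<delta>' * exp (m * (\<delta> - 1))"])
  show "(%y. a y * mult g y) \<in> BM borel"
   using a mult_measurable[OF Suc.prems(1)] by measurable
  fix x
  note mb = mult_bounds[OF Suc.prems(1,2,4), of x]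
  show "\<delta>' * exp (m * (\<delta> - 1)) <= a x * mult g x"
   using a_b mb(1) a0 by (intro mult_mono) auto
  have "a x * mult g x <= alpha * exp (m * (beta - 1))"
   using a_b mb(2) a0 alpha_gt_1 by (intro mult_mono) (auto simp: mult_def)
  then show "a x * mult g x <= beta" by (simp add: alpha_beta)
 qed (use a_b in auto)
 also have "... = EW (Suc n) a g x"
  by (rule EW_Suc[symmetric, where \<delta>=\<delta>]) (use Suc.prems a a0 a_b in auto)
 finally show ?case .
qed

theorem EG_reflect:
 assumes even: "even_fun \<phi>" and a: "a \<in> BM borel" and a_b: "!!x. \<delta> <= a x" "0 < \<delta>" "!!x. a x <= alpha"
 shows "EG (%y. a (- y)) (- x) = EG a x"
proof -
 have a0: "0 <= a x" for x using a_b(1)[of x] a_b(2) by linarith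
 have "EW n (%y. a (- y)) (%_. 1) (- x) = EW n a (%_. 1) x" for n
  using EW_reflect[OF even a a_b, of "%_. 1" 1 n x] beta_gt_1 by simp
 moreover have "(%n. EW n (%y. a (- y)) (%_. 1) (- x)) ----> EG (%y. a (- y)) (- x)"
  by (rule EW_tendsto_EG) (use a a0 a_b in auto)
 moreover have "(%n. EW n a (%_. 1) x) ----> EG a x"
  by (rule EW_tendsto_EG) (use a a0 a_b in auto)
 ultimately show ?thesis by (simp add: LIMSEQ_unique)
qed

end

section \<open>Second moment of the cluster transform\<close>

lemma borel_measurable_cnj [measurable]:
 assumes "f \<in> BM M"
 shows "(%x. cnj (f x)) \<in> BM M"
proof (rule measurable_compose[OF assms])
 show "cnj \<in> BM borel"
  by (intro borel_measurable_continuous_onI continuous_intros)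
qed

context cluster
begin

text \<open>Counterpart of \<open>peel_nn\<close> for products of complex factors, where
  integrability takes the place of positivity.\<close>

lemma peel_complex:
 fixes F :: "(nat list => nat \<times> (nat => real)) => complex" and G :: "nat \<times> (nat => real) => complex"
 assumes F: "F \<in> BM family_space" and dep: "!!ze c. F (ze(v := c)) = F ze"
  and G: "G \<in> BM offspring_space"
  and int: "integrable M (%om. F (fam om))" "integrable M (%om. G (fam om v))"
 shows "integrable M (%om. F (fam om) * G (fam om v))"
  and "(LINT om|M. F (fam om) * G (fam om v)) = (LINT om|M. F (fam om)) * (LINT om|M. G (fam om v))"
proof -
 define c :: "nat \<times> (nat => real)" where "c = (0, %_. 0)"
 have "(%r. r(v := c)) \<in> measurable (Pi\<^sub>M (- {v}) (%_. offspring_space)) family_space"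
  by (rule measurable_insert_component) (simp add: space_pair_measure space_PiM)
 from indep_rvs_compose[OF indep_rest G measurable_compose[OF this F]]
 have ind: "indep_var borel (%om. G (fam om v)) borel (%om. F (fam om))"
  unfolding restrict_upd dep .
 show "integrable M (%om. F (fam om) * G (fam om v))"
  using indep_var_integrable[OF ind int(2,1)] by (simp add: mult.commute)
 show "(LINT om|M. F (fam om) * G (fam om v)) = (LINT om|M. F (fam om)) * (LINT om|M. G (fam om v))"
  using indep_var_lebesgue_integral[OF ind int(2,1)] by (simp add: mult.commute)
qed

lemma fst_fam [simp]: "fst (fam om u) = K u om" and snd_fam [simp]: "snd (fam om u) i = X u i om"
 by (simp_all add: fam_def)

lemma K_measurable [measurable]: "K u \<in> measurable M (count_space UNIV)"
 using measurable_compose[OF fam_component_measurable measurable_fst, of u] by simp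

lemma X_measurable [measurable]: "X u i \<in> BM M"
 using measurable_compose[OF fam_measurable measurable_snd_component, of u i] by simp

text \<open>Every individual except the root is a child of exactly one individual. Summing over
  parents gives a linear identity for the whole tree without reference to generations.\<close>

lemma sum_tree:
 fixes F :: "nat list => 'b :: comm_monoid_add"
 assumes fin: "finite (tree om)"
 shows "(\<Sum>w\<in>tree om. F w) = F [] + (\<Sum>u\<in>tree om. \<Sum>i<K u om. F (i # u))"
proof -
 have inj: "inj_on (%(u, i). i # u) (SIGMA u:tree om. {..<K u om})" by (auto simp: inj_on_def)
 have eq: "tree om = insert [] ((%(u, i). i # u) ` (SIGMA u:tree om. {..<K u om}))"
 proof (intro set_eqI iffI)
  fix w assume "w \<in> tree om"
  then show "w \<in> insert [] ((%(u, i). i # u) ` (SIGMA u:tree om. {..<K u om}))"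
   by (cases w) (auto simp: tree_def image_iff)
 qed (auto simp: tree_def)
 have "(\<Sum>w\<in>tree om. F w) = F [] + (\<Sum>w\<in>(%(u, i). i # u) ` (SIGMA u:tree om. {..<K u om}). F w)"
  using fin by (subst eq, subst sum.insert) auto
 also have "(\<Sum>w\<in>(%(u, i). i # u) ` (SIGMA u:tree om. {..<K u om}). F w) = (\<Sum>(u, i)\<in>(SIGMA u:tree om. {..<K u om}). F (i # u))"
  by (subst sum.reindex[OF inj]) (auto intro!: sum.cong)
 also have "... = (\<Sum>u\<in>tree om. \<Sum>i<K u om. F (i # u))"
  using fin by (subst sum.Sigma) auto
 finally show ?thesis .
qed

text \<open>Half of the available exponential moment: the remaining factor
  \<open>theta ^ |C|\<close> of \<open>alpha ^ |C|\<close> absorbs any power of |C|.\<close>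

definition theta :: real where "theta = sqrt alpha"

lemma theta: "1 < theta" "theta * theta = alpha"
 using alpha_gt_1 by (auto simp: theta_def)

lemma power_le_theta_power: "\<exists>C>0. \<forall>n. real n ^ k <= C * theta ^ n"
proof -
 \<comment> \<open>\<open>(c * n) ^ k\<close> is at most \<open>exp (k * c * n)\<close>, which must
   stay below \<open>theta ^ n\<close>; dividing by \<open>Suc k\<close> rather than
   \<open>k\<close> also covers \<open>k = 0\<close>.\<close>
 define c where "c = ln theta / real (Suc k)"
 have c: "0 < c" using theta by (simp add: c_def)
 have "real n ^ k <= (1 / c) ^ k * theta ^ n" for n
 proof -
  have "c * real n <= exp (c * real n)" using exp_ge_add_one_self[of "c * real n"] by linarith
  then have "(c * real n) ^ k <= exp (c * real n) ^ k" using c by (intro power_mono) auto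
  also have "... = exp (real k * (c * real n))" by (simp add: exp_of_nat_mult)
  also have "... <= exp (real (Suc k) * (c * real n))" using c by (simp add: mult_right_mono)
  also have "real (Suc k) * (c * real n) = real n * ln theta" by (simp add: c_def)
  also have "exp (real n * ln theta) = theta ^ n" using theta by (simp add: exp_of_nat_mult)
  finally have "c ^ k * real n ^ k <= theta ^ n" by (simp add: power_mult_distrib)
  then show ?thesis using c by (simp add: field_simps power_divide)
 qed
 then show ?thesis using c by (intro exI[of _ "(1 / c) ^ k"]) auto
qed

lemma card_moment: "integrable M (%om. real (card (ftree om)) ^ k * theta ^ card (ftree om))"
proof -
 obtain C where C: "0 < C" "!!n. real n ^ k <= C * theta ^ n" using power_le_theta_power by blast
 have "integrable M (%om. alpha ^ card (ftree om))"
  using exp_moment alpha_gt_1 by (intro integrableI_bounded) (auto intro: le_less_trans)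
 then have "integrable M (%om. C * alpha ^ card (ftree om))" by simp
 then show ?thesis
 proof (rule bintegrable_bound)
  show "AE om in M. norm (real (card (ftree om)) ^ k * theta ^ card (ftree om)) <= norm (C * alpha ^ card (ftree om))"
  proof (rule AE_I2)
   fix om
   let ?n = "card (ftree om)"
   have "real ?n ^ k * theta ^ ?n <= (C * theta ^ ?n) * theta ^ ?n"
    using C theta by (intro mult_right_mono) auto
   also have "... = C * alpha ^ ?n" using theta(2) by (simp add: mult.assoc flip: power_mult_distrib)
   finally show "norm (real ?n ^ k * theta ^ ?n) <= norm (C * alpha ^ ?n)" using C theta alpha_gt_1 by simp
  qed
 qed measurable
qed

lemma card_power_integrable: "integrable M (%om. real (card (ftree om)) ^ k)"
proof (rule bintegrable_bound[OF card_moment[of k]])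
 show "AE om in M. norm (real (card (ftree om)) ^ k) <= norm (real (card (ftree om)) ^ k * theta ^ card (ftree om))" (is "AE om in _. ?AE om")
 proof (rule AE_I2)
  fix om
  have "real (card (ftree om)) ^ k * 1 <= real (card (ftree om)) ^ k * theta ^ card (ftree om)"
   using theta by (intro mult_left_mono one_le_power) auto
  then show "?AE om" by simp
 qed
qed measurable

lemma card_mean: "(LINT om|M. real (card (ftree om))) = 1 / (1 - m)"
 using ftree_card_mean m by (subst integral_eq_nn_integral) (auto simp: ennreal_of_nat_eq_real_of_nat)

section \<open>Orthogonal decomposition of the cluster transform at a fixed frequency\<close>

context
 fixes w :: real
begin

definition wave :: "real => complex" where "wave y = iexp (- (w * y))"

lemma norm_wave [simp]: "norm (wave y) = 1" by (simp add: wave_def)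
lemma wave_0 [simp]: "wave 0 = 1" by (simp add: wave_def)
lemma wave_add: "wave (x + y) = wave x * wave y"
 by (simp add: wave_def algebra_simps flip: exp_add)
lemma wave_cnj: "wave y * cnj (wave y) = 1"
 using complex_norm_square[of "wave y"] by simp
lemma wave_measurable [measurable]: "wave \<in> BM borel"
 unfolding wave_def by measurable

definition wbar :: complex where "wbar = m * fourier \<phi> w"

lemma wbar_integral: "wbar = (LINT z|mu. wave z)"
proof -
 have "(LINT z|mu. wave z) = (LINT z|lborel. (m * \<phi> z) *\<^sub>R wave z)"
  using m phi_nn by (subst integral_density) auto
 also have "... = (LINT z|lborel. m * (iexp (- (w * z)) * complex_of_real (\<phi> z)))"
  by (intro bintegral_cong) (auto simp: wave_def scaleR_conv_of_real mult_ac)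
 also have "... = wbar" by (simp add: wbar_def fourier_def)
 finally show ?thesis ..
qed

lemma wave_Re_Im: "wave y = Complex (cos (w * y)) (- sin (w * y))"
 by (simp add: wave_def complex_eq_iff Re_exp Im_exp)

lemma wbar_Re_Im: "Re wbar = (LINT z|mu. cos (w * z))" "Im wbar = - (LINT z|mu. sin (w * z))"
proof -
 have int: "integrable mu wave" by (rule mu.integrable_const_bound[of _ 1]) auto
 show "Re wbar = (LINT z|mu. cos (w * z))"
  unfolding wbar_integral integral_Re[OF int, symmetric] by (simp add: wave_Re_Im)
 show "Im wbar = - (LINT z|mu. sin (w * z))"
  unfolding wbar_integral integral_Im[OF int, symmetric] by (simp add: wave_Re_Im)
qed

lemma norm_wbar: "norm wbar <= m"
 using fourier_norm_le[OF phi, of w] m by (simp add: wbar_def norm_mult mult_left_le)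

text \<open>The offspring sum of \<open>u\<close> centred at its mean \<open>wbar\<close>: the
  innovation that \<open>u\<close> contributes to the decomposition of the transform.\<close>

definition noise :: "nat list => 'w => complex" where
 "noise u om = (\<Sum>i<K u om. wave (X u i om)) - wbar"

lemma noise_measurable [measurable]: "noise u \<in> BM M"
proof -
 have "(%om. \<Sum>i<K u om. wave (X u i om)) \<in> BM M"
  by (rule measurable_compose_countable'[where I=UNIV and f="%k om. \<Sum>i<k. wave (X u i om)", OF _ K_measurable]) auto
 then show ?thesis unfolding noise_def by measurable
qed

text \<open>\<open>bounded_moments\<close> is real, so cosine and sine parts are treated separately.
  The squared means cancel against \<open>wbar\<close>, and the remaining second moments add up to
  the mass \<open>m\<close> of \<open>mu\<close> because the squares of cosine and sine add up to
  1.\<close>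

lemma noise_moments:
 "integrable M (noise u)" "(LINT om|M. noise u om) = 0"
 "integrable M (%om. (norm (noise u om))\<^sup>2)" "(LINT om|M. (norm (noise u om))\<^sup>2) = m"
proof -
 interpret P: poisson_loc M mu "%om. points_measure {..<K u om} (%i. X u i om)" by (rule offspring_poisson)
 let ?c = "%y. cos (w * y)" and ?s = "%y. sin (w * y)"
 define c where "c om = (\<Sum>i<K u om. cos (w * X u i om))" for om
 define s where "s om = (\<Sum>i<K u om. sin (w * X u i om))" for om
 have fin: "emeasure mu UNIV < \<infinity>" by (simp add: emeasure_mu)
 have c_eq: "(LINT x|points_measure {..<K u om} (%i. X u i om). ?c x) = c om" for om
  unfolding c_def by (rule integral_points) measurable
 have s_eq: "(LINT x|points_measure {..<K u om} (%i. X u i om). ?s x) = s om" for om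
  unfolding s_def by (rule integral_points) measurable
 have cm: "?c \<in> BM borel" and sm: "?s \<in> BM borel" by measurable
 have cb: "\<bar>?c x\<bar> <= 1" and sb: "\<bar>?s x\<bar> <= 1" for x by auto
 note C = P.bounded_moments(2-5)[OF fin cm cb, unfolded c_eq]
 note S = P.bounded_moments(2-5)[OF fin sm sb, unfolded s_eq]
 have n_eq: "noise u om = Complex (c om - Re wbar) (- s om - Im wbar)" for om
  by (simp add: noise_def c_def s_def wave_Re_Im complex_eq_iff sum_negf)
 have n_eq': "noise u om = complex_of_real (c om) - \<i> * complex_of_real (s om) - wbar" for om
  by (simp add: n_eq complex_eq_iff)
 have intc: "integrable M (%om. complex_of_real (c om))" "integrable M (%om. \<i> * complex_of_real (s om))"
  using C(1) S(1) by auto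
 show "integrable M (noise u)"
  unfolding n_eq'[abs_def] using intc by (intro bintegrable_diff) auto
 have "(LINT om|M. noise u om) = complex_of_real (LINT om|M. c om) - \<i> * complex_of_real (LINT om|M. s om) - wbar"
  unfolding n_eq' using intc by (simp add: prob_space)
 also have "... = 0" unfolding C(2) S(2) by (simp add: complex_eq_iff wbar_Re_Im)
 finally show "(LINT om|M. noise u om) = 0" .
 have sq: "(norm (noise u om))\<^sup>2 = (c om)\<^sup>2 + (s om)\<^sup>2 - 2 * Re wbar * c om + 2 * Im wbar * s om + ((Re wbar)\<^sup>2 + (Im wbar)\<^sup>2)" for om
  unfolding n_eq cmod_power2 by (simp add: power2_eq_square algebra_simps)
 show "integrable M (%om. (norm (noise u om))\<^sup>2)"
  unfolding sq using C S by auto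
 have "(LINT om|M. (norm (noise u om))\<^sup>2) = (LINT om|M. (c om)\<^sup>2) + (LINT om|M. (s om)\<^sup>2) - 2 * Re wbar * (LINT om|M. c om)
   + 2 * Im wbar * (LINT om|M. s om) + ((Re wbar)\<^sup>2 + (Im wbar)\<^sup>2)"
  unfolding sq using C(1,3) S(1,3) by (simp add: prob_space)
 also have "... = (LINT z|mu. (?c z)\<^sup>2) + (LINT z|mu. (?s z)\<^sup>2)"
  unfolding C(2,4) S(2,4) wbar_Re_Im by (simp add: power2_eq_square algebra_simps)
 also have "... = (LINT z|mu. (?c z)\<^sup>2 + (?s z)\<^sup>2)"
  by (rule bintegral_add[symmetric]; rule mu.integrable_const_bound[of _ 1]) (auto simp: abs_square_le_1)
 also have "... = m" using measure_mu by simp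
 finally show "(LINT om|M. (norm (noise u om))\<^sup>2) = m" .
qed

definition incr :: "nat list => 'w => complex" where
 "incr u om = (if alive (fam om) u then wave (place (fam om) u) * noise u om else 0)"

lemma incr_measurable [measurable]: "incr u \<in> BM M"
 unfolding incr_def by measurable

lemma noise_functional:
 "(%z. (\<Sum>i<fst z. wave (snd z i)) - wbar) \<in> BM offspring_space"
 "noise u om = (\<Sum>i<fst (fam om u). wave (snd (fam om u) i)) - wbar"
proof -
 have "(%z :: nat \<times> (nat => real). \<Sum>i<fst z. wave (snd z i)) \<in> BM offspring_space"
  by (rule measurable_compose_countable'[where I=UNIV and f="%k z. \<Sum>i<k. wave (snd z i)", OF _ measurable_fst]) auto
 then show "(%z. (\<Sum>i<fst z. wave (snd z i)) - wbar) \<in> BM offspring_space" by measurable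
 show "noise u om = (\<Sum>i<fst (fam om u). wave (snd (fam om u) i)) - wbar" by (simp add: noise_def)
qed

lemma norm_incr_le: "norm (incr u om) <= norm (noise u om)"
 by (simp add: incr_def norm_mult)

lemma incr_integrable: "integrable M (incr u)"
 by (rule bintegrable_bound[OF integrable_norm[OF noise_moments(1)[of u]]])
  (use norm_incr_le in auto)

lemma incr_mean: "(LINT om|M. incr u om) = 0"
proof -
 let ?F = "%ze. if alive ze u then wave (place ze u) else 0"
 have "(LINT om|M. ?F (fam om) * ((\<Sum>i<fst (fam om u). wave (snd (fam om u) i)) - wbar)) =
   (LINT om|M. ?F (fam om)) * (LINT om|M. (\<Sum>i<fst (fam om u). wave (snd (fam om u) i)) - wbar)"
 proof (rule peel_complex(2)[OF _ _ noise_functional(1)])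
  show "?F \<in> BM family_space" by measurable
  show "?F (ze(u := c)) = ?F ze" for ze c by (simp add: alive_upd place_upd)
  show "integrable M (%om. ?F (fam om))" by (rule integrable_const_bound[of _ 1]) auto
  show "integrable M (%om. (\<Sum>i<fst (fam om u). wave (snd (fam om u) i)) - wbar)"
   using noise_moments(1)[of u] unfolding noise_functional(2)[abs_def] .
 qed
 then show ?thesis
  using noise_moments(2)[of u] unfolding incr_def noise_functional(2)[symmetric]
  by (simp add: if_distrib[of "%x. x * _"] cong: if_cong)
qed

text \<open>The noise of the label that is not shorter is independent of all other data, in
  particular of the other increment and of its own ancestry, and it has mean 0.\<close>

lemma incr_orthogonal_aux:
 assumes uv: "u ~= v" "length u <= length v"
 shows "integrable M (%om. incr u om * cnj (incr v om))" "(LINT om|M. incr u om * cnj (incr v om)) = 0"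
proof -
 let ?F = "%ze. (if alive ze u then wave (place ze u) * ((\<Sum>i<fst (ze u). wave (snd (ze u) i)) - wbar) else 0) *
  (if alive ze v then cnj (wave (place ze v)) else 0)"
 let ?G = "%z. cnj ((\<Sum>i<fst z. wave (snd z i)) - wbar)"
 have eq: "incr u om * cnj (incr v om) = ?F (fam om) * ?G (fam om v)" for om
  by (simp add: incr_def noise_functional(2) mult_ac)
 have nm: "(%ze. (\<Sum>i<fst (ze u). wave (snd (ze u) i)) - wbar) \<in> BM family_space"
  by (rule measurable_compose[OF measurable_family_component noise_functional(1)])
 have 1: "?F \<in> BM family_space"
  using nm by measurable
 have 2: "?F (ze(v := c)) = ?F ze" for ze c using uv by (simp add: alive_upd place_upd)
 have 3: "?G \<in> BM offspring_space" using noise_functional(1) by measurable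
 have 4: "integrable M (%om. ?F (fam om))"
 proof (rule bintegrable_bound[OF integrable_norm[OF noise_moments(1)[of u]]])
  show "(%om. ?F (fam om)) \<in> BM M" by (rule measurable_compose[OF fam_measurable 1])
 qed (auto simp: norm_mult noise_functional(2))
 have 5: "integrable M (%om. ?G (fam om v))"
  unfolding noise_functional(2)[symmetric]
  by (rule integrable_bounded_linear[OF bounded_linear_cnj noise_moments(1)])
 have 6: "(LINT om|M. ?G (fam om v)) = 0"
  using noise_moments(2)[of v] unfolding noise_functional(2)[symmetric] by (simp add: Bochner_Integration.integral_cnj)
 show "integrable M (%om. incr u om * cnj (incr v om))"
  unfolding eq by (rule peel_complex(1)[OF 1 2 3 4 5])
 show "(LINT om|M. incr u om * cnj (incr v om)) = 0"
  unfolding eq using peel_complex(2)[OF 1 2 3 4 5] 6 by simp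
qed

lemma incr_orthogonal:
 assumes "u ~= v"
 shows "integrable M (%om. incr u om * cnj (incr v om))" "(LINT om|M. incr u om * cnj (incr v om)) = 0"
proof -
 have "integrable M (%om. incr u om * cnj (incr v om)) \<and> (LINT om|M. incr u om * cnj (incr v om)) = 0"
 proof (cases "length u <= length v")
  case True
  then show ?thesis using incr_orthogonal_aux assms by blast
 next
  case False
  then have le: "v ~= u" "length v <= length u" using assms by auto
  have eq: "incr u om * cnj (incr v om) = cnj (incr v om * cnj (incr u om))" for om by simp
  show ?thesis
   unfolding eq Bochner_Integration.integral_cnj using incr_orthogonal_aux[OF le] by (simp del: complex_cnj_mult)
 qed
 then show "integrable M (%om. incr u om * cnj (incr v om))" "(LINT om|M. incr u om * cnj (incr v om)) = 0" by auto
qed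

text \<open>\<open>wave\<close> has modulus 1, so on survival of \<open>u\<close> only the variance
  \<open>m\<close> of the noise remains; survival is independent of the noise.\<close>

lemma incr_square:
 "integrable M (%om. incr u om * cnj (incr u om))"
 "(LINT om|M. incr u om * cnj (incr u om)) = complex_of_real (m * prob {om \<in> space M. alive (fam om) u})"
proof -
 let ?F = "%ze. (if alive ze u then 1 else 0) :: complex"
 let ?G = "%z. ((\<Sum>i<fst z. wave (snd z i)) - wbar) * cnj ((\<Sum>i<fst z. wave (snd z i)) - wbar)"
 have eq: "incr u om * cnj (incr u om) = ?F (fam om) * ?G (fam om u)" for om
 proof (cases "alive (fam om) u")
  case True
  have "incr u om * cnj (incr u om) = (wave (place (fam om) u) * cnj (wave (place (fam om) u))) * (noise u om * cnj (noise u om))"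
   using True by (simp add: incr_def mult_ac)
  then show ?thesis using True unfolding wave_cnj noise_functional(2) by simp
 qed (simp add: incr_def)
 have G: "?G (fam om u) = complex_of_real ((norm (noise u om))\<^sup>2)" for om
  unfolding noise_functional(2)[symmetric] by (rule complex_norm_square[symmetric])
 have 1: "?F \<in> BM family_space" by measurable
 have 2: "?F (ze(u := c)) = ?F ze" for ze c by (simp add: alive_upd)
 have 3: "?G \<in> BM offspring_space" using noise_functional(1) by measurable
 have 4: "integrable M (%om. ?F (fam om))" by (rule integrable_const_bound[of _ 1]) auto
 have 5: "integrable M (%om. ?G (fam om u))" unfolding G by (rule integrable_of_real[OF noise_moments(3)])
 have 6: "(LINT om|M. ?G (fam om u)) = m" unfolding G by (simp only: integral_complex_of_real noise_moments(4))
 have 7: "(LINT om|M. ?F (fam om)) = prob {om \<in> space M. alive (fam om) u}"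
 proof -
  have "(LINT om|M. ?F (fam om)) = (LINT om|M. complex_of_real (indicator {om \<in> space M. alive (fam om) u} om))"
   by (intro bintegral_cong) (auto simp: indicator_def)
  also have "... = prob {om \<in> space M. alive (fam om) u}" unfolding integral_complex_of_real by simp
  finally show ?thesis .
 qed
 show "integrable M (%om. incr u om * cnj (incr u om))"
  unfolding eq by (rule peel_complex(1)[OF 1 2 3 4 5])
 show "(LINT om|M. incr u om * cnj (incr u om)) = complex_of_real (m * prob {om \<in> space M. alive (fam om) u})"
  unfolding eq using peel_complex(2)[OF 1 2 3 4 5] 6 7 by simp
qed

lemma incr_sum_square:
 assumes "finite J"
 shows "(LINT om|M. (norm (\<Sum>u\<in>J. incr u om))\<^sup>2) = m * (\<Sum>u\<in>J. prob {om \<in> space M. alive (fam om) u})"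
proof -
 have int: "integrable M (%om. incr u om * cnj (incr v om))" for u v
  using incr_orthogonal(1)[of u v] incr_square(1)[of u] by (cases "u = v") auto
 have "complex_of_real (LINT om|M. (norm (\<Sum>u\<in>J. incr u om))\<^sup>2) = (LINT om|M. complex_of_real ((norm (\<Sum>u\<in>J. incr u om))\<^sup>2))"
  by (rule integral_complex_of_real[symmetric])
 also have "... = (LINT om|M. (\<Sum>u\<in>J. \<Sum>v\<in>J. incr u om * cnj (incr v om)))"
  by (subst complex_norm_square) (simp add: sum_product)
 also have "... = (\<Sum>u\<in>J. \<Sum>v\<in>J. LINT om|M. incr u om * cnj (incr v om))"
  using int by (simp add: bintegral_sum)
 also have "... = (\<Sum>u\<in>J. \<Sum>v\<in>J. if u = v then complex_of_real (m * prob {om \<in> space M. alive (fam om) u}) else 0)"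
  by (intro sum.cong refl) (use incr_orthogonal(2) incr_square(2) in auto)
 also have "... = (\<Sum>u\<in>J. complex_of_real (m * prob {om \<in> space M. alive (fam om) u}))"
  using assms by simp
 also have "... = complex_of_real (m * (\<Sum>u\<in>J. prob {om \<in> space M. alive (fam om) u}))"
  by (simp add: sum_distrib_left)
 finally show ?thesis unfolding of_real_eq_iff .
qed

definition incr_total :: "'w => complex" where
 "incr_total om = (\<Sum>u\<in>ftree om. incr u om)"

lemma incr_total_measurable [measurable]: "incr_total \<in> BM M"
 unfolding incr_total_def[abs_def] by (rule measurable_ftree_compose) measurable

text \<open>For the bound: children of individuals in the tree are distinct members of the tree, so
  the offspring numbers sum to at most |C|, and the centring adds at most \<open>m * |C|\<close>.
  This explains the factor 2.\<close>

lemma incr_partial: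
 defines "J \<equiv> %k. {u \<in> UNIV. to_nat (u :: nat list) < k}"
 assumes fin: "finite (tree om)"
 shows "(%k. \<Sum>u\<in>J k. incr u om) ----> incr_total om"
  and "norm (\<Sum>u\<in>J k. incr u om) <= 2 * real (card (ftree om))"
proof -
 have finJ: "finite (J k)" for k unfolding J_def by (rule finite_to_nat_less)
 have zero: "incr u om = 0" if "u \<notin> tree om" for u using that by (simp add: incr_def tree_def)
 show "(%k. \<Sum>u\<in>J k. incr u om) ----> incr_total om"
 proof (rule Lim_transform_eventually[OF tendsto_const])
  have "eventually (%k. tree om \<subseteq> J k) sequentially"
   unfolding J_def by (rule eventually_subset_to_nat_less[OF fin]) auto
  then show "\<forall>\<^sub>F k in sequentially. incr_total om = (\<Sum>u\<in>J k. incr u om)"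
  proof eventually_elim
   case (elim k)
   then show ?case unfolding incr_total_def ftree_eq[OF fin]
    using finJ zero by (intro sum.mono_neutral_left) auto
  qed
 qed
 have nb: "norm (noise u om) <= real (K u om) + m" for u
 proof -
  have "norm (noise u om) <= norm (\<Sum>i<K u om. wave (X u i om)) + norm wbar"
   unfolding noise_def by (rule norm_triangle_ineq4)
  also have "norm (\<Sum>i<K u om. wave (X u i om)) <= (\<Sum>i<K u om. norm (wave (X u i om)))" by (rule norm_sum)
  finally show ?thesis using norm_wbar by simp
 qed
 have "norm (\<Sum>u\<in>J k. incr u om) = norm (\<Sum>u\<in>J k \<inter> tree om. incr u om)"
  using finJ zero by (intro arg_cong[where f=norm] sum.mono_neutral_right) auto
 also have "... <= (\<Sum>u\<in>J k \<inter> tree om. norm (incr u om))" by (rule norm_sum)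
 also have "... <= (\<Sum>u\<in>J k \<inter> tree om. real (K u om) + m)"
  by (intro sum_mono order_trans[OF norm_incr_le nb])
 also have "... <= (\<Sum>u\<in>tree om. real (K u om) + m)"
  using fin m by (intro sum_mono2) auto
 also have "... = (\<Sum>u\<in>tree om. real (K u om)) + m * real (card (tree om))"
  by (simp add: sum.distrib)
 also have "... <= real (card (tree om)) + 1 * real (card (tree om))"
 proof (intro add_mono mult_right_mono)
  show "(\<Sum>u\<in>tree om. real (K u om)) <= real (card (tree om))"
   using sum_tree[OF fin, of "%_. 1 :: real"] by simp
 qed (use m in auto)
 finally show "norm (\<Sum>u\<in>J k. incr u om) <= 2 * real (card (ftree om))" by (simp add: ftree_eq[OF fin])
qed

lemma sum_prob_alive:
 "(%k. \<Sum>u\<in>{u \<in> UNIV. to_nat (u :: nat list) < k}. prob {om \<in> space M. alive (fam om) u}) ----> 1 / (1 - m)"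
proof -
 let ?J = "%k. {u \<in> UNIV. to_nat (u :: nat list) < k}"
 have finJ: "finite (?J k)" for k by (rule finite_to_nat_less)
 have "(%k. LINT om|M. (\<Sum>u\<in>?J k. indicator {om \<in> space M. alive (fam om) u} om :: real)) ----> (LINT om|M. real (card (ftree om)))"
 proof (rule integral_dominated_convergence[where w="%om. real (card (ftree om))"])
  have eq: "(\<Sum>u\<in>?J k. indicator {om \<in> space M. alive (fam om) u} om) = real (card (?J k \<inter> tree om))" if "om \<in> space M" for om k
  proof -
   have "(\<Sum>u\<in>?J k. indicator {om \<in> space M. alive (fam om) u} om) = (\<Sum>u\<in>?J k. indicator (tree om) u :: real)"
    using that by (intro sum.cong) (auto simp: tree_def indicator_def)
   also have "... = (\<Sum>u\<in>?J k \<inter> tree om. 1)"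
    by (subst sum.inter_restrict[OF finJ]) (auto simp: indicator_def intro!: sum.cong)
   finally show ?thesis by simp
  qed
  show "AE om in M. (%k. \<Sum>u\<in>?J k. indicator {om \<in> space M. alive (fam om) u} om) ----> real (card (ftree om))"
   using finite_tree AE_space
  proof eventually_elim
   case (elim om)
   show ?case
   proof (rule Lim_transform_eventually[OF tendsto_const])
    have "eventually (%k. tree om \<subseteq> ?J k) sequentially"
    by (rule eventually_subset_to_nat_less[OF elim(1)]) auto
    then show "\<forall>\<^sub>F k in sequentially. real (card (ftree om)) = (\<Sum>u\<in>?J k. indicator {om \<in> space M. alive (fam om) u} om)"
    by eventually_elim (simp only: eq[OF elim(2)] ftree_eq[OF elim(1)] Int_absorb1)
   qed
  qed
  show "AE om in M. norm (\<Sum>u\<in>?J k. indicator {om \<in> space M. alive (fam om) u} om :: real) <= real (card (ftree om))" for k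
   using finite_tree AE_space
  proof eventually_elim
   case (elim om)
   have "card (?J k \<inter> tree om) <= card (tree om)" by (rule card_mono[OF elim(1)]) auto
   then show ?case by (simp only: eq[OF elim(2)] ftree_eq[OF elim(1)]) simp
  qed
  show "integrable M (%om. real (card (ftree om)))" using card_power_integrable[of 1] by simp
 qed measurable
 moreover have "(LINT om|M. (\<Sum>u\<in>?J k. indicator {om \<in> space M. alive (fam om) u} om :: real)) = (\<Sum>u\<in>?J k. prob {om \<in> space M. alive (fam om) u})" for k
 proof (subst bintegral_sum)
  show "integrable M (indicator {om \<in> space M. alive (fam om) u} :: _ => real)" for u
   by (rule integrable_const_bound[of _ 1]) auto
 qed simp
 ultimately show ?thesis using card_mean by simp
qed

text \<open>Partial sums are dominated by twice the cluster size, whose square is integrable, so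
  that the orthogonality over finite label sets survives in the limit.\<close>

lemma incr_total_moments:
 "integrable M incr_total" "(LINT om|M. incr_total om) = 0"
 "integrable M (%om. (norm (incr_total om))\<^sup>2)" "(LINT om|M. (norm (incr_total om))\<^sup>2) = m / (1 - m)"
proof -
 let ?J = "%k. {u \<in> UNIV. to_nat (u :: nat list) < k}"
 have finJ: "finite (?J k)" for k by (rule finite_to_nat_less)
 have dom1: "integrable M (%om. 2 * real (card (ftree om)))" using card_power_integrable[of 1] by simp
 have dom2: "integrable M (%om. (2 * real (card (ftree om)))\<^sup>2)"
  using card_power_integrable[of 2] by (simp add: power_mult_distrib)
 have c1: "AE om in M. (%k. \<Sum>u\<in>?J k. incr u om) ----> incr_total om"
  using finite_tree by eventually_elim (rule incr_partial(1))
 have b1: "AE om in M. norm (\<Sum>u\<in>?J k. incr u om) <= 2 * real (card (ftree om))" for k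
  using finite_tree by eventually_elim (rule incr_partial(2))
 have c2: "AE om in M. (%k. (norm (\<Sum>u\<in>?J k. incr u om))\<^sup>2) ----> (norm (incr_total om))\<^sup>2"
  using c1 by eventually_elim (intro tendsto_intros)
 have b2: "AE om in M. norm ((norm (\<Sum>u\<in>?J k. incr u om))\<^sup>2) <= (2 * real (card (ftree om)))\<^sup>2" for k
  using b1[of k]
 proof eventually_elim
  case (elim om)
  show ?case using power_mono[OF elim norm_ge_zero, of 2] by simp
 qed
 have m1: "(%om. \<Sum>u\<in>?J k. incr u om) \<in> BM M" for k by measurable
 have m2: "(%om. (norm (\<Sum>u\<in>?J k. incr u om))\<^sup>2) \<in> BM M" for k by measurable
 have m3: "(%om. (norm (incr_total om))\<^sup>2) \<in> BM M" by measurable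
 show "integrable M incr_total"
  by (rule integrable_dominated_convergence[OF incr_total_measurable m1 dom1 c1 b1])
 show "integrable M (%om. (norm (incr_total om))\<^sup>2)"
  by (rule integrable_dominated_convergence[OF m3 m2 dom2 c2 b2])
 have "(%k. LINT om|M. (\<Sum>u\<in>?J k. incr u om)) ----> (LINT om|M. incr_total om)"
  by (rule integral_dominated_convergence[OF incr_total_measurable m1 dom1 c1 b1])
 moreover have "(LINT om|M. (\<Sum>u\<in>?J k. incr u om)) = 0" for k
  by (subst bintegral_sum) (auto intro: incr_integrable simp: incr_mean)
 ultimately show "(LINT om|M. incr_total om) = 0" by (simp add: LIMSEQ_const_iff)
 have "(%k. LINT om|M. (norm (\<Sum>u\<in>?J k. incr u om))\<^sup>2) ----> (LINT om|M. (norm (incr_total om))\<^sup>2)"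
  by (rule integral_dominated_convergence[OF m3 m2 dom2 c2 b2])
 moreover have "(%k. LINT om|M. (norm (\<Sum>u\<in>?J k. incr u om))\<^sup>2) ----> m * (1 / (1 - m))"
  unfolding incr_sum_square[OF finJ] by (intro tendsto_mult tendsto_const sum_prob_alive)
 ultimately show "(LINT om|M. (norm (incr_total om))\<^sup>2) = m / (1 - m)"
  by (auto dest: LIMSEQ_unique)
qed

text \<open>In \<open>sum_tree\<close> the children of \<open>u\<close> contribute their mean
  \<open>wbar * wave\<close> plus the increment of \<open>u\<close>. The result is a linear equation
  for the cluster transform, solved by moving the \<open>wbar\<close> term to the left.\<close>

lemma wave_sum_eq:
 assumes fin: "finite (tree om)"
 shows "(1 - wbar) * (\<Sum>u\<in>ftree om. wave (place (fam om) u)) = 1 + incr_total om"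
proof -
 let ?S = "\<Sum>u\<in>tree om. wave (place (fam om) u)"
 have "?S = 1 + (\<Sum>u\<in>tree om. \<Sum>i<K u om. wave (place (fam om) (i # u)))"
  using sum_tree[OF fin, of "%u. wave (place (fam om) u)"] by simp
 also have "(\<Sum>u\<in>tree om. \<Sum>i<K u om. wave (place (fam om) (i # u))) = (\<Sum>u\<in>tree om. incr u om + wbar * wave (place (fam om) u))"
 proof (rule sum.cong[OF refl])
  fix u assume "u \<in> tree om"
  then have "incr u om = wave (place (fam om) u) * noise u om" by (simp add: incr_def tree_def)
  then show "(\<Sum>i<K u om. wave (place (fam om) (i # u))) = incr u om + wbar * wave (place (fam om) u)"
   by (simp add: noise_def wave_add sum_distrib_left algebra_simps)
 qed
 also have "... = incr_total om + wbar * ?S"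
  by (simp add: sum.distrib sum_distrib_left incr_total_def ftree_eq[OF fin])
 finally have "?S = 1 + (incr_total om + wbar * ?S)" .
 then show ?thesis
  unfolding ftree_eq[OF fin] left_diff_distrib diff_eq_eq add.assoc mult_1_left .
qed

text \<open>The total increment is centred, so the mixed term vanishes and the mean square of
  \<open>1 + incr_total\<close> is \<open>1 + m / (1 - m) = 1 / (1 - m)\<close>.\<close>

lemma wave_sum_square:
 "(LINT om|M. (norm (\<Sum>u\<in>ftree om. wave (place (fam om) u)))\<^sup>2) = 1 / ((1 - m) * (norm (1 - wbar))\<^sup>2)"
proof -
 have nz: "norm (1 - wbar) ~= 0" using norm_wbar m norm_triangle_ineq2[of 1 wbar] by auto
 have int: "integrable M (%om. Re (incr_total om))" using incr_total_moments(1) by simp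
 have "(norm (1 - wbar))\<^sup>2 * (LINT om|M. (norm (\<Sum>u\<in>ftree om. wave (place (fam om) u)))\<^sup>2) =
  (LINT om|M. (norm ((1 - wbar) * (\<Sum>u\<in>ftree om. wave (place (fam om) u))))\<^sup>2)"
  by (simp add: norm_mult power_mult_distrib)
 also have "... = (LINT om|M. (norm (1 + incr_total om))\<^sup>2)"
 proof (rule integral_cong_AE)
  have [measurable]: "(%om. \<Sum>u\<in>ftree om. wave (place (fam om) u)) \<in> BM M"
   by (rule measurable_ftree_compose) measurable
  show "(%om. (norm ((1 - wbar) * (\<Sum>u\<in>ftree om. wave (place (fam om) u))))\<^sup>2) \<in> BM M" by measurable
  show "AE om in M. (norm ((1 - wbar) * (\<Sum>u\<in>ftree om. wave (place (fam om) u))))\<^sup>2 = (norm (1 + incr_total om))\<^sup>2"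
   using finite_tree by eventually_elim (simp only: wave_sum_eq)
 qed measurable
 also have "... = (LINT om|M. 1 + 2 * Re (incr_total om) + (norm (incr_total om))\<^sup>2)"
  by (intro bintegral_cong refl) (simp only: cmod_power2, simp add: power2_eq_square algebra_simps)
 also have "... = 1 + 2 * (LINT om|M. Re (incr_total om)) + m / (1 - m)"
  using int incr_total_moments(3,4) by (simp add: prob_space)
 also have "(LINT om|M. Re (incr_total om)) = 0"
  using incr_total_moments(1,2) by (simp add: integral_Re)
 finally show ?thesis using nz m by (simp add: field_simps)
qed

end

theorem second_moment:
 "(LINT om|M. (cmod (\<Sum>u\<in>ftree om. iexp (- (w * place (fam om) u))))\<^sup>2) =
  1 / ((1 - m) * (cmod (1 - m * fourier \<phi> w))\<^sup>2)"
 using wave_sum_square[of w] unfolding wave_def wbar_def .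

end

section \<open>The generating functional of a cluster\<close>

text \<open>Factors are switched on one at a time. The bound is linear in the deviations
  \<open>\<bar>a u - 1\<bar>\<close>, which is what makes it integrable over the root position
  later.\<close>

lemma abs_prod_minus_one_le:
 fixes a :: "'b => real"
 assumes "finite T" "1 <= \<theta>" "!!u. u \<in> T ==> 0 <= a u" "!!u. u \<in> T ==> a u <= \<theta>"
 shows "\<bar>(\<Prod>u\<in>T. a u) - 1\<bar> <= (\<Sum>u\<in>T. \<bar>a u - 1\<bar>) * \<theta> ^ card T"
 using assms
proof (induction T rule: finite_induct)
 case (insert v T)
 let ?P = "\<Prod>u\<in>T. a u" and ?S = "\<Sum>u\<in>T. \<bar>a u - 1\<bar>"
 have IH: "\<bar>?P - 1\<bar> <= ?S * \<theta> ^ card T" using insert by auto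
 have "\<bar>a v * ?P - 1\<bar> = \<bar>a v * (?P - 1) + (a v - 1)\<bar>" by (simp add: algebra_simps)
 also have "... <= a v * \<bar>?P - 1\<bar> + \<bar>a v - 1\<bar>"
  using insert.prems by (intro order_trans[OF abs_triangle_ineq]) (auto simp: abs_mult)
 also have "a v * \<bar>?P - 1\<bar> <= \<theta> * (?S * \<theta> ^ card T)"
  using insert.prems IH by (intro mult_mono) auto
 finally have le: "\<bar>a v * ?P - 1\<bar> <= \<theta> * (?S * \<theta> ^ card T) + \<bar>a v - 1\<bar>" by simp
 have "\<bar>a v - 1\<bar> * 1 <= \<bar>a v - 1\<bar> * \<theta> ^ Suc (card T)"
  using insert.prems by (intro mult_left_mono one_le_power) auto
 then show ?case using insert.hyps le by (simp add: algebra_simps)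
qed simp

lemma prod_one_plus_has_derivative:
 fixes b c :: "'b => real"
 assumes "finite T"
 shows "((%t. \<Prod>u\<in>T. b u + t * c u) has_real_derivative (\<Sum>u\<in>T. c u * (\<Prod>v\<in>T - {u}. b v + t * c v))) (at t)"
 by (rule has_field_derivative_prod) (auto intro!: derivative_eq_intros)

lemma nn_integral_lborel_shift:
 fixes f :: "real => ennreal"
 assumes [measurable]: "f \<in> BM borel"
 shows "(\<integral>\<^sup>+x. f (x + c) \<partial>lborel) = (\<integral>\<^sup>+x. f x \<partial>lborel)"
proof -
 have "(\<integral>\<^sup>+x. f x \<partial>lborel) = (\<integral>\<^sup>+x. f x \<partial>distr lborel borel ((+) c))" by (simp add: lborel_distr_plus)
 also have "... = (\<integral>\<^sup>+x. f (c + x) \<partial>lborel)" by (subst nn_integral_distr) auto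
 finally show ?thesis by (simp add: add.commute)
qed

section \<open>Products and sums over a cluster with the root spread over the line\<close>

context cluster
begin

sublocale LM: pair_sigma_finite lborel M
 by unfold_locales

lemma measurable_ftree_pair:
 assumes "!!A. finite A ==> (%p. F A p) \<in> measurable (L \<Otimes>\<^sub>M M) N"
 shows "(%p. F (ftree (snd p)) p) \<in> measurable (L \<Otimes>\<^sub>M M) N"
proof -
 have [measurable]: "Measurable.pred (L \<Otimes>\<^sub>M M) (%p. u \<in> tree (snd p))" for u
  unfolding tree_def mem_Collect_eq by measurable
 show ?thesis
  unfolding ftree_def by (rule measurable_finite_part_compose) (use assms in auto)
qed

text \<open>The root position is integrated first. By translation invariance every individual
  contributes the same integral of \<open>\<bar>g\<bar>\<close>, so that only one more power of |C|
  appears.\<close>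

lemma integrable_ftree_sum:
 assumes g: "integrable lborel g"
 shows "integrable (lborel \<Otimes>\<^sub>M M) (%(x, om). (\<Sum>u\<in>ftree om. \<bar>g (x + place (fam om) u)\<bar>) *
  (real (card (ftree om)) ^ k * theta ^ card (ftree om)))"
proof -
 have [measurable]: "g \<in> BM borel" using g by auto
 let ?c = "%om. real (card (ftree om)) ^ k * theta ^ card (ftree om)"
 let ?f = "%p. (\<Sum>u\<in>ftree (snd p). \<bar>g (fst p + place (fam (snd p)) u)\<bar>) * ?c (snd p)"
 have c0: "0 <= ?c om" for om using theta by simp
 have meas: "?f \<in> BM (lborel \<Otimes>\<^sub>M M)"
  by (rule measurable_ftree_pair) measurable
 define I where "I = (\<integral>\<^sup>+x. ennreal \<bar>g x\<bar> \<partial>lborel)"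
 have I: "I < \<infinity>" using g by (simp add: I_def integrable_iff_bounded)
 have "(\<integral>\<^sup>+p. ennreal (norm (?f p)) \<partial>(lborel \<Otimes>\<^sub>M M)) = (\<integral>\<^sup>+om. (\<integral>\<^sup>+x. ennreal (norm (?f (x, om))) \<partial>lborel) \<partial>M)"
  using meas by (subst LM.nn_integral_snd[symmetric]) auto
 also have "... = (\<integral>\<^sup>+om. ennreal (real (card (ftree om)) ^ Suc k * theta ^ card (ftree om)) * I \<partial>M)"
 proof (intro nn_integral_cong)
  fix om
  have "(\<integral>\<^sup>+x. ennreal (norm (?f (x, om))) \<partial>lborel) =
    (\<integral>\<^sup>+x. ennreal (?c om) * (\<Sum>u\<in>ftree om. ennreal \<bar>g (x + place (fam om) u)\<bar>) \<partial>lborel)"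
  proof (intro nn_integral_cong)
   fix x
   have "norm (?f (x, om)) = ?c om * (\<Sum>u\<in>ftree om. \<bar>g (x + place (fam om) u)\<bar>)"
    using theta by (simp add: abs_mult sum_nonneg mult_ac power_abs)
   then show "ennreal (norm (?f (x, om))) = ennreal (?c om) * (\<Sum>u\<in>ftree om. ennreal \<bar>g (x + place (fam om) u)\<bar>)"
    using c0[of om] by (simp add: ennreal_mult sum_nonneg sum_ennreal mult.commute)
  qed
  also have "... = ennreal (?c om) * (\<Sum>u\<in>ftree om. I)"
  proof -
   have "(\<integral>\<^sup>+x. ennreal \<bar>g (x + place (fam om) u)\<bar> \<partial>lborel) = I" for u
    unfolding I_def by (rule nn_integral_lborel_shift) measurable
   then show ?thesis by (simp add: nn_integral_cmult nn_integral_sum del: sum_ennreal)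
  qed
  also have "... = ennreal (real (card (ftree om)) ^ Suc k * theta ^ card (ftree om)) * I"
  proof -
   have "ennreal (real (card (ftree om)) ^ Suc k * theta ^ card (ftree om)) = ennreal (?c om * real (card (ftree om)))"
    by (simp add: mult_ac)
   also have "... = ennreal (?c om) * of_nat (card (ftree om))"
    using c0 by (subst ennreal_mult) (auto simp: ennreal_of_nat_eq_real_of_nat)
   finally show ?thesis by (simp add: mult.assoc)
  qed
  finally show "(\<integral>\<^sup>+x. ennreal (norm (?f (x, om))) \<partial>lborel) = ennreal (real (card (ftree om)) ^ Suc k * theta ^ card (ftree om)) * I" .
 qed
 also have "... = (\<integral>\<^sup>+om. ennreal (real (card (ftree om)) ^ Suc k * theta ^ card (ftree om)) \<partial>M) * I"
  by (rule nn_integral_multc) measurable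
 also have "... < \<infinity>"
 proof -
  have "(\<integral>\<^sup>+om. ennreal (norm (real (card (ftree om)) ^ Suc k * theta ^ card (ftree om))) \<partial>M) < \<infinity>"
   using card_moment[of "Suc k"] by (simp only: integrable_iff_bounded)
  moreover have "norm (real (card (ftree om)) ^ Suc k * theta ^ card (ftree om)) = real (card (ftree om)) ^ Suc k * theta ^ card (ftree om)" for om
   using theta by simp
  ultimately show ?thesis using I by (simp add: ennreal_mult_less_top)
 qed
 finally show ?thesis using meas by (simp add: integrable_iff_bounded case_prod_unfold)
qed

definition cprod :: "(real => real) => real => 'w => real" where
 "cprod a x om = (\<Prod>u\<in>ftree om. a (x + place (fam om) u))"

definition G :: "(real => real) => real => real" where
 "G a x = (LINT om|M. cprod a x om)"

lemma cprod_measurable: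
 assumes [measurable]: "a \<in> BM borel"
 shows "cprod a x \<in> BM M" "(%(x, om). cprod a x om) \<in> BM (lborel \<Otimes>\<^sub>M M)"
proof -
 show "cprod a x \<in> BM M"
  unfolding cprod_def[abs_def] by (rule prod_ftree_measurable) measurable
 show "(%(x, om). cprod a x om) \<in> BM (lborel \<Otimes>\<^sub>M M)"
  unfolding cprod_def[abs_def] case_prod_unfold by (rule measurable_ftree_pair) measurable
qed

lemma cprod_bounds:
 assumes "!!x. 0 <= a x" "!!x. a x <= theta"
 shows "0 <= cprod a x om" "cprod a x om <= theta ^ card (ftree om)"
proof -
 show "0 <= cprod a x om" unfolding cprod_def by (intro prod_nonneg) (use assms in auto)
 have "cprod a x om <= (\<Prod>u\<in>ftree om. theta)" unfolding cprod_def by (intro prod_mono) (use assms in auto)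
 then show "cprod a x om <= theta ^ card (ftree om)" by simp
qed

lemma cprod_integrable:
 assumes "a \<in> BM borel" "!!x. 0 <= a x" "!!x. a x <= theta"
 shows "integrable M (cprod a x)"
 by (rule bintegrable_bound[OF card_moment[of 0]])
  (use cprod_bounds[OF assms(2,3)] theta cprod_measurable[OF assms(1)] in auto)

lemma EG_eq_G:
 assumes "a \<in> BM borel" "!!x. 0 <= a x" "!!x. a x <= theta"
 shows "EG a x = ennreal (G a x)"
 unfolding EG_def G_def cprod_def[symmetric]
 by (rule nn_integral_eq_integral[OF cprod_integrable[OF assms]]) (use cprod_bounds[OF assms(2,3)] in auto)

lemma theta_le_alpha: "theta <= alpha"
proof -
 have "theta * 1 <= theta * theta" using theta(1) by (intro mult_left_mono) auto
 then show ?thesis using theta(2) by simp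
qed

lemma G_reflect:
 assumes "even_fun \<phi>" "a \<in> BM borel" "!!x. \<delta> <= a x" "0 < \<delta>" "!!x. a x <= theta"
 shows "G (%y. a (- y)) (- x) = G a x"
proof -
 have a0: "0 <= a x" for x using assms(3)[of x] assms(4) by linarith
 have al: "a x <= alpha" for x using assms(5)[of x] theta_le_alpha by linarith
 have "ennreal (G (%y. a (- y)) (- x)) = EG (%y. a (- y)) (- x)"
  by (rule EG_eq_G[symmetric]) (use assms a0 in auto)
 also have "... = EG a x" by (rule EG_reflect[OF assms(1-4) al])
 also have "... = ennreal (G a x)" by (rule EG_eq_G) (use assms a0 in auto)
 finally show ?thesis
  using cprod_bounds(1)[of a] cprod_bounds(1)[of "%y. a (- y)"] a0 assms(5)
  by (subst (asm) ennreal_inj) (auto simp: G_def intro!: bintegral_nonneg)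
qed

lemma cprod_minus_one_integrable:
 assumes a: "a \<in> BM borel" "!!x. 0 <= a x" "!!x. a x <= theta" and int: "integrable lborel (%x. a x - 1)"
 shows "integrable (lborel \<Otimes>\<^sub>M M) (%(x, om). cprod a x om - 1)"
proof (rule bintegrable_bound[OF integrable_ftree_sum[OF int, of 0]])
 show "(%(x, om). cprod a x om - 1) \<in> BM (lborel \<Otimes>\<^sub>M M)"
  using cprod_measurable(2)[OF a(1)] by (simp add: case_prod_unfold)
 show "AE p in lborel \<Otimes>\<^sub>M M. norm (case p of (x, om) => cprod a x om - 1) <=
   norm (case p of (x, om) => (\<Sum>u\<in>ftree om. \<bar>a (x + place (fam om) u) - 1\<bar>) * (real (card (ftree om)) ^ 0 * theta ^ card (ftree om)))"
 proof (intro AE_I2, clarify)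
  fix x om
  have "\<bar>cprod a x om - 1\<bar> <= (\<Sum>u\<in>ftree om. \<bar>a (x + place (fam om) u) - 1\<bar>) * theta ^ card (ftree om)"
   unfolding cprod_def by (rule abs_prod_minus_one_le) (use a theta in auto)
  then show "norm (cprod a x om - 1) <= norm ((\<Sum>u\<in>ftree om. \<bar>a (x + place (fam om) u) - 1\<bar>) * (real (card (ftree om)) ^ 0 * theta ^ card (ftree om)))"
   using theta by (simp add: abs_mult sum_nonneg)
 qed
qed

lemma G_minus_one:
 assumes a: "a \<in> BM borel" "!!x. 0 <= a x" "!!x. a x <= theta" and int: "integrable lborel (%x. a x - 1)"
 shows "integrable lborel (%x. G a x - 1)"
  and "(LINT x|lborel. G a x - 1) = (LINT p|(lborel \<Otimes>\<^sub>M M). cprod a (fst p) (snd p) - 1)"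
proof -
 have eq: "G a x - 1 = (LINT om|M. cprod a x om - 1)" for x
  using cprod_integrable[OF a] by (simp add: G_def prob_space)
 note I = cprod_minus_one_integrable[OF a int]
 show "integrable lborel (%x. G a x - 1)" unfolding eq using LM.integrable_fst'[OF I] by simp
 show "(LINT x|lborel. G a x - 1) = (LINT p|(lborel \<Otimes>\<^sub>M M). cprod a (fst p) (snd p) - 1)"
  unfolding eq using LM.integral_fst'[OF I] by (simp add: case_prod_unfold)
qed

lemma G_measurable:
 assumes "a \<in> BM borel"
 shows "G a \<in> BM borel"
 unfolding G_def using borel_measurable_lebesgue_integral[OF cprod_measurable(2)[OF assms]] by simp

text \<open>The point is uniformity in the root and in \<open>a\<close>: the bounds are the means of
  \<open>\<delta> ^ |C|\<close> and \<open>theta ^ |C|\<close>. The first is positive because |C| is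
  finite, and together they keep \<open>ln (G a x)\<close> bounded.\<close>

lemma G_bounds:
 assumes \<delta>: "0 < \<delta>" "\<delta> <= 1"
 shows "\<exists>g0 g1. 0 < g0 \<and> (\<forall>a x. a \<in> BM borel --> (\<forall>x. \<delta> <= a x) --> (\<forall>x. a x <= theta) --> g0 <= G a x \<and> G a x <= g1)"
proof -
 let ?d = "%om. \<delta> ^ card (ftree om)"
 define g0 where "g0 = (LINT om|M. ?d om)"
 define g1 where "g1 = (LINT om|M. theta ^ card (ftree om))"
 have d: "integrable M ?d"
  using \<delta> by (intro integrable_const_bound[of _ 1]) (auto simp: power_le_one)
 have t: "integrable M (%om. theta ^ card (ftree om))" using card_moment[of 0] by simp
 have "0 < g0"
 proof -
  have "0 <= g0" unfolding g0_def using \<delta> by (intro bintegral_nonneg) auto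
  moreover have "g0 ~= 0"
  proof
   assume "g0 = 0"
   then have "AE om in M. ?d om = 0"
    unfolding g0_def using d \<delta> by (subst (asm) integral_nonneg_eq_0_iff_AE) auto
   then have "AE om in M. False" by eventually_elim (use \<delta> in auto)
   then show False using AE_False by simp
  qed
  ultimately show ?thesis by linarith
 qed
 moreover have "g0 <= G a x \<and> G a x <= g1" if a: "a \<in> BM borel" "!!x. \<delta> <= a x" "!!x. a x <= theta" for a x
 proof -
  have a0: "0 <= a x" for x using a(2)[of x] \<delta> by linarith
  have I: "integrable M (cprod a x)" by (rule cprod_integrable[OF a(1) a0 a(3)])
  have "?d om <= cprod a x om" for om
  proof -
   have "(\<Prod>u\<in>ftree om. \<delta>) <= cprod a x om" unfolding cprod_def using a \<delta> by (intro prod_mono) auto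
   then show ?thesis by simp
  qed
  then have "g0 <= G a x" unfolding g0_def G_def using d I by (intro integral_mono) auto
  moreover have "G a x <= g1" unfolding g1_def G_def
   using t I cprod_bounds(2)[OF a0 a(3)] by (intro integral_mono) auto
  ultimately show ?thesis by simp
 qed
 ultimately show ?thesis by blast
qed

definition csum :: "(real => real) => real => 'w => real" where
 "csum f x om = (\<Sum>u\<in>ftree om. f (x + place (fam om) u))"

lemma csum_measurable:
 assumes [measurable]: "f \<in> BM borel"
 shows "csum f x \<in> BM M" "(%(x, om). csum f x om) \<in> BM (lborel \<Otimes>\<^sub>M M)"
proof -
 show "csum f x \<in> BM M"
  unfolding csum_def[abs_def] by (rule measurable_ftree_compose) measurable
 show "(%(x, om). csum f x om) \<in> BM (lborel \<Otimes>\<^sub>M M)"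
  unfolding csum_def[abs_def] case_prod_unfold by (rule measurable_ftree_pair) measurable
qed

text \<open>Mean sums over a cluster are recovered from \<open>G\<close> as derivatives along
  \<open>1 + s * f\<close>, so that clusters with the same \<open>G\<close> have the same mean
  sums.\<close>

lemma G_has_derivative:
 assumes f [measurable]: "f \<in> BM borel" and B: "!!x. \<bar>f x\<bar> <= B" "0 < B"
 shows "((%s. G (%y. 1 + s * f y) x) has_real_derivative (LINT om|M. csum f x om)) (at 0)"
proof -
 \<comment> \<open>Small enough that \<open>1 + t * f y\<close> stays between 0 and
   \<open>theta\<close>.\<close>
 define e where "e = min (1 / B) ((theta - 1) / B)"
 have e: "0 < e" using B theta by (simp add: e_def)
 have eB: "e * B <= 1" "e * B <= theta - 1" using B by (simp_all add: e_def min_def field_simps)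
 have small: "\<bar>t * f y\<bar> <= 1" "\<bar>t * f y\<bar> <= theta - 1" if "\<bar>t\<bar> < e" for t y
 proof -
  have "\<bar>t * f y\<bar> <= e * B" unfolding abs_mult using that B e by (intro mult_mono) auto
  then show "\<bar>t * f y\<bar> <= 1" "\<bar>t * f y\<bar> <= theta - 1" using eB by linarith+
 qed
 have rng: "0 <= 1 + t * f y" "1 + t * f y <= theta" if "\<bar>t\<bar> < e" for t y
  using small[OF that, of y] by linarith+
 define D where "D t om = (\<Sum>u\<in>ftree om. f (x + place (fam om) u) * (\<Prod>v\<in>ftree om - {u}. 1 + t * f (x + place (fam om) v)))" for t om
 have "((%t. LINT om|M. cprod (%y. 1 + t * f y) x om) has_real_derivative (LINT om|M. D 0 om)) (at 0)"
 proof (rule has_real_derivative_integral[OF e, where w="%om. B * (real (card (ftree om)) ^ 1 * theta ^ card (ftree om))"])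
  show "integrable M (cprod (%y. 1 + t * f y) x)" if "\<bar>t\<bar> < e" for t
   by (rule cprod_integrable) (use rng[OF that] in auto)
  have "D 0 = csum f x" by (simp add: D_def csum_def fun_eq_iff)
  then show "D 0 \<in> BM M" using csum_measurable(1)[OF f] by simp
  show "((%t. cprod (%y. 1 + t * f y) x om) has_real_derivative D t om) (at t)" for t om
   unfolding cprod_def D_def by (rule prod_one_plus_has_derivative) simp
  show "\<bar>D t om\<bar> <= B * (real (card (ftree om)) ^ 1 * theta ^ card (ftree om))" if "\<bar>t\<bar> < e" for t om
  proof -
   have "\<bar>D t om\<bar> <= (\<Sum>u\<in>ftree om. \<bar>f (x + place (fam om) u) * (\<Prod>v\<in>ftree om - {u}. 1 + t * f (x + place (fam om) v))\<bar>)"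
    unfolding D_def by (rule sum_abs)
   also have "... <= (\<Sum>u\<in>ftree om. B * theta ^ card (ftree om))"
   proof (rule sum_mono)
    fix u assume u: "u \<in> ftree om"
    have "\<bar>\<Prod>v\<in>ftree om - {u}. 1 + t * f (x + place (fam om) v)\<bar> = (\<Prod>v\<in>ftree om - {u}. 1 + t * f (x + place (fam om) v))"
    using rng[OF that] by (intro abs_of_nonneg prod_nonneg) auto
    also have "... <= (\<Prod>v\<in>ftree om - {u}. theta)" using rng[OF that] by (intro prod_mono) auto
    also have "... <= (\<Prod>v\<in>ftree om. theta)" using theta by (intro prod_mono2) auto
    finally show "\<bar>f (x + place (fam om) u) * (\<Prod>v\<in>ftree om - {u}. 1 + t * f (x + place (fam om) v))\<bar> <= B * theta ^ card (ftree om)"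
    unfolding abs_mult using B by (intro mult_mono) auto
   qed
   finally show ?thesis by (simp add: mult_ac)
  qed
  show "integrable M (%om. B * (real (card (ftree om)) ^ 1 * theta ^ card (ftree om)))"
   by (rule integrable_mult_right[OF card_moment])
 qed
 moreover have "D 0 = csum f x" by (simp add: D_def csum_def fun_eq_iff)
 ultimately show ?thesis by (simp add: G_def)
qed

end

text \<open>Each cluster of the stationary process comes with its own family data, and equality of
  the laws is not part of the definition. What is needed of it is derived here: \<open>mult\<close>,
  \<open>alpha\<close> and \<open>beta\<close> are the same for both clusters, so the recursion
  \<open>EW_Suc\<close> gives both the same values.\<close>

locale two_clusters = c1: cluster M1 m \<phi> K1 X1 + c2: cluster M2 m \<phi> K2 X2
 for M1 :: "'w1 measure" and M2 :: "'w2 measure" and m \<phi> K1 X1 K2 X2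
begin

lemma EW_eq:
 assumes a: "a \<in> BM borel" and a_b: "!!x. \<delta>' <= a x" "0 < \<delta>'" "!!x. a x <= c1.alpha"
 shows "g \<in> BM borel ==> (!!x. \<delta> <= g x) ==> 0 < \<delta> ==> (!!x. g x <= c1.beta) ==>
  c1.EW n a g x = c2.EW n a g x"
proof (induction n arbitrary: g \<delta>)
 case 0
 then show ?case by (simp add: c1.EW_0 c2.EW_0)
next
 case (Suc n)
 have a0: "0 <= a x" for x using a_b(1)[of x] a_b(2) by linarith
 have "c1.EW (Suc n) a g x = c1.EW n a (%y. a y * c1.mult g y) x"
  by (rule c1.EW_Suc[where \<delta>=\<delta>]) (use Suc.prems a a0 a_b in auto)
 also have "... = c2.EW n a (%y. a y * c1.mult g y) x"
 proof (rule Suc.IH[of "%y. a y * c1.mult g y" "\<delta>' * exp (m * (\<delta> - 1))"])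
  show "(%y. a y * c1.mult g y) \<in> BM borel"
   using a c1.mult_measurable[OF Suc.prems(1)] by measurable
  fix x
  note mb = c1.mult_bounds[OF Suc.prems(1,2,4), of x]
  show "\<delta>' * exp (m * (\<delta> - 1)) <= a x * c1.mult g x"
   using a_b mb(1) a0 by (intro mult_mono) auto
  have "a x * c1.mult g x <= c1.alpha * exp (m * (c1.beta - 1))"
   using a_b mb(2) a0 c1.alpha_gt_1 by (intro mult_mono) (auto simp: c1.mult_def)
  then show "a x * c1.mult g x <= c1.beta" by (simp add: c1.alpha_beta)
 qed (use a_b in auto)
 also have "... = c2.EW (Suc n) a g x"
  by (rule c2.EW_Suc[symmetric, where \<delta>=\<delta>]) (use Suc.prems a a0 a_b in auto)
 finally show ?case .
qed

lemma G_eq: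
 assumes a: "a \<in> BM borel" and a_b: "!!x. \<delta> <= a x" "0 < \<delta>" "!!x. a x <= c1.theta"
 shows "c1.G a x = c2.G a x"
proof -
 have a0: "0 <= a x" for x using a_b(1)[of x] a_b(2) by linarith
 have al: "a x <= c1.alpha" for x using a_b(3)[of x] c1.theta_le_alpha by linarith
 have "c1.EW n a (%_. 1) x = c2.EW n a (%_. 1) x" for n
  by (rule EW_eq[OF a a_b(1,2) al, where \<delta>=1]) (use c1.beta_gt_1 in auto)
 moreover have "(%n. c1.EW n a (%_. 1) x) ----> c1.EG a x"
  by (rule c1.EW_tendsto_EG) (use a a0 al in auto)
 moreover have "(%n. c2.EW n a (%_. 1) x) ----> c2.EG a x"
  by (rule c2.EW_tendsto_EG) (use a a0 al in auto)
 ultimately have "c1.EG a x = c2.EG a x" by (simp add: LIMSEQ_unique)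
 then have "ennreal (c1.G a x) = ennreal (c2.G a x)"
  using c1.EG_eq_G[OF a a0 a_b(3)] c2.EG_eq_G[OF a a0 a_b(3)] by simp
 then show ?thesis
  using c1.cprod_bounds(1)[OF a0 a_b(3)] c2.cprod_bounds(1)[OF a0 a_b(3)]
  by (subst (asm) ennreal_inj) (auto simp: c1.G_def c2.G_def intro!: bintegral_nonneg)
qed

text \<open>Both means are the derivative at 0 of one function, as the two functionals agree on
  weights close to 1.\<close>

lemma csum_mean_eq:
 assumes f [measurable]: "f \<in> BM borel" and B: "!!x. \<bar>f x\<bar> <= B" "0 < B"
 shows "(LINT om|M1. c1.csum f x om) = (LINT om|M2. c2.csum f x om)"
proof (rule DERIV_unique)
 show "((%s. c1.G (%y. 1 + s * f y) x) has_real_derivative (LINT om|M1. c1.csum f x om)) (at 0)"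
  by (rule c1.G_has_derivative[OF f B])
 \<comment> \<open>The factor 2 keeps \<open>1 + t * f y\<close> above 1/2, because
   \<open>G_eq\<close> needs a positive lower bound.\<close>
 define e where "e = min (1 / (2 * B)) ((c1.theta - 1) / B)"
 have e: "0 < e" using B c1.theta by (simp add: e_def)
 have eB: "e * B <= 1 / 2" "e * B <= c1.theta - 1" using B by (simp_all add: e_def min_def field_simps)
 have eq: "c1.G (%y. 1 + t * f y) x = c2.G (%y. 1 + t * f y) x" if "\<bar>t\<bar> < e" for t
 proof (rule G_eq[where \<delta>="1 / 2"])
  fix y
  have "\<bar>t * f y\<bar> <= e * B" unfolding abs_mult using that B e by (intro mult_mono) auto
  then show "1 / 2 <= 1 + t * f y" "1 + t * f y <= c1.theta" using eB by linarith+
 qed auto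
 have "((%s. c2.G (%y. 1 + s * f y) x) has_real_derivative (LINT om|M2. c2.csum f x om)) (at 0)"
  by (rule c2.G_has_derivative[OF f B])
 then show "((%s. c1.G (%y. 1 + s * f y) x) has_real_derivative (LINT om|M2. c2.csum f x om)) (at 0)"
 proof (rule has_field_derivative_transform_within_open[where S="{-e<..<e}"])
  show "c2.G (%y. 1 + t * f y) x = c1.G (%y. 1 + t * f y) x" if "t \<in> {-e<..<e}" for t
   using that by (intro eq[symmetric]) auto
 qed (use e in auto)
qed

end

section \<open>The stationary process\<close>

lemma nn_integral_suminf_measure:
 fixes f :: "real => ennreal"
 assumes N: "sets N = sets borel" "!!j. sets (\<mu> j) = sets borel"
  and eq: "!!A. A \<in> sets borel ==> emeasure N A = (\<Sum>j::nat. emeasure (\<mu> j) A)"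
 shows "f \<in> BM borel ==> integral\<^sup>N N f = (\<Sum>j. integral\<^sup>N (\<mu> j) f)"
proof (induction rule: borel_measurable_induct)
 case (cong f g)
 then have "f = g" by auto
 with cong show ?case by simp
next
 case (set A)
 then show ?case using eq N by simp
next
 case (mult f c)
 then show ?case using N by (simp add: nn_integral_cmult measurable_cong_sets[OF N(1) refl] measurable_cong_sets[OF N(2) refl])
next
 case (add f g)
 then show ?case using N
  by (simp add: nn_integral_add measurable_cong_sets[OF N(1) refl] measurable_cong_sets[OF N(2) refl] suminf_add)
next
 case (seq F)
 have M: "integral\<^sup>N \<mu>' (%x. SUP i. F i x) = (SUP i. integral\<^sup>N \<mu>' (F i))" if "sets \<mu>' = sets borel" for \<mu>'
  using seq that by (intro nn_integral_monotone_convergence_SUP) (auto simp: measurable_cong_sets[OF that refl])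
 have "integral\<^sup>N N (%x. SUP i. F i x) = (SUP i. \<Sum>j. integral\<^sup>N (\<mu> j) (F i))"
  using M[OF N(1)] seq by simp
 also have "... = (\<Sum>j. SUP i. integral\<^sup>N (\<mu> j) (F i))"
  using seq by (intro ennreal_suminf_SUP_eq[symmetric]) (auto simp: incseq_def le_fun_def intro!: nn_integral_mono)
 also have "... = (\<Sum>j. integral\<^sup>N (\<mu> j) (%x. SUP i. F i x))"
  using M[OF N(2)] by simp
 finally show ?case by (simp add: SUP_apply[abs_def] image_image)
qed

text \<open>Scaling into \<open>subprob_algebra\<close> gives joint measurability of integrals that
  depend on a parameter; \<open>shift_integral\<close> multiplies the mass back. For infinite mass
  the scaling factor is 0, a case that clusters avoid almost surely.\<close>

definition normalised :: "real measure => real measure" where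
 "normalised \<mu> = scale_measure (1 / (1 + emeasure \<mu> UNIV)) \<mu>"

lemma measurable_normalised: "normalised \<in> measurable measure_space_real (subprob_algebra borel)"
proof (rule measurable_subprob_algebra)
 fix \<mu> :: "real measure" assume "\<mu> \<in> space measure_space_real"
 then have s: "sets \<mu> = sets borel" by (simp add: space_measure_space_real)
 then show "sets (normalised \<mu>) = sets borel" by (simp add: normalised_def)
 have sp: "space \<mu> = UNIV" using sets_eq_imp_space_eq[OF s] by simp
 have le: "1 / (1 + c) * c <= 1" for c :: ennreal
 proof (cases c)
  case (real r)
  then have "1 / (1 + c) = ennreal (1 / (1 + r))"
   by (simp add: divide_ennreal ennreal_1[symmetric] ennreal_plus[symmetric] del: ennreal_1 ennreal_plus)
  then have "1 / (1 + c) * c = ennreal (1 / (1 + r) * r)"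
   using real by (subst ennreal_mult) auto
  also have "... <= ennreal 1" using real by (intro ennreal_leI) (simp add: field_simps)
  finally show ?thesis by simp
 qed simp
 show "subprob_space (normalised \<mu>)"
  by (rule subprob_spaceI) (use le[of "emeasure \<mu> UNIV"] sp in "auto simp: normalised_def space_scale_measure")
next
 fix A :: "real set" assume [measurable]: "A \<in> sets borel"
 show "(%\<mu>. emeasure (normalised \<mu>) A) \<in> BM measure_space_real"
  unfolding normalised_def emeasure_scale_measure
  using measurable_emeasure_measure_space_real[of A] measurable_emeasure_measure_space_real[of UNIV] by measurable
qed

definition shift_integral :: "(real => ennreal) => real \<times> real measure => ennreal" where
 "shift_integral h p = (1 + emeasure (snd p) UNIV) * (\<integral>\<^sup>+y. h (fst p + y) \<partial>normalised (snd p))"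

lemma shift_integral_measurable:
 assumes [measurable]: "h \<in> BM borel"
 shows "shift_integral h \<in> BM (borel \<Otimes>\<^sub>M measure_space_real)"
proof -
 have "(%p. \<integral>\<^sup>+y. h (fst p + y) \<partial>normalised (snd p)) \<in> BM (borel \<Otimes>\<^sub>M measure_space_real)"
  by (rule nn_integral_measurable_subprob_algebra2[OF _ measurable_compose[OF measurable_snd measurable_normalised]])
   (simp add: case_prod_unfold)
 moreover have "(%p :: real \<times> real measure. emeasure (snd p) UNIV) \<in> BM (borel \<Otimes>\<^sub>M measure_space_real)"
  by (rule measurable_compose[OF measurable_snd measurable_emeasure_measure_space_real]) simp
 ultimately show ?thesis unfolding shift_integral_def[abs_def] by (intro borel_measurable_times_ennreal borel_measurable_add) auto
qed

lemma shift_integral_finite: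
 assumes "emeasure \<mu> UNIV < \<infinity>" "sets \<mu> = sets borel" and [measurable]: "h \<in> BM borel"
 shows "shift_integral h (x, \<mu>) = (\<integral>\<^sup>+y. h (x + y) \<partial>\<mu>)"
proof -
 have *: "(1 + c) * (1 / (1 + c)) = 1" if "c < \<infinity>" for c :: ennreal
  using that by (cases c) (auto simp: divide_ennreal ennreal_mult[symmetric] ennreal_1[symmetric] ennreal_plus[symmetric] simp del: ennreal_1 ennreal_plus)
 have "(%y. h (x + y)) \<in> BM \<mu>" using assms(2) by (simp add: measurable_cong_sets[OF assms(2) refl])
 then show ?thesis
  unfolding shift_integral_def normalised_def fst_conv snd_conv
  by (simp add: nn_integral_scale_measure mult.assoc[symmetric] *[OF assms(1)])
qed

locale pbc = prob_space M
 for M :: "'w measure" +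
 fixes \<nu> m :: real and \<phi> :: "real => real" and N :: "'w => real measure"
  and U :: "nat => 'w => real" and C :: "nat => 'w => real measure"
  and KK :: "nat => nat list => 'w => nat" and XX :: "nat => nat list => nat => 'w => real"
 assumes nu: "0 < \<nu>"
  and U_meas [measurable]: "!!j. U j \<in> BM M"
  and U_pois: "poisson_process M (density lborel (%_. ennreal \<nu>)) (%om. points_measure UNIV (%j. U j om))"
  and clus: "!!j. cluster M m \<phi> (KK j) (XX j)"
  and C_eq: "!!j om. om \<in> space M ==> C j om =
    points_measure {u. in_tree (%v. KK j v om) u} (position (%v i. XX j v i om))"
  and C_indep: "indep_vars (%_. measure_space_real) C UNIV"
  and UC: "indep_rvs M (\<Pi>\<^sub>M j\<in>UNIV. borel) (%om j. U j om)
    (\<Pi>\<^sub>M j\<in>UNIV. measure_space_real) (%om j. C j om)"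
  and N_sets: "!!om. om \<in> space M ==> sets (N om) = sets borel"
  and N_eq: "!!om A. om \<in> space M ==> A \<in> sets borel ==>
    emeasure (N om) A = (\<Sum>j. emeasure (translate (U j om) (C j om)) A)"

lemma poisson_branching_cluster_process_pbc:
 assumes P: "poisson_branching_cluster_process M \<nu> m \<phi> N" and "0 < \<nu>" "0 < m" "m < 1" "prob_density \<phi>"
 shows "\<exists>U C KK XX. pbc M \<nu> m \<phi> N U C KK XX"
proof -
 obtain U C where UC: "prob_space M" "!!j. U j \<in> BM M"
   "poisson_process M (density lborel (%_. ennreal \<nu>)) (%om. points_measure UNIV (%j. U j om))"
   "!!j::nat. rooted_cluster M m \<phi> (C j)"
   "prob_space.indep_vars M (%_. measure_space_real) C UNIV"
   "indep_rvs M (\<Pi>\<^sub>M j\<in>UNIV. borel) (%om j. U j om) (\<Pi>\<^sub>M j\<in>UNIV. measure_space_real) (%om j. C j om)"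
   "!!om. om \<in> space M ==> sets (N om) = sets borel"
   "!!om A. om \<in> space M ==> A \<in> sets borel ==> emeasure (N om) A = (\<Sum>j. emeasure (translate (U j om) (C j om)) A)"
  using P unfolding poisson_branching_cluster_process_def by blast
 have "\<exists>K X. cluster M m \<phi> K X \<and> (\<forall>om\<in>space M. C j om =
    points_measure {u. in_tree (%v. K v om) u} (position (%v i. X v i om)))" for j
  using UC(4)[of j] UC(1) assms(3-5) unfolding rooted_cluster_def cluster_def cluster_axioms_def by blast
 then obtain KK XX where "!!j. cluster M m \<phi> (KK j) (XX j)"
  "!!j om. om \<in> space M ==> C j om = points_measure {u. in_tree (%v. KK j v om) u} (position (%v i. XX j v i om))"
  by metis
 then have "pbc M \<nu> m \<phi> N U C KK XX"
  unfolding pbc_def pbc_axioms_def using UC assms(2) by blast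
 then show ?thesis by blast
qed

context pbc
begin

sublocale c0: cluster M m \<phi> "KK 0" "XX 0" by (rule clus)

abbreviation "tr j \<equiv> cluster.tree (KK j) (XX j)"
abbreviation "ftr j \<equiv> cluster.ftree (KK j) (XX j)"
abbreviation "pl j om \<equiv> place (cluster.fam (KK j) (XX j) om)"

lemma C_measurable [measurable]: "C j \<in> measurable M measure_space_real"
 using C_indep by (auto simp: indep_vars_def)

lemma tr_eq: "tr j om = {u. in_tree (%v. KK j v om) u}"
 unfolding cluster.tree_def[OF clus] alive_def cluster.fam_def[OF clus] by simp

lemma pl_eq: "pl j om u = position (%v i. XX j v i om) u"
 unfolding place_def cluster.fam_def[OF clus] by simp

lemma C_eq': "om \<in> space M ==> C j om = points_measure (tr j om) (pl j om)"
 unfolding tr_eq pl_eq[abs_def] by (rule C_eq)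

lemma sets_C: "om \<in> space M ==> sets (C j om) = sets borel"
 by (simp add: C_eq' points_measure_def)

lemma AE_finite: "AE om in M. \<forall>j. finite (tr j om)"
 unfolding AE_all_countable using cluster.finite_tree[OF clus] by blast

lemma nn_integral_C:
 assumes om: "om \<in> space M" and fin: "finite (tr j om)" and [measurable]: "h \<in> BM borel"
 shows "(\<integral>\<^sup>+y. h y \<partial>C j om) = (\<Sum>u\<in>ftr j om. h (pl j om u))"
 unfolding C_eq'[OF om] points_measure_def cluster.ftree_eq[OF clus fin]
 using fin by (subst nn_integral_distr) (auto simp: nn_integral_count_space_finite)

lemma shift_integral_C:
 assumes om: "om \<in> space M" and fin: "finite (tr j om)" and [measurable]: "h \<in> BM borel"
 shows "shift_integral h (x, C j om) = (\<Sum>u\<in>ftr j om. h (x + pl j om u))"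
proof (subst shift_integral_finite)
 have "emeasure (C j om) UNIV = (\<integral>\<^sup>+y. 1 \<partial>C j om)"
  using sets_eq_imp_space_eq[OF sets_C[OF om, of j]] by simp
 also have "... = (\<Sum>u\<in>ftr j om. 1)" by (rule nn_integral_C[OF om fin]) simp
 also have "... < \<infinity>" by (simp add: of_nat_less_top)
 finally show "emeasure (C j om) UNIV < \<infinity>" .
 show "(\<integral>\<^sup>+y. h (x + y) \<partial>C j om) = (\<Sum>u\<in>ftr j om. h (x + pl j om u))"
  by (rule nn_integral_C[OF om fin]) measurable
qed (use om sets_C in auto)

text \<open>Clusters are independent marks of the immigrants. First the joint law of all clusters is
  separated from that of all positions, then for fixed positions the product over \<open>j\<close>
  is separated.\<close>

lemma independent_product:
 assumes J: "finite J" and \<Psi>: "!!j. \<Psi> j \<in> BM (borel \<Otimes>\<^sub>M measure_space_real)"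
 shows "(\<integral>\<^sup>+om. (\<Prod>j\<in>J. \<Psi> j (U j om, C j om)) \<partial>M) =
  (\<integral>\<^sup>+om. (\<Prod>j\<in>J. \<integral>\<^sup>+om'. \<Psi> j (U j om, C j om') \<partial>M) \<partial>M)"
proof -
 let ?PU = "\<Pi>\<^sub>M j\<in>(UNIV::nat set). (borel :: real measure)" and ?PC = "\<Pi>\<^sub>M j\<in>(UNIV::nat set). measure_space_real"
 let ?u = "%om j. U j om" and ?c = "%om j. C j om"
 have [measurable]: "?u \<in> measurable M ?PU" "?c \<in> measurable M ?PC" using UC by (auto simp: indep_rvs_def)
 note \<Psi> [measurable]
 interpret D1: prob_space "distr M ?PU ?u" by (rule prob_space_distr) simp
 interpret D2: prob_space "distr M ?PC ?c" by (rule prob_space_distr) simp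
 interpret pair_sigma_finite "distr M ?PU ?u" "distr M ?PC ?c" ..
 have F [measurable]: "(%p. \<Prod>j\<in>J. \<Psi> j (fst p j, snd p j)) \<in> BM (?PU \<Otimes>\<^sub>M ?PC)"
  by measurable
 have "(\<integral>\<^sup>+om. (\<Prod>j\<in>J. \<Psi> j (U j om, C j om)) \<partial>M) =
   (\<integral>\<^sup>+p. (\<Prod>j\<in>J. \<Psi> j (fst p j, snd p j)) \<partial>distr M (?PU \<Otimes>\<^sub>M ?PC) (%om. (?u om, ?c om)))"
  by (subst nn_integral_distr) auto
 also have "... = (\<integral>\<^sup>+p. (\<Prod>j\<in>J. \<Psi> j (fst p j, snd p j)) \<partial>(distr M ?PU ?u \<Otimes>\<^sub>M distr M ?PC ?c))"
  by (simp add: indep_rvs_distr[OF UC])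
 also have "... = (\<integral>\<^sup>+u. (\<integral>\<^sup>+c. (\<Prod>j\<in>J. \<Psi> j (u j, c j)) \<partial>distr M ?PC ?c) \<partial>distr M ?PU ?u)"
  by (subst D2.nn_integral_fst[symmetric]) (auto simp: measurable_cong_sets[OF sets_pair_measure_cong[OF sets_distr sets_distr] refl])
 also have "... = (\<integral>\<^sup>+om. (\<integral>\<^sup>+c. (\<Prod>j\<in>J. \<Psi> j (U j om, c j)) \<partial>distr M ?PC ?c) \<partial>M)"
 proof (rule nn_integral_distr)
  have "(%(u, c). \<Prod>j\<in>J. \<Psi> j (u j, c j)) \<in> BM (?PU \<Otimes>\<^sub>M distr M ?PC ?c)"
   using F by (simp add: case_prod_unfold measurable_cong_sets[OF sets_pair_measure_cong[OF refl sets_distr] refl])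
  then have "(%u. \<integral>\<^sup>+c. (\<Prod>j\<in>J. \<Psi> j (u j, c j)) \<partial>distr M ?PC ?c) \<in> BM ?PU"
   by (rule D2.borel_measurable_nn_integral)
  then show "(%u. \<integral>\<^sup>+c. (\<Prod>j\<in>J. \<Psi> j (u j, c j)) \<partial>distr M ?PC ?c) \<in> BM (distr M ?PU ?u)"
   by simp
 qed simp
 also have "... = (\<integral>\<^sup>+om. (\<Prod>j\<in>J. \<integral>\<^sup>+om'. \<Psi> j (U j om, C j om') \<partial>M) \<partial>M)"
 proof (intro nn_integral_cong)
  fix om
  have m: "(%c. \<Psi> j (x, c)) \<in> BM measure_space_real" for j x
   by measurable
  have "(\<integral>\<^sup>+c. (\<Prod>j\<in>J. \<Psi> j (U j om, c j)) \<partial>distr M ?PC ?c) = (\<integral>\<^sup>+om'. (\<Prod>j\<in>J. \<Psi> j (U j om, C j om')) \<partial>M)"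
   by (subst nn_integral_distr) measurable
  also have "... = (\<Prod>j\<in>J. \<integral>\<^sup>+om'. \<Psi> j (U j om, C j om') \<partial>M)"
   by (rule indep_vars_nn_integral[OF J indep_vars_compose2[OF indep_vars_subset[OF C_indep]]]) (use m in auto)
  finally show "(\<integral>\<^sup>+c. (\<Prod>j\<in>J. \<Psi> j (U j om, c j)) \<partial>distr M ?PC ?c) = (\<Prod>j\<in>J. \<integral>\<^sup>+om'. \<Psi> j (U j om, C j om') \<partial>M)" .
 qed
 finally show ?thesis .
qed

lemma nn_integral_translate:
 assumes "sets \<mu> = sets borel" and [measurable]: "h \<in> BM borel"
 shows "(\<integral>\<^sup>+x. h x \<partial>translate c \<mu>) = (\<integral>\<^sup>+x. h (c + x) \<partial>\<mu>)"
 unfolding translate_def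
 by (subst nn_integral_distr) (auto simp: measurable_cong_sets[OF assms(1) refl] add.commute)

lemma nn_integral_N:
 assumes om: "om \<in> space M" and h: "h \<in> BM borel"
 shows "(\<integral>\<^sup>+x. h x \<partial>N om) = (\<Sum>j. \<integral>\<^sup>+x. h (U j om + x) \<partial>C j om)"
proof -
 have "integral\<^sup>N (N om) h = (\<Sum>j. integral\<^sup>N (translate (U j om) (C j om)) h)"
  by (rule nn_integral_suminf_measure[OF N_sets[OF om] _ N_eq[OF om] h]) (auto simp: translate_def)
 then show ?thesis by (simp add: nn_integral_translate[OF sets_C[OF om] h])
qed

lemma nn_integral_N_finite:
 assumes om: "om \<in> space M" and fin: "\<forall>j. finite (tr j om)" and [measurable]: "h \<in> BM borel"
 shows "(\<integral>\<^sup>+x. h x \<partial>N om) = (\<Sum>j. \<Sum>u\<in>ftr j om. h (U j om + pl j om u))"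
 unfolding nn_integral_N[OF om assms(3)]
 by (intro suminf_cong nn_integral_C) (use om fin in auto)

text \<open>Counts are written as countable sums over all labels, living or not, so that no
  finiteness of the trees is required at any point of the sample space.\<close>

lemma N_measurable [measurable]: "N \<in> measurable M measure_space_real"
proof (rule measurable_measure_space_realI[OF N_sets])
 fix A :: "real set" assume [measurable]: "A \<in> sets borel"
 interpret CS: sigma_finite_measure "count_space (UNIV :: nat list set)"
  by (rule sigma_finite_measure_count_space)
 define f where "f j om v = (indicator {u. in_tree (%v. KK j v om) u} v * indicator A (U j om + pl j om v) :: ennreal)" for j om v
 have fm: "(%om. f j om v) \<in> BM M" for j v
 proof -
  have [measurable]: "Measurable.pred M (%om. alive (cluster.fam (KK j) (XX j) om) v)"
   "(%om. pl j om v) \<in> BM M"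
   by (rule cluster.pred_alive_fam[OF clus], rule cluster.place_fam_measurable[OF clus])
  have "(%om. indicator {om. alive (cluster.fam (KK j) (XX j) om) v} om * indicator A (U j om + pl j om v) :: ennreal) \<in> BM M"
   by measurable
  then show ?thesis unfolding f_def tr_eq[symmetric] cluster.tree_def[OF clus] by (simp add: indicator_def)
 qed
 have "(%(om, v). f j om v) \<in> BM (M \<Otimes>\<^sub>M count_space UNIV)" for j
  by (rule measurable_pair_swap_iff[THEN iffD2], rule measurable_pair_measure_countable1) (use fm in auto)
 then have [measurable]: "(%om. \<integral>\<^sup>+v. f j om v \<partial>count_space UNIV) \<in> BM M" for j
  by (rule CS.borel_measurable_nn_integral)
 have "emeasure (N om) A = (\<Sum>j. \<integral>\<^sup>+v. f j om v \<partial>count_space UNIV)" if om: "om \<in> space M" for om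
 proof -
  have "emeasure (N om) A = (\<integral>\<^sup>+x. indicator A x \<partial>N om)" using N_sets[OF om] by simp
  also have "... = (\<Sum>j. \<integral>\<^sup>+x. indicator A (U j om + x) \<partial>C j om)" by (rule nn_integral_N[OF om]) simp
  also have "... = (\<Sum>j. \<integral>\<^sup>+v. f j om v \<partial>count_space UNIV)"
  proof (rule suminf_cong)
   fix j
   have "(\<integral>\<^sup>+x. indicator A (U j om + x) \<partial>C j om) = (\<integral>\<^sup>+v. indicator A (U j om + pl j om v) \<partial>count_space (tr j om))"
    unfolding C_eq'[OF om] points_measure_def by (subst nn_integral_distr) auto
   also have "... = (\<integral>\<^sup>+v. f j om v \<partial>count_space UNIV)"
    unfolding f_def tr_eq[symmetric]
    by (subst nn_integral_count_space_indicator) (auto simp: mult.commute)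
   finally show "(\<integral>\<^sup>+x. indicator A (U j om + x) \<partial>C j om) = (\<integral>\<^sup>+v. f j om v \<partial>count_space UNIV)" .
  qed
  finally show ?thesis .
 qed
 then have "(%om. emeasure (N om) A) \<in> BM M \<longleftrightarrow> (%om. \<Sum>j. \<integral>\<^sup>+v. f j om v \<partial>count_space UNIV) \<in> BM M"
  by (rule measurable_cong)
 then show "(%om. emeasure (N om) A) \<in> BM M" by simp
qed

lemma two: "two_clusters M M m \<phi> (KK j) (XX j) (KK 0) (XX 0)"
 unfolding two_clusters_def using clus by blast

sublocale P: poisson_loc M "density lborel (%_. ennreal \<nu>)" "%om. points_measure UNIV (%j. U j om)"
proof -
 have "sigma_finite_measure (density (lborel :: real measure) (%_. ennreal \<nu>))"
 proof
 show "\<exists>A :: real set set. countable A \<and> A \<subseteq> sets (density lborel (%_. ennreal \<nu>)) \<and> \<Union> A = space (density lborel (%_. ennreal \<nu>)) \<and>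
   (\<forall>a\<in>A. emeasure (density lborel (%_. ennreal \<nu>)) a ~= \<infinity>)"
 proof (rule exI[of _ "range (%n::nat. {- real n..real n})"], intro conjI ballI)
  show "countable (range (%n::nat. {- real n..real n}))" by simp
  show "\<Union> (range (%n::nat. {- real n..real n})) = space (density lborel (%_. ennreal \<nu>))"
  proof -
   have "x \<in> \<Union> (range (%n::nat. {- real n..real n}))" for x :: real
   proof -
    obtain n :: nat where "\<bar>x\<bar> <= real n" using real_arch_simple by blast
    then have "x \<in> {- real n..real n}" by (simp add: abs_le_iff)
    then show ?thesis by blast
   qed
   then have "\<Union> (range (%n::nat. {- real n..real n})) = (UNIV :: real set)" by blast
   then show ?thesis by simp
  qed
  show "emeasure (density lborel (%_. ennreal \<nu>)) a ~= \<infinity>" if range: "a \<in> range (%n::nat. {- real n..real n})" for a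
  proof -
   obtain n where a: "a = {- real n..real n}" using range by blast
   have "emeasure (density lborel (%_. ennreal \<nu>)) a = ennreal \<nu> * emeasure lborel a"
    unfolding a by (subst emeasure_density) (auto simp: nn_integral_cmult_indicator)
   then show ?thesis unfolding a by (simp add: ennreal_mult_eq_top_iff)
  qed
 qed auto
 qed
 then show "poisson_loc M (density lborel (%_. ennreal \<nu>)) (%om. points_measure UNIV (%j. U j om))"
  unfolding poisson_loc_def poisson_loc_axioms_def using prob_space_axioms U_pois by simp
qed

lemma nn_integral_U:
 assumes [measurable]: "h \<in> BM borel"
 shows "(\<integral>\<^sup>+x. h x \<partial>points_measure UNIV (%j. U j om)) = (\<Sum>j. h (U j om))"
 unfolding points_measure_def by (subst nn_integral_distr) (auto simp: nn_integral_count_space_nat)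

lemma csum_mean_nn:
 assumes f: "f \<in> BM borel" "!!x. 0 <= f x" "!!x. f x <= B" "0 < B"
 shows "(\<integral>\<^sup>+om. (\<Sum>u\<in>ftr j om. ennreal (f (x + pl j om u))) \<partial>M) = (\<integral>\<^sup>+om. (\<Sum>u\<in>ftr 0 om. ennreal (f (x + pl 0 om u))) \<partial>M)"
proof -
 have B: "\<bar>f x\<bar> <= B" for x using f(2,3) by simp
 have eq: "(\<integral>\<^sup>+om. (\<Sum>u\<in>ftr j om. ennreal (f (x + pl j om u))) \<partial>M) = ennreal (LINT om|M. cluster.csum (KK j) (XX j) f x om)" for j
 proof -
  interpret c: cluster M m \<phi> "KK j" "XX j" by (rule clus)
  have "integrable M (%om. B * (real (card (ftr j om)) ^ 1))" by (rule integrable_mult_right[OF c.card_power_integrable])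
  then have int: "integrable M (c.csum f x)"
  proof (rule bintegrable_bound)
   show "c.csum f x \<in> BM M" by (rule c.csum_measurable(1)[OF f(1)])
   show "AE om in M. norm (c.csum f x om) <= norm (B * real (card (ftr j om)) ^ 1)" (is "AE om in _. ?AE om")
   proof (rule AE_I2)
    fix om
    have "\<bar>c.csum f x om\<bar> <= (\<Sum>u\<in>ftr j om. \<bar>f (x + pl j om u)\<bar>)" unfolding c.csum_def by (rule sum_abs)
    also have "... <= (\<Sum>u\<in>ftr j om. B)" by (intro sum_mono B)
    finally show "?AE om" using f(4) by (simp add: mult.commute)
   qed
  qed
  have "(\<integral>\<^sup>+om. (\<Sum>u\<in>ftr j om. ennreal (f (x + pl j om u))) \<partial>M) = (\<integral>\<^sup>+om. ennreal (c.csum f x om) \<partial>M)"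
   by (intro nn_integral_cong) (simp add: c.csum_def sum_ennreal f(2))
  also have "... = ennreal (LINT om|M. c.csum f x om)"
   by (rule nn_integral_eq_integral[OF int]) (auto simp: c.csum_def f(2) intro!: sum_nonneg)
  finally show ?thesis .
 qed
 show ?thesis unfolding eq using two_clusters.csum_mean_eq[OF two[of j] f(1) B f(4), of x] by simp
qed

text \<open>Each cluster is replaced by its mean as a function of the root, the same function
  \<open>H 0\<close> for all \<open>j\<close>. Campbell's formula integrates it over the immigrants,
  and integrating the root first turns every individual into a copy of Lebesgue measure, weighted by
  the mean size \<open>1 / (1 - m)\<close>.\<close>

theorem intensity: "has_intensity M N (\<nu> / (1 - m))"
 unfolding has_intensity_def
proof (intro ballI)
 fix A :: "real set" assume A [measurable]: "A \<in> sets borel"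
 let ?h = "indicator A :: real => ennreal"
 define H where "H j x = (\<integral>\<^sup>+om. shift_integral ?h (x, C j om) \<partial>M)" for j x
 have si [measurable]: "shift_integral ?h \<in> BM (borel \<Otimes>\<^sub>M measure_space_real)"
  by (rule shift_integral_measurable) simp
 have H_eq: "H j x = (\<integral>\<^sup>+om. (\<Sum>u\<in>ftr j om. ?h (x + pl j om u)) \<partial>M)" for j x
  unfolding H_def using AE_finite AE_space
  by (intro nn_integral_cong_AE) (auto elim!: eventually_elim2 intro!: shift_integral_C)
 have HH: "H j x = H 0 x" for j x
  unfolding H_eq using csum_mean_nn[where f="indicator A" and B=1 and j=j and x=x] by (simp add: ennreal_indicator)
 have H_meas [measurable]: "H 0 \<in> BM borel"
 proof -
  have "(%(x, om). shift_integral ?h (x, C 0 om)) \<in> BM (borel \<Otimes>\<^sub>M M)" by measurable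
  from borel_measurable_nn_integral[OF this] show ?thesis unfolding H_def by simp
 qed
 have "(\<integral>\<^sup>+om. emeasure (N om) A \<partial>M) = (\<integral>\<^sup>+om. (\<Sum>j. shift_integral ?h (U j om, C j om)) \<partial>M)"
 proof (rule nn_integral_cong_AE)
  show "AE om in M. emeasure (N om) A = (\<Sum>j. shift_integral ?h (U j om, C j om))"
   using AE_finite AE_space
  proof eventually_elim
   case (elim om)
   have "emeasure (N om) A = (\<integral>\<^sup>+x. ?h x \<partial>N om)" using N_sets[OF elim(2)] by simp
   then show ?case using nn_integral_N_finite[OF elim(2,1), of ?h] shift_integral_C[OF elim(2)] elim(1) by simp
  qed
 qed
 also have "... = (\<Sum>j. \<integral>\<^sup>+om. shift_integral ?h (U j om, C j om) \<partial>M)"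
  by (rule nn_integral_suminf) measurable
 also have "... = (\<Sum>j. \<integral>\<^sup>+om. H 0 (U j om) \<partial>M)"
 proof (rule suminf_cong)
  fix j
  have "(\<integral>\<^sup>+om. shift_integral ?h (U j om, C j om) \<partial>M) = (\<integral>\<^sup>+om. H j (U j om) \<partial>M)"
   using independent_product[of "{j}" "%_. shift_integral ?h"] si by (simp add: H_def)
  then show "(\<integral>\<^sup>+om. shift_integral ?h (U j om, C j om) \<partial>M) = (\<integral>\<^sup>+om. H 0 (U j om) \<partial>M)" by (simp only: HH[of j])
 qed
 also have "... = (\<integral>\<^sup>+om. (\<Sum>j. H 0 (U j om)) \<partial>M)" by (rule nn_integral_suminf[symmetric]) measurable
 also have "... = (\<integral>\<^sup>+x. H 0 x \<partial>density lborel (%_. ennreal \<nu>))"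
  using P.campbell[OF H_meas] by (simp add: nn_integral_U)
 also have "... = ennreal \<nu> * (\<integral>\<^sup>+x. H 0 x \<partial>lborel)"
  by (subst nn_integral_density) (auto simp: nn_integral_cmult)
 also have "(\<integral>\<^sup>+x. H 0 x \<partial>lborel) = (\<integral>\<^sup>+om. (\<integral>\<^sup>+x. (\<Sum>u\<in>ftr 0 om. ?h (x + pl 0 om u)) \<partial>lborel) \<partial>M)"
  unfolding H_eq
 proof (rule c0.LM.Fubini'[symmetric])
  show "(%(x, om). \<Sum>u\<in>ftr 0 om. ?h (x + pl 0 om u)) \<in> BM (lborel \<Otimes>\<^sub>M M)"
   unfolding case_prod_unfold by (rule c0.measurable_ftree_pair) measurable
 qed
 also have "... = (\<integral>\<^sup>+om. of_nat (card (ftr 0 om)) * emeasure lborel A \<partial>M)"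
 proof (intro nn_integral_cong)
  fix om
  have "(\<integral>\<^sup>+x. ?h (x + pl 0 om u) \<partial>lborel) = emeasure lborel A" for u
   using nn_integral_lborel_shift[of ?h "pl 0 om u"] by simp
  then show "(\<integral>\<^sup>+x. (\<Sum>u\<in>ftr 0 om. ?h (x + pl 0 om u)) \<partial>lborel) = of_nat (card (ftr 0 om)) * emeasure lborel A"
   by (simp add: nn_integral_sum)
 qed
 also have "... = ennreal (1 / (1 - m)) * emeasure lborel A"
  using c0.ftree_card_mean by (simp add: nn_integral_multc)
 finally show "(\<integral>\<^sup>+om. emeasure (N om) A \<partial>M) = ennreal (\<nu> / (1 - m)) * emeasure lborel A"
  using nu c0.m by (simp add: mult.assoc[symmetric] ennreal_mult[symmetric])
qed

end

section \<open>Laplace functional of the stationary process\<close>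

lemma integrable_bounded_support:
 fixes f :: "real => real"
 assumes "sets \<mu> = sets borel" "f \<in> BM borel" "!!x. \<bar>f x\<bar> <= B" "!!x. f x ~= 0 ==> \<bar>x\<bar> <= r"
  and "emeasure \<mu> {- r..r} < \<infinity>"
 shows "integrable \<mu> f"
proof (rule bintegrable_bound)
 show "integrable \<mu> (%x. B * indicator {- r..r} x)"
  using assms by (intro integrable_mult_right integrable_real_indicator) auto
 show "f \<in> BM \<mu>" using assms by (simp add: measurable_cong_sets[OF assms(1) refl])
 show "AE x in \<mu>. norm (f x) <= norm (B * indicator {- r..r} x)" (is "AE x in _. ?AE x")
 proof (rule AE_I2)
  fix x
  show "?AE x"
   using assms(3)[of x] assms(4)[of x] by (cases "f x = 0") (auto simp: indicator_def abs_le_iff)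
 qed
qed

context pbc
begin

lemma AE_N_finite: "AE om in M. \<forall>k::nat. emeasure (N om) {- real k..real k} < \<infinity>"
 unfolding AE_all_countable
proof
 fix k :: nat
 have "(\<integral>\<^sup>+om. emeasure (N om) {- real k..real k} \<partial>M) = ennreal (\<nu> / (1 - m)) * emeasure lborel {- real k..real k}"
  using intensity unfolding has_intensity_def by (rule bspec) simp
 then have "AE om in M. emeasure (N om) {- real k..real k} ~= \<infinity>"
  by (intro nn_integral_PInf_AE measurable_compose[OF N_measurable measurable_emeasure_measure_space_real])
   (auto simp: ennreal_mult_eq_top_iff)
 then show "AE om in M. emeasure (N om) {- real k..real k} < \<infinity>" by (simp add: less_top)
qed

text \<open>The almost sure event on which all trees are finite and the process is locally finite,
  so that identities between \<open>N om\<close> and the clusters hold pointwise.\<close>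

definition good :: "'w => bool" where
 "good om \<longleftrightarrow> om \<in> space M \<and> (\<forall>j. finite (tr j om)) \<and> (\<forall>k::nat. emeasure (N om) {- real k..real k} < \<infinity>)"

lemma AE_good: "AE om in M. good om"
 using AE_space AE_finite AE_N_finite by eventually_elim (simp add: good_def)

lemma good_interval: "good om ==> emeasure (N om) {- r..r} < \<infinity>"
proof -
 assume g: "good om"
 obtain k :: nat where "r <= real k" using real_arch_simple by blast
 then have "emeasure (N om) {- r..r} <= emeasure (N om) {- real k..real k}"
  using g N_sets[of om] by (intro emeasure_mono) (auto simp: good_def)
 then show ?thesis using g by (auto simp: good_def intro: le_less_trans)
qed

abbreviation "csm j \<equiv> cluster.csum (KK j) (XX j)"
abbreviation "cpr j \<equiv> cluster.cprod (KK j) (XX j)"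

lemma csm_eq: "csm j f x om = (\<Sum>u\<in>ftr j om. f (x + pl j om u))"
 by (rule cluster.csum_def[OF clus])

lemma cpr_eq: "cpr j f x om = (\<Prod>u\<in>ftr j om. f (x + pl j om u))"
 by (rule cluster.cprod_def[OF clus])

lemma sums_N_nonneg:
 assumes g: "good om" and f [measurable]: "f \<in> BM borel" and f0: "!!x. 0 <= f x" and int: "integrable (N om) f"
 shows "(%j. csm j f (U j om) om) sums (LINT x|N om. f x)"
proof -
 have "(\<Sum>j. ennreal (csm j f (U j om) om)) = (\<Sum>j. \<Sum>u\<in>ftr j om. ennreal (f (U j om + pl j om u)))"
  unfolding csm_eq by (simp add: sum_ennreal f0)
 also have "... = (\<integral>\<^sup>+x. ennreal (f x) \<partial>N om)"
  using g by (intro nn_integral_N_finite[symmetric]) (auto simp: good_def)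
 also have "... = ennreal (LINT x|N om. f x)"
  using int f0 by (intro nn_integral_eq_integral) auto
 finally have eq: "(\<Sum>j. ennreal (csm j f (U j om) om)) = ennreal (LINT x|N om. f x)" .
 have nn: "0 <= csm j f (U j om) om" for j unfolding csm_eq by (intro sum_nonneg) (auto simp: f0)
 have sm: "summable (%j. csm j f (U j om) om)"
  using eq nn by (intro summable_suminf_not_top) auto
 have "ennreal (\<Sum>j. csm j f (U j om) om) = ennreal (LINT x|N om. f x)"
  using suminf_ennreal2[OF nn sm] eq by simp
 then have "(\<Sum>j. csm j f (U j om) om) = (LINT x|N om. f x)"
  using nn sm f0 by (subst (asm) ennreal_inj) (auto intro!: suminf_nonneg bintegral_nonneg)
 then show ?thesis using summable_sums[OF sm] by simp
qed

lemma sums_N: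
 assumes g: "good om" and f [measurable]: "f \<in> BM borel" and int: "integrable (N om) f"
 shows "(%j. csm j f (U j om) om) sums (LINT x|N om. f x)"
proof -
 have I: "integrable (N om) (%x. max 0 (f x))" "integrable (N om) (%x. max 0 (- f x))"
  using int by (intro integrable_max; simp)+
 have "(%j. csm j (%x. max 0 (f x)) (U j om) om - csm j (%x. max 0 (- f x)) (U j om) om) sums
  ((LINT x|N om. max 0 (f x)) - (LINT x|N om. max 0 (- f x)))"
  using I by (intro sums_diff sums_N_nonneg[OF g]) simp_all
 moreover have "csm j (%x. max 0 (f x)) (U j om) om - csm j (%x. max 0 (- f x)) (U j om) om = csm j f (U j om) om" for j
  unfolding csm_eq sum_subtractf[symmetric] by (intro sum.cong) (auto simp: max_def)
 moreover have "(LINT x|N om. max 0 (f x)) - (LINT x|N om. max 0 (- f x)) = (LINT x|N om. f x)"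
  by (subst bintegral_diff[OF I, symmetric]) (auto intro!: bintegral_cong simp: max_def)
 ultimately show ?thesis by simp
qed

text \<open>The exponential weight of a cluster as a measurable function of root and cluster, the
  form required by \<open>independent_product\<close>. Positive and negative part are separate
  because \<open>shift_integral\<close> takes nonnegative functions.\<close>

definition mark :: "(real => real) => real \<times> real measure => ennreal" where
 "mark f p = ennreal (exp (enn2real (shift_integral (%x. ennreal (f x)) p) - enn2real (shift_integral (%x. ennreal (- f x)) p)))"

lemma mark_measurable:
 assumes [measurable]: "f \<in> BM borel"
 shows "mark f \<in> BM (borel \<Otimes>\<^sub>M measure_space_real)"
proof -
 have [measurable]: "shift_integral (%x. ennreal (f x)) \<in> BM (borel \<Otimes>\<^sub>M measure_space_real)"
  "shift_integral (%x. ennreal (- f x)) \<in> BM (borel \<Otimes>\<^sub>M measure_space_real)"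
  by (rule shift_integral_measurable; measurable)+
 show ?thesis unfolding mark_def[abs_def] by measurable
qed

lemma mark_C:
 assumes om: "om \<in> space M" and fin: "finite (tr j om)" and [measurable]: "f \<in> BM borel"
 shows "mark f (x, C j om) = ennreal (exp (csm j f x om))"
proof -
 have pos: "ennreal y = ennreal (max 0 y)" for y by (simp add: max_def ennreal_neg)
 have e: "enn2real (shift_integral (%x. ennreal (g x)) (x, C j om)) = (\<Sum>u\<in>ftr j om. max 0 (g (x + pl j om u)))"
  if [measurable]: "g \<in> BM borel" for g
 proof -
  have "shift_integral (%x. ennreal (g x)) (x, C j om) = (\<Sum>u\<in>ftr j om. ennreal (max 0 (g (x + pl j om u))))"
   using shift_integral_C[OF om fin, of "%x. ennreal (g x)"] by (simp flip: pos)
  also have "... = ennreal (\<Sum>u\<in>ftr j om. max 0 (g (x + pl j om u)))" by (rule sum_ennreal) simp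
  finally show ?thesis by (simp add: sum_nonneg)
 qed
 have "(\<Sum>u\<in>ftr j om. max 0 (f (x + pl j om u))) - (\<Sum>u\<in>ftr j om. max 0 (- f (x + pl j om u))) = csm j f x om"
  unfolding csm_eq sum_subtractf[symmetric] by (intro sum.cong) (auto simp: max_def)
 then show ?thesis unfolding mark_def by (simp add: e)
qed

context
 fixes a :: "real => real" and \<delta> r :: real
 assumes a [measurable]: "a \<in> BM borel" and \<delta>: "0 < \<delta>" "\<delta> <= 1" and a_ge: "!!x. \<delta> <= a x" and a_le: "!!x. a x <= c0.theta"
  and a_supp: "!!x. a x ~= 1 ==> \<bar>x\<bar> <= r"
begin

lemma a_pos: "0 < a x" using a_ge[of x] \<delta> by linarith

lemma ln_a_bound: "\<bar>ln (a x)\<bar> <= \<bar>ln \<delta>\<bar> + \<bar>ln c0.theta\<bar>"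
proof -
 have "ln \<delta> <= ln (a x)" "ln (a x) <= ln c0.theta" using a_ge[of x] a_le[of x] a_pos[of x] \<delta> by auto
 then show ?thesis by linarith
qed

lemma ln_a_integrable: "good om ==> integrable (N om) (%x. ln (a x))"
proof (rule integrable_bounded_support[OF _ _ ln_a_bound, where r=r])
 show "\<bar>x\<bar> <= r" if "ln (a x) ~= 0" for x using a_supp[of x] that by (cases "a x = 1") auto
qed (use good_interval N_sets in "auto simp: good_def")

lemma cpr_exp: "cpr j a x om = exp (csm j (%x. ln (a x)) x om)"
proof -
 have "finite (ftr j om)" by (rule cluster.finite_ftree[OF clus])
 then show ?thesis unfolding cpr_eq csm_eq by (simp add: exp_sum a_pos)
qed

text \<open>With finitely many clusters, independence replaces the product over each cluster by its
  mean at the immigrant's position. Cluster 0 may stand for all, by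
  \<open>two_clusters.G_eq\<close>.\<close>

lemma partial_product:
 "(\<integral>\<^sup>+om. ennreal (\<Prod>j<n. cpr j a (U j om) om) \<partial>M) = (\<integral>\<^sup>+om. ennreal (\<Prod>j<n. c0.G a (U j om)) \<partial>M)"
proof -
 have a0: "0 <= a x" for x using a_pos[of x] by linarith
 have E: "(\<integral>\<^sup>+om. mark (%x. ln (a x)) (x, C j om) \<partial>M) = ennreal (c0.G a x)" for j x
 proof -
  have "(\<integral>\<^sup>+om. mark (%x. ln (a x)) (x, C j om) \<partial>M) = (\<integral>\<^sup>+om. ennreal (cpr j a x om) \<partial>M)"
  proof (rule nn_integral_cong_AE)
   show "AE om in M. mark (%x. ln (a x)) (x, C j om) = ennreal (cpr j a x om)"
    using AE_finite AE_space
   proof eventually_elim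
    case (elim om)
    then show ?case using mark_C[OF elim(2), of j "%x. ln (a x)" x] by (simp add: cpr_exp)
   qed
  qed
  also have "... = cluster.EG M (KK j) (XX j) a x"
   unfolding cluster.EG_def[OF clus] cpr_eq ..
  also have "... = ennreal (cluster.G M (KK j) (XX j) a x)"
   by (rule cluster.EG_eq_G[OF clus a a0 a_le])
  also have "cluster.G M (KK j) (XX j) a x = c0.G a x"
   by (rule two_clusters.G_eq[OF two a a_ge \<delta>(1) a_le])
  finally show ?thesis .
 qed
 have G0: "0 <= c0.G a x" for x
  unfolding c0.G_def by (intro bintegral_nonneg c0.cprod_bounds(1)) (use a0 a_le in auto)
 have "(\<integral>\<^sup>+om. ennreal (\<Prod>j<n. cpr j a (U j om) om) \<partial>M) = (\<integral>\<^sup>+om. (\<Prod>j<n. mark (%x. ln (a x)) (U j om, C j om)) \<partial>M)"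
 proof (rule nn_integral_cong_AE)
  show "AE om in M. ennreal (\<Prod>j<n. cpr j a (U j om) om) = (\<Prod>j<n. mark (%x. ln (a x)) (U j om, C j om))"
   using AE_finite AE_space
  proof eventually_elim
   case (elim om)
   have "(\<Prod>j<n. mark (%x. ln (a x)) (U j om, C j om)) = (\<Prod>j<n. ennreal (cpr j a (U j om) om))"
    using elim by (intro prod.cong refl) (simp add: mark_C cpr_exp)
   then show ?case by (simp add: prod_ennreal cpr_exp)
  qed
 qed
 also have "... = (\<integral>\<^sup>+om. (\<Prod>j<n. \<integral>\<^sup>+om'. mark (%x. ln (a x)) (U j om, C j om') \<partial>M) \<partial>M)"
  by (rule independent_product[where \<Psi>="%_. mark (%x. ln (a x))"]) (auto intro!: mark_measurable)
 also have "... = (\<integral>\<^sup>+om. ennreal (\<Prod>j<n. c0.G a (U j om)) \<partial>M)"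
  unfolding E by (simp add: prod_ennreal G0)
 finally show ?thesis .
qed

lemma a_minus_one_integrable: "integrable lborel (%x. a x - 1)"
proof (rule integrable_bounded_support[where r=r and B="c0.theta"])
 show "\<bar>a x - 1\<bar> <= c0.theta" for x using a_pos[of x] a_le[of x] c0.theta(1) by linarith
qed (use a_supp in "auto simp: emeasure_lborel_Icc_eq")

text \<open>\<open>ln G \<le> G - 1\<close> from above and \<open>- ln G \<le> (1 - G) / G\<close>
  from below: once \<open>G\<close> is at least \<open>g0\<close>, the logarithm inherits
  integrability from \<open>G - 1\<close>.\<close>

lemma ln_G:
 "\<exists>B. \<forall>x. \<bar>ln (c0.G a x)\<bar> <= B" "integrable lborel (%x. ln (c0.G a x))" "0 < c0.G a x"
proof -
 obtain g0 g1 where g: "0 < g0" "!!x. g0 <= c0.G a x" "!!x. c0.G a x <= g1"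
  using c0.G_bounds[OF \<delta>] a a_ge a_le by blast
 have pos: "0 < c0.G a x" for x using g(1) g(2)[of x] by linarith
 then show "0 < c0.G a x" .
 have "\<bar>ln (c0.G a x)\<bar> <= \<bar>ln g0\<bar> + \<bar>ln g1\<bar>" for x
 proof -
  have "ln g0 <= ln (c0.G a x)" "ln (c0.G a x) <= ln g1" using g(2,3)[of x] pos[of x] g(1) by auto
  then show ?thesis by linarith
 qed
 then show "\<exists>B. \<forall>x. \<bar>ln (c0.G a x)\<bar> <= B" by blast
 have a0: "0 <= a x" for x using a_pos[of x] by linarith
 note I = c0.G_minus_one(1)[OF a a0 a_le a_minus_one_integrable]
 show "integrable lborel (%x. ln (c0.G a x))"
 proof (rule bintegrable_bound)
  show "integrable lborel (%x. (1 + 1 / g0) * (c0.G a x - 1))" by (rule integrable_mult_right[OF I])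
  show "(%x. ln (c0.G a x)) \<in> BM lborel" using c0.G_measurable[OF a] by simp
  show "AE x in lborel. norm (ln (c0.G a x)) <= norm ((1 + 1 / g0) * (c0.G a x - 1))"
  proof (rule AE_I2)
   fix x
   let ?G = "c0.G a x"
   have up: "ln ?G <= ?G - 1" by (rule ln_le_minus_one[OF pos])
   have "ln (1 / ?G) <= 1 / ?G - 1" using pos[of x] by (intro ln_le_minus_one) simp
   then have lo: "- ln ?G <= (1 - ?G) / ?G" using pos[of x] by (simp add: ln_div diff_divide_distrib)
   also have "... <= \<bar>1 - ?G\<bar> / ?G" using pos[of x] by (intro divide_right_mono) auto
   also have "... <= \<bar>1 - ?G\<bar> / g0" using g(1) g(2)[of x] by (intro divide_left_mono) (auto intro: mult_pos_pos pos)
   finally have "- ln ?G <= \<bar>?G - 1\<bar> / g0" by (simp add: abs_minus_commute)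
   moreover have "0 <= \<bar>?G - 1\<bar> / g0" using g(1) by simp
   ultimately have "\<bar>ln ?G\<bar> <= \<bar>?G - 1\<bar> + \<bar>?G - 1\<bar> / g0" using up by linarith
   also have "... = (1 + 1 / g0) * \<bar>?G - 1\<bar>" by (simp add: algebra_simps)
   finally show "norm (ln ?G) <= norm ((1 + 1 / g0) * (?G - 1))" using g(1) by (simp add: abs_mult)
  qed
 qed
qed

lemma integrable_Lambda: "integrable lborel h ==> integrable (density lborel (%_. ennreal \<nu>)) (h :: real => real)"
 using nu by (subst integrable_density) auto

lemma U_sums:
 assumes [measurable]: "h \<in> BM borel" and "integrable (points_measure UNIV (%j. U j om)) h"
 shows "(%j. h (U j om)) sums (LINT x|points_measure UNIV (%j. U j om). h x :: real)"
proof -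
 have "integrable (count_space UNIV) (%j. h (U j om))"
  using assms unfolding points_measure_def by (subst (asm) integrable_distr_eq) auto
 from sums_integral_count_space_nat[OF this] show ?thesis
  unfolding points_measure_def by (subst integral_distr) auto
qed

text \<open>The products over the immigrants are exponentials of partial sums of
  \<open>ln G\<close>. The second and third parts are the domination for the limit, and the last
  evaluates it by the exponential formula for the immigrants.\<close>

lemma G_product_limit:
 "AE om in M. (%n. ennreal (\<Prod>j<n. c0.G a (U j om))) ----> ennreal (exp (LINT x|points_measure UNIV (%j. U j om). ln (c0.G a x)))"
 "AE om in M. ennreal (\<Prod>j<n. c0.G a (U j om)) <= ennreal (exp (LINT x|points_measure UNIV (%j. U j om). \<bar>ln (c0.G a x)\<bar>))"
 "(\<integral>\<^sup>+om. ennreal (exp (LINT x|points_measure UNIV (%j. U j om). \<bar>ln (c0.G a x)\<bar>)) \<partial>M) < \<infinity>"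
 "(\<integral>\<^sup>+om. ennreal (exp (LINT x|points_measure UNIV (%j. U j om). ln (c0.G a x))) \<partial>M) = ennreal (exp (\<nu> * (LINT x|lborel. c0.G a x - 1)))"
proof -
 let ?h = "%x. ln (c0.G a x)"
 have hm [measurable]: "?h \<in> BM borel" using c0.G_measurable[OF a] by measurable
 have hm' [measurable]: "(%x. \<bar>?h x\<bar>) \<in> BM borel" by measurable
 obtain B where B: "!!x. \<bar>?h x\<bar> <= B" using ln_G(1) by blast
 have int: "integrable (density lborel (%_. ennreal \<nu>)) ?h" by (rule integrable_Lambda[OF ln_G(2)])
 have ae: "AE om in M. integrable (points_measure UNIV (%j. U j om)) ?h" by (rule P.AE_integrable_N[OF int])
 have prod: "(\<Prod>j<n. c0.G a (U j om)) = exp (\<Sum>j<n. ?h (U j om))" for n om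
  by (simp add: exp_sum ln_G(3))
 show "AE om in M. (%n. ennreal (\<Prod>j<n. c0.G a (U j om))) ----> ennreal (exp (LINT x|points_measure UNIV (%j. U j om). ?h x))"
  using ae
 proof eventually_elim
  case (elim om)
  from U_sums[OF hm elim] show ?case
   unfolding prod sums_def by (intro tendsto_ennrealI tendsto_exp)
 qed
 show "AE om in M. ennreal (\<Prod>j<n. c0.G a (U j om)) <= ennreal (exp (LINT x|points_measure UNIV (%j. U j om). \<bar>?h x\<bar>))"
  using ae
 proof eventually_elim
  case (elim om)
  then have "integrable (points_measure UNIV (%j. U j om)) (%x. \<bar>?h x\<bar>)" by simp
  from U_sums[OF hm' this] have s: "(%j. \<bar>?h (U j om)\<bar>) sums (LINT x|points_measure UNIV (%j. U j om). \<bar>?h x\<bar>)" .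
  have "(\<Sum>j<n. ?h (U j om)) <= (\<Sum>j<n. \<bar>?h (U j om)\<bar>)" by (intro sum_mono) auto
  also have "... <= (\<Sum>j. \<bar>?h (U j om)\<bar>)" by (rule sum_le_suminf) (use s in "auto simp: sums_iff")
  also have "... = (LINT x|points_measure UNIV (%j. U j om). \<bar>?h x\<bar>)" using s by (simp add: sums_iff)
  finally show ?case unfolding prod by (intro ennreal_leI) simp
 qed
 have "integrable M (%om. exp (LINT x|points_measure UNIV (%j. U j om). \<bar>?h x\<bar>))"
  by (rule P.integrable_exp_abs[OF int B])
 then show "(\<integral>\<^sup>+om. ennreal (exp (LINT x|points_measure UNIV (%j. U j om). \<bar>?h x\<bar>)) \<partial>M) < \<infinity>"
  by (simp add: integrable_iff_bounded)
 have "(LINT x|density lborel (%_. ennreal \<nu>). exp (?h x) - 1) = (LINT x|density lborel (%_. ennreal \<nu>). c0.G a x - 1)"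
  by (simp add: ln_G(3))
 also have "... = \<nu> * (LINT x|lborel. c0.G a x - 1)"
  using nu c0.G_measurable[OF a] by (subst integral_density) auto
 finally have v: "(LINT x|density lborel (%_. ennreal \<nu>). exp (?h x) - 1) = \<nu> * (LINT x|lborel. c0.G a x - 1)" .
 show "(\<integral>\<^sup>+om. ennreal (exp (LINT x|points_measure UNIV (%j. U j om). ?h x)) \<partial>M) = ennreal (exp (\<nu> * (LINT x|lborel. c0.G a x - 1)))"
  using P.exp_formula[OF int B] by (subst nn_integral_eq_integral) (auto simp: v)
qed

lemma cpr_product_limit:
 "AE om in M. (%n. ennreal (\<Prod>j<n. cpr j a (U j om) om)) ----> ennreal (exp (LINT x|N om. ln (a x)))"
 using AE_good
proof eventually_elim
 case (elim om)
 have "(%x. ln (a x)) \<in> BM borel" by measurable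
 from sums_N[OF elim this ln_a_integrable[OF elim]] show ?case
  unfolding cpr_exp sums_def exp_sum[OF finite_lessThan, symmetric] by (intro tendsto_ennrealI tendsto_exp)
qed

lemma cpr_product_measurable: "(%om. ennreal (\<Prod>j<n. cpr j a (U j om) om)) \<in> BM M"
proof -
 have "(%om. cpr j a (U j om) om) \<in> BM M" for j
 proof -
  interpret c: cluster M m \<phi> "KK j" "XX j" by (rule clus)
  show ?thesis unfolding c.cprod_def[abs_def] by (rule c.measurable_ftree_compose) measurable
 qed
 then show ?thesis by measurable
qed

lemma integral_ln_a_measurable: "(%om. LINT x|N om. ln (a x)) \<in> BM M"
 by (rule measurable_compose[OF N_measurable measurable_integral_measure_space_real]) measurable

text \<open>Fatou gives finiteness before any domination is known. Applied to weights that are at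
  least 1, it supplies the dominating variable in \<open>laplace_formula\<close>.\<close>

lemma exp_integral_le: "(\<integral>\<^sup>+om. ennreal (exp (LINT x|N om. ln (a x))) \<partial>M) < \<infinity>"
proof -
 let ?C = "\<integral>\<^sup>+om. ennreal (exp (LINT x|points_measure UNIV (%j. U j om). \<bar>ln (c0.G a x)\<bar>)) \<partial>M"
 have "(\<integral>\<^sup>+om. ennreal (exp (LINT x|N om. ln (a x))) \<partial>M) <= ?C"
 proof (rule c0.nn_integral_fatou_le[OF cpr_product_measurable cpr_product_limit])
  show "(\<integral>\<^sup>+om. ennreal (\<Prod>j<n. cpr j a (U j om) om) \<partial>M) <= ?C" for n
   unfolding partial_product by (rule nn_integral_mono_AE[OF G_product_limit(2)])
 qed
 also have "... < \<infinity>" by (rule G_product_limit(3))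
 finally show ?thesis .
qed

end

theorem laplace_formula:
 assumes a [measurable]: "a \<in> BM borel" and \<delta>: "0 < \<delta>" "\<delta> <= 1" and a_ge: "!!x. \<delta> <= a x" and a_le: "!!x. a x <= c0.theta"
  and a_supp: "!!x. a x ~= 1 ==> \<bar>x\<bar> <= r"
 shows "integrable M (%om. exp (LINT x|N om. ln (a x)))"
  and "(LINT om|M. exp (LINT x|N om. ln (a x))) = exp (\<nu> * (LINT x|lborel. c0.G a x - 1))"
proof -
 \<comment> \<open>Partial products of \<open>a\<close> may exceed their limit, since factors below
   1 can come late. Partial products of \<open>max (a x) 1\<close> increase, so their limit
   dominates all of them.\<close>
 let ?b = "%x. max (a x) 1"
 have b: "?b \<in> BM borel" "!!x. \<delta> <= ?b x" "!!x. ?b x <= c0.theta" "!!x. ?b x ~= 1 ==> \<bar>x\<bar> <= r"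
 proof -
  show "?b \<in> BM borel" by measurable
  show "\<delta> <= ?b x" for x using a_ge[of x] by simp
  show "?b x <= c0.theta" for x using a_le[of x] c0.theta(1) by simp
  show "?b x ~= 1 ==> \<bar>x\<bar> <= r" for x using a_supp[of x] by (auto simp: max_def split: if_splits)
 qed
 note ctx_a = a \<delta> a_ge a_le a_supp and ctx_b = b(1) \<delta> b(2-4)
 have a_pos: "0 < a x" for x using a_ge[of x] \<delta> by linarith
 have dom: "AE om in M. ennreal (\<Prod>j<n. cpr j a (U j om) om) <= ennreal (exp (LINT x|N om. ln (?b x)))" for n
  using AE_good
 proof eventually_elim
  case (elim om)
  have bm: "(%x. ln (?b x)) \<in> BM borel" by measurable
  have s: "(%j. csm j (%x. ln (?b x)) (U j om) om) sums (LINT x|N om. ln (?b x))"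
   by (rule sums_N[OF elim bm ln_a_integrable[OF ctx_b elim]])
  have "(\<Prod>j<n. cpr j a (U j om) om) = exp (\<Sum>j<n. csm j (%x. ln (a x)) (U j om) om)"
  proof -
   have "cpr j a (U j om) om = exp (csm j (%x. ln (a x)) (U j om) om)" for j by (rule cpr_exp[OF ctx_a])
   then show ?thesis unfolding exp_sum[OF finite_lessThan] by (intro prod.cong refl)
  qed
  also have "... <= exp (\<Sum>j<n. csm j (%x. ln (?b x)) (U j om) om)"
   unfolding csm_eq exp_le_cancel_iff using a_pos by (intro sum_mono) (simp add: max_def)
  also have "(\<Sum>j<n. csm j (%x. ln (?b x)) (U j om) om) <= (LINT x|N om. ln (?b x))"
   unfolding sums_unique[OF s] using s by (intro sum_le_suminf) (auto simp: sums_iff csm_eq intro!: sum_nonneg)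
  finally show ?case by (intro ennreal_leI) simp
 qed
 have mm: "(%om. ennreal (exp (LINT x|N om. ln (a x)))) \<in> BM M"
  using integral_ln_a_measurable[OF ctx_a] by measurable
 have mb: "(%om. ennreal (exp (LINT x|N om. ln (?b x)))) \<in> BM M"
  using integral_ln_a_measurable[OF ctx_b] by measurable
 have L1: "(%n. \<integral>\<^sup>+om. ennreal (\<Prod>j<n. cpr j a (U j om) om) \<partial>M) ----> (\<integral>\<^sup>+om. ennreal (exp (LINT x|N om. ln (a x))) \<partial>M)"
  by (rule nn_integral_dominated_convergence[OF cpr_product_measurable[OF ctx_a] mm mb dom exp_integral_le[OF ctx_b] cpr_product_limit[OF ctx_a]])
 have L2: "(%n. \<integral>\<^sup>+om. ennreal (\<Prod>j<n. c0.G a (U j om)) \<partial>M) ---->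
   (\<integral>\<^sup>+om. ennreal (exp (LINT x|points_measure UNIV (%j. U j om). ln (c0.G a x))) \<partial>M)"
 proof (rule nn_integral_dominated_convergence[OF _ _ _ G_product_limit(2)[OF ctx_a] G_product_limit(3)[OF ctx_a] G_product_limit(1)[OF ctx_a]])
  note [measurable] = c0.G_measurable[OF a]
  show "(%om. ennreal (\<Prod>j<n. c0.G a (U j om))) \<in> BM M" for n by measurable
  have "(%om. LINT x|points_measure UNIV (%j. U j om). ln (c0.G a x)) \<in> BM M"
   "(%om. LINT x|points_measure UNIV (%j. U j om). \<bar>ln (c0.G a x)\<bar>) \<in> BM M"
   by (rule P.integral_N_measurable; measurable)+
  then show "(%om. ennreal (exp (LINT x|points_measure UNIV (%j. U j om). ln (c0.G a x)))) \<in> BM M"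
   "(%om. ennreal (exp (LINT x|points_measure UNIV (%j. U j om). \<bar>ln (c0.G a x)\<bar>))) \<in> BM M"
   by measurable
 qed
 have "(%n. \<integral>\<^sup>+om. ennreal (\<Prod>j<n. cpr j a (U j om) om) \<partial>M) = (%n. \<integral>\<^sup>+om. ennreal (\<Prod>j<n. c0.G a (U j om)) \<partial>M)"
  by (rule ext, rule partial_product[OF ctx_a])
 from LIMSEQ_unique[OF L1[unfolded this] L2] have eq: "(\<integral>\<^sup>+om. ennreal (exp (LINT x|N om. ln (a x))) \<partial>M) = ennreal (exp (\<nu> * (LINT x|lborel. c0.G a x - 1)))"
  using G_product_limit(4)[OF ctx_a] by (rule trans)
 show int: "integrable M (%om. exp (LINT x|N om. ln (a x)))"
  using eq integral_ln_a_measurable[OF ctx_a] by (intro integrableI_bounded) auto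
 show "(LINT om|M. exp (LINT x|N om. ln (a x))) = exp (\<nu> * (LINT x|lborel. c0.G a x - 1))"
  using eq integral_ln_a_measurable[OF ctx_a] by (subst integral_eq_nn_integral) auto
qed

end

section \<open>Reversibility\<close>

text \<open>Generating functions are taken at positive arguments only, as logarithms of the weights
  occur; hence the limit is one-sided at 0.\<close>

lemma power_series_zero_coeff:
 fixes d :: "nat => real"
 assumes B: "!!n. \<bar>d n\<bar> <= B" and z: "!!x. 0 < x ==> x < 1 ==> (%n. d n * x ^ n) sums 0"
 shows "d 0 = 0"
proof -
 have smm: "summable (%n. d n * x ^ n)" if "norm x < 1" for x
 proof (rule summable_comparison_test')
  show "summable (%n. B * norm x ^ n)" using that by (intro summable_mult summable_geometric) auto
  show "norm (d n * x ^ n) <= B * norm x ^ n" if "0 <= n" for n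
   using B[of n] by (auto simp: abs_mult power_abs intro!: mult_right_mono)
 qed
 have "((%x. \<Sum>n. d n * x ^ n) \<longlongrightarrow> d 0) (at 0)"
  by (rule powser_limit_0[of 1]) (use smm summable_sums in auto)
 then have 1: "((%x. \<Sum>n. d n * x ^ n) \<longlongrightarrow> d 0) (at_right 0)"
  by (rule tendsto_within_subset) simp
 have "(\<Sum>n. d n * x ^ n) = 0" if "0 < x" "x < 1" for x
  by (rule sums_unique[OF z[OF that], symmetric])
 then have "eventually (%x. (\<Sum>n. d n * x ^ n) = 0) (at_right (0::real))"
  unfolding eventually_at_right_field by (intro exI[of _ 1]) auto
 then have 2: "((%x. \<Sum>n. d n * x ^ n) \<longlongrightarrow> 0) (at_right (0::real))" by (rule tendsto_eventually)
 show ?thesis by (rule tendsto_unique[OF trivial_limit_at_right_real 1 2])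
qed

lemma power_series_zero:
 fixes d :: "nat => real"
 assumes "!!n. \<bar>d n\<bar> <= B" "!!x. 0 < x ==> x < 1 ==> (%n. d n * x ^ n) sums 0"
 shows "d k = 0"
 using assms
proof (induction k arbitrary: d)
 case 0
 then show ?case by (rule power_series_zero_coeff)
next
 case (Suc k)
 have d0: "d 0 = 0" by (rule power_series_zero_coeff[OF Suc.prems])
 show ?case
 proof (rule Suc.IH[of "%n. d (Suc n)"])
  fix x :: real assume x: "0 < x" "x < 1"
  have "(%n. d (Suc n) * x ^ Suc n) sums 0"
   using Suc.prems(2)[OF x] d0 sums_Suc_iff[of "%n. d n * x ^ n" 0] by simp
  then have "(%n. (d (Suc n) * x ^ Suc n) / x) sums (0 / x)" by (rule sums_divide)
  then show "(%n. d (Suc n) * x ^ n) sums 0" using x by simp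
 qed (use Suc.prems in auto)
qed

text \<open>\<open>R\<close> carries the remaining coordinates. The function \<open>g\<close> is
  general in order to serve twice: for powers, to identify the coefficients, and for indicators, to
  sum them over an event.\<close>

lemma (in prob_space) pgf_sums:
 fixes R :: "'a => real" and c :: "'a => nat" and g :: "nat => real"
 assumes [measurable]: "R \<in> BM M" "c \<in> measurable M (count_space UNIV)"
  and R: "!!om. 0 <= R om" "!!om. R om <= 1" and g: "!!n. \<bar>g n\<bar> <= 1"
 shows "(%n. (LINT om|M. R om * indicator {n} (c om)) * g n) sums (LINT om|M. R om * g (c om))"
proof -
 have [measurable]: "(%om. indicator {n} (c om) :: real) \<in> BM M" for n
  by (rule measurable_compose[OF assms(2)]) simp
 have [measurable]: "(%om. g (c om)) \<in> BM M" by (rule measurable_compose[OF assms(2)]) simp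
 have [measurable]: "(%om. \<Sum>n<N. R om * indicator {n} (c om) * g n) \<in> BM M" for N by measurable
 have bd: "\<bar>R om * y\<bar> <= 1" if "\<bar>y\<bar> <= 1" for om y
  using R[of om] that by (simp add: abs_mult mult_le_one)
 have "(%N. LINT om|M. (\<Sum>n<N. R om * indicator {n} (c om) * g n)) ----> (LINT om|M. R om * g (c om))"
 proof (rule integral_dominated_convergence[where w="%_. 1"])
  have eq: "(\<Sum>n<N. R om * indicator {n} (c om) * g n) = (if c om < N then R om * g (c om) else 0)" for N om
  proof -
   have "(\<Sum>n<N. R om * indicator {n} (c om) * g n) = (\<Sum>n<N. if n = c om then R om * g (c om) else 0)"
    by (intro sum.cong) (auto simp: indicator_def)
   then show ?thesis by simp
  qed
  show "AE om in M. (%N. \<Sum>n<N. R om * indicator {n} (c om) * g n) ----> R om * g (c om)" (is "AE om in _. ?AE om")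
  proof (rule AE_I2)
   fix om
   have "eventually (%N. c om < N) sequentially" by (rule eventually_gt_at_top)
   then have "eventually (%N. (\<Sum>n<N. R om * indicator {n} (c om) * g n) = R om * g (c om)) sequentially"
    by eventually_elim (simp add: eq)
   then show "?AE om" by (rule tendsto_eventually)
  qed
  show "AE om in M. norm (\<Sum>n<N. R om * indicator {n} (c om) * g n) <= 1" for N
   unfolding eq using bd[OF g] by auto
 qed auto
 moreover have "(LINT om|M. (\<Sum>n<N. R om * indicator {n} (c om) * g n)) = (\<Sum>n<N. (LINT om|M. R om * indicator {n} (c om)) * g n)" for N
 proof -
  have "integrable M (%om. R om * indicator {n} (c om))" for n
   by (rule integrable_const_bound[of _ 1]) (use R in "auto simp: indicator_def abs_of_nonneg")
  then show ?thesis by (subst bintegral_sum) auto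
 qed
 ultimately show ?thesis by (simp add: sums_def)
qed

text \<open>Coordinates are converted one by one from \<open>z i ^ c i om\<close> to the indicator
  of \<open>B i\<close>; \<open>J\<close> holds those already converted. In the next variable both
  means are power series that agree on an interval, so their coefficients agree and may be summed
  over \<open>B k\<close>.\<close>

lemma (in prob_space) pgf_determines:
 fixes c c' :: "'i => 'a => nat"
 assumes I: "finite I" and c: "!!i. c i \<in> measurable M (count_space UNIV)" and c': "!!i. c' i \<in> measurable M (count_space UNIV)"
  and pgf: "!!z. (!!i. 0 < z i) ==> (!!i. z i <= 1) ==>
   (LINT om|M. (\<Prod>i\<in>I. z i ^ c i om)) = (LINT om|M. (\<Prod>i\<in>I. z i ^ c' i om :: real))"
 shows "prob {om \<in> space M. \<forall>i\<in>I. c i om \<in> B i} = prob {om \<in> space M. \<forall>i\<in>I. c' i om \<in> B i}"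
proof -
 note [measurable] = c c'
 define R where "R d J z om = (\<Prod>i\<in>J. indicator (B i) (d i om)) * (\<Prod>i\<in>I - J. z i ^ d i om :: real)"
  for d :: "'i => 'a => nat" and J z om
 have "\<forall>z. (\<forall>i. 0 < z i) --> (\<forall>i. z i <= 1) --> (LINT om|M. R c J z om) = (LINT om|M. R c' J z om)" if "finite J" "J \<subseteq> I" for J
  using that
 proof (induction J rule: finite_induct)
  case empty
  then show ?case using pgf by (simp add: R_def)
 next
  case (insert k J)
  have k: "k \<in> I" "k \<notin> J" using insert by auto
  show ?case
  proof (intro allI impI)
   fix z :: "'i => real" assume z: "\<forall>i. 0 < z i" "\<forall>i. z i <= 1"
   define Q where "Q d om = (\<Prod>i\<in>J. indicator (B i) (d i om)) * (\<Prod>i\<in>I - J - {k}. z i ^ d i om :: real)"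
    for d :: "'i => 'a => nat" and om
   have Qm: "Q c \<in> BM M" "Q c' \<in> BM M"
    unfolding Q_def by measurable
   have Q0: "0 <= Q d om" for d om
    unfolding Q_def using z(1) by (intro mult_nonneg_nonneg prod_nonneg) (auto intro: less_imp_le)
   have Q1: "Q d om <= 1" for d om
    unfolding Q_def using z by (intro mult_le_one prod_le_1 prod_nonneg) (auto intro: less_imp_le power_le_one)
   have Rt: "R d J (z(k := t)) om = Q d om * t ^ d k om" for d t om
   proof -
    have "(\<Prod>i\<in>I - J. (z(k := t)) i ^ d i om) = t ^ d k om * (\<Prod>i\<in>I - J - {k}. (z(k := t)) i ^ d i om)"
    using I k by (subst prod.remove[of _ k]) auto
    also have "(\<Prod>i\<in>I - J - {k}. (z(k := t)) i ^ d i om) = (\<Prod>i\<in>I - J - {k}. z i ^ d i om)"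
    by (intro prod.cong) auto
    finally show ?thesis by (simp add: R_def Q_def mult_ac)
   qed
   have Rk: "R d (insert k J) z om = Q d om * indicator (B k) (d k om)" for d om
   proof -
    have "I - insert k J = I - J - {k}" by auto
    then show ?thesis using insert.hyps by (simp add: R_def Q_def)
   qed
   define e where "e d n = (LINT om|M. Q d om * indicator {n} (d k om))" for d n
   have eb: "\<bar>e d n\<bar> <= 1" if "Q d \<in> BM M" "d k \<in> measurable M (count_space UNIV)" for d n
   proof -
    note [measurable] = that
    have "\<bar>e d n\<bar> <= (LINT om|M. \<bar>Q d om * indicator {n} (d k om)\<bar>)" unfolding e_def by (rule integral_abs_bound)
    also have "... <= (LINT om|M. 1)"
    using Q0 Q1 by (intro integral_mono_AE' AE_I2) (auto simp: indicator_def)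
    finally show ?thesis by (simp add: prob_space)
   qed
   have "e c n - e c' n = 0" for n
   proof (rule power_series_zero[where B=2])
    show "\<bar>e c n - e c' n\<bar> <= 2" for n using eb[OF Qm(1) c, of n] eb[OF Qm(2) c', of n] by linarith
    fix t :: real assume t: "0 < t" "t < 1"
    have g: "\<bar>t ^ n\<bar> <= 1" for n using t by (simp add: power_le_one)
    have "(LINT om|M. R c J (z(k := t)) om) = (LINT om|M. R c' J (z(k := t)) om)"
    using insert.IH insert.prems z t by simp
    then have "(LINT om|M. Q c om * t ^ c k om) = (LINT om|M. Q c' om * t ^ c' k om)" unfolding Rt .
    moreover have "(%n. e c n * t ^ n) sums (LINT om|M. Q c om * t ^ c k om)"
    unfolding e_def by (rule pgf_sums[OF Qm(1) c Q0 Q1 g])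
    moreover have "(%n. e c' n * t ^ n) sums (LINT om|M. Q c' om * t ^ c' k om)"
    unfolding e_def by (rule pgf_sums[OF Qm(2) c' Q0 Q1 g])
    ultimately show "(%n. (e c n - e c' n) * t ^ n) sums 0"
    using sums_diff[of "%n. e c n * t ^ n" _ "%n. e c' n * t ^ n"] by (fastforce simp: left_diff_distrib)
   qed
   then have ee: "e c = e c'" by auto
   have gi: "\<bar>indicator (B k) n :: real\<bar> <= 1" for n by (simp add: indicator_def)
   have "(LINT om|M. Q c om * indicator (B k) (c k om)) = (LINT om|M. Q c' om * indicator (B k) (c' k om))"
   proof (rule sums_unique2)
    show "(%n. e c n * indicator (B k) n) sums (LINT om|M. Q c om * indicator (B k) (c k om))"
    unfolding e_def by (rule pgf_sums[OF Qm(1) c Q0 Q1 gi])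
    show "(%n. e c n * indicator (B k) n) sums (LINT om|M. Q c' om * indicator (B k) (c' k om))"
    unfolding ee unfolding e_def by (rule pgf_sums[OF Qm(2) c' Q0 Q1 gi])
   qed
   then show "(LINT om|M. R c (insert k J) z om) = (LINT om|M. R c' (insert k J) z om)" unfolding Rk .
  qed
 qed
 from this[OF I order_refl, rule_format, of "%_. 1"]
 have "(LINT om|M. (\<Prod>i\<in>I. indicator (B i) (c i om) :: real)) = (LINT om|M. (\<Prod>i\<in>I. indicator (B i) (c' i om)))"
  by (simp add: R_def[abs_def])
 moreover have "(LINT om|M. (\<Prod>i\<in>I. indicator (B i) (d i om) :: real)) = prob {om \<in> space M. \<forall>i\<in>I. d i om \<in> B i}" for d :: "'i => 'a => nat"
 proof -
  have "(LINT om|M. (\<Prod>i\<in>I. indicator (B i) (d i om) :: real)) = (LINT om|M. indicator {om \<in> space M. \<forall>i\<in>I. d i om \<in> B i} om)"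
   using I by (intro bintegral_cong) (auto simp: indicator_def prod_zero_iff)
  then show ?thesis by (simp add: Int_absorb2 subset_eq)
 qed
 ultimately show ?thesis by simp
qed

section \<open>Uniqueness of the law of an integer-valued point process\<close>

definition bounded_borel :: "real set set" where
 "bounded_borel = {A \<in> sets borel. \<exists>r. A \<subseteq> {- r..r}}"

definition cylinders :: "real measure set set" where
 "cylinders = {{\<mu> \<in> space measure_space_real. \<forall>A\<in>F. emeasure \<mu> A \<in> B A} | F B.
  finite F \<and> F \<subseteq> bounded_borel \<and> (\<forall>A\<in>F. B A \<in> sets borel)}"

lemma cylinders_sets: "X \<in> cylinders ==> X \<in> sets measure_space_real"
proof -
 assume "X \<in> cylinders"
 then obtain F B where X: "X = {\<mu> \<in> space measure_space_real. \<forall>A\<in>F. emeasure \<mu> A \<in> B A}"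
  and F: "finite F" "F \<subseteq> bounded_borel" "!!A. A \<in> F ==> B A \<in> sets borel"
  unfolding cylinders_def by blast
 show "X \<in> sets measure_space_real"
  unfolding X
 proof (rule sets.sets_Collect_finite_All[OF _ F(1)])
  fix A assume A: "A \<in> F"
  then have "A \<in> sets borel" using F(2) by (auto simp: bounded_borel_def)
  from measurable_sets[OF measurable_emeasure_measure_space_real[OF this] F(3)[OF A]]
  show "{\<mu> \<in> space measure_space_real. emeasure \<mu> A \<in> B A} \<in> sets measure_space_real"
   by (simp add: vimage_def Int_def conj_commute)
 qed
qed

lemma Int_stable_cylinders: "Int_stable cylinders"
proof (rule Int_stableI)
 fix X Y assume "X \<in> cylinders" "Y \<in> cylinders"
 then obtain F B F' B' where X: "X = {\<mu> \<in> space measure_space_real. \<forall>A\<in>F. emeasure \<mu> A \<in> B A}"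
  and F: "finite F" "F \<subseteq> bounded_borel" "\<forall>A\<in>F. B A \<in> sets borel"
  and Y: "Y = {\<mu> \<in> space measure_space_real. \<forall>A\<in>F'. emeasure \<mu> A \<in> B' A}"
  and F': "finite F'" "F' \<subseteq> bounded_borel" "\<forall>A\<in>F'. B' A \<in> sets borel"
  unfolding cylinders_def by blast
 define C where "C A = (if A \<in> F then B A else UNIV) \<inter> (if A \<in> F' then B' A else UNIV)" for A
 have "X \<inter> Y = {\<mu> \<in> space measure_space_real. \<forall>A\<in>F \<union> F'. emeasure \<mu> A \<in> C A}"
  unfolding X Y C_def by auto
 moreover have "\<forall>A\<in>F \<union> F'. C A \<in> sets borel" using F(3) F'(3) by (auto simp: C_def)
 ultimately show "X \<inter> Y \<in> cylinders"
  unfolding cylinders_def using F F' by (intro CollectI exI[of _ "F \<union> F'"] exI[of _ C]) auto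
qed

text \<open>Cylinders are restricted to bounded sets, where the counts are finite. They still
  generate, since the evaluation at any Borel set is an increasing limit of evaluations at bounded
  ones.\<close>

lemma sets_measure_space_real_cylinders:
 "sets measure_space_real = sigma_sets (space measure_space_real) cylinders"
proof
 show "sigma_sets (space measure_space_real) cylinders \<subseteq> sets measure_space_real"
  by (rule sets.sigma_sets_subset) (use cylinders_sets in auto)
 let ?S = "sigma (space measure_space_real) cylinders"
 have sub: "cylinders \<subseteq> Pow (space measure_space_real)" by (auto simp: cylinders_def)
 have sp: "space ?S = space measure_space_real" by (rule space_measure_of[OF sub])
 have bnd: "(%\<mu>. emeasure \<mu> A) \<in> BM ?S" if A: "A \<in> bounded_borel" for A
 proof (rule measurableI)
  fix B :: "ennreal set" assume "B \<in> sets borel"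
  then have "{\<mu> \<in> space measure_space_real. \<forall>A'\<in>{A}. emeasure \<mu> A' \<in> B} \<in> cylinders"
   unfolding cylinders_def using A by (intro CollectI exI[of _ "{A}"] exI[of _ "%_. B"]) auto
  then have "{\<mu> \<in> space measure_space_real. emeasure \<mu> A \<in> B} \<in> sets ?S"
   using sub by (simp add: sigma_sets.Basic)
  then show "(%\<mu>. emeasure \<mu> A) -` B \<inter> space ?S \<in> sets ?S"
   unfolding sp by (simp add: vimage_def Int_def conj_commute)
 qed simp
 have "(%\<mu>. \<mu>) \<in> measurable ?S measure_space_real"
 proof (rule measurable_measure_space_realI)
  show "sets \<mu> = sets borel" if "\<mu> \<in> space ?S" for \<mu> using that sp by (simp add: space_measure_space_real)
  fix A :: "real set" assume A: "A \<in> sets borel"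
  have "(%\<mu>. emeasure \<mu> A) \<in> BM ?S \<longleftrightarrow> (%\<mu>. SUP k::nat. emeasure \<mu> (A \<inter> {- real k..real k})) \<in> BM ?S"
  proof (rule measurable_cong)
   fix \<mu> assume "\<mu> \<in> space ?S"
   then have s: "sets \<mu> = sets borel" using sp by (simp add: space_measure_space_real)
   have "(SUP k::nat. emeasure \<mu> (A \<inter> {- real k..real k})) = emeasure \<mu> (\<Union>k::nat. A \<inter> {- real k..real k})"
   proof (rule SUP_emeasure_incseq)
    show "range (%k::nat. A \<inter> {- real k..real k}) \<subseteq> sets \<mu>" using A unfolding s by auto
    show "incseq (%k::nat. A \<inter> {- real k..real k})"
    proof (rule incseq_SucI, rule subsetI)
    fix k x assume "x \<in> A \<inter> {- real k..real k}"
    then show "x \<in> A \<inter> {- real (Suc k)..real (Suc k)}" by auto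
    qed
   qed
   also have "(\<Union>k::nat. A \<inter> {- real k..real k}) = A"
   proof -
    have "\<exists>k::nat. x \<in> {- real k..real k}" for x
    proof -
    obtain k :: nat where "\<bar>x\<bar> <= real k" using real_arch_simple by blast
    then have "x \<in> {- real k..real k}" by (simp add: abs_le_iff)
    then show ?thesis by blast
    qed
    then show ?thesis by blast
   qed
   finally show "emeasure \<mu> A = (SUP k::nat. emeasure \<mu> (A \<inter> {- real k..real k}))" ..
  qed
  moreover have "(%\<mu>. SUP k::nat. emeasure \<mu> (A \<inter> {- real k..real k})) \<in> BM ?S"
  proof (intro borel_measurable_SUP bnd)
   show "A \<inter> {- real k..real k} \<in> bounded_borel" for k :: nat
    unfolding bounded_borel_def using A by (intro CollectI conjI exI[of _ "real k"]) auto
  qed auto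
  ultimately show "(%\<mu>. emeasure \<mu> A) \<in> BM ?S" by simp
 qed
 then have "X \<in> sets ?S" if "X \<in> sets measure_space_real" for X
  using measurable_sets[OF _ that, of "%\<mu>. \<mu>" ?S] sets.sets_into_space[OF that] sp by (simp add: Int_absorb2 subset_eq)
 then show "sets measure_space_real \<subseteq> sigma_sets (space measure_space_real) cylinders"
  using sub by auto
qed

lemma exp_sum_measure_measurable:
 assumes P: "P \<in> measurable M measure_space_real" and F: "F \<subseteq> bounded_borel"
 shows "(%om. exp (\<Sum>A\<in>F. ln (z A) * measure (P om) A :: real)) \<in> BM M"
proof -
 have "(%om. measure (P om) A) \<in> BM M" if "A \<in> F" for A
 proof -
  have "A \<in> sets borel" using that F by (auto simp: bounded_borel_def)
  then have [measurable]: "(%om. emeasure (P om) A) \<in> BM M"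
   by (rule measurable_compose[OF P measurable_emeasure_measure_space_real])
  show ?thesis unfolding measure_def by measurable
 qed
 then have "(%om. \<Sum>A\<in>F. ln (z A) * measure (P om) A) \<in> BM M"
  by (intro borel_measurable_sum borel_measurable_times borel_measurable_const)
 then show ?thesis by measurable
qed

text \<open>The cylinders are closed under intersection and generate, and on a cylinder both laws
  are determined by the joint generating function of finitely many integer counts.\<close>

lemma (in prob_space) point_process_distr_eqI:
 assumes N: "N \<in> measurable M measure_space_real" and N': "N' \<in> measurable M measure_space_real"
  and nat: "!!A. A \<in> bounded_borel ==> AE om in M. \<exists>n. emeasure (N om) A = of_nat n"
  and nat': "!!A. A \<in> bounded_borel ==> AE om in M. \<exists>n. emeasure (N' om) A = of_nat n"
  and pgf: "!!F z. finite F ==> F \<subseteq> bounded_borel ==> (!!A. 0 < z A) ==> (!!A. z A <= 1) ==>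
   (LINT om|M. exp (\<Sum>A\<in>F. ln (z A) * measure (N om) A)) = (LINT om|M. exp (\<Sum>A\<in>F. ln (z A) * measure (N' om) A))"
 shows "distr M measure_space_real N = distr M measure_space_real N'"
proof (rule measure_eqI_generator_eq[where E=cylinders and \<Omega>="space measure_space_real" and A="%_. space measure_space_real"])
 have nats: "\<forall>A\<in>bounded_borel. AE om in M. \<exists>n. emeasure (N om) A = of_nat n"
  and nats': "\<forall>A\<in>bounded_borel. AE om in M. \<exists>n. emeasure (N' om) A = of_nat n"
  using nat nat' by auto
 define cnt where "cnt P A om = nat \<lfloor>measure (P om) A\<rfloor>" for P :: "'a => real measure" and A om
 fix X assume X: "X \<in> cylinders"
 then obtain F B where X_eq: "X = {\<mu> \<in> space measure_space_real. \<forall>A\<in>F. emeasure \<mu> A \<in> B A}"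
  and F: "finite F" "F \<subseteq> bounded_borel" "!!A. A \<in> F ==> B A \<in> sets borel"
  unfolding cylinders_def by blast
 have cm: "cnt P A \<in> measurable M (count_space UNIV)" if P: "P \<in> measurable M measure_space_real" "A \<in> F" for P A
 proof -
  have "A \<in> sets borel" using that F(2) by (auto simp: bounded_borel_def)
  then have [measurable]: "(%om. emeasure (P om) A) \<in> BM M"
   by (rule measurable_compose[OF P(1) measurable_emeasure_measure_space_real])
  show ?thesis unfolding cnt_def[abs_def] measure_def by measurable
 qed
 have cnt_eq: "AE om in M. \<forall>A\<in>F. emeasure (P om) A = of_nat (cnt P A om) \<and> measure (P om) A = real (cnt P A om)"
  if "\<forall>A\<in>bounded_borel. AE om in M. \<exists>n. emeasure (P om) A = of_nat n" for P
 proof -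
  have "AE om in M. \<forall>A\<in>F. \<exists>n. emeasure (P om) A = of_nat n"
   using F that by (intro AE_finite_allI) auto
  then show ?thesis
  proof eventually_elim
   case (elim om)
   show ?case
   proof
    fix A assume "A \<in> F"
    then obtain n where n: "emeasure (P om) A = of_nat n" using elim by blast
    then have "measure (P om) A = real n" by (simp add: measure_def)
    then show "emeasure (P om) A = of_nat (cnt P A om) \<and> measure (P om) A = real (cnt P A om)"
    using n by (simp add: cnt_def)
   qed
  qed
 qed
 \<comment> \<open>\<open>pgf_determines\<close> asks for measurable counts at every index, so sets
   outside \<open>F\<close> receive the constant count 0.\<close>
 define cc where "cc P A = (if A \<in> F then cnt P A else (%_. 0))" for P A
 have ccm: "cc P A \<in> measurable M (count_space UNIV)" if "P \<in> measurable M measure_space_real" for P A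
  using cm[OF that] by (simp add: cc_def)
 have E_eq: "(LINT om|M. (\<Prod>A\<in>F. z A ^ cc P A om)) = (LINT om|M. exp (\<Sum>A\<in>F. ln (z A) * measure (P om) A))"
  if P: "P \<in> measurable M measure_space_real" "\<forall>A\<in>bounded_borel. AE om in M. \<exists>n. emeasure (P om) A = of_nat n"
   and z: "!!A. 0 < z A" for P z
 proof (rule integral_cong_AE)
  note [measurable] = ccm[OF P(1)]
  show "(%om. \<Prod>A\<in>F. z A ^ cc P A om) \<in> BM M" by measurable
  show "(%om. exp (\<Sum>A\<in>F. ln (z A) * measure (P om) A)) \<in> BM M"
   by (rule exp_sum_measure_measurable[OF P(1) F(2)])
  show "AE om in M. (\<Prod>A\<in>F. z A ^ cc P A om) = exp (\<Sum>A\<in>F. ln (z A) * measure (P om) A)"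
   using cnt_eq[OF P(2)]
  proof eventually_elim
   case (elim om)
   have "exp (\<Sum>A\<in>F. ln (z A) * measure (P om) A) = (\<Prod>A\<in>F. exp (ln (z A) * measure (P om) A))"
    using F(1) by (rule exp_sum)
   also have "... = (\<Prod>A\<in>F. z A ^ cc P A om)"
    using elim z by (intro prod.cong) (auto simp: cc_def exp_of_nat2_mult)
   finally show ?case ..
  qed
 qed
 have "prob {om \<in> space M. \<forall>A\<in>F. cc N A om \<in> {n. of_nat n \<in> B A}} = prob {om \<in> space M. \<forall>A\<in>F. cc N' A om \<in> {n. of_nat n \<in> B A}}"
 proof (rule pgf_determines[OF F(1) ccm[OF N] ccm[OF N']])
  fix z :: "real set => real" assume z: "!!A. 0 < z A" "!!A. z A <= 1"
  show "(LINT om|M. (\<Prod>A\<in>F. z A ^ cc N A om)) = (LINT om|M. (\<Prod>A\<in>F. z A ^ cc N' A om))"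
   unfolding E_eq[OF N nats z(1)] E_eq[OF N' nats' z(1)] by (rule pgf[OF F(1,2) z])
 qed
 moreover have "emeasure (distr M measure_space_real P) X = ennreal (prob {om \<in> space M. \<forall>A\<in>F. cc P A om \<in> {n. of_nat n \<in> B A}})"
  if P: "P \<in> measurable M measure_space_real" "\<forall>A\<in>bounded_borel. AE om in M. \<exists>n. emeasure (P om) A = of_nat n" for P
 proof -
  have "emeasure (distr M measure_space_real P) X = emeasure M (P -` X \<inter> space M)"
   using P(1) cylinders_sets[OF X] by (rule emeasure_distr)
  also have "... = emeasure M {om \<in> space M. \<forall>A\<in>F. cc P A om \<in> {n. of_nat n \<in> B A}}"
  proof (rule emeasure_eq_AE)
   show "P -` X \<inter> space M \<in> sets M" using P(1) cylinders_sets[OF X] by (rule measurable_sets)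
   show "{om \<in> space M. \<forall>A\<in>F. cc P A om \<in> {n. of_nat n \<in> B A}} \<in> sets M"
   proof (rule sets.sets_Collect_finite_All[OF _ F(1)])
    note [measurable] = ccm[OF P(1)]
    show "{om \<in> space M. cc P A om \<in> {n. of_nat n \<in> B A}} \<in> sets M" for A by measurable
   qed
   show "AE om in M. om \<in> P -` X \<inter> space M \<longleftrightarrow> om \<in> {om \<in> space M. \<forall>A\<in>F. cc P A om \<in> {n. of_nat n \<in> B A}}"
    using cnt_eq[OF P(2)] AE_space
    by eventually_elim (auto simp: X_eq cc_def dest: measurable_space[OF P(1)])
  qed
  finally show ?thesis by (simp add: emeasure_eq_measure)
 qed
 ultimately show "emeasure (distr M measure_space_real N) X = emeasure (distr M measure_space_real N') X"
  using N nats N' nats' by simp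
next
 show "range (%_::nat. space measure_space_real) \<subseteq> cylinders"
  unfolding cylinders_def by (auto intro!: exI[of _ "{} :: real set set"])
 show "emeasure (distr M measure_space_real N) (space measure_space_real) ~= \<infinity>" for i :: nat
  using N by (simp add: emeasure_distr)
qed (use Int_stable_cylinders sets_measure_space_real_cylinders in "auto simp: cylinders_def")

text \<open>The terms are natural numbers tending to 0, so all but finitely many of them
  vanish.\<close>

lemma suminf_of_nat_finite:
 fixes n :: "nat => nat"
 assumes "(\<Sum>j. of_nat (n j) :: ennreal) < \<infinity>"
 shows "\<exists>k. (\<Sum>j. of_nat (n j) :: ennreal) = of_nat k"
proof -
 have eq: "(\<Sum>j. of_nat (n j) :: ennreal) = (\<Sum>j. ennreal (real (n j)))" by (simp add: ennreal_of_nat_eq_real_of_nat)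
 have "summable (%j. real (n j))" by (rule summable_suminf_not_top) (use assms eq in auto)
 then have "(%j. real (n j)) ----> 0" by (rule summable_LIMSEQ_zero)
 from order_tendstoD(2)[OF this, of 1] obtain J where J: "!!j. J <= j ==> n j < 1"
  by (auto simp: eventually_sequentially)
 have "(\<Sum>j. of_nat (n j) :: ennreal) = (\<Sum>j<J. of_nat (n j))"
  by (rule suminf_finite) (use J in "auto simp: not_less")
 then show ?thesis by (metis of_nat_sum)
qed

section \<open>Reversibility of the stationary process\<close>

context pbc
begin

lemma N_integer_valued:
 assumes A: "A \<in> bounded_borel" and g: "good om"
 shows "\<exists>n. emeasure (N om) A = of_nat n"
proof -
 have [measurable]: "A \<in> sets borel" using A by (simp add: bounded_borel_def)
 obtain r where r: "A \<subseteq> {- r..r}" using A by (auto simp: bounded_borel_def)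
 have om: "om \<in> space M" "\<forall>j. finite (tr j om)" using g by (auto simp: good_def)
 have "emeasure (N om) A = (\<integral>\<^sup>+x. indicator A x \<partial>N om)" using N_sets[OF om(1)] by simp
 also have "... = (\<Sum>j. \<Sum>u\<in>ftr j om. indicator A (U j om + pl j om u))" by (rule nn_integral_N_finite[OF om]) simp
 also have "... = (\<Sum>j. of_nat (\<Sum>u\<in>ftr j om. indicator A (U j om + pl j om u)))"
  by (intro suminf_cong) (simp add: indicator_def of_nat_sum if_distrib[of of_nat] cong: if_cong)
 finally have eq: "emeasure (N om) A = (\<Sum>j. of_nat (\<Sum>u\<in>ftr j om. indicator A (U j om + pl j om u)))" .
 have "emeasure (N om) A <= emeasure (N om) {- r..r}"
  using r N_sets[OF om(1)] by (intro emeasure_mono) auto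
 also have "... < \<infinity>" by (rule good_interval[OF g])
 finally show ?thesis unfolding eq by (rule suminf_of_nat_finite)
qed

text \<open>\<open>laplace_formula\<close> integrates the cluster functional over all roots, so the
  reflection of the root in \<open>G_reflect\<close> is undone by a substitution in that
  integral.\<close>

lemma laplace_reflect:
 assumes even: "even_fun \<phi>"
  and a [measurable]: "a \<in> BM borel" and \<delta>: "0 < \<delta>" "\<delta> <= 1" and a_ge: "!!x. \<delta> <= a x" and a_le: "!!x. a x <= c0.theta"
  and a_supp: "!!x. a x ~= 1 ==> \<bar>x\<bar> <= r"
 shows "(LINT om|M. exp (LINT x|N om. ln (a (- x)))) = (LINT om|M. exp (LINT x|N om. ln (a x)))"
proof -
 have "(LINT om|M. exp (LINT x|N om. ln (a (- x)))) = exp (\<nu> * (LINT x|lborel. c0.G (%x. a (- x)) x - 1))"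
  by (rule laplace_formula(2)[where \<delta>=\<delta> and r=r]) (use \<delta> a_ge a_le a_supp[of "- _"] in auto)
 also have "(LINT x|lborel. c0.G (%x. a (- x)) x - 1) = (LINT x|lborel. c0.G (%x. a (- x)) (- x) - 1)"
  by (rule integral_lborel_uminus[symmetric])
 also have "... = (LINT x|lborel. c0.G a x - 1)"
  using c0.G_reflect[OF even a a_ge \<delta>(1) a_le] by simp
 also have "exp (\<nu> * ...) = (LINT om|M. exp (LINT x|N om. ln (a x)))"
  by (rule laplace_formula(2)[OF a \<delta> a_ge a_le a_supp, symmetric])
 finally show ?thesis .
qed

lemma sum_ln_measure:
 assumes g: "good om" and F: "finite F" "F \<subseteq> bounded_borel"
 shows "(LINT x|N om. (\<Sum>A\<in>F. ln (z A) * indicator A x)) = (\<Sum>A\<in>F. ln (z A) * measure (N om) A)"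
proof -
 have om: "om \<in> space M" using g by (simp add: good_def)
 have A: "A \<in> sets (N om)" "emeasure (N om) A < \<infinity>" if "A \<in> F" for A
 proof -
  have "A \<in> bounded_borel" using that F by auto
  from N_integer_valued[OF this g] show "emeasure (N om) A < \<infinity>" by (auto simp: of_nat_less_top)
  show "A \<in> sets (N om)" using \<open>A \<in> bounded_borel\<close> N_sets[OF om] by (simp add: bounded_borel_def)
 qed
 show ?thesis
  using A sets_eq_imp_space_eq[OF N_sets[OF om]] by (subst bintegral_sum) auto
qed

lemma emeasure_reflect:
 assumes "om \<in> space M" "A \<in> sets borel"
 shows "emeasure (reflect (N om)) A = emeasure (N om) (uminus -` A)"
 unfolding reflect_def using assms sets_eq_imp_space_eq[OF N_sets] N_sets
 by (subst emeasure_distr) (auto cong: measurable_cong_sets)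

lemma reflect_measurable: "(%om. reflect (N om)) \<in> measurable M measure_space_real"
proof (rule measurable_measure_space_realI)
 fix A :: "real set" assume A: "A \<in> sets borel"
 have A': "uminus -` A \<in> sets borel" using measurable_sets[OF _ A, of uminus borel] by simp
 have "(%om. emeasure (reflect (N om)) A) \<in> BM M \<longleftrightarrow> (%om. emeasure (N om) (uminus -` A)) \<in> BM M"
  using A by (intro measurable_cong emeasure_reflect)
 then show "(%om. emeasure (reflect (N om)) A) \<in> BM M"
  using measurable_compose[OF N_measurable measurable_emeasure_measure_space_real[OF A']] by simp
qed (simp add: reflect_def)

lemma bounded_borel_uminus: "A \<in> bounded_borel ==> uminus -` A \<in> bounded_borel"
proof -
 assume A: "A \<in> bounded_borel"
 then obtain r where r: "A \<subseteq> {- r..r}" "A \<in> sets borel" by (auto simp: bounded_borel_def)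
 have "uminus -` A \<in> sets borel" using measurable_sets[OF _ r(2), of uminus borel] by simp
 moreover have "uminus -` A \<subseteq> {- r..r}" using r(1) by force
 ultimately show ?thesis unfolding bounded_borel_def by blast
qed

theorem reversible_N:
 assumes even: "even_fun \<phi>"
 shows "reversible M N"
 unfolding reversible_def
proof (rule point_process_distr_eqI[OF N_measurable reflect_measurable])
 show "AE om in M. \<exists>n. emeasure (N om) A = of_nat n" if "A \<in> bounded_borel" for A
  using AE_good by eventually_elim (rule N_integer_valued[OF that])
 show "AE om in M. \<exists>n. emeasure (reflect (N om)) A = of_nat n" if A: "A \<in> bounded_borel" for A
  using AE_good
 proof eventually_elim
  case (elim om)
  then show ?case
   using N_integer_valued[OF bounded_borel_uminus[OF A] elim] A emeasure_reflect[of om A]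
   by (auto simp: good_def bounded_borel_def)
 qed
 fix F :: "real set set" and z :: "real set => real"
 assume F: "finite F" "F \<subseteq> bounded_borel" and z: "!!A. 0 < z A" "!!A. z A <= 1"
 \<comment> \<open>For this weight the Laplace functional is the joint generating function of the
   counts of the sets in \<open>F\<close>. The sets may overlap; a point in several of them collects
   several factors.\<close>
 define a where "a x = (\<Prod>A\<in>F. if x \<in> A then z A else 1)" for x
 have Fm: "A \<in> sets borel" if "A \<in> F" for A using that F(2) by (auto simp: bounded_borel_def)
 have am [measurable]: "a \<in> BM borel"
  unfolding a_def using Fm by (intro borel_measurable_prod measurable_If_set) auto
 have ln_a: "ln (a x) = (\<Sum>A\<in>F. ln (z A) * indicator A x)" for x
 proof -
  have "ln (a x) = (\<Sum>A\<in>F. ln (if x \<in> A then z A else 1))"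
   unfolding a_def by (rule ln_prod[OF F(1)]) (simp add: less_imp_neq[OF z(1), symmetric])
  also have "... = (\<Sum>A\<in>F. ln (z A) * indicator A x)" by (intro sum.cong) (auto simp: indicator_def)
  finally show ?thesis .
 qed
 define \<delta> where "\<delta> = (\<Prod>A\<in>F. z A)"
 have "0 < \<delta>" unfolding \<delta>_def by (rule prod_pos) (rule z(1))
 moreover have "\<delta> <= 1" unfolding \<delta>_def using z by (intro prod_le_1) (auto intro: less_imp_le)
 ultimately have \<delta>: "0 < \<delta>" "\<delta> <= 1" by auto
 have a_ge: "\<delta> <= a x" for x unfolding \<delta>_def a_def using z by (intro prod_mono) (auto intro: less_imp_le)
 have a_le1: "a x <= 1" for x unfolding a_def using z by (intro prod_le_1) (auto intro: less_imp_le)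
 have a_le: "a x <= c0.theta" for x using a_le1[of x] c0.theta(1) by linarith
 have "\<exists>r. \<forall>A\<in>F. A \<subseteq> {- r..r}"
  using F
 proof (induction F rule: finite_induct)
  case (insert A F)
  then obtain r where r: "\<forall>A\<in>F. A \<subseteq> {- r..r}" by auto
  obtain s where s: "A \<subseteq> {- s..s}" using insert.prems by (auto simp: bounded_borel_def)
  have "\<forall>B\<in>insert A F. B \<subseteq> {- max r s..max r s}" using r s by fastforce
  then show ?case by blast
 qed simp
 then obtain r where r: "!!A. A \<in> F ==> A \<subseteq> {- r..r}" by blast
 have a_supp: "\<bar>x\<bar> <= r" if "a x ~= 1" for x
 proof -
  have "\<exists>A\<in>F. x \<in> A"
  proof (rule ccontr)
   assume "\<not> (\<exists>A\<in>F. x \<in> A)"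
   then have "a x = 1" unfolding a_def by (intro prod.neutral) auto
   with that show False by simp
  qed
  then show ?thesis using r by (force simp: abs_le_iff)
 qed
 have "(LINT om|M. exp (\<Sum>A\<in>F. ln (z A) * measure (N om) A)) = (LINT om|M. exp (LINT x|N om. ln (a x)))"
 proof (rule integral_cong_AE)
  show "(%om. exp (\<Sum>A\<in>F. ln (z A) * measure (N om) A)) \<in> BM M"
   by (rule exp_sum_measure_measurable[OF N_measurable F(2)])
  have "(%om. LINT x|N om. ln (a x)) \<in> BM M"
   by (rule measurable_compose[OF N_measurable measurable_integral_measure_space_real]) measurable
  then show "(%om. exp (LINT x|N om. ln (a x))) \<in> BM M" by measurable
  show "AE om in M. exp (\<Sum>A\<in>F. ln (z A) * measure (N om) A) = exp (LINT x|N om. ln (a x))"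
   using AE_good by eventually_elim (simp add: ln_a sum_ln_measure[OF _ F])
 qed
 also have "... = (LINT om|M. exp (LINT x|N om. ln (a (- x))))"
  by (rule laplace_reflect[OF even am \<delta> a_ge a_le a_supp, symmetric])
 also have "... = (LINT om|M. exp (\<Sum>A\<in>F. ln (z A) * measure (reflect (N om)) A))"
 proof (rule integral_cong_AE)
  show "(%om. exp (\<Sum>A\<in>F. ln (z A) * measure (reflect (N om)) A)) \<in> BM M"
   by (rule exp_sum_measure_measurable[OF reflect_measurable F(2)])
  have "(%om. LINT x|N om. ln (a (- x))) \<in> BM M"
   by (rule measurable_compose[OF N_measurable measurable_integral_measure_space_real]) measurable
  then show "(%om. exp (LINT x|N om. ln (a (- x)))) \<in> BM M" by measurable
  show "AE om in M. exp (LINT x|N om. ln (a (- x))) = exp (\<Sum>A\<in>F. ln (z A) * measure (reflect (N om)) A)"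
   using AE_good
  proof eventually_elim
   case (elim om)
   then have om: "om \<in> space M" by (simp add: good_def)
   have "(LINT x|N om. ln (a (- x))) = (LINT x|N om. (\<Sum>A\<in>F. ln (z A) * indicator (uminus -` A) x))"
    by (intro bintegral_cong refl) (simp add: ln_a indicator_def)
   also have "... = (\<Sum>A\<in>F. LINT x|N om. ln (z A) * indicator (uminus -` A) x)"
   proof (rule bintegral_sum)
    fix A assume "A \<in> F"
    then have "uminus -` A \<in> bounded_borel" using F bounded_borel_uminus by auto
    moreover from N_integer_valued[OF this elim] have "emeasure (N om) (uminus -` A) < \<infinity>" by (auto simp: of_nat_less_top)
    ultimately show "integrable (N om) (%x. ln (z A) * indicator (uminus -` A) x)"
    using N_sets[OF om] by (intro integrable_mult_right integrable_real_indicator) (auto simp: bounded_borel_def)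
   qed
   also have "... = (\<Sum>A\<in>F. ln (z A) * measure (reflect (N om)) A)"
    using emeasure_reflect[OF om Fm] sets_eq_imp_space_eq[OF N_sets[OF om]] by (intro sum.cong refl) (simp add: measure_def)
   finally show ?case by simp
  qed
 qed
 finally show "(LINT om|M. exp (\<Sum>A\<in>F. ln (z A) * measure (N om) A)) =
   (LINT om|M. exp (\<Sum>A\<in>F. ln (z A) * measure (reflect (N om)) A))" .
qed

end

section \<open>Uniqueness of reduced transforms\<close>

text \<open>Agreement near the origin suffices: it passes to the innermost derivatives on a smaller
  cube, and so on down to order 0.\<close>

lemma has_mixed_partial_unique:
 assumes "has_mixed_partial n F D" "has_mixed_partial n F' D'" "0 < e"
  and "!!s. (\<forall>j<n. \<bar>s j\<bar> < e) ==> (\<forall>j\<ge>n. s j = 0) ==> F s = F' s"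
 shows "D = D'"
 using assms
proof (induction n arbitrary: F F' e)
 case 0
 then show ?case by auto
next
 case (Suc n)
 obtain G a where G: "0 < a" "!!s. (\<forall>j<n. \<bar>s j\<bar> < a) ==> (\<forall>j\<ge>n. s j = 0) ==>
   ((%t. F (s(n := t))) has_real_derivative G s) (at 0)" "has_mixed_partial n G D"
  using Suc.prems(1) unfolding has_mixed_partial.simps by blast
 obtain G' b where G': "0 < b" "!!s. (\<forall>j<n. \<bar>s j\<bar> < b) ==> (\<forall>j\<ge>n. s j = 0) ==>
   ((%t. F' (s(n := t))) has_real_derivative G' s) (at 0)" "has_mixed_partial n G' D'"
  using Suc.prems(2) unfolding has_mixed_partial.simps by blast
 show ?case
 proof (rule Suc.IH[OF G(3) G'(3)])
  show "0 < min e (min a b)" using G G' Suc.prems by auto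
  fix s :: "nat => real" assume s: "\<forall>j<n. \<bar>s j\<bar> < min e (min a b)" "\<forall>j\<ge>n. s j = 0"
  have "F (s(n := t)) = F' (s(n := t))" if "\<bar>t\<bar> < e" for t
   by (rule Suc.prems(4)) (use s that in "auto simp: less_Suc_eq")
  then have "eventually (%t. F (s(n := t)) = F' (s(n := t))) (nhds 0)"
   unfolding eventually_nhds_metric using Suc.prems(3) by (intro exI[of _ e]) auto
  then have "((%t. F' (s(n := t))) has_real_derivative G s) (at 0)"
   using G(2)[of s] s DERIV_cong_ev[of 0 0 "%t. F (s(n := t))" "%t. F' (s(n := t))"] by auto
  then show "G s = G' s" using G'(2)[of s] s by (auto intro: DERIV_unique)
 qed
qed

section \<open>Complex product test functions\<close>

definition bounded_support :: "(real => complex) => bool" where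
 "bounded_support f \<longleftrightarrow> f \<in> BM borel \<and> (\<exists>B. \<forall>x. norm (f x) <= B) \<and> (\<exists>r. \<forall>x. f x ~= 0 --> \<bar>x\<bar> <= r)"

lemma bounded_support_of_real:
 "bounded_compact_support f ==> bounded_support (%x. complex_of_real (f x))"
 unfolding bounded_support_def bounded_compact_support_def by auto

lemma bounded_support_Re_Im:
 assumes "bounded_support f"
 shows "bounded_compact_support (%x. Re (f x))" "bounded_compact_support (%x. Im (f x))"
proof -
 obtain B r where "f \<in> BM borel" and B: "!!x. norm (f x) <= B" and r: "!!x. f x ~= 0 ==> \<bar>x\<bar> <= r"
  using assms unfolding bounded_support_def by auto
 note [measurable] = this(1)
 have "\<bar>Re (f x)\<bar> <= B" "\<bar>Im (f x)\<bar> <= B" "Re (f x) ~= 0 ==> \<bar>x\<bar> <= r" "Im (f x) ~= 0 ==> \<bar>x\<bar> <= r" for x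
  using B[of x] abs_Re_le_cmod[of "f x"] abs_Im_le_cmod[of "f x"] r[of x] by (cases "f x = 0"; simp)+
 then show "bounded_compact_support (%x. Re (f x))" "bounded_compact_support (%x. Im (f x))"
  unfolding bounded_compact_support_def by auto
qed

lemma bounded_support_sign:
 assumes "bounded_support f" "\<epsilon> \<in> {1, -1}"
 shows "bounded_support (%x. f (\<epsilon> * x))"
proof -
 obtain B r where "f \<in> BM borel" and B: "!!x. norm (f x) <= B" and r: "!!x. f x ~= 0 ==> \<bar>x\<bar> <= r"
  using assms unfolding bounded_support_def by auto
 note [measurable] = this(1)
 have "\<bar>x\<bar> <= r" if "f (\<epsilon> * x) ~= 0" for x using r[OF that] assms(2) by auto
 then show ?thesis unfolding bounded_support_def using B by auto
qed

definition shifted_prod :: "nat => (nat => real => complex) => real \<times> (nat => real) => complex" where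
 "shifted_prod n f p = (\<Prod>j<n. f j (if j = 0 then fst p else fst p + snd p j))"

definition prod_functional :: "nat => signed_pair => (nat => real => complex) => complex" where
 "prod_functional n \<tau> f =
  (CLINT p|(lborel \<Otimes>\<^sub>M fst \<tau>). shifted_prod n f p) - (CLINT p|(lborel \<Otimes>\<^sub>M snd \<tau>). shifted_prod n f p)"

lemma shifted_coordinate_measurable:
 fixes n j :: nat
 assumes P: "sets P = sets (\<Pi>\<^sub>M j\<in>{1..<n}. (borel :: real measure))" and j: "j < n"
 shows "(%p. if j = 0 then fst p else fst p + snd p j) \<in> BM (lborel \<Otimes>\<^sub>M P)"
proof (cases "j = 0")
 case False
 then have "1 <= j" by simp
 then have "(%v. v j) \<in> BM P"
  unfolding measurable_cong_sets[OF P refl] using False j by (intro measurable_component_singleton) auto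
 from measurable_compose[OF measurable_snd this] have [measurable]: "(%p. snd p j) \<in> BM (lborel \<Otimes>\<^sub>M P)" .
 show ?thesis using False by simp
qed simp

lemma shifted_prod_measurable:
 assumes P: "sets P = sets (\<Pi>\<^sub>M j\<in>{1..<n}. (borel :: real measure))" and f: "!!j. j < n ==> f j \<in> BM borel"
 shows "shifted_prod n f \<in> BM (lborel \<Otimes>\<^sub>M P)"
 unfolding shifted_prod_def[abs_def]
 by (intro borel_measurable_prod measurable_compose[OF shifted_coordinate_measurable[OF P] f]) auto

lemma integrable_strip:
 fixes g :: "'a => 'b::{banach, second_countable_topology}"
 assumes fin: "finite_measure P" and g: "g \<in> BM P" "!!v. norm (g v) <= 1"
 shows "integrable (lborel \<Otimes>\<^sub>M P) (%p. indicator {- r..r::real} (fst p) *\<^sub>R g (snd p))"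
  and "(LINT p|(lborel \<Otimes>\<^sub>M P). indicator {- 1..1::real} (fst p) *\<^sub>R g (snd p)) = 2 *\<^sub>R (LINT v|P. g v)"
proof -
 interpret P: finite_measure P by (rule fin)
 interpret L: pair_sigma_finite lborel P by unfold_locales
 note [measurable] = g(1)
 show I: "integrable (lborel \<Otimes>\<^sub>M P) (%p. indicator {- r..r} (fst p) *\<^sub>R g (snd p))" for r :: real
 proof (rule bintegrable_bound)
  have e: "emeasure (lborel \<Otimes>\<^sub>M P) ({- r..r} \<times> space P) < \<infinity>"
   by (subst P.emeasure_pair_measure_Times) (auto simp: ennreal_mult_less_top less_top[symmetric] emeasure_lborel_Icc_eq ennreal_mult_eq_top_iff)
  show "integrable (lborel \<Otimes>\<^sub>M P) (%p. indicator ({- r..r} \<times> space P) p :: real)"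
   using e by (intro integrable_real_indicator) auto
  show "AE p in lborel \<Otimes>\<^sub>M P. norm (indicator {- r..r} (fst p) *\<^sub>R g (snd p)) <= norm (indicator ({- r..r} \<times> space P) p :: real)"
   using g(2) by (intro AE_I2) (auto simp: indicator_def space_pair_measure)
 qed measurable
 have "(LINT p|(lborel \<Otimes>\<^sub>M P). indicator {- 1..1::real} (fst p) *\<^sub>R g (snd p)) =
   (LINT x|lborel. (LINT v|P. indicator {- 1..1::real} x *\<^sub>R g v))"
  using L.integral_fst'[OF I[of 1]] by simp
 also have "... = (LINT x|lborel. indicator {- 1..1::real} x *\<^sub>R (LINT v|P. g v))" by simp
 also have "... = (LINT x|lborel. indicator {- 1..1::real} x) *\<^sub>R (LINT v|P. g v)"
  by (intro integral_scaleR_left) (auto simp: emeasure_lborel_Icc_eq)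
 finally show "(LINT p|(lborel \<Otimes>\<^sub>M P). indicator {- 1..1::real} (fst p) *\<^sub>R g (snd p)) = 2 *\<^sub>R (LINT v|P. g v)" by simp
qed

lemma shifted_prod_integrable:
 assumes P: "finite_measure P" "sets P = sets (\<Pi>\<^sub>M j\<in>{1..<n}. (borel :: real measure))" and n: "0 < n"
  and f: "!!j. j < n ==> bounded_support (f j)"
 shows "integrable (lborel \<Otimes>\<^sub>M P) (shifted_prod n f)"
proof -
 obtain B where B: "!!j x. j < n ==> norm (f j x) <= B j"
  using f unfolding bounded_support_def by metis
 obtain r where r: "!!x. f 0 x ~= 0 ==> \<bar>x\<bar> <= r" using f[OF n] unfolding bounded_support_def by auto
 show ?thesis
 proof (rule bintegrable_bound)
  show "integrable (lborel \<Otimes>\<^sub>M P) (%p. (\<Prod>j<n. B j) * (indicator {- r..r} (fst p) *\<^sub>R (1::real)))"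
   by (intro integrable_mult_right integrable_strip(1)[OF P(1)]) auto
  show "shifted_prod n f \<in> BM (lborel \<Otimes>\<^sub>M P)"
   by (rule shifted_prod_measurable[OF P(2)]) (use f in "auto simp: bounded_support_def")
  show "AE p in lborel \<Otimes>\<^sub>M P. norm (shifted_prod n f p) <= norm ((\<Prod>j<n. B j) * (indicator {- r..r} (fst p) *\<^sub>R (1::real)))" (is "AE p in _. ?AE p")
  proof (rule AE_I2)
   fix p
   have le: "norm (shifted_prod n f p) <= (\<Prod>j<n. B j)"
    unfolding shifted_prod_def prod_norm[symmetric] using B by (intro prod_mono) auto
   show "?AE p"
   proof (cases "f 0 (fst p) = 0")
    case True
    then have "shifted_prod n f p = 0"
    unfolding shifted_prod_def using n by (intro prod_zero[OF finite_lessThan]) auto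
    then show ?thesis by simp
   next
    case False
    from r[OF this] show ?thesis using le by (auto simp: indicator_def abs_le_iff)
   qed
  qed
 qed
qed

lemma shifted_prod_split:
 assumes "k < n"
 shows "shifted_prod n f p = shifted_prod n (f(k := %x. complex_of_real (Re (f k x)))) p +
   \<i> * shifted_prod n (f(k := %x. complex_of_real (Im (f k x)))) p"
proof -
 let ?y = "%j. if j = 0 then fst p else fst p + snd p j"
 have eq: "shifted_prod n (f(k := g)) p = g (?y k) * (\<Prod>j\<in>{..<n} - {k}. f j (?y j))" for g
 proof -
  have "shifted_prod n (f(k := g)) p = (f(k := g)) k (?y k) * (\<Prod>j\<in>{..<n} - {k}. (f(k := g)) j (?y j))"
   unfolding shifted_prod_def using assms by (intro prod.remove) auto
  also have "(\<Prod>j\<in>{..<n} - {k}. (f(k := g)) j (?y j)) = (\<Prod>j\<in>{..<n} - {k}. f j (?y j))"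
   by (intro prod.cong) auto
  finally show ?thesis unfolding fun_upd_same .
 qed
 have "shifted_prod n f p = f k (?y k) * (\<Prod>j\<in>{..<n} - {k}. f j (?y j))" using eq[of "f k"] by simp
 also have "f k (?y k) = complex_of_real (Re (f k (?y k))) + \<i> * complex_of_real (Im (f k (?y k)))" by (rule complex_eq)
 finally show ?thesis unfolding eq by (simp add: distrib_right mult.assoc)
qed

lemma prod_functional_split:
 assumes \<tau>: "finite_signed \<tau>" "signed_measure_on {1..<n} \<tau>" and f: "!!j. j < n ==> bounded_support (f j)" and k: "k < n"
 shows "prod_functional n \<tau> f = prod_functional n \<tau> (f(k := %x. complex_of_real (Re (f k x)))) +
   \<i> * prod_functional n \<tau> (f(k := %x. complex_of_real (Im (f k x))))"
proof -
 let ?R = "f(k := %x. complex_of_real (Re (f k x)))" and ?I = "f(k := %x. complex_of_real (Im (f k x)))"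
 have n: "0 < n" using k by simp
 have R: "bounded_support (?R j)" and I: "bounded_support (?I j)" if "j < n" for j
  using f[OF that] bounded_support_Re_Im[OF f[OF k]] by (auto intro: bounded_support_of_real)
 have "(CLINT p|(lborel \<Otimes>\<^sub>M P). shifted_prod n f p) = (CLINT p|(lborel \<Otimes>\<^sub>M P). shifted_prod n ?R p) + \<i> * (CLINT p|(lborel \<Otimes>\<^sub>M P). shifted_prod n ?I p)"
  if "finite_measure P" "sets P = sets (\<Pi>\<^sub>M j\<in>{1..<n}. (borel :: real measure))" for P
 proof -
  have "integrable (lborel \<Otimes>\<^sub>M P) (shifted_prod n ?R)" by (rule shifted_prod_integrable[OF that n]) (rule R)
  moreover have "integrable (lborel \<Otimes>\<^sub>M P) (shifted_prod n ?I)" by (rule shifted_prod_integrable[OF that n]) (rule I)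
  ultimately show ?thesis unfolding shifted_prod_split[OF k, of f] by simp
 qed
 note this[of "fst \<tau>"] this[of "snd \<tau>"]
 then show ?thesis
  using \<tau> unfolding prod_functional_def finite_signed_def signed_measure_on_def locally_finite_on_def
  by (simp add: algebra_simps)
qed

text \<open>By multilinearity real test functions determine the complex ones. Induction on
  \<open>k\<close>, the number of leading slots that may be complex: slot \<open>k\<close> is split
  into real and imaginary part. The sign \<epsilon> treats equality and reflection together.\<close>

lemma prod_functional_complex:
 assumes \<tau>: "finite_signed \<tau>" "signed_measure_on {1..<n} \<tau>" and \<tau>': "finite_signed \<tau>'" "signed_measure_on {1..<n} \<tau>'" and \<epsilon>: "\<epsilon> \<in> {1, -1}"
  and real: "!!f. (!!j. j < n ==> bounded_compact_support (f j)) ==>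
   prod_functional n \<tau> (%j x. complex_of_real (f j x)) = prod_functional n \<tau>' (%j x. complex_of_real (f j (\<epsilon> * x)))"
  and f: "!!j. j < n ==> bounded_support (f j)"
 shows "prod_functional n \<tau> f = prod_functional n \<tau>' (%j x. f j (\<epsilon> * x))"
proof -
 have "prod_functional n \<tau> f = prod_functional n \<tau>' (%j x. f j (\<epsilon> * x))"
  if "k <= n" "!!j. j < n ==> bounded_support (f j)" "!!j x. k <= j ==> j < n ==> f j x \<in> \<real>" for k f
  using that
 proof (induction k arbitrary: f)
  case 0
  have cong: "prod_functional n \<tau>'' (%j x. complex_of_real (Re (f j (d * x)))) = prod_functional n \<tau>'' (%j x. f j (d * x))" for \<tau>'' d
  proof -
   have "shifted_prod n (%j x. complex_of_real (Re (f j (d * x)))) = shifted_prod n (%j x. f j (d * x))"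
    unfolding shifted_prod_def using 0 by (intro ext prod.cong) auto
   then show ?thesis by (simp add: prod_functional_def)
  qed
  have "bounded_compact_support (%x. Re (f j x))" if "j < n" for j
   using bounded_support_Re_Im(1)[OF 0(2)[OF that]] .
  from real[of "%j x. Re (f j x)", OF this] show ?case using cong[of \<tau> 1] cong[of \<tau>' \<epsilon>] by simp
 next
  case (Suc k)
  then have k: "k < n" "k <= n" by auto
  have e: "(%j x. (f(k := g)) j (\<epsilon> * x)) = (%j x. f j (\<epsilon> * x))(k := %x. g (\<epsilon> * x))" for g by auto
  have IH: "prod_functional n \<tau> (f(k := g)) = prod_functional n \<tau>' ((%j x. f j (\<epsilon> * x))(k := %x. g (\<epsilon> * x)))"
   if g: "bounded_support g" "!!x. g x \<in> \<real>" for g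
   unfolding e[symmetric] by (rule Suc.IH[OF k(2)]) (use Suc.prems g in auto)
  note bs = bounded_support_Re_Im[OF Suc.prems(2)[OF k(1)], THEN bounded_support_of_real]
  have b': "bounded_support (%x. f j (\<epsilon> * x))" if "j < n" for j using bounded_support_sign[OF Suc.prems(2)[OF that] \<epsilon>] .
  have "prod_functional n \<tau> f = prod_functional n \<tau> (f(k := %x. complex_of_real (Re (f k x)))) +
    \<i> * prod_functional n \<tau> (f(k := %x. complex_of_real (Im (f k x))))"
   by (rule prod_functional_split[OF \<tau> _ k(1)]) (rule Suc.prems(2))
  also have "... = prod_functional n \<tau>' (%j x. f j (\<epsilon> * x))"
   using IH[OF bs(1)] IH[OF bs(2)] by (subst prod_functional_split[OF \<tau>' b' k(1)]) simp_all
  finally show ?case .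
 qed
 from this[of n f] f show ?thesis by auto
qed

text \<open>Test functions are truncated exponentials; the truncation of coordinate \<open>0\<close> stays fixed.\<close>

definition truncated_exp :: "nat => (nat => real) => nat => nat => real => complex" where
 "truncated_exp n w k j x = (if j = 0 then indicator {- 1..1} x *\<^sub>R iexp ((\<Sum>i\<in>{1..<n}. w i) * x)
  else indicator {- real k..real k} x *\<^sub>R iexp (- (w j * x)))"

lemma truncated_exp_bounded_support: "bounded_support (truncated_exp n w k j)"
proof -
 have m: "truncated_exp n w k j \<in> BM borel"
  unfolding truncated_exp_def[abs_def] by (cases "j = 0") simp_all
 have "norm (truncated_exp n w k j x) <= 1" "truncated_exp n w k j x ~= 0 ==> \<bar>x\<bar> <= max 1 (real k)" for x
  by (auto simp: truncated_exp_def indicator_def norm_mult split: if_splits)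
 then show ?thesis unfolding bounded_support_def using m by blast
qed

text \<open>Slot 0 carries the sum of all frequencies, which cancels the dependence of the other
  phases on the base point. So integrating the base point over \<open>{- 1..1}\<close> only
  contributes the length 2.\<close>

lemma prod_functional_truncated_exp:
 assumes \<tau>: "finite_signed \<tau>" "signed_measure_on {1..<n} \<tau>" and n: "0 < n"
 shows "(%k. prod_functional n \<tau> (truncated_exp n w k)) ----> 2 * fourier_stieltjes n \<tau> w"
proof -
 let ?e = "%v. iexp (- (\<Sum>j\<in>{1..<n}. w j * v j))"
 have lim: "(%k. CLINT p|(lborel \<Otimes>\<^sub>M P). shifted_prod n (truncated_exp n w k) p) ----> 2 * (CLINT v|P. ?e v)"
  if P: "finite_measure P" "sets P = sets (\<Pi>\<^sub>M j\<in>{1..<n}. (borel :: real measure))" for P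
 proof -
  have "(%v. v j) \<in> BM P" if "j \<in> {1..<n}" for j
   unfolding measurable_cong_sets[OF P(2) refl] using that by (rule measurable_component_singleton)
  then have "(%v. \<Sum>j\<in>{1..<n}. w j * v j) \<in> BM P" by (intro borel_measurable_sum borel_measurable_times) auto
  then have em: "?e \<in> BM P" by measurable
  have "(%k. CLINT p|(lborel \<Otimes>\<^sub>M P). shifted_prod n (truncated_exp n w k) p) ---->
    (CLINT p|(lborel \<Otimes>\<^sub>M P). indicator {- 1..1::real} (fst p) *\<^sub>R ?e (snd p))"
  proof (rule integral_dominated_convergence[where w="%p. indicator {- 1..1} (fst p) *\<^sub>R 1"])
   show "(%p. indicator {- 1..1::real} (fst p) *\<^sub>R ?e (snd p)) \<in> BM (lborel \<Otimes>\<^sub>M P)"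
    by (rule borel_measurable_integrable, rule integrable_strip(1)[OF P(1) em]) (simp only: norm_exp_i_times order_refl)
   show "shifted_prod n (truncated_exp n w k) \<in> BM (lborel \<Otimes>\<^sub>M P)" for k
    using truncated_exp_bounded_support by (intro shifted_prod_measurable[OF P(2)]) (auto simp: bounded_support_def)
   show "integrable (lborel \<Otimes>\<^sub>M P) (%p. indicator {- 1..1::real} (fst p) *\<^sub>R (1::real))"
    by (rule integrable_strip(1)[OF P(1)]) auto
   have ins: "{..<n} = insert 0 {1..<n}" using n by auto
   have eq: "shifted_prod n f p = f 0 (fst p) * (\<Prod>j\<in>{1..<n}. f j (fst p + snd p j))" for f p
    unfolding shifted_prod_def ins by simp
   show "AE p in lborel \<Otimes>\<^sub>M P. norm (shifted_prod n (truncated_exp n w k) p) <= indicator {- 1..1::real} (fst p) *\<^sub>R (1::real)" for k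
   proof (rule AE_I2)
    fix p :: "real \<times> (nat => real)"
    have "norm (\<Prod>j\<in>{1..<n}. truncated_exp n w k j (fst p + snd p j)) <= 1"
    unfolding prod_norm[symmetric] by (intro prod_le_1) (auto simp: truncated_exp_def indicator_def)
    moreover have "norm (truncated_exp n w k 0 (fst p)) = indicator {- 1..1} (fst p)"
    by (simp add: truncated_exp_def indicator_def)
    ultimately show "norm (shifted_prod n (truncated_exp n w k) p) <= indicator {- 1..1} (fst p) *\<^sub>R 1"
    unfolding eq norm_mult by (auto simp: indicator_def)
   qed
   show "AE p in lborel \<Otimes>\<^sub>M P. (%k. shifted_prod n (truncated_exp n w k) p) ----> indicator {- 1..1::real} (fst p) *\<^sub>R ?e (snd p)"
   proof (rule AE_I2)
    fix p :: "real \<times> (nat => real)"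
    obtain t v where p: "p = (t, v)" by (cases p)
    have "(%k. truncated_exp n w k 0 t * (\<Prod>j\<in>{1..<n}. truncated_exp n w k j (t + v j))) ---->
    indicator {- 1..1} t *\<^sub>R iexp ((\<Sum>i\<in>{1..<n}. w i) * t) * (\<Prod>j\<in>{1..<n}. iexp (- (w j * (t + v j))))"
    proof (intro tendsto_mult tendsto_prod)
    fix j assume j: "j \<in> {1..<n}"
    have "eventually (%k. \<bar>t + v j\<bar> <= real k) sequentially"
    using filterlim_real_sequentially by (rule filterlim_at_top[THEN iffD1, rule_format])
    then have "eventually (%k. truncated_exp n w k j (t + v j) = iexp (- (w j * (t + v j)))) sequentially"
    by eventually_elim (use j in "auto simp: truncated_exp_def indicator_def")
    then show "(%k. truncated_exp n w k j (t + v j)) ----> iexp (- (w j * (t + v j)))" by (rule tendsto_eventually)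
    qed (simp add: truncated_exp_def)
    also have "indicator {- 1..1} t *\<^sub>R iexp ((\<Sum>i\<in>{1..<n}. w i) * t) * (\<Prod>j\<in>{1..<n}. iexp (- (w j * (t + v j)))) =
    indicator {- 1..1} t *\<^sub>R ?e v"
    proof -
    have "(\<Prod>j\<in>{1..<n}. iexp (- (w j * (t + v j)))) = exp (\<Sum>j\<in>{1..<n}. \<i> * complex_of_real (- (w j * (t + v j))))"
    by (simp add: exp_sum)
    also have "iexp ((\<Sum>i\<in>{1..<n}. w i) * t) * ... = ?e v"
    unfolding exp_add[symmetric]
    by (rule arg_cong[where f=exp]) (simp add: algebra_simps sum.distrib sum_distrib_left sum_negf sum_subtractf)
    finally show ?thesis by simp
    qed
    finally show "(%k. shifted_prod n (truncated_exp n w k) p) ----> indicator {- 1..1} (fst p) *\<^sub>R ?e (snd p)"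
    unfolding eq p by simp
   qed
  qed
  also have "(CLINT p|(lborel \<Otimes>\<^sub>M P). indicator {- 1..1::real} (fst p) *\<^sub>R ?e (snd p)) = 2 * (CLINT v|P. ?e v)"
   using integrable_strip(2)[OF P(1) em] by (simp add: scaleR_conv_of_real)
  finally show ?thesis .
 qed
 have "(%k. prod_functional n \<tau> (truncated_exp n w k)) ----> 2 * (CLINT v|fst \<tau>. ?e v) - 2 * (CLINT v|snd \<tau>. ?e v)"
  unfolding prod_functional_def using \<tau>
  by (intro tendsto_diff lim) (auto simp: finite_signed_def signed_measure_on_def locally_finite_on_def)
 then show ?thesis by (simp add: fourier_stieltjes_def right_diff_distrib)
qed

text \<open>With \<epsilon> = 1 this compares different representatives of one reduced measure; with
  \<epsilon> = -1 it turns invariance under reflected test functions into a symmetry of the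
  transform.\<close>

lemma fourier_stieltjes_unique:
 assumes \<tau>: "finite_signed \<tau>" "signed_measure_on {1..<n} \<tau>" and \<tau>': "finite_signed \<tau>'" "signed_measure_on {1..<n} \<tau>'" and \<epsilon>: "\<epsilon> \<in> {1, -1}"
  and n: "0 < n"
  and real: "!!f. (!!j. j < n ==> bounded_compact_support (f j)) ==>
   prod_functional n \<tau> (%j x. complex_of_real (f j x)) = prod_functional n \<tau>' (%j x. complex_of_real (f j (\<epsilon> * x)))"
 shows "fourier_stieltjes n \<tau> w = fourier_stieltjes n \<tau>' (%j. \<epsilon> * w j)"
proof -
 have eq: "(%j x. truncated_exp n w k j (\<epsilon> * x)) = truncated_exp n (%j. \<epsilon> * w j) k" for k
  using \<epsilon> by (auto simp: truncated_exp_def fun_eq_iff indicator_def sum_negf)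
 have "prod_functional n \<tau> (truncated_exp n w k) = prod_functional n \<tau>' (truncated_exp n (%j. \<epsilon> * w j) k)" for k
 proof -
  have "prod_functional n \<tau> (truncated_exp n w k) = prod_functional n \<tau>' (%j x. truncated_exp n w k j (\<epsilon> * x))"
   by (rule prod_functional_complex[OF \<tau> \<tau>' \<epsilon>]) (use real truncated_exp_bounded_support in auto)
  then show ?thesis unfolding eq .
 qed
 with prod_functional_truncated_exp[OF \<tau> n, of w]
 have "(%k. prod_functional n \<tau>' (truncated_exp n (%j. \<epsilon> * w j) k)) ----> 2 * fourier_stieltjes n \<tau> w" by simp
 from LIMSEQ_unique[OF this prod_functional_truncated_exp[OF \<tau>' n]] have "2 * fourier_stieltjes n \<tau> w = 2 * fourier_stieltjes n \<tau>' (%j. \<epsilon> * w j)"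
  .
 then show ?thesis by simp
qed

text \<open>Finiteness of \<tau> is what turns the iterated integral of \<open>is_reduction\<close>
  into integrals over product measures, by Fubini.\<close>

lemma reduced_signed_integral:
 assumes \<tau>: "finite_signed \<tau>" "is_reduction n \<sigma> \<tau>" and n: "0 < n" and f: "!!j. j < n ==> bounded_compact_support (f j)"
 shows "complex_of_real (signed_integral \<sigma> (%t. \<Prod>j<n. f j (t j))) = prod_functional n \<tau> (%j x. complex_of_real (f j x))"
proof -
 let ?F = "%t. \<Prod>j<n. f j (t j)"
 have s: "signed_measure_on {1..<n} \<tau>" using \<tau>(2) by (simp add: is_reduction_def)
 obtain B where B: "!!j x. j < n ==> \<bar>f j x\<bar> <= B j" using f unfolding bounded_compact_support_def by metis
 obtain r where r: "!!j x. j < n ==> f j x ~= 0 ==> \<bar>x\<bar> <= r j" using f unfolding bounded_compact_support_def by metis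
 have "bounded_compact_support_on {..<n} ?F"
  unfolding bounded_compact_support_on_def
 proof (intro conjI exI allI impI ballI)
  show "?F \<in> BM (\<Pi>\<^sub>M j\<in>{..<n}. borel)"
   using f by (intro borel_measurable_prod measurable_compose[OF measurable_component_singleton]) (auto simp: bounded_compact_support_def)
  show "\<bar>?F t\<bar> <= (\<Prod>j<n. B j)" for t unfolding abs_prod using B by (intro prod_mono) auto
  fix t :: "nat => real" and j assume "?F t ~= 0" "j \<in> {..<n}"
  then have "\<bar>t j\<bar> <= r j" by (intro r) auto
  also have "... <= Max (r ` {..<n})" using \<open>j \<in> {..<n}\<close> by (intro Max_ge) auto
  finally show "\<bar>t j\<bar> <= Max (r ` {..<n})" .
 qed
 then have "signed_integral \<sigma> ?F = (LINT t0|lborel. signed_integral \<tau> (%v. ?F (\<lambda>j\<in>{..<n}. if j = 0 then t0 else t0 + v j)))"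
  using \<tau>(2) unfolding is_reduction_def by blast
 also have "(%t0 v. ?F (\<lambda>j\<in>{..<n}. if j = 0 then t0 else t0 + v j)) = (%t0 v. Re (shifted_prod n (%j x. complex_of_real (f j x)) (t0, v)))"
  unfolding shifted_prod_def of_real_prod[symmetric] Re_complex_of_real by (intro ext prod.cong) auto
 finally have "signed_integral \<sigma> ?F = (LINT t0|lborel. signed_integral \<tau> (%v. Re (shifted_prod n (%j x. complex_of_real (f j x)) (t0, v))))"
  by (simp add: fun_eq_iff)
 moreover have int: "integrable (lborel \<Otimes>\<^sub>M P) (%p. Re (shifted_prod n (%j x. complex_of_real (f j x)) p))"
  and "integrable lborel (%t0. LINT v|P. Re (shifted_prod n (%j x. complex_of_real (f j x)) (t0, v)))"
  and "complex_of_real (LINT t0|lborel. LINT v|P. Re (shifted_prod n (%j x. complex_of_real (f j x)) (t0, v))) =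
   (CLINT p|(lborel \<Otimes>\<^sub>M P). shifted_prod n (%j x. complex_of_real (f j x)) p)"
  if P: "finite_measure P" "sets P = sets (\<Pi>\<^sub>M j\<in>{1..<n}. (borel :: real measure))" for P
 proof -
  interpret P: finite_measure P by (rule P)
  interpret L: pair_sigma_finite lborel P by unfold_locales
  have I: "integrable (lborel \<Otimes>\<^sub>M P) (shifted_prod n (%j x. complex_of_real (f j x)))"
   by (rule shifted_prod_integrable[OF P n bounded_support_of_real[OF f]])
  then show J: "integrable (lborel \<Otimes>\<^sub>M P) (%p. Re (shifted_prod n (%j x. complex_of_real (f j x)) p))" by simp
  show "integrable lborel (%t0. LINT v|P. Re (shifted_prod n (%j x. complex_of_real (f j x)) (t0, v)))"
   by (rule L.integrable_fst'[OF J])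
  have "shifted_prod n (%j x. complex_of_real (f j x)) p = complex_of_real (Re (shifted_prod n (%j x. complex_of_real (f j x)) p))" for p
   unfolding shifted_prod_def of_real_prod[symmetric] by simp
  then show "complex_of_real (LINT t0|lborel. LINT v|P. Re (shifted_prod n (%j x. complex_of_real (f j x)) (t0, v))) =
   (CLINT p|(lborel \<Otimes>\<^sub>M P). shifted_prod n (%j x. complex_of_real (f j x)) p)"
   unfolding L.integral_fst'[OF J] integral_complex_of_real[symmetric] by simp
 qed
 ultimately show ?thesis
  using \<tau>(1) s unfolding prod_functional_def signed_integral_def finite_signed_def signed_measure_on_def locally_finite_on_def
  by simp
qed

section \<open>Differentiation of the log-functionals\<close>

text \<open>One development covers both functionals: \<open>1 + v\<close> belongs to the factorial
  one, \<open>exp v\<close> to the complete one.\<close>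

definition weight :: "bool => real => real" where
 "weight b v = (if b then 1 + v else exp v)"

definition shrink :: "bool => 'i set => 'i => 'i set" where
 "shrink b T u = (if b then T - {u} else T)"

text \<open>
 With \<open>b\<close> the tuples have distinct entries, which gives the factorial cumulants;
 without it they are arbitrary, which gives the complete ones.
\<close>

fun tuples :: "nat => bool => 'i set => 'i list set" where
 "tuples 0 b T = {[]}"
| "tuples (Suc n) b T = (\<Union>u\<in>T. (#) u ` tuples n b (shrink b T u))"

text \<open>The iterated directional derivative of the product of weights over \<open>T\<close>.
  Differentiating \<open>1 + v\<close> uses its factor up, so \<open>shrink\<close> removes the
  label; \<open>exp v\<close> reproduces itself, so the label may be hit again.\<close>

fun label_sum :: "(real => real) list => bool => ('i => real) => 'i set => (real => real) => real" where
 "label_sum [] b y T g = (\<Prod>u\<in>T. weight b (g (y u)))"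
| "label_sum (f # fs) b y T g = (\<Sum>u\<in>T. f (y u) * label_sum fs b y (shrink b T u) g)"

lemma finite_shrink [simp]: "finite T ==> finite (shrink b T u)"
 by (simp add: shrink_def)

lemma finite_tuples: "finite T ==> finite (tuples n b T)"
 by (induction n arbitrary: T) auto

lemma sum_tuples_Suc:
 fixes h :: "'i list => 'b::comm_monoid_add"
 assumes "finite T"
 shows "(\<Sum>us\<in>tuples (Suc n) b T. h us) = (\<Sum>u\<in>T. \<Sum>us\<in>tuples n b (shrink b T u). h (u # us))"
proof -
 have "(\<Sum>us\<in>tuples (Suc n) b T. h us) = (\<Sum>u\<in>T. sum h ((#) u ` tuples n b (shrink b T u)))"
  unfolding tuples.simps by (rule sum.UNION_disjoint) (auto simp: assms intro!: finite_imageI finite_tuples)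
 also have "... = (\<Sum>u\<in>T. \<Sum>us\<in>tuples n b (shrink b T u). h (u # us))"
  by (simp add: sum.reindex inj_on_def)
 finally show ?thesis .
qed

lemma label_sum_zero:
 "finite T ==> label_sum fs b y T (%_. 0) = (\<Sum>us\<in>tuples (length fs) b T. \<Prod>j<length fs. (fs ! j) (y (us ! j)))"
proof (induction fs arbitrary: T)
 case Nil
 then show ?case by (simp add: weight_def)
next
 case (Cons f fs)
 have "label_sum (f # fs) b y T (%_. 0) =
   (\<Sum>u\<in>T. \<Sum>us\<in>tuples (length fs) b (shrink b T u). f (y u) * (\<Prod>j<length fs. (fs ! j) (y (us ! j))))"
  using Cons by (simp add: sum_distrib_left)
 also have "... = (\<Sum>us\<in>tuples (Suc (length fs)) b T. \<Prod>j<Suc (length fs). ((f # fs) ! j) (y (us ! j)))"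
  unfolding sum_tuples_Suc[OF Cons.prems] prod.lessThan_Suc_shift by simp
 finally show ?case by simp
qed

text \<open>In the derivative of a sum that already carries \<open>f\<close>, the new direction
  \<open>h\<close> appears behind \<open>f\<close>; the symmetry of the tuples brings it to the
  front.\<close>

lemma label_sum_swap:
 assumes "finite T"
 shows "(\<Sum>u\<in>T. f (y u) * label_sum (h # fs) b y (shrink b T u) g) = label_sum (h # f # fs) b y T g"
proof (cases b)
 case True
 have "(\<Sum>u\<in>T. \<Sum>v | v \<in> T \<and> v ~= u. f (y u) * (h (y v) * label_sum fs b y (T - {u} - {v}) g)) =
   (\<Sum>v\<in>T. \<Sum>u | u \<in> T \<and> v ~= u. f (y u) * (h (y v) * label_sum fs b y (T - {u} - {v}) g))"
  by (rule sum.swap_restrict[OF assms assms])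
 moreover have "{v. v \<in> T \<and> v ~= u} = T - {u}" "{v. v \<in> T \<and> u ~= v} = T - {u}" for u by auto
 moreover have "T - {u} - {v} = T - {v} - {u}" for u v by auto
 ultimately show ?thesis using True by (simp add: shrink_def sum_distrib_left mult_ac)
next
 case False
 have "(\<Sum>u\<in>T. \<Sum>v\<in>T. f (y u) * (h (y v) * label_sum fs b y T g)) = (\<Sum>v\<in>T. \<Sum>u\<in>T. f (y u) * (h (y v) * label_sum fs b y T g))"
  by (rule sum.swap)
 then show ?thesis using False by (simp add: shrink_def sum_distrib_left mult.left_commute)
qed

lemma label_sum_has_derivative:
 assumes "finite T"
 shows "((%t. label_sum fs b y T (%x. g x + t * f x)) has_real_derivative
  label_sum (f # fs) b y T (%x. g x + t * f x)) (at t)"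
 using assms
proof (induction fs arbitrary: T)
 case Nil
 show ?case
 proof (cases b)
  case True
  then show ?thesis
   using prod_one_plus_has_derivative[OF Nil, of "%u. 1 + g (y u)" "%u. f (y u)" t]
   by (simp add: weight_def shrink_def add.assoc)
 next
  case False
  have "((%t. exp (\<Sum>u\<in>T. g (y u) + t * f (y u))) has_real_derivative
    exp (\<Sum>u\<in>T. g (y u) + t * f (y u)) * (\<Sum>u\<in>T. f (y u))) (at t)"
   by (auto intro!: derivative_eq_intros)
  then show ?thesis using False Nil
   by (simp add: weight_def shrink_def exp_sum sum_distrib_right[symmetric] mult.commute)
 qed
next
 case (Cons f1 fs)
 have "((%t. \<Sum>u\<in>T. f1 (y u) * label_sum fs b y (shrink b T u) (%x. g x + t * f x)) has_real_derivative
   (\<Sum>u\<in>T. f1 (y u) * label_sum (f # fs) b y (shrink b T u) (%x. g x + t * f x))) (at t)"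
  using Cons by (intro DERIV_sum DERIV_cmult) auto
 then show ?case unfolding label_sum_swap[OF Cons.prems] by simp
qed

lemma label_sum_bound:
 assumes "finite T" "!!f x. f \<in> set fs ==> \<bar>f x\<bar> <= B" "1 <= \<theta>" "0 <= B"
  and "!!x. 0 <= weight b (g x)" "!!x. weight b (g x) <= \<theta>"
 shows "\<bar>label_sum fs b y T g\<bar> <= B ^ length fs * (real (card T) ^ length fs * \<theta> ^ card T)"
 using assms(1,2)
proof (induction fs arbitrary: T)
 case Nil
 have "(\<Prod>u\<in>T. weight b (g (y u))) <= (\<Prod>u\<in>T. \<theta>)" using assms by (intro prod_mono) auto
 moreover have "0 <= (\<Prod>u\<in>T. weight b (g (y u)))" using assms by (intro prod_nonneg) auto
 ultimately show ?case by simp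
next
 case (Cons f fs)
 have card: "card (shrink b T u) <= card T" for u using Cons.prems(1) by (auto simp: shrink_def intro: card_mono)
 have "\<bar>label_sum (f # fs) b y T g\<bar> <= (\<Sum>u\<in>T. \<bar>f (y u) * label_sum fs b y (shrink b T u) g\<bar>)"
  by simp
 also have "... <= (\<Sum>u\<in>T. B * (B ^ length fs * (real (card T) ^ length fs * \<theta> ^ card T)))"
 proof (rule sum_mono)
  fix u assume "u \<in> T"
  have "\<bar>label_sum fs b y (shrink b T u) g\<bar> <= B ^ length fs * (real (card (shrink b T u)) ^ length fs * \<theta> ^ card (shrink b T u))"
   using Cons.prems by (intro Cons.IH) auto
  also have "... <= B ^ length fs * (real (card T) ^ length fs * \<theta> ^ card T)"
   using card[of u] assms by (intro mult_left_mono mult_mono power_mono power_increasing) auto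
  finally show "\<bar>f (y u) * label_sum fs b y (shrink b T u) g\<bar> <= B * (B ^ length fs * (real (card T) ^ length fs * \<theta> ^ card T))"
   unfolding abs_mult using Cons.prems(2)[of f] assms(4) by (intro mult_mono) auto
 qed
 finally show ?case by (simp add: mult_ac)
qed

lemma label_sum_measurable:
 assumes "finite T" "!!u. y u \<in> BM L" "!!f. f \<in> set fs ==> f \<in> BM borel" "g \<in> BM borel"
 shows "(%p. label_sum fs b (%u. y u p) T g) \<in> BM L"
 using assms(1,3)
proof (induction fs arbitrary: T)
 case Nil
 have [measurable]: "weight b \<in> BM borel" by (cases b) (simp_all add: weight_def[abs_def])
 note [measurable] = assms(2,4)
 show ?case by simp
next
 case (Cons f fs)
 have [measurable]: "(%p. f (y u p)) \<in> BM L" for u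
  by (rule measurable_compose[OF assms(2)]) (use Cons.prems in auto)
 show ?case using Cons by simp
qed

lemma bounded_compact_support_integrable:
 assumes "bounded_compact_support f" shows "integrable lborel f"
proof -
 obtain B r where "f \<in> BM borel" "!!x. \<bar>f x\<bar> <= B" "!!x. f x ~= 0 ==> \<bar>x\<bar> <= r"
  using assms unfolding bounded_compact_support_def by auto
 then show ?thesis by (intro integrable_bounded_support[of _ f B r]) (auto simp: emeasure_lborel_Icc_eq)
qed

lemma bounded_compact_support_add_scaled:
 assumes "bounded_compact_support f" "bounded_compact_support g"
 shows "bounded_compact_support (%x. g x + t * f x)"
proof -
 obtain B r where f: "f \<in> BM borel" "!!x. \<bar>f x\<bar> <= B" "!!x. f x ~= 0 ==> \<bar>x\<bar> <= r"
  using assms(1) unfolding bounded_compact_support_def by auto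
 obtain C q where g: "g \<in> BM borel" "!!x. \<bar>g x\<bar> <= C" "!!x. g x ~= 0 ==> \<bar>x\<bar> <= q"
  using assms(2) unfolding bounded_compact_support_def by auto
 have "\<bar>g x + t * f x\<bar> <= C + \<bar>t\<bar> * B" for x
  using f(2)[of x] g(2)[of x] mult_left_mono[OF f(2)[of x], of "\<bar>t\<bar>"] abs_triangle_ineq[of "g x" "t * f x"] by (simp add: abs_mult)
 moreover have "\<bar>x\<bar> <= max r q" if "g x + t * f x ~= 0" for x
  using that f(3)[of x] g(3)[of x] by (cases "f x = 0") auto
 ultimately show ?thesis unfolding bounded_compact_support_def using f(1) g(1) by auto
qed

lemma bounded_compact_support_sum:
 fixes n :: nat
 assumes "!!j. j < n ==> bounded_compact_support (f j)"
 shows "bounded_compact_support (%x. \<Sum>j<n. s j * f j x)"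
 using assms
proof (induction n)
 case 0
 then show ?case by (auto simp: bounded_compact_support_def)
next
 case (Suc n)
 then show ?case using bounded_compact_support_add_scaled[of "f n" "%x. \<Sum>j<n. s j * f j x" "s n"] by simp
qed

lemma bounded_compact_support_common_bound:
 fixes n :: nat
 assumes "!!j. j < n ==> bounded_compact_support (f j)"
 shows "\<exists>B\<ge>1. \<forall>j<n. \<forall>x. \<bar>f j x\<bar> <= B"
proof -
 obtain B where B: "!!j x. j < n ==> \<bar>f j x\<bar> <= B j" using assms unfolding bounded_compact_support_def by metis
 have "\<bar>f j x\<bar> <= 1 + (\<Sum>i<n. \<bar>B i\<bar>)" if "j < n" for j x
 proof -
  have "\<bar>B j\<bar> <= (\<Sum>i<n. \<bar>B i\<bar>)" using that by (intro member_le_sum) auto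
  then show ?thesis using B[OF that, of x] by linarith
 qed
 then show ?thesis by (intro exI[of _ "1 + (\<Sum>i<n. \<bar>B i\<bar>)"]) (auto simp: sum_nonneg)
qed

section \<open>Tuple sums over one cluster and their mixed derivatives\<close>

context cluster
begin

text \<open>Arguments of this size keep both weights admissible for the Laplace formula:
  \<open>exp v\<close> is at most \<open>theta\<close>, and \<open>1 + v\<close> is at least
  1/2.\<close>

definition small :: real where "small = min (ln theta) (1/2)"

lemma small: "0 < small" "small <= 1/2" "small <= ln theta"
 using theta(1) by (auto simp: small_def)

lemma weight_bounds:
 assumes "\<bar>v\<bar> <= small"
 shows "exp (- small) / 2 <= weight b v" "0 <= weight b v" "weight b v <= theta"
proof -
 have e: "exp v <= theta"
 proof -
  have "exp v <= exp (ln theta)" using assms small by (subst exp_le_cancel_iff) linarith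
  then show ?thesis using theta(1) by simp
 qed
 have "1 + v <= exp v" by (rule exp_ge_add_one_self)
 then have "1 + v <= theta" using e by linarith
 then show "weight b v <= theta" using e by (auto simp: weight_def)
 have a: "exp (- small) <= 1" "exp (- small) <= exp v" using assms small by auto
 have "exp (- small) / 2 <= 1 + v" using a(1) assms small by linarith
 moreover have "exp (- small) / 2 <= exp v" using a(2) exp_gt_zero[of v] by linarith
 ultimately show l: "exp (- small) / 2 <= weight b v" unfolding weight_def by simp
 show "0 <= weight b v" by (rule order_trans[OF _ l]) simp
qed

definition lsum :: "(real => real) list => bool => (real => real) => real \<times> 'w => real" where
 "lsum fs b g p = label_sum fs b (%u. fst p + place (fam (snd p)) u) (ftree (snd p)) g"

lemma lsum_Nil: "lsum [] b g p = cprod (%x. weight b (g x)) (fst p) (snd p)"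
 by (simp add: lsum_def cprod_def)

lemma lsum_measurable:
 assumes "!!f. f \<in> set fs ==> f \<in> BM borel" "g \<in> BM borel"
 shows "lsum fs b g \<in> BM (lborel \<Otimes>\<^sub>M M)"
 unfolding lsum_def[abs_def] by (rule measurable_ftree_pair, rule label_sum_measurable) (use assms in auto)

lemma weight_minus_one_integrable:
 assumes g: "bounded_compact_support g" and s: "!!x. \<bar>g x\<bar> <= small"
 shows "(%x. weight b (g x)) \<in> BM borel" "integrable lborel (%x. weight b (g x) - 1)"
proof -
 obtain B r where m: "g \<in> BM borel" "!!x. g x ~= 0 ==> \<bar>x\<bar> <= r"
  using g unfolding bounded_compact_support_def by auto
 note [measurable] = m(1)
 show [measurable]: "(%x. weight b (g x)) \<in> BM borel" by (cases b) (simp_all add: weight_def)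
 show "integrable lborel (%x. weight b (g x) - 1)"
 proof (rule integrable_bounded_support[where B=theta and r=r])
  show "\<bar>weight b (g x) - 1\<bar> <= theta" for x using weight_bounds[OF s, of b x] theta(1) by auto
  show "\<bar>x\<bar> <= r" if "weight b (g x) - 1 ~= 0" for x using that m(2)[of x] by (cases "g x = 0"; cases b) (auto simp: weight_def)
 qed (auto simp: emeasure_lborel_Icc_eq)
qed

text \<open>The first test function is kept, since its integrability over the root position makes
  the sum integrable; all others are estimated by \<open>B\<close>.\<close>

lemma lsum_Cons_bound:
 assumes B: "!!h x. h \<in> set fs ==> \<bar>h x\<bar> <= B" "0 <= B" and s: "!!x. \<bar>g x\<bar> <= small"
 shows "\<bar>lsum (f # fs) b g p\<bar> <= B ^ length fs *
  ((\<Sum>u\<in>ftree (snd p). \<bar>f (fst p + place (fam (snd p)) u)\<bar>) * (real (card (ftree (snd p))) ^ length fs * theta ^ card (ftree (snd p))))"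
proof -
 let ?T = "ftree (snd p)" and ?y = "%u. fst p + place (fam (snd p)) u"
 have "\<bar>lsum (f # fs) b g p\<bar> <= (\<Sum>u\<in>?T. \<bar>f (?y u)\<bar> * \<bar>label_sum fs b ?y (shrink b ?T u) g\<bar>)"
  unfolding lsum_def label_sum.simps abs_mult[symmetric] by (rule sum_abs)
 also have "... <= (\<Sum>u\<in>?T. \<bar>f (?y u)\<bar> * (B ^ length fs * (real (card ?T) ^ length fs * theta ^ card ?T)))"
 proof (intro sum_mono mult_left_mono)
  fix u
  have card: "card (shrink b ?T u) <= card ?T" by (auto simp: shrink_def intro: card_mono)
  have "\<bar>label_sum fs b ?y (shrink b ?T u) g\<bar> <= B ^ length fs * (real (card (shrink b ?T u)) ^ length fs * theta ^ card (shrink b ?T u))"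
   using B weight_bounds[OF s] theta(1) by (intro label_sum_bound) auto
  also have "... <= B ^ length fs * (real (card ?T) ^ length fs * theta ^ card ?T)"
   using card B(2) theta(1) by (intro mult_left_mono mult_mono power_mono power_increasing) auto
  finally show "\<bar>label_sum fs b ?y (shrink b ?T u) g\<bar> <= B ^ length fs * (real (card ?T) ^ length fs * theta ^ card ?T)" .
 qed simp
 finally show ?thesis unfolding sum_distrib_right[symmetric] by (simp only: mult_ac)
qed

text \<open>Far from the support the sum for the empty list is the product 1, so 1 is subtracted
  there; with at least one test function in the list the sum already vanishes far away.\<close>

lemma lsum_integrable:
 assumes fs: "!!h. h \<in> set fs ==> bounded_compact_support h" "!!h x. h \<in> set fs ==> \<bar>h x\<bar> <= B" "0 <= B"
  and g: "bounded_compact_support g" and s: "!!x. \<bar>g x\<bar> <= small"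
 shows "integrable (lborel \<Otimes>\<^sub>M M) (%p. lsum fs b g p - (if fs = [] then 1 else 0))"
proof (cases fs)
 case Nil
 have "integrable (lborel \<Otimes>\<^sub>M M) (%(x, om). cprod (%x. weight b (g x)) x om - 1)"
  using weight_bounds[OF s] by (intro cprod_minus_one_integrable weight_minus_one_integrable[OF g s]) auto
 then show ?thesis using Nil by (simp add: lsum_Nil case_prod_unfold)
next
 case (Cons f fs')
 note I = integrable_ftree_sum[OF bounded_compact_support_integrable[OF fs(1)[of f]], of "length fs'"]
 have "integrable (lborel \<Otimes>\<^sub>M M) (lsum fs b g)"
 proof (rule bintegrable_bound[OF integrable_mult_right[OF I, of "B ^ length fs'"]])
  show "lsum fs b g \<in> BM (lborel \<Otimes>\<^sub>M M)"
   using fs g by (intro lsum_measurable) (auto simp: bounded_compact_support_def)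
  show "AE p in lborel \<Otimes>\<^sub>M M. norm (lsum fs b g p) <= norm (B ^ length fs' * (case p of (x, om) =>
    (\<Sum>u\<in>ftree om. \<bar>f (x + place (fam om) u)\<bar>) * (real (card (ftree om)) ^ length fs' * theta ^ card (ftree om))))" (is "AE p in _. ?AE p")
  proof (rule AE_I2)
   fix p
   show "?AE p"
    unfolding Cons case_prod_unfold real_norm_def
    by (rule order_trans[OF lsum_Cons_bound abs_ge_self]) (use fs s Cons in auto)
  qed
 qed (use Cons in auto)
 then show ?thesis using Cons by simp
qed

lemma lsum_has_derivative:
 assumes fs: "!!h. h \<in> set fs ==> bounded_compact_support h" "!!h x. h \<in> set fs ==> \<bar>h x\<bar> <= B"
  and f: "bounded_compact_support f" "!!x. \<bar>f x\<bar> <= B" and B: "0 < B"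
  and g: "bounded_compact_support g" and s: "!!x. \<bar>g x\<bar> <= small / 2"
 shows "((%t. LINT p|(lborel \<Otimes>\<^sub>M M). lsum fs b (%x. g x + t * f x) p - (if fs = [] then 1 else 0))
  has_real_derivative (LINT p|(lborel \<Otimes>\<^sub>M M). lsum (f # fs) b g p)) (at 0)"
proof -
 let ?w = "%p. B ^ length fs * (case p of (x, om) => (\<Sum>u\<in>ftree om. \<bar>f (x + place (fam om) u)\<bar>) * (real (card (ftree om)) ^ length fs * theta ^ card (ftree om)))"
 have e0: "0 < small / (2 * B)" using small B by simp
 have sm: "\<bar>g x + t * f x\<bar> <= small" if "\<bar>t\<bar> < small / (2 * B)" for t x
 proof -
  have "\<bar>t * f x\<bar> <= small / (2 * B) * B" unfolding abs_mult using that f(2)[of x] B small by (intro mult_mono) auto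
  then show ?thesis using s[of x] B abs_triangle_ineq[of "g x" "t * f x"] by simp
 qed
 note bc = bounded_compact_support_add_scaled[OF f(1) g]
 have "((%t. LINT p|(lborel \<Otimes>\<^sub>M M). lsum fs b (%x. g x + t * f x) p - (if fs = [] then 1 else 0))
  has_real_derivative (LINT p|(lborel \<Otimes>\<^sub>M M). lsum (f # fs) b (%x. g x + 0 * f x) p)) (at 0)"
 proof (rule has_real_derivative_integral[OF e0, where w="?w" and f'="%t. lsum (f # fs) b (%x. g x + t * f x)"])
  show "integrable (lborel \<Otimes>\<^sub>M M) ?w"
   by (rule integrable_mult_right[OF integrable_ftree_sum[OF bounded_compact_support_integrable[OF f(1)]]])
  show "integrable (lborel \<Otimes>\<^sub>M M) (%p. lsum fs b (%x. g x + t * f x) p - (if fs = [] then 1 else 0))" if "\<bar>t\<bar> < small / (2 * B)" for t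
   by (rule lsum_integrable[where B=B]) (use B fs bc sm[OF that] in auto)
  show "lsum (f # fs) b (%x. g x + 0 * f x) \<in> BM (lborel \<Otimes>\<^sub>M M)"
   using fs f g by (intro lsum_measurable) (auto simp: bounded_compact_support_def)
  fix t :: real and p assume t: "\<bar>t\<bar> < small / (2 * B)"
  show "((%t. lsum fs b (%x. g x + t * f x) p - (if fs = [] then 1 else 0)) has_real_derivative
    lsum (f # fs) b (%x. g x + t * f x) p) (at t)"
   unfolding lsum_def by (rule DERIV_cong[OF DERIV_diff[OF label_sum_has_derivative DERIV_const]]) simp_all
  show "\<bar>lsum (f # fs) b (%x. g x + t * f x) p\<bar> <= ?w p"
   unfolding case_prod_unfold by (rule lsum_Cons_bound) (use fs B sm[OF t] in auto)
 qed
 then show ?thesis by simp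
qed

lemma lsum_mixed_partial:
 assumes f: "!!j. j < n ==> bounded_compact_support (f j)" and n: "0 < n" and e: "0 < e"
  and F: "!!s. (\<forall>j<n. \<bar>s j\<bar> < e) ==> (\<forall>j\<ge>n. s j = 0) ==>
   F s = \<nu> * (LINT p|(lborel \<Otimes>\<^sub>M M). lsum [] b (%x. \<Sum>j<n. s j * f j x) p - 1)"
 shows "has_mixed_partial n F (\<nu> * (LINT p|(lborel \<Otimes>\<^sub>M M). lsum (map f [0..<n]) b (%_. 0) p))"
proof -
 obtain B where B: "1 <= B" "!!j x. j < n ==> \<bar>f j x\<bar> <= B" using bounded_compact_support_common_bound[of n f] f by blast
 \<comment> \<open>With all variables below \<open>d\<close> the combined argument uses at most half
   of \<open>small\<close>; the other half is the room that \<open>lsum_has_derivative\<close> needs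
   for the variable being differentiated.\<close>
 define d where "d = min e (small / (2 * real n * B))"
 have d: "0 < d" "d <= e" "real n * d * B <= small / 2"
 proof -
  show "0 < d" "d <= e" using e small n B by (auto simp: d_def)
  have "real n * d * B <= real n * (small / (2 * real n * B)) * B" using B n unfolding d_def by (intro mult_right_mono mult_left_mono) auto
  also have "... = small / 2" using n B by simp
  finally show "real n * d * B <= small / 2" .
 qed
 have sm: "\<bar>\<Sum>j<k. s j * f j x\<bar> <= small / 2" if "k <= n" "!!j. j < k ==> \<bar>s j\<bar> < d" for k s x
 proof -
  have "\<bar>\<Sum>j<k. s j * f j x\<bar> <= (\<Sum>j<k. \<bar>s j * f j x\<bar>)" by (rule sum_abs)
  also have "... <= (\<Sum>j<k. d * B)"
   unfolding abs_mult using that B(2) d(1) by (intro sum_mono mult_mono) (auto simp: less_imp_le)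
  also have "... <= real n * (d * B)" using that(1) d(1) B(1) by (simp add: mult_right_mono)
  also have "... <= small / 2" using d(3) by (simp add: mult.assoc)
  finally show ?thesis .
 qed
 \<comment> \<open>What remains after differentiating in the variables from \<open>k\<close>
   upwards, taken at 0. For \<open>k = n\<close> nothing is differentiated yet, which is the one
   case where 1 is subtracted.\<close>
 define H where "H k s = \<nu> * (LINT p|(lborel \<Otimes>\<^sub>M M). lsum (map f [k..<n]) b (%x. \<Sum>j<k. s j * f j x) p - (if map f [k..<n] = [] then 1 else 0))" for k s
 have step: "((%t. H (Suc k) (s(k := t))) has_real_derivative H k s) (at 0)"
  if k: "k < n" and s: "\<forall>j<k. \<bar>s j\<bar> < d" for k s
 proof -
  have "(\<Sum>j<Suc k. (s(k := t)) j * f j x) = (\<Sum>j<k. s j * f j x) + t * f k x" for t x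
   by simp
  moreover have "map f [k..<n] = f k # map f [Suc k..<n]" using k by (simp add: upt_conv_Cons)
  moreover have "((%t. LINT p|(lborel \<Otimes>\<^sub>M M). lsum (map f [Suc k..<n]) b (%x. (\<Sum>j<k. s j * f j x) + t * f k x) p - (if map f [Suc k..<n] = [] then 1 else 0))
   has_real_derivative (LINT p|(lborel \<Otimes>\<^sub>M M). lsum (f k # map f [Suc k..<n]) b (%x. \<Sum>j<k. s j * f j x) p)) (at 0)"
   by (rule lsum_has_derivative[where B=B]) (use f k B s sm[of k s] in "auto intro!: bounded_compact_support_sum")
  ultimately show ?thesis unfolding H_def by (simp del: fun_upd_apply sum.lessThan_Suc add: DERIV_cmult)
 qed
 have part: "has_mixed_partial k (H k) (\<nu> * (LINT p|(lborel \<Otimes>\<^sub>M M). lsum (map f [0..<n]) b (%_. 0) p))" if "k < n" for k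
  using that
 proof (induction k)
  case 0
  then show ?case by (simp add: H_def)
 next
  case (Suc k)
  then show ?case using step[of k] d(1) by (auto intro!: exI[of _ "H k"] exI[of _ d])
 qed
 obtain n' where n': "n = Suc n'" using n by (cases n) auto
 have "((%t. F (s(n' := t))) has_real_derivative H n' s) (at 0)" if s: "\<forall>j<n'. \<bar>s j\<bar> < d" "\<forall>j\<ge>n'. s j = 0" for s
 proof -
  have eq: "F (s(n' := t)) = H n (s(n' := t))" if "\<bar>t\<bar> < d" for t
   unfolding H_def by (subst F) (use s that d n' in "auto simp: less_Suc_eq")
  have "eventually (%t. H n (s(n' := t)) = F (s(n' := t))) (nhds 0)"
   unfolding eventually_nhds_metric using eq d(1) by (intro exI[of _ d]) auto
  then show ?thesis
   using step[of n' s] s(1) n' DERIV_cong_ev[of 0 0 "%t. H n (s(n' := t))" "%t. F (s(n' := t))"] by auto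
 qed
 then show ?thesis unfolding n' using part[of n'] n' d(1) by (auto intro!: exI[of _ "H n'"] exI[of _ d])
qed

end

section \<open>Cumulant measures from tuples of individuals\<close>

text \<open>The multiplicity of a position is the number of labels placed there, so the product over
  positions regroups into a product over labels, which is finite when few labels meet the
  support.\<close>

lemma point_prod_points_measure:
 assumes \<mu>: "\<mu> = points_measure J pt" and q [measurable]: "q \<in> BM borel" and pos: "!!x. 0 < 1 + q x"
 shows "point_prod q \<mu> = (if emeasure \<mu> {x. q x ~= 0} < \<infinity> then exp (LINT x|\<mu>. ln (1 + q x)) else 0)"
proof (cases "emeasure \<mu> {x. q x ~= 0} < \<infinity>")
 case True
 define S where "S = {z \<in> J. q (pt z) ~= 0}"
 have em: "emeasure \<mu> A = emeasure (count_space J) {z \<in> J. pt z \<in> A}" if "A \<in> sets borel" for A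
  unfolding \<mu> points_measure_def using that by (subst emeasure_distr) (auto intro!: arg_cong2[where f=emeasure])
 have E: "{x. q x ~= 0} \<in> sets borel" by measurable
 have fin: "finite S"
  using True unfolding em[OF E] S_def by (subst (asm) emeasure_count_space) (auto split: if_splits)
 have single: "emeasure \<mu> {x} = of_nat (card {z. z \<in> S \<and> pt z = x})" if "q x ~= 0" for x
 proof -
  have "{z \<in> J. pt z \<in> {x}} = {z. z \<in> S \<and> pt z = x}" using that by (auto simp: S_def)
  moreover have "{z. z \<in> S \<and> pt z = x} \<subseteq> J" by (auto simp: S_def)
  ultimately show ?thesis using fin by (simp add: em emeasure_count_space)
 qed
 have set: "{x. q x ~= 0 \<and> emeasure \<mu> {x} ~= 0} = pt ` S"
 proof -
  have "emeasure \<mu> {x} ~= 0 \<longleftrightarrow> x \<in> pt ` S" if "q x ~= 0" for x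
   unfolding single[OF that] using fin by auto
  moreover have "q x ~= 0" if "x \<in> pt ` S" for x using that by (auto simp: S_def)
  ultimately show ?thesis by blast
 qed
 have "point_prod q \<mu> = (\<Prod>x\<in>pt ` S. (1 + q x) ^ nat \<lfloor>measure \<mu> {x}\<rfloor>)"
  using True unfolding point_prod_def set by simp
 also have "... = (\<Prod>x\<in>pt ` S. \<Prod>z | z \<in> S \<and> pt z = x. 1 + q (pt z))"
 proof (rule prod.cong[OF refl])
  fix x assume "x \<in> pt ` S"
  then have "q x ~= 0" by (auto simp: S_def)
  then have "measure \<mu> {x} = real (card {z. z \<in> S \<and> pt z = x})" using single[of x] by (simp add: measure_def)
  moreover have "(\<Prod>z | z \<in> S \<and> pt z = x. 1 + q (pt z)) = (\<Prod>z | z \<in> S \<and> pt z = x. 1 + q x)"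
   by (intro prod.cong) auto
  ultimately show "(1 + q x) ^ nat \<lfloor>measure \<mu> {x}\<rfloor> = (\<Prod>z | z \<in> S \<and> pt z = x. 1 + q (pt z))" by simp
 qed
 also have "... = (\<Prod>z\<in>S. 1 + q (pt z))" by (rule prod.image_gen[OF fin, symmetric])
 also have "... = exp (\<Sum>z\<in>S. ln (1 + q (pt z)))" using pos by (simp add: exp_sum[OF fin])
 also have "(\<Sum>z\<in>S. ln (1 + q (pt z))) = (LINT x|\<mu>. ln (1 + q x))"
 proof -
  have S: "{z. z \<in> J \<and> ln (1 + q (pt z)) ~= 0} = S" unfolding S_def using pos by (auto simp: ln_eq_zero_iff)
  have "(LINT x|\<mu>. ln (1 + q x)) = (LINT z|count_space J. ln (1 + q (pt z)))"
   unfolding \<mu> points_measure_def by (subst integral_distr) auto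
  also have "... = (\<Sum>z\<in>S. ln (1 + q (pt z)))"
   using fin by (subst lebesgue_integral_count_space_finite_support) (simp_all add: S)
  finally show ?thesis ..
 qed
 finally show ?thesis using True by simp
qed (simp add: point_prod_def)

text \<open>\<open>c\<close> times the integral over \<open>X\<close> of the random counting measure
  with atoms \<open>pt u x\<close> for \<open>u\<close> in \<open>S x\<close>. Written as an image
  of a density on a product, so that its integrals follow from Fubini.\<close>

definition tuple_measure :: "'x measure => real => ('x => 'l set) => ('l => 'x => 'y) => 'y measure => 'y measure" where
 "tuple_measure X c S pt P =
  distr (density (X \<Otimes>\<^sub>M count_space UNIV) (%z. ennreal (c * indicator (S (fst z)) (snd z)))) P (%z. pt (snd z) (fst z))"

context
 fixes X :: "'x measure" and c :: real and S :: "'x => 'l::countable set" and pt :: "'l => 'x => 'y" and P :: "'y measure"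
 assumes X: "sigma_finite_measure X" and c: "0 <= c" and S: "!!u. Measurable.pred X (%x. u \<in> S x)" "!!x. finite (S x)"
  and pt: "!!u. pt u \<in> measurable X P"
begin

lemma measurable_pair_labels:
 fixes f :: "'x => 'l => 'z"
 assumes "!!u. (%x. f x u) \<in> measurable X N"
 shows "(%z. f (fst z) (snd z)) \<in> measurable (X \<Otimes>\<^sub>M count_space UNIV) N"
proof -
 have "(%z. f (snd z) (fst z)) \<in> measurable (count_space UNIV \<Otimes>\<^sub>M X) N"
  by (rule measurable_pair_measure_countable1) (use assms in auto)
 from measurable_compose[OF measurable_pair_swap' this] show ?thesis by (simp add: case_prod_unfold)
qed

lemma label_indicator_measurable: "(%z. c * indicator (S (fst z)) (snd z) :: real) \<in> BM (X \<Otimes>\<^sub>M count_space UNIV)"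
proof (rule measurable_pair_labels)
 fix u
 note [measurable] = S(1)[of u]
 have "(%x. c * (if u \<in> S x then 1 else 0)) \<in> BM X" by measurable
 then show "(%x. c * indicator (S x) u :: real) \<in> BM X" by (simp add: indicator_def)
qed

lemma nn_integral_tuple_measure:
 assumes H: "H \<in> BM P"
 shows "(\<integral>\<^sup>+v. H v \<partial>tuple_measure X c S pt P) = (\<integral>\<^sup>+x. (\<Sum>u\<in>S x. ennreal c * H (pt u x)) \<partial>X)"
proof -
 interpret sigma_finite_measure "count_space (UNIV :: 'l set)" by (rule sigma_finite_measure_count_space)
 have m: "(%z. pt (snd z) (fst z)) \<in> measurable (X \<Otimes>\<^sub>M count_space UNIV) P" by (rule measurable_pair_labels[OF pt])
 note [measurable] = measurable_compose[OF m H] label_indicator_measurable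
 have "(\<integral>\<^sup>+v. H v \<partial>tuple_measure X c S pt P) = (\<integral>\<^sup>+z. ennreal (c * indicator (S (fst z)) (snd z)) * H (pt (snd z) (fst z)) \<partial>(X \<Otimes>\<^sub>M count_space UNIV))"
  unfolding tuple_measure_def using m H by (subst nn_integral_distr) (auto simp: nn_integral_density)
 also have "... = (\<integral>\<^sup>+x. \<integral>\<^sup>+u. ennreal (c * indicator (S x) u) * H (pt u x) \<partial>count_space UNIV \<partial>X)"
  by (subst nn_integral_fst[symmetric]) auto
 also have "... = (\<integral>\<^sup>+x. (\<Sum>u\<in>S x. ennreal c * H (pt u x)) \<partial>X)"
 proof (rule nn_integral_cong)
  fix x
  have "(\<integral>\<^sup>+u. ennreal (c * indicator (S x) u) * H (pt u x) \<partial>count_space UNIV) = (\<Sum>u\<in>S x. ennreal (c * indicator (S x) u) * H (pt u x))"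
   by (rule nn_integral_count_space'[OF S(2)]) auto
  then show "(\<integral>\<^sup>+u. ennreal (c * indicator (S x) u) * H (pt u x) \<partial>count_space UNIV) = (\<Sum>u\<in>S x. ennreal c * H (pt u x))" by simp
 qed
 finally show ?thesis .
qed

lemma integral_tuple_measure:
 fixes H :: "'y => 'b::{banach, second_countable_topology}"
 assumes H: "H \<in> BM P" and int: "integrable X (%x. \<Sum>u\<in>S x. norm (H (pt u x)))"
 shows "integrable (tuple_measure X c S pt P) H"
  and "(LINT v|tuple_measure X c S pt P. H v) = (LINT x|X. (\<Sum>u\<in>S x. c *\<^sub>R H (pt u x)))"
proof -
 interpret CS: sigma_finite_measure "count_space (UNIV :: 'l set)" by (rule sigma_finite_measure_count_space)
 interpret X: sigma_finite_measure X by (rule X)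
 interpret L: pair_sigma_finite X "count_space (UNIV :: 'l set)" by unfold_locales
 have m: "(%z. pt (snd z) (fst z)) \<in> measurable (X \<Otimes>\<^sub>M count_space UNIV) P" by (rule measurable_pair_labels[OF pt])
 note [measurable] = measurable_compose[OF m H] label_indicator_measurable
 let ?G = "%z. (c * indicator (S (fst z)) (snd z)) *\<^sub>R H (pt (snd z) (fst z))"
 have dens: "integrable (density (X \<Otimes>\<^sub>M count_space UNIV) (%z. ennreal (c * indicator (S (fst z)) (snd z)))) (%z. H (pt (snd z) (fst z)))
  \<longleftrightarrow> integrable (X \<Otimes>\<^sub>M count_space UNIV) ?G"
  using c by (intro integrable_density) auto
 show I: "integrable (tuple_measure X c S pt P) H"
 proof (rule integrableI_bounded)
  have mm: "(%v. ennreal (norm (H v))) \<in> BM P" using H by measurable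
  have "(\<integral>\<^sup>+v. norm (H v) \<partial>tuple_measure X c S pt P) = (\<integral>\<^sup>+x. ennreal (norm (c * (\<Sum>u\<in>S x. norm (H (pt u x))))) \<partial>X)"
   unfolding nn_integral_tuple_measure[OF mm] using c
   by (intro nn_integral_cong) (simp add: sum_nonneg abs_mult sum_distrib_left ennreal_mult[symmetric] sum_ennreal)
  also have "... < \<infinity>" using integrable_mult_right[OF int, of c] unfolding integrable_iff_bounded by blast
  finally show "(\<integral>\<^sup>+v. norm (H v) \<partial>tuple_measure X c S pt P) < \<infinity>" .
 qed (use H in "simp add: tuple_measure_def")
 then have G: "integrable (X \<Otimes>\<^sub>M count_space UNIV) ?G"
  unfolding tuple_measure_def using m H by (subst (asm) integrable_distr_eq) (auto simp: dens)
 have "(LINT v|tuple_measure X c S pt P. H v) = (LINT z|(X \<Otimes>\<^sub>M count_space UNIV). ?G z)"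
  unfolding tuple_measure_def using m H c by (subst integral_distr) (auto simp: integral_density)
 also have "... = (LINT x|X. LINT u|count_space UNIV. ?G (x, u))" by (rule L.integral_fst'[OF G, symmetric])
 also have "... = (LINT x|X. (\<Sum>u\<in>S x. c *\<^sub>R H (pt u x)))"
 proof (rule bintegral_cong[OF refl])
  fix x
  have sub: "{u. u \<in> UNIV \<and> ?G (x, u) ~= 0} \<subseteq> S x" by (auto simp: indicator_def)
  have "(LINT u|count_space UNIV. ?G (x, u)) = (\<Sum>u | u \<in> UNIV \<and> ?G (x, u) ~= 0. ?G (x, u))"
   by (rule lebesgue_integral_count_space_finite_support[OF finite_subset[OF sub S(2)]])
  also have "... = (\<Sum>u\<in>S x. ?G (x, u))" by (rule sum.mono_neutral_left[OF S(2) sub]) auto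
  finally show "(LINT u|count_space UNIV. ?G (x, u)) = (\<Sum>u\<in>S x. c *\<^sub>R H (pt u x))" by simp
 qed
 finally show "(LINT v|tuple_measure X c S pt P. H v) = (LINT x|X. (\<Sum>u\<in>S x. c *\<^sub>R H (pt u x)))" .
qed

end

lemma card_tuples_le: "finite T ==> card (tuples n b T) <= card T ^ n"
proof (induction n arbitrary: T)
 case (Suc n)
 have "card (tuples (Suc n) b T) = (\<Sum>us\<in>tuples (Suc n) b T. 1)" by simp
 also have "... = (\<Sum>u\<in>T. card (tuples n b (shrink b T u)))" by (subst sum_tuples_Suc[OF Suc.prems]) simp
 also have "... <= (\<Sum>u\<in>T. card T ^ n)"
 proof (rule sum_mono)
  fix u
  have "card (tuples n b (shrink b T u)) <= card (shrink b T u) ^ n" using Suc by simp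
  also have "... <= card T ^ n" using Suc.prems by (intro power_mono card_mono) (auto simp: shrink_def)
  finally show "card (tuples n b (shrink b T u)) <= card T ^ n" .
 qed
 finally show ?case by simp
qed simp

section \<open>Full and reduced tuple measures of a cluster\<close>

abbreviation (input) "coord_space J \<equiv> (\<Pi>\<^sub>M j\<in>J. (borel :: real measure)) :: (nat => real) measure"

context cluster
begin

abbreviation (input) "pl om u \<equiv> place (fam om) u"

text \<open>Positions are taken relative to the first member of the tuple, so the root disappears.
  \<open>full\<close> keeps the root and spreads it by Lebesgue measure.\<close>

definition red :: "nat => bool => real => (nat => real) measure" where
 "red n b c = tuple_measure M c (%om. tuples n b (ftree om)) (%us om. \<lambda>j\<in>{1..<n}. pl om (us ! j) - pl om (us ! 0)) (coord_space {1..<n})"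

definition full :: "nat => bool => real => (nat => real) measure" where
 "full n b c = tuple_measure (lborel \<Otimes>\<^sub>M M) c (%p. tuples n b (ftree (snd p))) (%us p. \<lambda>j\<in>{..<n}. fst p + pl (snd p) (us ! j)) (coord_space {..<n})"

lemma sets_red_full [simp]: "sets (red n b c) = sets (coord_space {1..<n})" "sets (full n b c) = sets (coord_space {..<n})"
 by (simp_all add: red_def full_def tuple_measure_def)

lemma tuple_assumptions:
 "Measurable.pred M (%om. us \<in> tuples n b (ftree om))"
 "Measurable.pred (lborel \<Otimes>\<^sub>M M) (%p. us \<in> tuples n b (ftree (snd p)))"
 "finite (tuples n b (ftree om))"
 "(%om. \<lambda>j\<in>{1..<n}. pl om (us ! j) - pl om (us ! 0)) \<in> measurable M (coord_space {1..<n})"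
 "(%p. \<lambda>j\<in>{..<n}. fst p + pl (snd p) (us ! j)) \<in> measurable (lborel \<Otimes>\<^sub>M M) (coord_space {..<n})"
proof -
 show P: "Measurable.pred M (%om. us \<in> tuples n b (ftree om))"
  using measurable_ftree_compose[of "%A om. us \<in> tuples n b A" "count_space UNIV"] by simp
 show "Measurable.pred (lborel \<Otimes>\<^sub>M M) (%p. us \<in> tuples n b (ftree (snd p)))"
  by (rule measurable_compose[OF measurable_snd P])
 show "finite (tuples n b (ftree om))" by (intro finite_tuples) simp
 show "(%om. \<lambda>j\<in>{1..<n}. pl om (us ! j) - pl om (us ! 0)) \<in> measurable M (coord_space {1..<n})"
  by (rule measurable_restrict) measurable
 show "(%p. \<lambda>j\<in>{..<n}. fst p + pl (snd p) (us ! j)) \<in> measurable (lborel \<Otimes>\<^sub>M M) (coord_space {..<n})"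
  by (rule measurable_restrict) measurable
qed

lemma sigma_finite_pair: "sigma_finite_measure (lborel \<Otimes>\<^sub>M M)"
 using LM.sigma_finite_measure_axioms .

lemma red_nn:
 assumes "0 <= c" "H \<in> BM (coord_space {1..<n})"
 shows "(\<integral>\<^sup>+v. H v \<partial>red n b c) =
  (\<integral>\<^sup>+om. (\<Sum>us\<in>tuples n b (ftree om). ennreal c * H (\<lambda>j\<in>{1..<n}. pl om (us ! j) - pl om (us ! 0))) \<partial>M)"
 unfolding red_def
 by (rule nn_integral_tuple_measure[OF sigma_finite_measure_axioms assms(1) tuple_assumptions(1,3,4) assms(2)])

lemma red_int:
 fixes H :: "(nat => real) => 'b::{banach, second_countable_topology}"
 assumes "0 <= c" "H \<in> BM (coord_space {1..<n})"
  "integrable M (%om. \<Sum>us\<in>tuples n b (ftree om). norm (H (\<lambda>j\<in>{1..<n}. pl om (us ! j) - pl om (us ! 0))))"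
 shows "integrable (red n b c) H"
  "(LINT v|red n b c. H v) = (LINT om|M. (\<Sum>us\<in>tuples n b (ftree om). c *\<^sub>R H (\<lambda>j\<in>{1..<n}. pl om (us ! j) - pl om (us ! 0))))"
 unfolding red_def
 by (rule integral_tuple_measure[OF sigma_finite_measure_axioms assms(1) tuple_assumptions(1,3,4) assms(2)], rule assms(3))+

lemma full_nn:
 assumes "0 <= c" "H \<in> BM (coord_space {..<n})"
 shows "(\<integral>\<^sup>+v. H v \<partial>full n b c) =
  (\<integral>\<^sup>+p. (\<Sum>us\<in>tuples n b (ftree (snd p)). ennreal c * H (\<lambda>j\<in>{..<n}. fst p + pl (snd p) (us ! j))) \<partial>(lborel \<Otimes>\<^sub>M M))"
 unfolding full_def
 by (rule nn_integral_tuple_measure[OF sigma_finite_pair assms(1) tuple_assumptions(2,3,5) assms(2)])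

lemma full_int:
 fixes H :: "(nat => real) => 'b::{banach, second_countable_topology}"
 assumes "0 <= c" "H \<in> BM (coord_space {..<n})"
  "integrable (lborel \<Otimes>\<^sub>M M) (%p. \<Sum>us\<in>tuples n b (ftree (snd p)). norm (H (\<lambda>j\<in>{..<n}. fst p + pl (snd p) (us ! j))))"
 shows "integrable (full n b c) H"
  "(LINT v|full n b c. H v) = (LINT p|(lborel \<Otimes>\<^sub>M M). (\<Sum>us\<in>tuples n b (ftree (snd p)). c *\<^sub>R H (\<lambda>j\<in>{..<n}. fst p + pl (snd p) (us ! j))))"
 unfolding full_def
 by (rule integral_tuple_measure[OF sigma_finite_pair assms(1) tuple_assumptions(2,3,5) assms(2)], rule assms(3))+

lemma card_tuples_integrable: "integrable M (%om. real (card (tuples n b (ftree om))))"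
proof (rule bintegrable_bound[OF card_power_integrable[of n]])
 show "(%om. real (card (tuples n b (ftree om)))) \<in> BM M"
  by (rule measurable_ftree_compose) simp
 show "AE om in M. norm (real (card (tuples n b (ftree om)))) <= norm (real (card (ftree om)) ^ n)"
  using card_tuples_le[OF finite_ftree, of n b] by (intro AE_I2) (simp flip: of_nat_power)
qed

lemma finite_red: assumes "0 <= c" shows "finite_measure (red n b c)"
proof -
 have "integrable (red n b c) (%_. 1 :: real)"
  by (rule red_int(1)[OF assms]) (simp_all add: card_tuples_integrable)
 then show ?thesis by (intro finite_measureI) (simp add: integrable_iff_bounded less_top)
qed

lemma red_bounded_integral:
 fixes H :: "(nat => real) => 'b::{banach, second_countable_topology}"
 assumes c: "0 <= c" and H: "H \<in> BM (coord_space {1..<n})" "!!v. norm (H v) <= 1"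
 shows "(LINT v|red n b c. H v) = (LINT om|M. (\<Sum>us\<in>tuples n b (ftree om). c *\<^sub>R H (\<lambda>j\<in>{1..<n}. pl om (us ! j) - pl om (us ! 0))))"
  and "integrable M (%om. \<Sum>us\<in>tuples n b (ftree om). c *\<^sub>R H (\<lambda>j\<in>{1..<n}. pl om (us ! j) - pl om (us ! 0)))"
proof -
 have m: "(%om. \<Sum>us\<in>tuples n b (ftree om). r *\<^sub>R g (H (\<lambda>j\<in>{1..<n}. pl om (us ! j) - pl om (us ! 0)))) \<in> BM M"
  if [measurable]: "g \<in> BM borel" for g :: "'b => 'c::{banach, second_countable_topology}" and r
 proof (rule measurable_ftree_compose, rule borel_measurable_sum)
  fix us :: "nat list list"
  note [measurable] = measurable_compose[OF tuple_assumptions(4)[where n=n and us=us] H(1)]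
  show "(%om. r *\<^sub>R g (H (\<lambda>j\<in>{1..<n}. pl om (us ! j) - pl om (us ! 0)))) \<in> BM M" by measurable
 qed
 have n: "norm (\<Sum>us\<in>A. r *\<^sub>R g (H (f us))) <= \<bar>r\<bar> * real (card A)"
  if "!!v. norm (g (H v)) <= 1" for g :: "'b => 'c::{banach, second_countable_topology}" and r A and f :: "nat list list => _"
 proof -
  have "norm (\<Sum>us\<in>A. r *\<^sub>R g (H (f us))) <= (\<Sum>us\<in>A. norm (r *\<^sub>R g (H (f us))))" by (rule norm_sum)
  also have "... <= (\<Sum>us\<in>A. \<bar>r\<bar> * 1)" unfolding norm_scaleR using that by (intro sum_mono mult_left_mono) auto
  finally show ?thesis by (simp add: mult.commute)
 qed
 have I: "integrable M (%om. \<Sum>us\<in>tuples n b (ftree om). r *\<^sub>R g (H (\<lambda>j\<in>{1..<n}. pl om (us ! j) - pl om (us ! 0))))"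
  if g: "g \<in> BM borel" "!!v. norm (g (H v)) <= 1" for g :: "'b => 'c::{banach, second_countable_topology}" and r
 proof (rule bintegrable_bound[OF integrable_mult_right[OF card_tuples_integrable, of "\<bar>r\<bar>" n b] m[OF g(1)]])
  show "AE om in M. norm (\<Sum>us\<in>tuples n b (ftree om). r *\<^sub>R g (H (\<lambda>j\<in>{1..<n}. pl om (us ! j) - pl om (us ! 0)))) <= norm (\<bar>r\<bar> * real (card (tuples n b (ftree om))))" (is "AE om in _. ?AE om")
  proof (rule AE_I2)
   fix om
   have "norm (\<Sum>us\<in>tuples n b (ftree om). r *\<^sub>R g (H (\<lambda>j\<in>{1..<n}. pl om (us ! j) - pl om (us ! 0)))) <= \<bar>r\<bar> * real (card (tuples n b (ftree om)))"
    by (rule n) (rule g(2))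
   then show "?AE om"
    by simp
  qed
 qed
 show "(LINT v|red n b c. H v) = (LINT om|M. (\<Sum>us\<in>tuples n b (ftree om). c *\<^sub>R H (\<lambda>j\<in>{1..<n}. pl om (us ! j) - pl om (us ! 0))))"
  by (rule red_int(2)[OF c H(1)]) (use I[of norm 1] H(2) in simp)
 show "integrable M (%om. \<Sum>us\<in>tuples n b (ftree om). c *\<^sub>R H (\<lambda>j\<in>{1..<n}. pl om (us ! j) - pl om (us ! 0)))"
  using I[of "%x. x" c] H(2) by simp
qed

lemma shift_map_measurable:
 "(%p. \<lambda>j\<in>{..<n}. if j = 0 then fst p else fst p + snd p j) \<in> measurable (lborel \<Otimes>\<^sub>M red n b c) (coord_space {..<n})"
 by (rule measurable_restrict) (use shifted_coordinate_measurable[of "red n b c" n] in auto)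

text \<open>For each tuple the root is translated by the position of the first member. Lebesgue
  measure is invariant, and the first coordinate becomes the base point of the reduction.\<close>

lemma full_eq:
 assumes c: "0 <= c" and n: "0 < n"
 shows "full n b c = distr (lborel \<Otimes>\<^sub>M red n b c) (coord_space {..<n}) (%p. \<lambda>j\<in>{..<n}. if j = 0 then fst p else fst p + snd p j)"
proof (rule measure_eqI)
 let ?s = "%p. \<lambda>j\<in>{..<n}. if j = 0 then fst p else fst p + snd p j"
 interpret R: finite_measure "red n b c" by (rule finite_red[OF c])
 interpret L: pair_sigma_finite lborel "red n b c" by unfold_locales
 fix A assume "A \<in> sets (full n b c)"
 then have A [measurable]: "A \<in> sets (coord_space {..<n})" by simp
 let ?H = "indicator A :: _ => ennreal"
 have H: "?H \<in> BM (coord_space {..<n})" by measurable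
 note sm = shift_map_measurable[of n b c]
 note hm [measurable] = measurable_compose[OF sm H]
 let ?d = "%us om. \<lambda>j\<in>{1..<n}. pl om (us ! j) - pl om (us ! 0)"
 have "emeasure (distr (lborel \<Otimes>\<^sub>M red n b c) (coord_space {..<n}) ?s) A = (\<integral>\<^sup>+p. ?H (?s p) \<partial>(lborel \<Otimes>\<^sub>M red n b c))"
 proof -
  have "(\<integral>\<^sup>+v. ?H v \<partial>distr (lborel \<Otimes>\<^sub>M red n b c) (coord_space {..<n}) ?s) = (\<integral>\<^sup>+p. ?H (?s p) \<partial>(lborel \<Otimes>\<^sub>M red n b c))"
   by (rule nn_integral_distr[OF sm]) (use H in simp)
  then show ?thesis using A by simp
 qed
 also have "... = (\<integral>\<^sup>+v. (\<integral>\<^sup>+t. ?H (?s (t, v)) \<partial>lborel) \<partial>red n b c)"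
  by (subst L.nn_integral_snd[symmetric]) auto
 also have "... = (\<integral>\<^sup>+om. (\<Sum>us\<in>tuples n b (ftree om). ennreal c * (\<integral>\<^sup>+t. ?H (?s (t, ?d us om)) \<partial>lborel)) \<partial>M)"
 proof (rule red_nn[OF c])
  have "(%v. \<integral>\<^sup>+t. ?H (?s (t, v)) \<partial>lborel) \<in> BM (red n b c)"
   by (rule lborel.borel_measurable_nn_integral) (use hm in \<open>simp add: case_prod_unfold measurable_pair_swap_iff[of _ "red n b c" lborel]\<close>)
  then show "(%v. \<integral>\<^sup>+t. ?H (?s (t, v)) \<partial>lborel) \<in> BM (coord_space {1..<n})"
   by (simp add: measurable_cong_sets[OF sets_red_full(1) refl])
 qed
 also have "... = (\<integral>\<^sup>+om. (\<integral>\<^sup>+x. (\<Sum>us\<in>tuples n b (ftree om). ennreal c * ?H (\<lambda>j\<in>{..<n}. x + pl om (us ! j))) \<partial>lborel) \<partial>M)"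
 proof (rule nn_integral_cong)
  fix om
  have cm: "(%x :: real. ?H (\<lambda>j\<in>{..<n}. x + a j)) \<in> BM borel" for a :: "nat => real"
   by (rule measurable_compose[OF measurable_restrict H]) auto
  have cm': "(%t :: real. ?H (?s (t, ?d us om))) \<in> BM borel" for us
   by (rule measurable_compose[OF measurable_restrict H], unfold fst_conv snd_conv) measurable
  have "(\<integral>\<^sup>+x. (\<Sum>us\<in>tuples n b (ftree om). ennreal c * ?H (\<lambda>j\<in>{..<n}. x + pl om (us ! j))) \<partial>lborel) =
    (\<Sum>us\<in>tuples n b (ftree om). ennreal c * (\<integral>\<^sup>+x. ?H (\<lambda>j\<in>{..<n}. x + pl om (us ! j)) \<partial>lborel))"
   using cm by (subst nn_integral_sum) (auto simp: nn_integral_cmult)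
  also have "... = (\<Sum>us\<in>tuples n b (ftree om). ennreal c * (\<integral>\<^sup>+t. ?H (?s (t, ?d us om)) \<partial>lborel))"
  proof (rule sum.cong[OF refl], rule sym, rule arg_cong[where f="%y. ennreal c * y"])
   fix us
   have "(\<integral>\<^sup>+t. ?H (?s (t, ?d us om)) \<partial>lborel) = (\<integral>\<^sup>+x. ?H (?s (x + pl om (us ! 0), ?d us om)) \<partial>lborel)"
    by (rule nn_integral_lborel_shift[OF cm', symmetric])
   also have "... = (\<integral>\<^sup>+x. ?H (\<lambda>j\<in>{..<n}. x + pl om (us ! j)) \<partial>lborel)"
   proof (rule nn_integral_cong, rule arg_cong[where f="?H"])
    fix x
    show "?s (x + pl om (us ! 0), ?d us om) = (\<lambda>j\<in>{..<n}. x + pl om (us ! j))"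
    unfolding fst_conv snd_conv by (rule restrict_ext) auto
   qed
   finally show "(\<integral>\<^sup>+t. ?H (?s (t, ?d us om)) \<partial>lborel) = (\<integral>\<^sup>+x. ?H (\<lambda>j\<in>{..<n}. x + pl om (us ! j)) \<partial>lborel)" .
  qed
  finally show "(\<Sum>us\<in>tuples n b (ftree om). ennreal c * (\<integral>\<^sup>+t. ?H (?s (t, ?d us om)) \<partial>lborel)) =
   (\<integral>\<^sup>+x. (\<Sum>us\<in>tuples n b (ftree om). ennreal c * ?H (\<lambda>j\<in>{..<n}. x + pl om (us ! j))) \<partial>lborel)" ..
 qed
 also have "... = (\<integral>\<^sup>+p. (\<Sum>us\<in>tuples n b (ftree (snd p)). ennreal c * ?H (\<lambda>j\<in>{..<n}. fst p + pl (snd p) (us ! j))) \<partial>(lborel \<Otimes>\<^sub>M M))"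
 proof (subst LM.nn_integral_snd[symmetric])
  show "(%p. \<Sum>us\<in>tuples n b (ftree (snd p)). ennreal c * ?H (\<lambda>j\<in>{..<n}. fst p + pl (snd p) (us ! j))) \<in> BM (lborel \<Otimes>\<^sub>M M)"
  proof (rule measurable_ftree_pair, rule borel_measurable_sum)
   fix us :: "nat list list"
   note [measurable] = measurable_compose[OF tuple_assumptions(5)[where n=n and us=us] H]
   show "(%p. ennreal c * ?H (\<lambda>j\<in>{..<n}. fst p + pl (snd p) (us ! j))) \<in> BM (lborel \<Otimes>\<^sub>M M)" by measurable
  qed
 qed simp
 also have "... = emeasure (full n b c) A"
  using A by (subst full_nn[OF c H, symmetric]) simp
 finally show "emeasure (full n b c) A = emeasure (distr (lborel \<Otimes>\<^sub>M red n b c) (coord_space {..<n}) ?s) A" ..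
qed simp

text \<open>Tested on products, \<open>full\<close> yields precisely the tuple sums found as mixed
  derivatives in \<open>lsum_mixed_partial\<close>; this is what makes it a cumulant
  measure.\<close>

lemma full_prod:
 assumes c: "0 <= c" and n: "0 < n" and f: "!!j. j < n ==> bounded_compact_support (f j)"
 shows "integrable (full n b c) (%t. \<Prod>j<n. f j (t j))"
  and "(LINT t|full n b c. (\<Prod>j<n. f j (t j))) = c * (LINT p|(lborel \<Otimes>\<^sub>M M). lsum (map f [0..<n]) b (%_. 0) p)"
proof -
 have H: "(%t. \<Prod>j<n. f j (t j)) \<in> BM (coord_space {..<n})"
  using f by (intro borel_measurable_prod measurable_compose[OF measurable_component_singleton]) (auto simp: bounded_compact_support_def)
 have eq: "lsum (map g [0..<n]) b (%_. 0) p = (\<Sum>us\<in>tuples n b (ftree (snd p)). \<Prod>j<n. g j (fst p + pl (snd p) (us ! j)))" for g p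
  unfolding lsum_def label_sum_zero[OF finite_ftree] by (intro sum.cong prod.cong) auto
 obtain B where B: "1 <= B" "!!j x. j < n ==> \<bar>f j x\<bar> <= B" using bounded_compact_support_common_bound[of n f] f by blast
 have "integrable (lborel \<Otimes>\<^sub>M M) (%p. lsum (map (%j x. \<bar>f j x\<bar>) [0..<n]) b (%_. 0) p - (if map (%j x. \<bar>f j x\<bar>) [0..<n] = [] then 1 else 0))"
 proof (rule lsum_integrable[where B=B])
  show "bounded_compact_support h" if "h \<in> set (map (%j x. \<bar>f j x\<bar>) [0..<n])" for h
   using that f by (fastforce simp: bounded_compact_support_def)
  show "bounded_compact_support (%_. 0)" by (auto simp: bounded_compact_support_def)
 qed (use B small in auto)
 then have int: "integrable (lborel \<Otimes>\<^sub>M M) (%p. \<Sum>us\<in>tuples n b (ftree (snd p)). norm (\<Prod>j<n. f j ((\<lambda>j\<in>{..<n}. fst p + pl (snd p) (us ! j)) j)))"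
  using n unfolding eq by (simp add: abs_prod)
 show "integrable (full n b c) (%t. \<Prod>j<n. f j (t j))" by (rule full_int(1)[OF c H int])
 show "(LINT t|full n b c. (\<Prod>j<n. f j (t j))) = c * (LINT p|(lborel \<Otimes>\<^sub>M M). lsum (map f [0..<n]) b (%_. 0) p)"
  unfolding full_int(2)[OF c H int] eq by (simp add: sum_distrib_left[symmetric])
qed

text \<open>Measures built from tuples are positive, so the second component of each pair is null.
  Local finiteness of \<open>full\<close> comes from testing with indicators of intervals.\<close>

lemma full_reduction:
 assumes c: "0 <= c" and n: "0 < n"
 shows "signed_measure_on {..<n} (full n b c, null_measure (coord_space {..<n}))"
  and "is_reduction n (full n b c, null_measure (coord_space {..<n})) (red n b c, null_measure (coord_space {1..<n}))"
  and "finite_signed (red n b c, null_measure (coord_space {1..<n}))"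
proof -
 interpret R: finite_measure "red n b c" by (rule finite_red[OF c])
 interpret L: pair_sigma_finite lborel "red n b c" by unfold_locales
 have lf: "locally_finite_on {..<n} (full n b c)"
  unfolding locally_finite_on_def
 proof (intro conjI allI)
  fix r :: real
  have "bounded_compact_support (indicator {- r..r})"
   unfolding bounded_compact_support_def by (auto simp: indicator_def abs_le_iff intro: exI[of _ 1] exI[of _ r])
  from full_prod(1)[OF c n, of "%_. indicator {- r..r}", OF this] have "(\<integral>\<^sup>+t. ennreal (norm (\<Prod>j<n. indicator {- r..r} (t j) :: real)) \<partial>full n b c) < \<infinity>"
   by (simp add: integrable_iff_bounded)
  moreover have "emeasure (full n b c) (\<Pi>\<^sub>E j\<in>{..<n}. {- r..r}) = (\<integral>\<^sup>+t. indicator (\<Pi>\<^sub>E j\<in>{..<n}. {- r..r}) t \<partial>full n b c)"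
   by (rule nn_integral_indicator[symmetric]) (auto intro!: sets_PiM_I_finite)
  moreover have "... <= (\<integral>\<^sup>+t. ennreal (norm (\<Prod>j<n. indicator {- r..r} (t j) :: real)) \<partial>full n b c)"
   by (intro nn_integral_mono) (auto simp: indicator_def PiE_iff)
  ultimately show "emeasure (full n b c) (\<Pi>\<^sub>E j\<in>{..<n}. {- r..r}) < \<infinity>" by (auto intro: le_less_trans)
 qed simp
 have null: "locally_finite_on J (null_measure (coord_space J))" for J by (simp add: locally_finite_on_def)
 have red: "locally_finite_on {1..<n} (red n b c)"
  using R.emeasure_finite by (simp add: locally_finite_on_def less_top[symmetric])
 show "signed_measure_on {..<n} (full n b c, null_measure (coord_space {..<n}))"
  using lf null by (simp add: signed_measure_on_def)
 show "finite_signed (red n b c, null_measure (coord_space {1..<n}))"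
  using R.finite_measure_axioms by (auto simp: finite_signed_def intro!: finite_measureI)
 show "is_reduction n (full n b c, null_measure (coord_space {..<n})) (red n b c, null_measure (coord_space {1..<n}))"
  unfolding is_reduction_def
 proof (intro conjI allI impI)
  show "signed_measure_on {1..<n} (red n b c, null_measure (coord_space {1..<n}))" using red null by (simp add: signed_measure_on_def)
  fix F :: "(nat => real) => real" assume "bounded_compact_support_on {..<n} F"
  then obtain B r where F': "F \<in> BM (coord_space {..<n})" "\<forall>t. \<bar>F t\<bar> <= B" "\<forall>t. F t ~= 0 --> (\<forall>j\<in>{..<n}. \<bar>t j\<bar> <= r)"
   unfolding bounded_compact_support_on_def by blast
  then have F: "F \<in> BM (coord_space {..<n})" "\<bar>F t\<bar> <= B" "F t ~= 0 ==> j < n ==> \<bar>t j\<bar> <= r" for t j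
   by auto
  let ?s = "%p. \<lambda>j\<in>{..<n}. if j = 0 then fst p else fst p + snd p j"
  have int: "integrable (lborel \<Otimes>\<^sub>M red n b c) (%p. F (?s p))"
  proof (rule bintegrable_bound)
   show "integrable (lborel \<Otimes>\<^sub>M red n b c) (%p. B * (indicator {- r..r} (fst p) *\<^sub>R (1::real)))"
    by (intro integrable_mult_right integrable_strip(1)[OF R.finite_measure_axioms]) auto
   show "(%p. F (?s p)) \<in> BM (lborel \<Otimes>\<^sub>M red n b c)" by (rule measurable_compose[OF shift_map_measurable F(1)])
   show "AE p in lborel \<Otimes>\<^sub>M red n b c. norm (F (?s p)) <= norm (B * (indicator {- r..r} (fst p) *\<^sub>R (1::real)))" (is "AE p in _. ?AE p")
   proof (rule AE_I2)
    fix p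
    show "?AE p"
    using F(2)[of "?s p"] F(3)[of "?s p" 0] n by (cases "F (?s p) = 0") (auto simp: indicator_def abs_le_iff)
   qed
  qed
  have "(LINT t|full n b c. F t) = (LINT p|(lborel \<Otimes>\<^sub>M red n b c). F (?s p))"
   unfolding full_eq[OF c n] by (rule integral_distr[OF shift_map_measurable F(1)])
  also have "... = (LINT t0|lborel. LINT v|red n b c. F (?s (t0, v)))" by (rule L.integral_fst'[OF int, symmetric])
  finally show "signed_integral (full n b c, null_measure (coord_space {..<n})) F =
    (LINT t0|lborel. signed_integral (red n b c, null_measure (coord_space {1..<n})) (%v. F (\<lambda>j\<in>{..<n}. if j = 0 then t0 else t0 + v j)))"
   unfolding fst_conv snd_conv by (simp add: signed_integral_def)
 qed
qed

end

section \<open>Cumulants of the stationary process\<close>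

text \<open>Inclusion and exclusion over the three possible coincidences: a triple of equal indices
  is counted by each of the three pair sums, twice too often.\<close>

lemma sum_coincidences:
 fixes E :: "'i => 'i => 'i => complex"
 assumes T: "finite T"
 shows "(\<Sum>a\<in>T. \<Sum>b\<in>T. \<Sum>c\<in>T. E a b c) = (\<Sum>a\<in>T. \<Sum>b\<in>T - {a}. \<Sum>c\<in>T - {a} - {b}. E a b c) +
  (\<Sum>a\<in>T. \<Sum>b\<in>T. E a b a) + (\<Sum>a\<in>T. \<Sum>b\<in>T. E a a b) + (\<Sum>a\<in>T. \<Sum>b\<in>T. E a b b) - 2 * (\<Sum>a\<in>T. E a a a)"
proof -
 have "(\<Sum>b\<in>T - {a}. \<Sum>c\<in>T - {a} - {b}. E a b c) =
   (\<Sum>b\<in>T. \<Sum>c\<in>T. E a b c) - (\<Sum>b\<in>T. E a b a) - (\<Sum>b\<in>T. E a a b) - (\<Sum>b\<in>T. E a b b) + 2 * E a a a" if a: "a \<in> T" for a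
 proof -
  have "(\<Sum>b\<in>T - {a}. \<Sum>c\<in>T - {a} - {b}. E a b c) = (\<Sum>b\<in>T - {a}. (\<Sum>c\<in>T. E a b c) - E a b a - E a b b)"
   using T a by (intro sum.cong) (auto simp: sum_diff1)
  also have "... = (\<Sum>b\<in>T. (\<Sum>c\<in>T. E a b c) - E a b a - E a b b) - ((\<Sum>c\<in>T. E a a c) - E a a a - E a a a)"
   using T a by (simp add: sum_diff1)
  finally show ?thesis by (simp add: sum_subtractf)
 qed
 then show ?thesis by (simp add: sum_subtractf sum.distrib sum_distrib_left)
qed

text \<open>Both measures are positive, and their masses agree by frequency 0. After normalisation
  they become probability laws on the line, to which Levy's uniqueness theorem applies.\<close>

lemma measure_eq_fourier_stieltjes:
 assumes P: "finite_measure P" "sets P = sets (coord_space {1..<2})" and P': "finite_measure P'" "sets P' = sets (coord_space {1..<2})"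
  and pos: "0 < measure P (space P)"
  and eq: "!!w. (CLINT v|P. iexp (w * v 1)) = (CLINT v|P'. iexp (w * v 1))"
 shows "P = P'"
proof -
 let ?p = "%v :: nat => real. v 1"
 have pm: "?p \<in> BM Q" if "sets Q = sets (coord_space {1..<2})" for Q
  unfolding measurable_cong_sets[OF that refl] by (rule measurable_component_singleton) simp
 note pm1 = pm[OF P(2)] and pm2 = pm[OF P'(2)]
 define c where "c = measure P (space P)"
 have "(CLINT v|P. iexp (0 * v 1)) = (CLINT v|P'. iexp (0 * v 1))" by (rule eq)
 then have c': "measure P' (space P') = c" unfolding c_def by (simp add: complex_of_real_def)
 define R where "R Q = density (distr Q borel ?p) (%_. ennreal (1 / c))" for Q
 have c0: "0 < c" using pos by (simp add: c_def)
 have dist: "real_distribution (R Q)" if Q: "finite_measure Q" "sets Q = sets (coord_space {1..<2})" "measure Q (space Q) = c" for Q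
 proof -
  interpret Q: finite_measure Q by (rule Q)
  have "emeasure (R Q) (space (R Q)) = ennreal (1 / c) * emeasure Q (space Q)"
   using pm[OF Q(2)] by (simp add: R_def emeasure_density_const emeasure_distr)
  also have "... = 1" using c0 Q(3) by (simp add: Q.emeasure_eq_measure ennreal_mult[symmetric])
  finally show ?thesis
   unfolding real_distribution_def real_distribution_axioms_def by (auto intro: prob_spaceI simp: R_def)
 qed
 have char: "char (R Q) t = (1 / c) *\<^sub>R (CLINT v|Q. iexp (t * v 1))" if "sets Q = sets (coord_space {1..<2})" for Q t
  using pm[OF that] c0 unfolding char_def R_def by (simp add: integral_density integral_distr)
 have "R P = R P'"
  by (rule Levy_uniqueness) (use dist P P' c' char eq in "auto simp: c_def[symmetric] fun_eq_iff")
 then have "density (R P) (%_. ennreal c) = density (R P') (%_. ennreal c)" by simp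
 moreover have "density (R Q) (%_. ennreal c) = distr Q borel ?p" for Q
  unfolding R_def using c0 by (subst density_density_eq) (auto simp: ennreal_mult[symmetric] density_1)
 ultimately have D: "distr P borel ?p = distr P' borel ?p" by simp
 \<comment> \<open>The product space over the single index 1 is a copy of the line, so a measure on
   it is recovered from its image under the coordinate.\<close>
 have recover: "Q = distr (distr Q borel ?p) (coord_space {1..<2}) (%x. \<lambda>j\<in>{1..<2}. x)" if Q: "sets Q = sets (coord_space {1..<2})" for Q
 proof -
  have m: "(%x :: real. \<lambda>j\<in>{1..<2::nat}. x) \<in> measurable borel (coord_space {1..<2})" by (rule measurable_restrict) simp
  have "distr (distr Q borel ?p) (coord_space {1..<2}) (%x. \<lambda>j\<in>{1..<2}. x) = distr Q (coord_space {1..<2}) (%v. \<lambda>j\<in>{1..<2}. v 1)"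
   by (subst distr_distr[OF m pm[OF Q]]) (simp add: comp_def)
  also have "... = distr Q Q (%v. v)"
  proof (rule distr_cong[OF refl Q[symmetric]])
   fix v assume "v \<in> space Q"
   then have v: "v \<in> extensional {1..<2}" using sets_eq_imp_space_eq[OF Q] by (auto simp: space_PiM PiE_def)
   have "{1..<2} = {1::nat}" by auto
   then show "(\<lambda>j\<in>{1..<2}. v 1) = v" using v by (auto simp: fun_eq_iff extensional_def)
  qed
  finally show ?thesis by simp
 qed
 show ?thesis using recover[OF P(2)] recover[OF P'(2)] D by simp
qed

section \<open>Log-functionals, cumulants and transforms of the stationary process\<close>

context pbc
begin

text \<open>One labelling of all points by cluster and individual, as required for evaluating
  \<open>point_prod\<close>.\<close>

lemma N_points:
 assumes om: "om \<in> space M"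
 shows "N om = points_measure {z. snd z \<in> tr (fst z) om} (%z. U (fst z) om + pl (fst z) om (snd z))"
proof (rule measure_eqI)
 show "sets (N om) = sets (points_measure {z. snd z \<in> tr (fst z) om} (%z. U (fst z) om + pl (fst z) om (snd z)))"
  using N_sets[OF om] by (simp add: points_measure_def)
 fix A assume "A \<in> sets (N om)"
 then have A [measurable]: "A \<in> sets borel" using N_sets[OF om] by simp
 let ?f = "%z. indicator {z. snd z \<in> tr (fst z) om} z * indicator A (U (fst z) om + pl (fst z) om (snd z)) :: ennreal"
 have "emeasure (N om) A = (\<integral>\<^sup>+x. indicator A x \<partial>N om)" using N_sets[OF om] by simp
 also have "... = (\<Sum>j. \<integral>\<^sup>+x. indicator A (U j om + x) \<partial>C j om)" by (rule nn_integral_N[OF om]) simp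
 also have "... = (\<Sum>j. \<integral>\<^sup>+v. ?f (j, v) \<partial>count_space UNIV)"
 proof (rule suminf_cong)
  fix j
  have "(\<integral>\<^sup>+x. indicator A (U j om + x) \<partial>C j om) = (\<integral>\<^sup>+v. indicator A (U j om + pl j om v) \<partial>count_space (tr j om))"
   unfolding C_eq'[OF om] points_measure_def by (subst nn_integral_distr) auto
  also have "... = (\<integral>\<^sup>+v. ?f (j, v) \<partial>count_space UNIV)"
   by (subst nn_integral_count_space_indicator) (auto simp: mult.commute indicator_def intro!: nn_integral_cong)
  finally show "(\<integral>\<^sup>+x. indicator A (U j om + x) \<partial>C j om) = (\<integral>\<^sup>+v. ?f (j, v) \<partial>count_space UNIV)" .
 qed
 also have "... = (\<integral>\<^sup>+z. ?f z \<partial>count_space UNIV)"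
  unfolding nn_integral_count_space_nat[symmetric] by (rule nn_integral_fst_count_space)
 also have "... = (\<integral>\<^sup>+z. indicator A (U (fst z) om + pl (fst z) om (snd z)) \<partial>count_space {z. snd z \<in> tr (fst z) om})"
  by (subst (2) nn_integral_count_space_indicator) (auto simp: mult.commute)
 also have "... = (\<integral>\<^sup>+x. indicator A x \<partial>points_measure {z. snd z \<in> tr (fst z) om} (%z. U (fst z) om + pl (fst z) om (snd z)))"
  unfolding points_measure_def by (subst nn_integral_distr) auto
 also have "... = emeasure (points_measure {z. snd z \<in> tr (fst z) om} (%z. U (fst z) om + pl (fst z) om (snd z))) A"
  by (rule nn_integral_indicator) (simp add: points_measure_def)
 finally show "emeasure (N om) A = emeasure (points_measure {z. snd z \<in> tr (fst z) om} (%z. U (fst z) om + pl (fst z) om (snd z))) A" .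
qed

definition K_of :: "bool => (real => real) => real" where
 "K_of b = (if b then K_fac M N else K_comp M N)"

text \<open>Almost surely only finitely many points meet the support, so the default value 0 of
  \<open>point_prod\<close> does not occur; as \<open>1 + f\<close> is positive the product is the
  exponential of an integral, as in the complete case.\<close>

lemma K_formula:
 assumes f: "bounded_compact_support f" and s: "!!x. \<bar>f x\<bar> <= c0.small"
 shows "K_of b f = ln (LINT om|M. exp (LINT x|N om. ln (weight b (f x))))"
proof (cases b)
 case True
 obtain r where fm [measurable]: "f \<in> BM borel" and r: "!!x. f x ~= 0 ==> \<bar>x\<bar> <= r"
  using f unfolding bounded_compact_support_def by auto
 have pos: "0 < 1 + f x" for x using s[of x] c0.small by linarith
 note pp = point_prod_points_measure[OF N_points fm pos]
 have E: "{x. f x ~= 0} \<in> sets borel" by measurable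
 have im [measurable]: "(%om. LINT x|N om. ln (1 + f x)) \<in> BM M"
  by (rule measurable_compose[OF N_measurable measurable_integral_measure_space_real]) measurable
 have [measurable]: "(%om. emeasure (N om) {x. f x ~= 0}) \<in> BM M"
  by (rule measurable_compose[OF N_measurable measurable_emeasure_measure_space_real[OF E]])
 have "(LINT om|M. point_prod f (N om)) = (LINT om|M. (if emeasure (N om) {x. f x ~= 0} < \<infinity> then exp (LINT x|N om. ln (1 + f x)) else 0))"
  by (rule bintegral_cong[OF refl pp])
 also have "... = (LINT om|M. exp (LINT x|N om. ln (1 + f x)))"
 proof (rule integral_cong_AE)
  show "AE om in M. (if emeasure (N om) {x. f x ~= 0} < \<infinity> then exp (LINT x|N om. ln (1 + f x)) else 0) = exp (LINT x|N om. ln (1 + f x))"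
   using AE_good
  proof eventually_elim
   case (elim om)
   have "{x. f x ~= 0} \<subseteq> {- r..r}" using r by (force simp: abs_le_iff)
   then have "emeasure (N om) {x. f x ~= 0} <= emeasure (N om) {- r..r}"
    using elim N_sets[of om] by (intro emeasure_mono) (auto simp: good_def)
   then show ?case using good_interval[OF elim, of r] by (auto dest: le_less_trans)
  qed
 qed measurable
 finally show ?thesis using True by (simp add: K_of_def K_fac_def weight_def)
qed (simp add: K_of_def K_comp_def weight_def)

lemma weight_assms:
 assumes f: "bounded_compact_support f" and s: "!!x. \<bar>f x\<bar> <= c0.small"
 shows "(%x. weight b (f x)) \<in> BM borel" "0 < exp (- c0.small) / 2" "exp (- c0.small) / 2 <= 1"
  "exp (- c0.small) / 2 <= weight b (f x)" "weight b (f x) <= c0.theta"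
  "\<exists>r. \<forall>x. weight b (f x) ~= 1 --> \<bar>x\<bar> <= r"
proof -
 show "(%x. weight b (f x)) \<in> BM borel" by (rule c0.weight_minus_one_integrable(1)[OF f s])
 show "0 < exp (- c0.small) / 2" by simp
 have "exp (- c0.small) <= 1" using c0.small by simp
 then show "exp (- c0.small) / 2 <= 1" by linarith
 show "exp (- c0.small) / 2 <= weight b (f x)" "weight b (f x) <= c0.theta" using c0.weight_bounds[OF s] by auto
 obtain r where r: "!!x. f x ~= 0 ==> \<bar>x\<bar> <= r" using f unfolding bounded_compact_support_def by auto
 have "\<bar>x\<bar> <= r" if "weight b (f x) ~= 1" for x
  using that r[of x] by (cases "f x = 0"; cases b) (auto simp: weight_def)
 then show "\<exists>r. \<forall>x. weight b (f x) ~= 1 --> \<bar>x\<bar> <= r" by blast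
qed

text \<open>The logarithm cancels the exponential of \<open>laplace_formula\<close>. What remains is
  linear in the functional of a single cluster, so its derivatives contain no products of lower
  orders.\<close>

lemma K_eq:
 assumes f: "bounded_compact_support f" and s: "!!x. \<bar>f x\<bar> <= c0.small"
 shows "K_of b f = \<nu> * (LINT p|(lborel \<Otimes>\<^sub>M M). c0.lsum [] b f p - 1)"
proof -
 note w = weight_assms(1)[OF f s, where b=b] weight_assms(2,3)[OF f s] weight_assms(4-6)[OF f s, where b=b]
 obtain r where r: "!!x. weight b (f x) ~= 1 ==> \<bar>x\<bar> <= r" using w(6) by blast
 have "(LINT om|M. exp (LINT x|N om. ln (weight b (f x)))) = exp (\<nu> * (LINT x|lborel. c0.G (%x. weight b (f x)) x - 1))"
  by (rule laplace_formula(2)[OF w(1-5) r])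
 also have "(LINT x|lborel. c0.G (%x. weight b (f x)) x - 1) = (LINT p|(lborel \<Otimes>\<^sub>M M). c0.lsum [] b f p - 1)"
  unfolding c0.lsum_Nil
  by (rule c0.G_minus_one(2)) (use w c0.weight_bounds[OF s] c0.weight_minus_one_integrable[OF f s] in auto)
 finally show ?thesis unfolding K_formula[OF f s] by simp
qed

lemma bounded_compact_support_uminus: "bounded_compact_support f ==> bounded_compact_support (%x. f (- x))"
 unfolding bounded_compact_support_def by (auto; metis abs_minus minus_minus)

lemma K_reflect:
 assumes "even_fun \<phi>" and f: "bounded_compact_support f" and s: "!!x. \<bar>f x\<bar> <= c0.small"
 shows "K_of b (%x. f (- x)) = K_of b f"
proof -
 note w = weight_assms(1)[OF f s, where b=b] weight_assms(2,3)[OF f s] weight_assms(4-6)[OF f s, where b=b]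
 obtain r where r: "!!x. weight b (f x) ~= 1 ==> \<bar>x\<bar> <= r" using w(6) by blast
 show ?thesis
  using laplace_reflect[OF assms(1) w(1-5) r] K_formula[OF f s, of b] K_formula[OF bounded_compact_support_uminus[OF f] s, of b] by simp
qed

lemma small_sums:
 fixes n :: nat
 assumes "!!j. j < n ==> bounded_compact_support (f j)"
 shows "\<exists>e>0. \<forall>s. (\<forall>j<n. \<bar>s j\<bar> < e) --> (\<forall>x. \<bar>\<Sum>j<n. s j * f j x\<bar> <= c0.small)"
proof -
 obtain B where B: "1 <= B" "!!j x. j < n ==> \<bar>f j x\<bar> <= B" using bounded_compact_support_common_bound[of n f] assms by blast
 \<comment> \<open>\<open>Suc n\<close> in place of \<open>n\<close> avoids a division by 0 for the
   empty sum.\<close>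
 define e where "e = c0.small / (real (Suc n) * B)"
 have e: "0 < e" using c0.small B by (simp add: e_def)
 have "\<bar>\<Sum>j<n. s j * f j x\<bar> <= c0.small" if s: "\<forall>j<n. \<bar>s j\<bar> < e" for s x
 proof -
  have "\<bar>\<Sum>j<n. s j * f j x\<bar> <= (\<Sum>j<n. \<bar>s j * f j x\<bar>)" by (rule sum_abs)
  also have "... <= (\<Sum>j<n. e * B)"
   unfolding abs_mult using s B(2) e by (intro sum_mono mult_mono) (auto simp: less_imp_le)
  also have "... <= real (Suc n) * (e * B)" using e B by simp
  also have "... = c0.small" using B unfolding e_def by (simp del: of_nat_Suc)
  finally show ?thesis .
 qed
 then show ?thesis using e by blast
qed

definition cumulant :: "nat => bool => (nat => real => real) => real" where
 "cumulant n b f = \<nu> * (LINT p|(lborel \<Otimes>\<^sub>M M). c0.lsum (map f [0..<n]) b (%_. 0) p)"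

lemma mixed_partial:
 assumes f: "!!j. j < n ==> bounded_compact_support (f j)" and n: "0 < n"
 shows "has_mixed_partial n (%s. K_of b (%x. \<Sum>j<n. s j * f j x)) (cumulant n b f)"
proof -
 obtain e where e: "0 < e" "!!s x. (\<forall>j<n. \<bar>s j\<bar> < e) ==> \<bar>\<Sum>j<n. s j * f j x\<bar> <= c0.small"
  using small_sums[of n f] f by blast
 show ?thesis
  unfolding cumulant_def
  by (rule c0.lsum_mixed_partial[OF f n e(1)]) (use f e(2) in "auto intro!: K_eq bounded_compact_support_sum")
qed

lemma mixed_partial_unique:
 assumes f: "!!j. j < n ==> bounded_compact_support (f j)" and n: "0 < n"
  and D: "has_mixed_partial n (%s. K_of b (%x. \<Sum>j<n. s j * f j x)) D"
 shows "D = cumulant n b f"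
 by (rule has_mixed_partial_unique[OF D mixed_partial[OF f n], where e=1]) auto

text \<open>\<open>K_reflect\<close> holds for small arguments only, which suffices for derivatives
  at the origin.\<close>

lemma cumulant_reflect:
 assumes even: "even_fun \<phi>" and f: "!!j. j < n ==> bounded_compact_support (f j)" and n: "0 < n"
 shows "cumulant n b (%j x. f j (- x)) = cumulant n b f"
proof -
 obtain e where e: "0 < e" "!!s x. (\<forall>j<n. \<bar>s j\<bar> < e) ==> \<bar>\<Sum>j<n. s j * f j x\<bar> <= c0.small"
  using small_sums[of n f] f by blast
 show ?thesis
 proof (rule has_mixed_partial_unique[OF mixed_partial mixed_partial e(1)])
  show "K_of b (%x. \<Sum>j<n. s j * f j (- x)) = K_of b (%x. \<Sum>j<n. s j * f j x)" if "\<forall>j<n. \<bar>s j\<bar> < e" for s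
   by (rule K_reflect[OF even, of "%x. \<Sum>j<n. s j * f j x"]) (use f e(2)[OF that] in "auto intro!: bounded_compact_support_sum")
 qed (use f n bounded_compact_support_uminus in auto)
qed

text \<open>The derivative condition becomes an equation with an explicit value: the derivative
  exists by \<open>mixed_partial\<close> and is unique.\<close>

lemma is_cumulant_iff:
 assumes n: "0 < n"
 shows "is_cumulant_measure (K_of b) n \<sigma> \<longleftrightarrow> signed_measure_on {..<n} \<sigma> \<and>
  (\<forall>f. (\<forall>j<n. bounded_compact_support (f j)) --> signed_integral \<sigma> (%t. \<Prod>j<n. f j (t j)) = cumulant n b f)"
proof -
 have "has_mixed_partial n (%s. K_of b (%x. \<Sum>j<n. s j * f j x)) D \<longleftrightarrow> D = cumulant n b f"
  if f: "\<forall>j<n. bounded_compact_support (f j)" for f D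
 proof
  assume "D = cumulant n b f"
  then show "has_mixed_partial n (%s. K_of b (%x. \<Sum>j<n. s j * f j x)) D"
   using mixed_partial[of n f b] f n by simp
 next
  assume "has_mixed_partial n (%s. K_of b (%x. \<Sum>j<n. s j * f j x)) D"
  with f n show "D = cumulant n b f" by (intro mixed_partial_unique) auto
 qed
 then show ?thesis unfolding is_cumulant_measure_def by simp
qed

abbreviation "red_pair n b \<equiv> (c0.red n b \<nu>, null_measure (coord_space {1..<n}))"

lemma red_pair:
 assumes n: "0 < n"
 shows "is_reduced_cumulant_measure (K_of b) n (red_pair n b)" "finite_signed (red_pair n b)"
  "signed_measure_on {1..<n} (red_pair n b)"
proof -
 have nu0: "0 <= \<nu>" using nu by simp
 note R = c0.full_reduction[OF nu0 n, of b]
 have "is_cumulant_measure (K_of b) n (c0.full n b \<nu>, null_measure (coord_space {..<n}))"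
  unfolding is_cumulant_iff[OF n] using R(1) c0.full_prod(2)[OF nu0 n]
  by (auto simp: signed_integral_def cumulant_def)
 then show "is_reduced_cumulant_measure (K_of b) n (red_pair n b)"
  unfolding is_reduced_cumulant_measure_def using R(2) by blast
 show "finite_signed (red_pair n b)" by (rule R(3))
 show "signed_measure_on {1..<n} (red_pair n b)" using R(2) by (simp add: is_reduction_def)
qed

lemma reduced_prod_functional:
 assumes n: "0 < n" and \<tau>: "is_reduced_cumulant_measure (K_of b) n \<tau>" "finite_signed \<tau>" and f: "!!j. j < n ==> bounded_compact_support (f j)"
 shows "prod_functional n \<tau> (%j x. complex_of_real (f j x)) = complex_of_real (cumulant n b f)"
proof -
 obtain \<sigma> where \<sigma>: "is_cumulant_measure (K_of b) n \<sigma>" "is_reduction n \<sigma> \<tau>"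
  using \<tau>(1) unfolding is_reduced_cumulant_measure_def by blast
 have "signed_integral \<sigma> (%t. \<Prod>j<n. f j (t j)) = cumulant n b f"
  using \<sigma>(1) f unfolding is_cumulant_iff[OF n] by blast
 moreover have "complex_of_real (signed_integral \<sigma> (%t. \<Prod>j<n. f j (t j))) = prod_functional n \<tau> (%j x. complex_of_real (f j x))"
  by (rule reduced_signed_integral[OF \<tau>(2) \<sigma>(2) n]) (rule f)
 ultimately show ?thesis by simp
qed

lemma reduced_signed_measure: "is_reduced_cumulant_measure K n \<tau> ==> signed_measure_on {1..<n} \<tau>"
 unfolding is_reduced_cumulant_measure_def is_reduction_def by blast

text \<open>Pairs representing the reduced measure are not unique, but each finite one has the same
  values on product test functions, hence the transform of the reference
  \<open>red_pair\<close>.\<close>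

lemma reduced_fourier_stieltjes:
 assumes n: "0 < n" and \<tau>: "is_reduced_cumulant_measure (K_of b) n \<tau>" "finite_signed \<tau>"
 shows "fourier_stieltjes n \<tau> w = fourier_stieltjes n (red_pair n b) w"
proof -
 have "fourier_stieltjes n \<tau> w = fourier_stieltjes n (red_pair n b) (%j. 1 * w j)"
  by (rule fourier_stieltjes_unique[OF \<tau>(2) reduced_signed_measure[OF \<tau>(1)] red_pair(2,3)[OF n] _ n])
   (use reduced_prod_functional[OF n \<tau>] reduced_prod_functional[OF n red_pair(1,2)[OF n]] in auto)
 then show ?thesis by simp
qed

lemma fourier_stieltjes_uminus: "fourier_stieltjes n \<tau> (%j. - 1 * w j) = cnj (fourier_stieltjes n \<tau> w)"
proof -
 have "(CLINT v|P. iexp (- (\<Sum>j\<in>{1..<n}. - 1 * w j * v j))) = cnj (CLINT v|P. iexp (- (\<Sum>j\<in>{1..<n}. w j * v j)))" for P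
 proof -
  have "(CLINT v|P. iexp (- (\<Sum>j\<in>{1..<n}. - 1 * w j * v j))) = (CLINT v|P. cnj (iexp (- (\<Sum>j\<in>{1..<n}. w j * v j))))"
   by (rule bintegral_cong[OF refl]) (simp add: exp_cnj sum_negf)
  then show ?thesis by simp
 qed
 then show ?thesis by (simp only: fourier_stieltjes_def complex_cnj_diff)
qed

text \<open>Reflection invariance of the cumulants makes the transform even in the frequencies,
  while negating the frequencies conjugates it, the measure being real.\<close>

lemma reduced_fourier_stieltjes_real:
 assumes n: "0 < n" and even: "even_fun \<phi>" and \<tau>: "is_reduced_cumulant_measure (K_of b) n \<tau>" "finite_signed \<tau>"
 shows "fourier_stieltjes n \<tau> w \<in> \<real>"
proof -
 have "fourier_stieltjes n \<tau> w = fourier_stieltjes n \<tau> (%j. - 1 * w j)"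
 proof (rule fourier_stieltjes_unique[OF \<tau>(2) reduced_signed_measure[OF \<tau>(1)] \<tau>(2) reduced_signed_measure[OF \<tau>(1)] _ n])
  fix f :: "nat => real => real" assume f: "!!j. j < n ==> bounded_compact_support (f j)"
  have "prod_functional n \<tau> (%j x. complex_of_real (f j (- x))) = complex_of_real (cumulant n b (%j x. f j (- x)))"
   by (rule reduced_prod_functional[OF n \<tau>]) (rule bounded_compact_support_uminus[OF f])
  moreover have "cumulant n b (%j x. f j (- x)) = cumulant n b f" by (rule cumulant_reflect[OF even f n])
  moreover have "prod_functional n \<tau> (%j x. complex_of_real (f j x)) = complex_of_real (cumulant n b f)"
   by (rule reduced_prod_functional[OF n \<tau> f])
  ultimately show "prod_functional n \<tau> (%j x. complex_of_real (f j x)) = prod_functional n \<tau> (%j x. complex_of_real (f j (- 1 * x)))"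
   by simp
 qed simp
 then show ?thesis unfolding fourier_stieltjes_uminus by (metis Reals_cnj_iff)
qed

definition phase :: "nat => (nat => real) => 'w => nat list list => complex" where
 "phase n w om us = iexp (- (\<Sum>j\<in>{1..<n}. w j * (pl 0 om (us ! j) - pl 0 om (us ! 0))))"

lemma red_pair_fourier_stieltjes:
 "fourier_stieltjes n (red_pair n b) w = (CLINT om|M. (\<Sum>us\<in>tuples n b (ftr 0 om). \<nu> *\<^sub>R phase n w om us))"
 "integrable M (%om. \<Sum>us\<in>tuples n b (ftr 0 om). \<nu> *\<^sub>R phase n w om us)"
proof -
 have nu0: "0 <= \<nu>" using nu by simp
 let ?H = "%v :: nat => real. iexp (- (\<Sum>j\<in>{1..<n}. w j * v j))"
 have "(%v. \<Sum>j\<in>{1..<n}. w j * v j) \<in> BM (coord_space {1..<n})"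
  by (intro borel_measurable_sum borel_measurable_times measurable_component_singleton) auto
 then have H: "?H \<in> BM (coord_space {1..<n})" by measurable
 have H1: "norm (?H v) <= 1" for v by (simp only: norm_exp_i_times order_refl)
 have ph: "?H (\<lambda>j\<in>{1..<n}. pl 0 om (us ! j) - pl 0 om (us ! 0)) = phase n w om us" for om us
  unfolding phase_def by (intro arg_cong[where f="%x. iexp (- x)"] sum.cong) auto
 note R = c0.red_bounded_integral[OF nu0 H H1, of b, unfolded ph]
 show "integrable M (%om. \<Sum>us\<in>tuples n b (ftr 0 om). \<nu> *\<^sub>R phase n w om us)" by (rule R(2))
 show "fourier_stieltjes n (red_pair n b) w = (CLINT om|M. (\<Sum>us\<in>tuples n b (ftr 0 om). \<nu> *\<^sub>R phase n w om us))"
  using R(1) by (simp add: fourier_stieltjes_def)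
qed

lemma finite_ftr: "finite (ftr 0 om)" by (rule c0.finite_ftree)

definition spectrum :: "real => complex" where
 "spectrum w = fourier_stieltjes 2 (red_pair 2 False) (%_. w)"

lemma spectrum_eq: "spectrum w = complex_of_real (\<nu> / ((1 - m) * (cmod (1 - m * fourier \<phi> w))\<^sup>2))"
proof -
 let ?S = "%om. \<Sum>u\<in>ftr 0 om. iexp (- (w * pl 0 om u))"
 have "(\<Sum>us\<in>tuples 2 False (ftr 0 om). \<nu> *\<^sub>R phase 2 (%_. w) om us) = complex_of_real (\<nu> * (cmod (?S om))\<^sup>2)" for om
 proof -
  have i: "{1..<2} = {1::nat}" by auto
  have "(\<Sum>us\<in>tuples 2 False (ftr 0 om). \<nu> *\<^sub>R phase 2 (%_. w) om us) = (\<Sum>u\<in>ftr 0 om. \<Sum>v\<in>ftr 0 om. \<nu> *\<^sub>R phase 2 (%_. w) om [u, v])"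
   using finite_ftr unfolding numeral_2_eq_2 by (simp add: sum_tuples_Suc shrink_def del: tuples.simps(2))
  also have "... = (\<Sum>u\<in>ftr 0 om. \<Sum>v\<in>ftr 0 om. \<nu> *\<^sub>R (cnj (iexp (- (w * pl 0 om u))) * iexp (- (w * pl 0 om v))))"
   unfolding phase_def i by (intro sum.cong refl arg_cong[where f="%z. \<nu> *\<^sub>R z"]) (simp add: exp_cnj algebra_simps flip: exp_add)
  also have "... = \<nu> *\<^sub>R (cnj (?S om) * ?S om)"
   by (simp add: sum_product scaleR_sum_right)
  also have "cnj (?S om) * ?S om = complex_of_real ((cmod (?S om))\<^sup>2)"
   unfolding complex_norm_square by (rule mult.commute)
  finally show ?thesis by (simp add: scaleR_conv_of_real)
 qed
 then have "spectrum w = complex_of_real (\<nu> * (LINT om|M. (cmod (?S om))\<^sup>2))"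
  unfolding spectrum_def red_pair_fourier_stieltjes(1) by (simp only: integral_complex_of_real integral_mult_right_zero)
 then show ?thesis unfolding c0.second_moment by simp
qed

text \<open>Existence and uniqueness of the spectrum at once, although the measure in its definition
  is only one of many pairs.\<close>

lemma bartlett_iff: "full_bartlett_spectrum M N \<Gamma> \<longleftrightarrow> \<Gamma> = spectrum"
proof
 assume "full_bartlett_spectrum M N \<Gamma>"
 then obtain \<gamma> where \<gamma>: "is_reduced_cumulant_measure (K_of False) 2 \<gamma>" "finite_signed \<gamma>" "!!w. \<Gamma> w = fourier_stieltjes 2 \<gamma> (%_. w)"
  unfolding full_bartlett_spectrum_def K_of_def by auto
 show "\<Gamma> = spectrum"
  unfolding spectrum_def \<gamma>(3) fun_eq_iff by (intro allI reduced_fourier_stieltjes[OF _ \<gamma>(1,2)]) simp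
next
 assume "\<Gamma> = spectrum"
 then show "full_bartlett_spectrum M N \<Gamma>"
  unfolding full_bartlett_spectrum_def spectrum_def
  using red_pair(1,2)[of 2 False] by (auto simp: K_of_def intro!: exI[of _ "red_pair 2 False"])
qed

lemma third_order_relation:
 "fourier_stieltjes 3 (red_pair 3 False) w = fourier_stieltjes 3 (red_pair 3 True) w +
  (spectrum (w 1) + spectrum (w 2) + spectrum (w 1 + w 2) - 2 * complex_of_real (\<nu> / (1 - m)))"
proof -
 let ?T = "%om. ftr 0 om"
 have i: "{1..<3} = {1, 2::nat}" "{1..<2} = {1::nat}" by auto
 have sum3: "(\<Sum>us\<in>tuples 3 b T. h us) = (\<Sum>u\<in>T. \<Sum>v\<in>shrink b T u. \<Sum>x\<in>shrink b (shrink b T u) v. h [u, v, x])"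
  if "finite T" for T :: "nat list set" and b and h :: "nat list list => complex"
  using that unfolding numeral_3_eq_3 by (simp add: sum_tuples_Suc del: tuples.simps(2))
 have sum2: "(\<Sum>us\<in>tuples 2 False T. h us) = (\<Sum>u\<in>T. \<Sum>v\<in>T. h [u, v])"
  if "finite T" for T :: "nat list set" and h :: "nat list list => complex"
  using that unfolding numeral_2_eq_2 by (simp add: sum_tuples_Suc shrink_def del: tuples.simps(2))
 let ?P3 = "%b om. \<Sum>us\<in>tuples 3 b (?T om). \<nu> *\<^sub>R phase 3 w om us"
 let ?P2 = "%x om. \<Sum>us\<in>tuples 2 False (?T om). \<nu> *\<^sub>R phase 2 (%_. x) om us"
 have point: "?P3 False om = ?P3 True om + (?P2 (w 1) om + ?P2 (w 2) om + ?P2 (w 1 + w 2) om - complex_of_real (2 * \<nu> * real (card (?T om))))" for om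
 proof -
  \<comment> \<open>The first member is the reference point: a later member that coincides with it
    loses its frequency, while a coincidence of the last two adds theirs. If all coincide the phase
    is 1, and the mean size yields the intensity.\<close>
  have p: "phase 3 w om [u, v, u] = phase 2 (%_. w 1) om [u, v]" "phase 3 w om [u, u, v] = phase 2 (%_. w 2) om [u, v]"
   "phase 3 w om [u, v, v] = phase 2 (%_. w 1 + w 2) om [u, v]" "phase 2 (%_. x) om [u, u] = 1" for u v x
   unfolding phase_def i by (simp_all add: algebra_simps)
  show ?thesis
   unfolding sum3[OF finite_ftr] sum2[OF finite_ftr] shrink_def if_True if_False
    sum_coincidences[OF finite_ftr, of "%a b c. \<nu> *\<^sub>R phase 3 w om [a, b, c]"] p
   by (simp add: scaleR_conv_of_real)
 qed
 have C: "integrable M (%om. complex_of_real (2 * \<nu> * real (card (?T om))))"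
  using c0.card_power_integrable[of 1] by (intro integrable_of_real integrable_mult_right) simp
 note I3 = red_pair_fourier_stieltjes(2)[where n=3 and b=True and w=w] and I2 = red_pair_fourier_stieltjes(2)[where n=2 and b=False]
 have "fourier_stieltjes 3 (red_pair 3 False) w = (CLINT om|M. ?P3 True om + (?P2 (w 1) om + ?P2 (w 2) om + ?P2 (w 1 + w 2) om - complex_of_real (2 * \<nu> * real (card (?T om)))))"
  unfolding red_pair_fourier_stieltjes(1) point ..
 also have "... = (CLINT om|M. ?P3 True om) + ((CLINT om|M. ?P2 (w 1) om) + (CLINT om|M. ?P2 (w 2) om) + (CLINT om|M. ?P2 (w 1 + w 2) om)
   - (CLINT om|M. complex_of_real (2 * \<nu> * real (card (?T om)))))"
  using I3 I2 C by (simp only: bintegral_add bintegral_diff bintegrable_add bintegrable_diff)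
 also have "(CLINT om|M. complex_of_real (2 * \<nu> * real (card (?T om)))) = 2 * complex_of_real (\<nu> / (1 - m))"
  unfolding integral_complex_of_real integral_mult_right_zero c0.card_mean by simp
 finally show ?thesis unfolding spectrum_def red_pair_fourier_stieltjes(1) .
qed

end

section \<open>The theorem\<close>

text \<open>The reference measures of order 2 are positive, so equal spectra force them to be equal,
  and with them all second cumulants. The second claim concerns arbitrary, possibly infinite
  \<gamma>; it is therefore reached through the values of \<open>cumulant\<close> and not through
  transforms of \<gamma>.\<close>

lemma same_second_order:
 assumes A: "pbc M \<nu> m \<phi> N U C KK XX" and B: "pbc M' \<nu> m h N' U' C' KK' XX'"
  and eq: "!!w. (cmod (1 - m * fourier \<phi> w))\<^sup>2 = (cmod (1 - m * fourier h w))\<^sup>2"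
 shows "full_bartlett_spectrum M N \<Gamma> \<longleftrightarrow> full_bartlett_spectrum M' N' \<Gamma>"
  and "is_reduced_cumulant_measure (K_comp M N) 2 \<gamma> \<longleftrightarrow> is_reduced_cumulant_measure (K_comp M' N') 2 \<gamma>"
proof -
 interpret A: pbc M \<nu> m \<phi> N U C KK XX by (rule A)
 interpret B: pbc M' \<nu> m h N' U' C' KK' XX' by (rule B)
 have sp: "A.spectrum = B.spectrum" unfolding A.spectrum_eq B.spectrum_eq fun_eq_iff eq by simp
 then show "full_bartlett_spectrum M N \<Gamma> \<longleftrightarrow> full_bartlett_spectrum M' N' \<Gamma>" unfolding A.bartlett_iff B.bartlett_iff by simp
 have nu0: "0 <= \<nu>" using A.nu by simp
 have i: "{1..<2} = {1::nat}" by auto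
 have a: "A.spectrum w = (CLINT v|A.c0.red 2 False \<nu>. iexp (- w * v 1))" for w
  unfolding A.spectrum_def fourier_stieltjes_def i by simp
 have b: "B.spectrum w = (CLINT v|B.c0.red 2 False \<nu>. iexp (- w * v 1))" for w
  unfolding B.spectrum_def fourier_stieltjes_def i by simp
 have "A.c0.red 2 False \<nu> = B.c0.red 2 False \<nu>"
 proof (rule measure_eq_fourier_stieltjes)
  show "(CLINT v|A.c0.red 2 False \<nu>. iexp (w * v 1)) = (CLINT v|B.c0.red 2 False \<nu>. iexp (w * v 1))" for w
   using a[of "- w"] b[of "- w"] sp by simp
  interpret R: finite_measure "A.c0.red 2 False \<nu>" by (rule A.c0.finite_red[OF nu0])
  have "complex_of_real (measure (A.c0.red 2 False \<nu>) (space (A.c0.red 2 False \<nu>))) = A.spectrum 0"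
   unfolding a by (simp add: scaleR_conv_of_real)
  then have "measure (A.c0.red 2 False \<nu>) (space (A.c0.red 2 False \<nu>)) = \<nu> / ((1 - m) * (cmod (1 - m * fourier \<phi> 0))\<^sup>2)"
   unfolding A.spectrum_eq of_real_eq_iff .
  moreover have "0 < (cmod (1 - m * fourier \<phi> 0))\<^sup>2"
  proof -
   have "cmod (m * fourier \<phi> 0) < 1"
    using A.c0.m fourier_norm_le[OF A.c0.phi, of 0] by (simp add: norm_mult) (smt (verit) mult_left_le)
   then have "m * fourier \<phi> 0 ~= 1" by auto
   then show ?thesis by simp
  qed
  ultimately show "0 < measure (A.c0.red 2 False \<nu>) (space (A.c0.red 2 False \<nu>))"
   using A.nu A.c0.m by (simp del: zero_less_power2)
 qed (use A.c0.finite_red[OF nu0] B.c0.finite_red[OF nu0] in auto)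
 then have "A.cumulant 2 False f = B.cumulant 2 False f" if f: "\<forall>j<2. bounded_compact_support (f j)" for f
  using A.reduced_prod_functional[OF _ A.red_pair(1,2), where n=2 and b=False and f=f] B.reduced_prod_functional[OF _ B.red_pair(1,2), where n=2 and b=False and f=f] f
  by simp
 then have "is_cumulant_measure (A.K_of False) 2 \<sigma> \<longleftrightarrow> is_cumulant_measure (B.K_of False) 2 \<sigma>" for \<sigma>
  using A.is_cumulant_iff[of 2 False \<sigma>] B.is_cumulant_iff[of 2 False \<sigma>] by auto
 then show "is_reduced_cumulant_measure (K_comp M N) 2 \<gamma> \<longleftrightarrow> is_reduced_cumulant_measure (K_comp M' N') 2 \<gamma>"
  unfolding is_reduced_cumulant_measure_def A.K_of_def B.K_of_def by simp
qed

lemma signed_density_fourier_stieltjes: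
 assumes "integrable (lborel_on {1..<n}) k"
 shows "finite_signed (signed_density {1..<n} k)" "fourier_stieltjes n (signed_density {1..<n} k) w = fourier_on {1..<n} k w"
proof -
 let ?L = "lborel_on {1..<n}"
 note [measurable] = borel_measurable_integrable[OF assms]
 have fin: "finite_measure (density ?L (%v. ennreal (g v)))" if g: "integrable ?L g" for g
 proof (rule finite_measureI)
  note [measurable] = borel_measurable_integrable[OF g]
  have "emeasure (density ?L (%v. ennreal (g v))) (space (density ?L (%v. ennreal (g v)))) = (\<integral>\<^sup>+v. ennreal (g v) \<partial>?L)"
   using borel_measurable_integrable[OF g] by (subst emeasure_density) (auto intro!: nn_integral_cong)
  also have "... <= (\<integral>\<^sup>+v. ennreal (norm (g v)) \<partial>?L)" by (intro nn_integral_mono ennreal_leI) simp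
  also have "... < \<infinity>" using g by (simp add: integrable_iff_bounded)
  finally show "emeasure (density ?L (%v. ennreal (g v))) (space (density ?L (%v. ennreal (g v)))) ~= \<infinity>" by simp
 qed
 show "finite_signed (signed_density {1..<n} k)"
  using fin[OF assms] fin[of "%v. - k v"] assms by (simp add: finite_signed_def signed_density_def)
 let ?e = "%v. iexp (- (\<Sum>j\<in>{1..<n}. w j * v j))"
 have sl: "sets ?L = sets (coord_space {1..<n})" unfolding lborel_on_def by (rule sets_PiM_cong) auto
 have "(%v. \<Sum>j\<in>{1..<n}. w j * v j) \<in> BM ?L"
  unfolding measurable_cong_sets[OF sl refl]
  by (intro borel_measurable_sum borel_measurable_times measurable_component_singleton) auto
 then have em [measurable]: "?e \<in> BM ?L" by measurable
 have dens: "(CLINT v|density ?L (%v. ennreal (g v)). ?e v) = (CLINT v|?L. max 0 (g v) *\<^sub>R ?e v)"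
  and I: "integrable ?L (%v. max 0 (g v) *\<^sub>R ?e v)" if g: "integrable ?L g" for g
 proof -
  note [measurable] = borel_measurable_integrable[OF g]
  have ms: "(%v. ennreal (g v)) \<in> BM ?L" "(%v. ennreal (max 0 (g v))) \<in> BM ?L"
   "(%v. max 0 (g v)) \<in> BM ?L" by measurable
  \<comment> \<open>\<open>ennreal\<close> sends negative values to 0, so each component of
    \<open>signed_density\<close> has a positive part as its density.\<close>
  have "density ?L (%v. ennreal (g v)) = density ?L (%v. ennreal (max 0 (g v)))"
   by (rule density_cong[OF ms(1,2)]) (simp add: max_def ennreal_neg)
  then show "(CLINT v|density ?L (%v. ennreal (g v)). ?e v) = (CLINT v|?L. max 0 (g v) *\<^sub>R ?e v)"
   by (simp only:, subst integral_density[OF em ms(3)]) auto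
  show "integrable ?L (%v. max 0 (g v) *\<^sub>R ?e v)"
  proof (rule bintegrable_bound[OF g])
   show "AE v in ?L. norm (max 0 (g v) *\<^sub>R ?e v) <= norm (g v)"
    unfolding norm_scaleR norm_exp_i_times by (intro AE_I2) (simp add: max_def)
  qed measurable
 qed
 have mi: "integrable ?L (%v. - k v)" using assms by simp
 have "fourier_stieltjes n (signed_density {1..<n} k) w = (CLINT v|?L. max 0 (k v) *\<^sub>R ?e v - max 0 (- k v) *\<^sub>R ?e v)"
  unfolding fourier_stieltjes_def signed_density_def fst_conv snd_conv dens[OF assms] dens[OF mi]
  by (rule bintegral_diff[OF I[OF assms] I[OF mi], symmetric])
 also have "... = fourier_on {1..<n} k w"
  unfolding fourier_on_def by (intro bintegral_cong refl) (auto simp: max_def scaleR_conv_of_real)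
 finally show "fourier_stieltjes n (signed_density {1..<n} k) w = fourier_on {1..<n} k w" .
qed

theorem theorem3p1:
  fixes m \<nu> :: real and h :: "real \<Rightarrow> real"
  assumes "0 < m" and "m < 1" and "0 < \<nu>"
    and "prob_density h"
    and "\<forall>x<0. h x = 0"
    and "\<exists>h'. antimono_on {0<..} h' \<and> (AE x in lborel. 0 < x \<longrightarrow> h' x = h x)"
  shows
    "(\<exists>\<rho>. prob_density \<rho> \<and> even_fun \<rho> \<and> (AE x in lborel. \<rho> x = rho m h x)) \<and>
     (\<forall>w. fourier (rho m h) w \<in> \<real>) \<and>
     ((\<lambda>n. p_weight m (Suc n)) sums 1) \<and>
     (\<forall>w. 1 - m * (2 - m) * fourier (rho m h) w
            = complex_of_real ((cmod (1 - m * fourier h w))\<^sup>2) \<and>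
          (1 - m)\<^sup>2 \<le> (cmod (1 - m * fourier h w))\<^sup>2 \<and> 0 < (1 - m)\<^sup>2) \<and>
     (\<forall>\<rho> (\<Omega> :: 'k measure) (K :: 'k \<Rightarrow> nat) (Y :: nat \<Rightarrow> 'k \<Rightarrow> real).
        prob_density \<rho> \<and> even_fun \<rho> \<and> (AE x in lborel. \<rho> x = rho m h x) \<and>
        prob_space \<Omega> \<and>
        K \<in> measurable \<Omega> (count_space UNIV) \<and>
        (\<forall>n\<ge>1. measure \<Omega> {\<omega>\<in>space \<Omega>. K \<omega> = n} = p_weight m n) \<and>
        prob_space.indep_vars \<Omega> (\<lambda>_. borel) Y {1..} \<and>
        (\<forall>k\<ge>1. distributed \<Omega> lborel (Y k) (\<lambda>x. ennreal (\<rho> x))) \<and>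
        indep_rvs \<Omega> (count_space UNIV) K
          (\<Pi>\<^sub>M k\<in>{1..}. borel) (\<lambda>\<omega>. \<lambda>k\<in>{1..}. Y k \<omega>)
        \<longrightarrow>
        (\<exists>\<phi>. prob_density \<phi> \<and> even_fun \<phi> \<and>
             distributed \<Omega> lborel (\<lambda>\<omega>. \<Sum>k=1..K \<omega>. Y k \<omega>) (\<lambda>x. ennreal (\<phi> x))) \<and>
        (\<forall>\<phi>. prob_density \<phi> \<and> even_fun \<phi> \<and>
             distributed \<Omega> lborel (\<lambda>\<omega>. \<Sum>k=1..K \<omega>. Y k \<omega>) (\<lambda>x. ennreal (\<phi> x))
           \<longrightarrow>
           (\<forall>w. fourier \<phi> w
                  = complex_of_real ((1 - sqrt (1 - m * (2 - m) * Re (fourier (rho m h) w))) / m) \<and>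
                (cmod (1 - m * fourier \<phi> w))\<^sup>2 = (cmod (1 - m * fourier h w))\<^sup>2) \<and>
           (\<forall>(M :: 'a measure) N (M' :: 'b measure) N'.
              poisson_branching_cluster_process M \<nu> m \<phi> N \<and>
              poisson_branching_cluster_process M' \<nu> m h N'
              \<longrightarrow>
              reversible M N \<and>
              has_intensity M N (\<nu> / (1 - m)) \<and>
              has_intensity M' N' (\<nu> / (1 - m)) \<and>
              (\<exists>!\<Gamma>. full_bartlett_spectrum M N \<Gamma>) \<and>
              (\<forall>\<Gamma>. full_bartlett_spectrum M N \<Gamma> \<longleftrightarrow> full_bartlett_spectrum M' N' \<Gamma>) \<and>
              (\<exists>\<gamma>. is_reduced_cumulant_measure (K_comp M N) 2 \<gamma> \<and> finite_signed \<gamma>) \<and>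
              (\<forall>\<gamma>. is_reduced_cumulant_measure (K_comp M N) 2 \<gamma>
                   \<longleftrightarrow> is_reduced_cumulant_measure (K_comp M' N') 2 \<gamma>)) \<and>
           (\<forall>(M :: 'a measure) N. poisson_branching_cluster_process M \<nu> m \<phi> N \<longrightarrow>
              (\<exists>\<gamma>. is_reduced_cumulant_measure (K_comp M N) 3 \<gamma> \<and> finite_signed \<gamma>) \<and>
              (\<forall>\<gamma>. is_reduced_cumulant_measure (K_comp M N) 3 \<gamma> \<and> finite_signed \<gamma> \<longrightarrow>
                   (\<forall>w. fourier_stieltjes 3 \<gamma> w \<in> \<real>)) \<and>
              (\<exists>\<kappa>. is_reduced_cumulant_measure (K_fac M N) 3 \<kappa> \<and> finite_signed \<kappa>) \<and>
              (\<forall>\<kappa>. is_reduced_cumulant_measure (K_fac M N) 3 \<kappa> \<and> finite_signed \<kappa> \<longrightarrow>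
                   (\<forall>w. fourier_stieltjes 3 \<kappa> w \<in> \<real>)) \<and>
              (\<forall>k. integrable (lborel_on {1..<3}) k \<and>
                   is_reduced_cumulant_measure (K_fac M N) 3 (signed_density {1..<3} k) \<longrightarrow>
                   (\<forall>w. fourier_on {1..<3} k w \<in> \<real>) \<and>
                   (\<forall>\<gamma> \<Gamma>. is_reduced_cumulant_measure (K_comp M N) 3 \<gamma> \<and> finite_signed \<gamma> \<and>
                          full_bartlett_spectrum M N \<Gamma> \<longrightarrow>
                          (\<forall>x. \<Gamma> x \<in> \<real>) \<and>
                          (\<forall>w. fourier_stieltjes 3 \<gamma> w =
                               fourier_on {1..<3} k w
                               + (\<Gamma> (w 1) + \<Gamma> (w 2) + \<Gamma> (w 1 + w 2)
                                  - 2 * complex_of_real (\<nu> / (1 - m)))))))))"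
proof (intro conjI allI impI; (elim conjE)?)
 have m: "0 < m" "m < 1" and \<nu>: "0 < \<nu>" and h: "prob_density h" "\<forall>x<0. h x = 0" using assms by auto
 note mh = m h
 show "\<exists>\<rho>. prob_density \<rho> \<and> even_fun \<rho> \<and> (AE x in lborel. \<rho> x = rho m h x)" by (rule ex_rho_density[OF mh assms(6)])
 show "fourier (rho m h) w \<in> \<real>" for w by (rule fourier_rho_real[OF mh])
 show "(%n. p_weight m (Suc n)) sums 1" by (rule p_weight_sums[OF m])
 show one: "1 - m * (2 - m) * fourier (rho m h) w = complex_of_real ((cmod (1 - m * fourier h w))\<^sup>2)" for w
  by (rule one_minus_fourier_rho[OF mh])
 show ge: "(1 - m)\<^sup>2 <= (cmod (1 - m * fourier h w))\<^sup>2" for w by (rule cmod_one_minus_fourier_ge[OF mh])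
 show "0 < (1 - m)\<^sup>2" using m by simp
 fix \<rho> and \<Omega> :: "'k measure" and K :: "'k => nat" and Y :: "nat => 'k => real"
 assume \<rho>: "prob_density \<rho>" "even_fun \<rho>" and \<rho>_eq: "AE x in lborel. \<rho> x = rho m h x"
  and \<Omega>: "prob_space \<Omega>" "K \<in> measurable \<Omega> (count_space UNIV)" "\<forall>n\<ge>1. measure \<Omega> {om\<in>space \<Omega>. K om = n} = p_weight m n"
   "prob_space.indep_vars \<Omega> (%_. borel) Y {1..}" "\<forall>k\<ge>1. distributed \<Omega> lborel (Y k) (%x. ennreal (\<rho> x))"
   "indep_rvs \<Omega> (count_space UNIV) K (\<Pi>\<^sub>M k\<in>{1..}. borel) (%om. \<lambda>k\<in>{1..}. Y k om)"
 note ctx = m \<rho> \<Omega> refl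
 show "\<exists>\<phi>. prob_density \<phi> \<and> even_fun \<phi> \<and> distributed \<Omega> lborel (%om. \<Sum>k=1..K om. Y k om) (%x. ennreal (\<phi> x))"
  by (rule ex_even_density_random_sum[OF ctx])
 \<comment> \<open>The summands may follow any even density version of \<open>rho m h\<close>; the
   transform does not see the null set on which they differ.\<close>
 have \<rho>_fourier: "fourier \<rho> w = fourier (rho m h) w" for w
  unfolding fourier_def
 proof (rule integral_cong_AE)
  have [measurable]: "\<rho> \<in> BM borel" "rho m h \<in> BM borel"
   using prob_densityD(1)[OF \<rho>(1)] rho_measurable[OF mh] by auto
  show "(%t. iexp (- (w * t)) * complex_of_real (\<rho> t)) \<in> BM lborel"
   "(%t. iexp (- (w * t)) * complex_of_real (rho m h t)) \<in> BM lborel" by measurable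
  show "AE t in lborel. iexp (- (w * t)) * complex_of_real (\<rho> t) = iexp (- (w * t)) * complex_of_real (rho m h t)"
   using \<rho>_eq by eventually_elim simp
 qed
 fix \<phi> assume \<phi>: "prob_density \<phi>" "even_fun \<phi>" and dist: "distributed \<Omega> lborel (%om. \<Sum>k=1..K om. Y k om) (%x. ennreal (\<phi> x))"
 show four: "fourier \<phi> w = complex_of_real ((1 - sqrt (1 - m * (2 - m) * Re (fourier (rho m h) w))) / m)" for w
  using integral_iexp_distributed[OF dist \<phi>(1), of w] char_random_sum[OF ctx, of w] \<rho>_fourier[of w] by simp
 show sq: "(cmod (1 - m * fourier \<phi> w))\<^sup>2 = (cmod (1 - m * fourier h w))\<^sup>2" for w
 proof -
  have "1 - m * (2 - m) * Re (fourier (rho m h) w) = Re (1 - m * (2 - m) * fourier (rho m h) w)" by simp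
  also have "... = (cmod (1 - m * fourier h w))\<^sup>2" unfolding one by simp
  finally have "fourier \<phi> w = complex_of_real ((1 - cmod (1 - m * fourier h w)) / m)" unfolding four by simp
  then have "1 - m * fourier \<phi> w = complex_of_real (cmod (1 - m * fourier h w))" using m(1) by (simp add: field_simps)
  then show ?thesis by simp
 qed
 {
  fix M :: "'a measure" and N and M' :: "'b measure" and N'
  assume P: "poisson_branching_cluster_process M \<nu> m \<phi> N" "poisson_branching_cluster_process M' \<nu> m h N'"
  obtain U C KK XX where A: "pbc M \<nu> m \<phi> N U C KK XX"
   using poisson_branching_cluster_process_pbc[OF P(1) \<nu> m \<phi>(1)] by blast
  obtain U' C' KK' XX' where B: "pbc M' \<nu> m h N' U' C' KK' XX'"
   using poisson_branching_cluster_process_pbc[OF P(2) \<nu> m h(1)] by blast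
  interpret A: pbc M \<nu> m \<phi> N U C KK XX by (rule A)
  show "reversible M N" by (rule A.reversible_N[OF \<phi>(2)])
  show "has_intensity M N (\<nu> / (1 - m))" by (rule A.intensity)
  show "has_intensity M' N' (\<nu> / (1 - m))" by (rule pbc.intensity[OF B])
  show "\<exists>!\<Gamma>. full_bartlett_spectrum M N \<Gamma>" unfolding A.bartlett_iff by simp
  show "full_bartlett_spectrum M N \<Gamma> \<longleftrightarrow> full_bartlett_spectrum M' N' \<Gamma>" for \<Gamma> by (rule same_second_order(1)[OF A B sq])
  show "\<exists>\<gamma>. is_reduced_cumulant_measure (K_comp M N) 2 \<gamma> \<and> finite_signed \<gamma>"
   using A.red_pair(1,2)[of 2 False] by (auto simp: A.K_of_def)
  show "is_reduced_cumulant_measure (K_comp M N) 2 \<gamma> \<longleftrightarrow> is_reduced_cumulant_measure (K_comp M' N') 2 \<gamma>" for \<gamma>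
   by (rule same_second_order(2)[OF A B sq])
 }
 fix M :: "'a measure" and N assume P: "poisson_branching_cluster_process M \<nu> m \<phi> N"
 obtain U C KK XX where A: "pbc M \<nu> m \<phi> N U C KK XX"
  using poisson_branching_cluster_process_pbc[OF P \<nu> m \<phi>(1)] by blast
 interpret A: pbc M \<nu> m \<phi> N U C KK XX by (rule A)
 have K: "K_comp M N = A.K_of False" "K_fac M N = A.K_of True" by (simp_all add: A.K_of_def)
 have n: "0 < (3::nat)" by simp
 show "\<exists>\<gamma>. is_reduced_cumulant_measure (K_comp M N) 3 \<gamma> \<and> finite_signed \<gamma>"
  "\<exists>\<kappa>. is_reduced_cumulant_measure (K_fac M N) 3 \<kappa> \<and> finite_signed \<kappa>"
  unfolding K using A.red_pair(1,2)[OF n] by blast+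
 show "fourier_stieltjes 3 \<gamma> w \<in> \<real>" if "is_reduced_cumulant_measure (K_comp M N) 3 \<gamma>" "finite_signed \<gamma>" for \<gamma> w
  by (rule A.reduced_fourier_stieltjes_real[OF n \<phi>(2) that[unfolded K]])
 show "fourier_stieltjes 3 \<gamma> w \<in> \<real>" if "is_reduced_cumulant_measure (K_fac M N) 3 \<gamma>" "finite_signed \<gamma>" for \<gamma> w
  by (rule A.reduced_fourier_stieltjes_real[OF n \<phi>(2) that[unfolded K]])
 fix k assume k: "integrable (lborel_on {1..<3}) k" and red: "is_reduced_cumulant_measure (K_fac M N) 3 (signed_density {1..<3} k)"
 note sd = signed_density_fourier_stieltjes[OF k]
 show "fourier_on {1..<3} k w \<in> \<real>" for w
  using A.reduced_fourier_stieltjes_real[OF n \<phi>(2) red[unfolded K] sd(1), of w] unfolding sd(2) .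
 fix \<gamma> \<Gamma> assume g: "is_reduced_cumulant_measure (K_comp M N) 3 \<gamma>" "finite_signed \<gamma>" "full_bartlett_spectrum M N \<Gamma>"
 then have \<Gamma>: "\<Gamma> = A.spectrum" using A.bartlett_iff by blast
 show "\<Gamma> x \<in> \<real>" for x unfolding \<Gamma> A.spectrum_eq by (rule Reals_of_real)
 show "fourier_stieltjes 3 \<gamma> w = fourier_on {1..<3} k w + (\<Gamma> (w 1) + \<Gamma> (w 2) + \<Gamma> (w 1 + w 2) - 2 * complex_of_real (\<nu> / (1 - m)))" for w
  unfolding A.reduced_fourier_stieltjes[OF n g(1,2)[unfolded K]] A.third_order_relation \<Gamma>
  using A.reduced_fourier_stieltjes[OF n red[unfolded K] sd(1), of w] unfolding sd(2) by simp
qed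

end
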